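(* Let $p\in(1,2]$, $\tilde p\in[1,2]$ and $\Phi\in L^p_{\mathrm{pr}}(\Omega_T\times U;H)$ be such that $\mathbb E\int_0^T\int_U\|D_{t,x}\Phi(s,y)\|^{\tilde p}\,\nu(\mathrm dy)\,\mathrm ds<\infty$ for $\lambda\otimes\nu$-almost all $(t,x)\in[0,T]\times U$. Then the equality $$D_{t,x}\int_0^T\int_U\Phi(s,y)\,\tilde N(\mathrm ds,\mathrm dy)=\int_0^T\int_UD_{t,x}\Phi(s,y)\,\tilde N(\mathrm ds,\mathrm dy)+\Phi(t,x)$$ holds $\mathbb P_T\otimes\nu$-almost everywhere.
   Context: Setting: $T\in(0,\infty)$, $U$ is a separable real Hilbert space, $\nu$ is a $\sigma$-finite measure on $(U,\mathcal B(U))$, $\lambda$ is Lebesgue measure on $[0,T]$. $\mathbf N$ is the space of all $\sigma$-finite $\mathbb N_0\cup\{+\infty\}$-valued measures on $([0,T]\times U,\mathcal B([0,T]\times U))$ with the $\sigma$-algebra generated by the evaluations $\eta\mapsto\eta(B)$. $(\Omega,\mathcal F,\mathbb P)$ is a complete probability space, $N:\Omega\to\mathbf N$ is a Poisson random measure on $[0,T]\times U$ with intensity measure $\lambda\otimes\nu$, given as a random sum of Dirac measures $N=\sum_{n=1}^{N([0,T]\times U)}\delta_{X_n}$ with random variables $X_n$ in $[0,T]\times U$; $\mathcal F$ is the $\mathbb P$-completion of $\sigma(N)$; $\tilde N:=N-\lambda\otimes\nu$. $H$ is a separable real Hilbert space with inner product $\langle\cdot,\cdot\rangle$, norm $\|\cdot\|$.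 Filtration: $\mathcal F_t:=\bigcap_{u\in(t,T]}\mathcal F_{[0,u]\times U}$ for $t<T$ and $\mathcal F_T:=\mathcal F$, where $\mathcal F_{[0,u]\times U}$ is the $\mathbb P$-completion of the $\sigma$-algebra generated by $N(([0,u]\times U)\cap B)$, $B\in\mathcal B([0,T]\times U)$. $\Omega_T:=\Omega\times[0,T]$, $\mathbb P_T:=\mathbb P\otimes\lambda$, $\mathcal P_T$ is the predictable $\sigma$-algebra of $(\mathcal F_t)$, and $L^p_{\mathrm{pr}}(\Omega_T\times U;H):=L^p(\Omega_T\times U,\mathcal P_T\otimes\mathcal B(U),\mathbb P_T\otimes\nu;H)$. Difference operator ($L^0$ denotes equivalence classes of strongly measurable functions): for $F\in L^0(\Omega;H)$, $D_{t,x}F:=f(N+\delta_{(t,x)})-f(N)$, where $f:\mathbf N\to H$ is measurable with $F=f(N)$ a.s. For $\Phi\in L^0(\Omega_T\times U;H)$ with $\Phi(s,y)=\varphi(N,s,y)$ a.e., $\varphi$ measurable, $D_{t,x}\Phi(s,y):=\varphi(N+\delta_{(t,x)},s,y)-\varphi(N,s,y)$. These are a.e. independent of the representatives. Stochastic integral: for $p\in[1,2]$, $\Phi\mapsto\int_0^T\int_U\Phi(s,y)\,\tilde N(\mathrm ds,\mathrm dy)$ is the unique continuous linear map $L^p_{\mathrm{pr}}(\Omega_T\times U;H)\to L^p(\Omega;H)$ that sends $F\mathbf 1_{(r,s]\times B}$ to $F\,\tilde N((r,s]\times B)$ for $0\le r\le s\le T$, $F:\Omega\to H$ bounded and $\mathcal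 F_r$-measurable, $\nu(B)<\infty$; the maps for different $p$ agree on the intersection of their domains. For $\Phi\in L^p_{\mathrm{pr}}(\Omega_T\times U;H)$ the derivative $(\omega,s,y,t,x)\mapsto D_{t,x}\Phi(\omega,s,y)$ has a $\mathcal P_T\otimes\mathcal B(U)\otimes\mathcal B([0,T]\times U)$-measurable version; $\int_0^T\int_UD_{t,x}\Phi(s,y)\,\tilde N(\mathrm ds,\mathrm dy)$ denotes, for $\lambda\otimes\nu$-almost all $(t,x)$, the $L^{\tilde p}$-stochastic integral of this version, regarded as an element of $L^0([0,T]\times U;L^{\tilde p}(\Omega;H))\subset L^0(\Omega_T\times U;H)$ in the variable $(t,x)$. *)

theory Defs
  imports "HOL-Probability.Probability"
begin

text \<open>
  A random variable or process is represented by a measurable function, not by an equivalence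
  class; all identities are almost everywhere identities. A point of \<open>\<Omega>\<^sub>T \<times> U\<close> is written
  \<open>((\<omega>, s), y)\<close>, and in comments \<open>\<E>\<close> is the measure \<open>\<lambda> \<otimes> \<nu>\<close> on \<open>[0,T] \<times> U\<close>.
\<close>

definition time_measure :: "real \<Rightarrow> real measure" where
  "time_measure T = restrict_space lborel {0..T}"

definition intensity :: "real \<Rightarrow> 'u measure \<Rightarrow> (real \<times> 'u) measure" where
  "intensity T \<nu> = time_measure T \<Otimes>\<^sub>M \<nu>"

definition process_measure ::
    "real \<Rightarrow> 'u measure \<Rightarrow> 'w measure \<Rightarrow> (('w \<times> real) \<times> 'u) measure" where
  "process_measure T \<nu> M = (M \<Otimes>\<^sub>M time_measure T) \<Otimes>\<^sub>M \<nu>"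

text \<open>\<open>L\<^sup>p\<close> functions on \<open>M\<close> that are measurable with respect to a \<open>\<sigma>\<close>-algebra \<open>A\<close>; for the
  predictable spaces \<open>A\<close> is strictly smaller than \<open>M\<close>.\<close>

definition Lp_fun ::
    "'a measure \<Rightarrow> 'a measure \<Rightarrow> real \<Rightarrow> ('a \<Rightarrow> 'b::real_normed_vector) set" where
  "Lp_fun A M p = {f \<in> borel_measurable A. (\<integral>\<^sup>+x. ennreal (norm (f x) powr p) \<partial>M) < \<infinity>}"


section \<open>Integer-valued measures and Poisson random measures\<close>

definition counting_measures :: "'a measure \<Rightarrow> 'a measure set" where
  "counting_measures E =
     {\<eta>. sets \<eta> = sets E \<and> sigma_finite_measure \<eta> \<and>
         (\<forall>B\<in>sets E. emeasure \<eta> B \<in> range ennreal_of_enat)}"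

definition counting_space :: "'a measure \<Rightarrow> 'a measure measure" where
  "counting_space E = sigma (counting_measures E)
     {{\<eta> \<in> counting_measures E. emeasure \<eta> B \<in> A} | A B. A \<in> sets borel \<and> B \<in> sets E}"

definition add_point :: "'a measure \<Rightarrow> 'a \<Rightarrow> 'a measure" where
  "add_point \<eta> z = measure_of (space \<eta>) (sets \<eta>) (\<lambda>B. emeasure \<eta> B + indicator B z)"

text \<open>For \<open>\<E> B = 0\<close> the second condition says \<open>N B = 0\<close> almost surely, since \<open>0 ^ 0 = 1\<close>.\<close>

definition poisson_random_measure ::
    "'w measure \<Rightarrow> 'a measure \<Rightarrow> ('w \<Rightarrow> 'a measure) \<Rightarrow> bool" where
  "poisson_random_measure M \<E> N \<longleftrightarrow>
     N \<in> M \<rightarrow>\<^sub>M counting_space \<E> \<and>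
     (\<forall>B\<in>sets \<E>. emeasure \<E> B < \<infinity> \<longrightarrow>
        (\<forall>k::nat. measure M {\<omega> \<in> space M. emeasure (N \<omega>) B = of_nat k} =
           exp (- measure \<E> B) * measure \<E> B ^ k / fact k)) \<and>
     (\<forall>B\<in>sets \<E>. emeasure \<E> B = \<infinity> \<longrightarrow> (AE \<omega> in M. emeasure (N \<omega>) B = \<infinity>)) \<and>
     (\<forall>(n::nat) B. B ` {..<n} \<subseteq> sets \<E> \<and> disjoint_family_on B {..<n} \<longrightarrow>
        prob_space.indep_vars M (\<lambda>_. borel) (\<lambda>i \<omega>. emeasure (N \<omega>) (B i)) {..<n})"

text \<open>\<open>N = \<Sum>\<^sub>n \<delta>\<^bsub>X n\<^esub>\<close>, the sum ranging over \<open>1 \<le> n \<le> N([0,T] \<times> U)\<close> (all \<open>n \<ge> 1\<close> if the total mass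
  is infinite).\<close>

definition sum_of_diracs ::
    "'w measure \<Rightarrow> 'a measure \<Rightarrow> (nat \<Rightarrow> 'w \<Rightarrow> 'a) \<Rightarrow> ('w \<Rightarrow> 'a measure) \<Rightarrow> bool" where
  "sum_of_diracs M E X N \<longleftrightarrow>
     (\<forall>n. X n \<in> M \<rightarrow>\<^sub>M E) \<and>
     (\<forall>\<omega>\<in>space M. \<forall>B\<in>sets E. emeasure (N \<omega>) B =
        (\<Sum>n. if 1 \<le> n \<and> of_nat n \<le> emeasure (N \<omega>) (space E) then indicator B (X n \<omega>) else 0))"


section \<open>Filtration and predictability\<close>

text \<open>The \<open>P\<close>-completion of a sub-\<open>\<sigma>\<close>-algebra adjoins all null sets of the underlying
  (complete) probability space, as in the usual conditions for filtrations.\<close>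

definition P_completion :: "'w measure \<Rightarrow> 'w measure \<Rightarrow> 'w measure" where
  "P_completion M G = sigma (space M) (sets G \<union> null_sets M)"

definition history :: "real \<Rightarrow> 'u measure \<Rightarrow> 'w measure \<Rightarrow> ('w \<Rightarrow> (real \<times> 'u) measure) \<Rightarrow>
    real \<Rightarrow> 'w measure" where
  "history T \<nu> M N u = P_completion M (sigma (space M)
     {{\<omega> \<in> space M. emeasure (N \<omega>) (({0..u} \<times> UNIV) \<inter> B) \<in> A} | A B.
        A \<in> sets borel \<and> B \<in> sets (intensity T \<nu>)})"

definition Filt :: "real \<Rightarrow> 'u measure \<Rightarrow> 'w measure \<Rightarrow> ('w \<Rightarrow> (real \<times> 'u) measure) \<Rightarrow>
    real \<Rightarrow> 'w measure" where
  "Filt T \<nu> M N t =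
     (if t < T then sigma (space M) (\<Inter>u\<in>{t<..T}. sets (history T \<nu> M N u)) else M)"

definition predictable :: "real \<Rightarrow> 'u measure \<Rightarrow> 'w measure \<Rightarrow> ('w \<Rightarrow> (real \<times> 'u) measure) \<Rightarrow>
    ('w \<times> real) measure" where
  "predictable T \<nu> M N = sigma (space M \<times> {0..T})
     ({A \<times> {0} | A. A \<in> sets (Filt T \<nu> M N 0)} \<union>
      {A \<times> {s<..t} | A s t. 0 \<le> s \<and> s \<le> t \<and> t \<le> T \<and> A \<in> sets (Filt T \<nu> M N s)})"

definition Lp_pr :: "real \<Rightarrow> 'u::topological_space measure \<Rightarrow> 'w measure \<Rightarrow>
    ('w \<Rightarrow> (real \<times> 'u) measure) \<Rightarrow> real \<Rightarrow>
    (('w \<times> real) \<times> 'u \<Rightarrow> 'h::real_normed_vector) set" where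
  "Lp_pr T \<nu> M N p = Lp_fun (predictable T \<nu> M N \<Otimes>\<^sub>M borel) (process_measure T \<nu> M) p"


section \<open>Difference operators\<close>

text \<open>Both operators are almost everywhere independent of the chosen representative, because the
  law of \<open>N + \<delta>\<^bsub>(t,x)\<^esub>\<close> under \<open>P \<otimes> \<lambda> \<otimes> \<nu>\<close> is absolutely continuous with
  respect to the law of \<open>N\<close> (Mecke formula).\<close>

definition diff_op :: "real \<Rightarrow> 'u measure \<Rightarrow> 'w measure \<Rightarrow> ('w \<Rightarrow> (real \<times> 'u) measure) \<Rightarrow>
    ('w \<Rightarrow> 'h::real_normed_vector) \<Rightarrow> real \<times> 'u \<Rightarrow> 'w \<Rightarrow> 'h" where
  "diff_op T \<nu> M N F = (let f = (SOME f. f \<in> borel_measurable (counting_space (intensity T \<nu>)) \<and>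
                                          (AE \<omega> in M. F \<omega> = f (N \<omega>)))
     in (\<lambda>z \<omega>. f (add_point (N \<omega>) z) - f (N \<omega>)))"

definition diff_op_process :: "real \<Rightarrow> 'u measure \<Rightarrow> 'w measure \<Rightarrow>
    ('w \<Rightarrow> (real \<times> 'u) measure) \<Rightarrow> (('w \<times> real) \<times> 'u \<Rightarrow> 'h::real_normed_vector) \<Rightarrow>
    real \<times> 'u \<Rightarrow> ('w \<times> real) \<times> 'u \<Rightarrow> 'h" where
  "diff_op_process T \<nu> M N \<Phi> =
     (let \<phi> = (SOME \<phi>.
            \<phi> \<in> borel_measurable ((counting_space (intensity T \<nu>) \<Otimes>\<^sub>M time_measure T) \<Otimes>\<^sub>M \<nu>) \<and>
            (AE ((\<omega>, s), y) in process_measure T \<nu> M. \<Phi> ((\<omega>, s), y) = \<phi> ((N \<omega>, s), y)))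
      in (\<lambda>z ((\<omega>, s), y). \<phi> ((add_point (N \<omega>) z, s), y) - \<phi> ((N \<omega>, s), y)))"

text \<open>The version of \<open>((\<omega>, s, y), (t, x)) \<mapsto> D\<^bsub>t,x\<^esub> \<Phi>(\<omega>, s, y)\<close> that is predictable in \<open>(\<omega>, s)\<close>.\<close>

definition diff_op_predictable :: "real \<Rightarrow> 'u::topological_space measure \<Rightarrow> 'w measure \<Rightarrow>
    ('w \<Rightarrow> (real \<times> 'u) measure) \<Rightarrow> (('w \<times> real) \<times> 'u \<Rightarrow> 'h::real_normed_vector) \<Rightarrow>
    (('w \<times> real) \<times> 'u) \<times> (real \<times> 'u) \<Rightarrow> 'h" where
  "diff_op_predictable T \<nu> M N \<Phi> = (SOME \<Psi>.
     \<Psi> \<in> borel_measurable ((predictable T \<nu> M N \<Otimes>\<^sub>M borel) \<Otimes>\<^sub>M intensity T \<nu>) \<and>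
     (AE (\<xi>, z) in process_measure T \<nu> M \<Otimes>\<^sub>M intensity T \<nu>.
        \<Psi> (\<xi>, z) = diff_op_process T \<nu> M N \<Phi> z \<xi>))"


section \<open>Stochastic integral\<close>

text \<open>\<open>I\<close> represents the continuous linear map from predictable \<open>L\<^sup>p\<close> processes to \<open>L\<^sup>p(\<Omega>; H)\<close> with
  the prescribed values on elementary integrands. Continuity is stated on representatives, so
  it also forces \<open>I\<close> to respect almost everywhere equality. The compensated value
  \<open>N B - \<E> B\<close> is only used for \<open>\<E> B < \<infinity>\<close>, where \<open>N B\<close> is almost surely finite.\<close>

definition stochastic_integral_map :: "real \<Rightarrow> 'u::topological_space measure \<Rightarrow> 'w measure \<Rightarrow>
    ('w \<Rightarrow> (real \<times> 'u) measure) \<Rightarrow> real \<Rightarrow>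
    ((('w \<times> real) \<times> 'u \<Rightarrow> 'h::real_normed_vector) \<Rightarrow> 'w \<Rightarrow> 'h) \<Rightarrow> bool" where
  "stochastic_integral_map T \<nu> M N p I \<longleftrightarrow>
     (\<forall>\<Phi> \<in> Lp_pr T \<nu> M N p. I \<Phi> \<in> Lp_fun M M p) \<and>
     (\<forall>\<Phi> \<in> Lp_pr T \<nu> M N p. \<forall>\<Psi> \<in> Lp_pr T \<nu> M N p. \<forall>a b :: real.
        AE \<omega> in M. I (\<lambda>\<xi>. a *\<^sub>R \<Phi> \<xi> + b *\<^sub>R \<Psi> \<xi>) \<omega> = a *\<^sub>R I \<Phi> \<omega> + b *\<^sub>R I \<Psi> \<omega>) \<and>
     (\<forall>\<Phi>s. \<forall>\<Phi> \<in> Lp_pr T \<nu> M N p.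
        (\<forall>n::nat. \<Phi>s n \<in> Lp_pr T \<nu> M N p) \<and>
        (\<lambda>n. \<integral>\<^sup>+\<xi>. ennreal (norm (\<Phi>s n \<xi> - \<Phi> \<xi>) powr p) \<partial>process_measure T \<nu> M)
          \<longlonglongrightarrow> 0 \<longrightarrow>
        (\<lambda>n. \<integral>\<^sup>+\<omega>. ennreal (norm (I (\<Phi>s n) \<omega> - I \<Phi> \<omega>) powr p) \<partial>M) \<longlonglongrightarrow> 0) \<and>
     (\<forall>r s F B. 0 \<le> r \<and> r \<le> s \<and> s \<le> T \<and>
        F \<in> borel_measurable (Filt T \<nu> M N r) \<and> bounded (F ` space M) \<and>
        B \<in> sets \<nu> \<and> emeasure \<nu> B < \<infinity> \<longrightarrow>
        (AE \<omega> in M. I (\<lambda>((\<omega>, t), y). indicator ({r<..s} \<times> B) (t, y) *\<^sub>R F \<omega>) \<omega> =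
           (measure (N \<omega>) ({r<..s} \<times> B) - measure (intensity T \<nu>) ({r<..s} \<times> B)) *\<^sub>R F \<omega>))"

definition stochastic_integral :: "real \<Rightarrow> 'u::topological_space measure \<Rightarrow> 'w measure \<Rightarrow>
    ('w \<Rightarrow> (real \<times> 'u) measure) \<Rightarrow> real \<Rightarrow>
    (('w \<times> real) \<times> 'u \<Rightarrow> 'h::real_normed_vector) \<Rightarrow> 'w \<Rightarrow> 'h" where
  "stochastic_integral T \<nu> M N p = (SOME I. stochastic_integral_map T \<nu> M N p I)"

text \<open>For a family \<open>\<Psi>(\<cdot>, z)\<close> of integrands, the map \<open>z \<mapsto> \<integral>\<integral> \<Psi>(s, y, z) (N - \<E>)(ds, dy)\<close> as an element of
  \<open>L\<^sup>0([0,T] \<times> U; L\<^sup>p(\<Omega>; H)) \<subseteq> L\<^sup>0(\<Omega>\<^sub>T \<times> U; H)\<close>, that is, as a jointly measurable function of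
  \<open>((\<omega>, t), x)\<close>. The integrals for single \<open>z\<close> are determined only up to null sets depending on \<open>z\<close>,
  so that the joint version has to be chosen.\<close>

definition stochastic_integral_family :: "real \<Rightarrow> 'u::topological_space measure \<Rightarrow> 'w measure \<Rightarrow>
    ('w \<Rightarrow> (real \<times> 'u) measure) \<Rightarrow> real \<Rightarrow>
    ((('w \<times> real) \<times> 'u) \<times> (real \<times> 'u) \<Rightarrow> 'h::real_normed_vector) \<Rightarrow>
    ('w \<times> real) \<times> 'u \<Rightarrow> 'h" where
  "stochastic_integral_family T \<nu> M N p \<Psi> = (SOME G.
     G \<in> borel_measurable (process_measure T \<nu> M) \<and>
     (AE (t, x) in intensity T \<nu>. AE \<omega> in M.
        G ((\<omega>, t), x) = stochastic_integral T \<nu> M N p (\<lambda>\<xi>. \<Psi> (\<xi>, (t, x))) \<omega>))"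

end

theory Submission
  imports Defs
begin

text \<open>
  For an integrand with a finite first moment the compensated integral is a difference of two
  ordinary integrals along a path. Write the integrand as a function
  \<open>\<phi> (\<eta>\<^sub>s, s, y)\<close> of the restriction \<open>\<eta>\<^sub>s\<close> of the configuration \<open>\<eta>\<close> to \<open>[0,s) \<times> U\<close>, and put
  \<open>J \<phi> \<eta> = \<integral> \<phi> (\<eta>\<^sub>s, s, y) \<eta>(ds,dy) - \<integral> \<phi> (\<eta>\<^sub>s, s, y) \<E>(ds,dy)\<close>. Adding a point \<open>z = (t,x)\<close> to \<open>\<eta>\<close> has two
  effects: the new point contributes \<open>\<phi> (\<eta>\<^sub>t, t, x)\<close>, and at all times after \<open>t\<close> the integrand sees
  \<open>z\<close> in its past, so that \<open>\<phi>\<close> is replaced by an integrand \<open>\<phi>\<^sup>z\<close>. Hence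
  \<open>J \<phi> (\<eta> + \<delta>\<^sub>z) - J \<phi> \<eta> = J (\<phi>\<^sup>z - \<phi>) \<eta> + \<phi> (\<eta>\<^sub>t, t, x)\<close>. This is \<open>J_add_point\<close>, and it is the
  theorem, once all objects are identified with their \<open>L\<^sup>p\<close> versions. That identification needs
  the following.

  \<^item> Mecke's formula (\<open>mecke\<close>): for measurable \<open>h \<ge> 0\<close>,
    \<open>E \<integral> h (N, z) N(dz) = E \<integral> h (N + \<delta>\<^sub>z, z) \<E>(dz)\<close>. It implies that a property that holds almost
    surely for \<open>N\<close> also holds for \<open>N + \<delta>\<^sub>z\<close>, for almost every \<open>z\<close> (\<open>AE_add_point\<close>); so difference
    operators do not depend on the representative, and almost sure limits may be taken at \<open>N + \<delta>\<^sub>z\<close>.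

  \<^item> Every predictable process is, up to null sets, a measurable function of the strict past
    \<open>(N\<^sub>s, s, y)\<close> (\<open>ex_rep_by\<close>), because the generators of the predictable \<open>\<sigma>\<close>-algebra are determined
    by it.

  \<^item> The bound \<open>E \<parallel>J \<phi> N\<parallel>\<^sup>p \<le> c E \<integral> \<parallel>\<phi>\<parallel>\<^sup>p d\<E>\<close> for \<open>1 \<le> p \<le> 2\<close> (\<open>Lp_bound\<close>). For \<open>p = 1\<close> it is the
    compensation formula. For \<open>p = 2\<close> it follows from Mecke's formula and \<open>J_add_point\<close>:
    \<open>E \<parallel>J \<phi> N\<parallel>\<^sup>2 = E \<integral> \<langle>J \<phi> (N + \<delta>\<^sub>z) - J \<phi> N, \<phi> z\<rangle> d\<E>\<close>, which is \<open>E \<integral> \<parallel>\<phi>\<parallel>\<^sup>2 d\<E>\<close> plus a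
    term that vanishes, since \<open>\<phi>\<^sup>z - \<phi>\<close> lives strictly after \<open>t\<close> and \<open>\<phi> (N\<^sub>t, t, x)\<close> is known by then. In
    between it is Marcinkiewicz interpolation.

  \<^item> The stochastic integral is characterised by linearity, continuity and its values on elementary
    processes. The bound yields one such map, the \<open>L\<^sup>p\<close> extension of \<open>J\<close>
    (\<open>the_integral_is_stochastic_integral_map\<close>), and a monotone class argument shows that any
    other such map agrees with it almost surely (\<open>agree_LP\<close>).

  The remaining obstacle is integrability: \<open>\<phi>\<close> has a finite moment of order \<open>p\<close>, \<open>\<phi>\<^sup>z - \<phi>\<close> one of
  order \<open>q\<close>, but \<open>\<phi>\<^sup>z\<close> and \<open>\<phi>\<^sup>z - \<phi>\<close> need not have one of order \<open>p\<close>. Along paths, however, the energies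
  \<open>\<integral> \<parallel>\<phi>\<parallel>\<^sup>p d\<E>\<close> and \<open>\<integral> \<parallel>\<phi>\<^sup>z\<parallel>\<^sup>p d\<E>\<close> are finite almost surely, the second one again by Mecke's formula.
  Switching the integrands off once an energy exceeds \<open>m\<close> makes their moments of order \<open>p\<close> at most
  \<open>m\<close> and does not change the integrals on the event that both energies are at most \<open>m\<close>; the
  commutation relation holds on this event, and these events exhaust the space as \<open>m \<rightarrow> \<infinity>\<close>
  (\<open>commutation_at_point\<close>).

  In comments \<open>E\<close> in front of an integral or a norm is the expectation and \<open>\<E>\<close> is the intensity
  measure, which is called \<open>E\<close> in the formal text.
\<close>

section \<open>Configurations and added points\<close>

lemma space_counting_space [simp]: "space (counting_space E) = counting_measures E"
  unfolding counting_space_def by (rule space_measure_of) auto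

lemma counting_measuresD:
  assumes "\<eta> \<in> counting_measures E"
  shows "sets \<eta> = sets E" "space \<eta> = space E" "sigma_finite_measure \<eta>"
    "B \<in> sets E \<Longrightarrow> emeasure \<eta> B \<in> range ennreal_of_enat"
  using assms by (auto simp: counting_measures_def dest: sets_eq_imp_space_eq)

lemma measurable_emeasure_counting_space:
  assumes "B \<in> sets E"
  shows "(\<lambda>\<eta>. emeasure \<eta> B) \<in> borel_measurable (counting_space E)"
proof (rule measurableI)
  fix A :: "ennreal set" assume "A \<in> sets borel"
  then have "{\<eta> \<in> counting_measures E. emeasure \<eta> B \<in> A} \<in> sets (counting_space E)"
    using assms unfolding counting_space_def by (subst sets_measure_of) auto
  then show "(\<lambda>\<eta>. emeasure \<eta> B) -` A \<inter> space (counting_space E) \<in> sets (counting_space E)"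
    by (simp add: vimage_def Int_def conj_commute)
qed simp

lemma measurable_counting_spaceI:
  assumes "\<And>x. x \<in> space A \<Longrightarrow> f x \<in> counting_measures E"
    and "\<And>B. B \<in> sets E \<Longrightarrow> (\<lambda>x. emeasure (f x) B) \<in> borel_measurable A"
  shows "f \<in> A \<rightarrow>\<^sub>M counting_space E"
  unfolding counting_space_def
proof (rule measurable_measure_of)
  show "f \<in> space A \<rightarrow> counting_measures E" using assms(1) by auto
  fix Y assume "Y \<in> {{\<eta> \<in> counting_measures E. emeasure \<eta> B \<in> W} |W B. W \<in> sets borel \<and> B \<in> sets E}"
  then obtain W B where Y: "Y = {\<eta> \<in> counting_measures E. emeasure \<eta> B \<in> W}" "W \<in> sets borel" "B \<in> sets E"
    by auto
  have "f -` Y \<inter> space A = (\<lambda>x. emeasure (f x) B) -` W \<inter> space A"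
    using assms(1) Y by auto
  also have "\<dots> \<in> sets A" using assms(2) Y by (auto intro: measurable_sets)
  finally show "f -` Y \<inter> space A \<in> sets A" .
qed auto

lemma measurable_emeasure_compose:
  assumes "f \<in> A \<rightarrow>\<^sub>M counting_space E" "B \<in> sets E"
  shows "(\<lambda>x. emeasure (f x) B) \<in> borel_measurable A"
  using measurable_compose[OF assms(1) measurable_emeasure_counting_space[OF assms(2)]] .

lemma sets_add_point [simp, measurable_cong]: "sets (add_point \<eta> z) = sets \<eta>"
  and space_add_point [simp]: "space (add_point \<eta> z) = space \<eta>"
  unfolding add_point_def by (auto simp: space_measure_of_conv sets.space_closed)

lemma emeasure_add_point:
  assumes "B \<in> sets \<eta>"
  shows "emeasure (add_point \<eta> z) B = emeasure \<eta> B + indicator B z"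
proof (rule emeasure_measure_of[OF add_point_def])
  show "sets \<eta> \<subseteq> Pow (space \<eta>)" by (rule sets.space_closed)
  show "B \<in> sets (add_point \<eta> z)" using assms by simp
  show "positive (sets (add_point \<eta> z)) (\<lambda>B. emeasure \<eta> B + indicator B z)"
    by (simp add: positive_def)
  show "countably_additive (sets (add_point \<eta> z)) (\<lambda>B. emeasure \<eta> B + indicator B z)"
  proof (rule countably_additiveI)
    fix A :: "nat \<Rightarrow> 'a set" assume A: "range A \<subseteq> sets (add_point \<eta> z)" "disjoint_family A"
    have "(\<Sum>i. emeasure \<eta> (A i) + indicator (A i) z) = (\<Sum>i. emeasure \<eta> (A i)) + (\<Sum>i. indicator (A i) z)"
      by (rule suminf_add[symmetric]) auto
    also have "\<dots> = emeasure \<eta> (\<Union>i. A i) + indicator (\<Union>i. A i) z"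
      using A by (simp add: suminf_emeasure suminf_indicator)
    finally show "(\<Sum>i. emeasure \<eta> (A i) + indicator (A i) z) = emeasure \<eta> (\<Union>i. A i) + indicator (\<Union>i. A i) z" .
  qed
qed

lemma add_point_in_counting_measures:
  assumes \<eta>: "\<eta> \<in> counting_measures E"
  shows "add_point \<eta> z \<in> counting_measures E"
proof -
  note D = counting_measuresD[OF \<eta>]
  interpret sigma_finite_measure \<eta> by (rule D)
  obtain A :: "'a set set" where A: "countable A" "A \<subseteq> sets \<eta>" "\<Union>A = space \<eta>" "\<forall>a\<in>A. emeasure \<eta> a \<noteq> \<infinity>"
    using sigma_finite_countable by blast
  have "emeasure (add_point \<eta> z) a \<noteq> \<infinity>" if "a \<in> A" for a
    using A that by (subst emeasure_add_point) (auto simp: indicator_def)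
  then have "sigma_finite_measure (add_point \<eta> z)"
    using A by (intro sigma_finite_measure.intro exI[of _ A]) auto
  moreover have "emeasure (add_point \<eta> z) B \<in> range ennreal_of_enat" if B: "B \<in> sets E" for B
  proof -
    obtain k where "emeasure \<eta> B = ennreal_of_enat k" using D(4)[OF B] by auto
    then have "emeasure (add_point \<eta> z) B = ennreal_of_enat (k + (if z \<in> B then 1 else 0))"
      using B D(1) by (cases k) (auto simp: emeasure_add_point indicator_def one_enat_def add.commute)
    then show ?thesis by (metis rangeI)
  qed
  ultimately show ?thesis using D by (auto simp: counting_measures_def)
qed

lemma measurable_add_point [measurable]:
  assumes [measurable]: "f \<in> A \<rightarrow>\<^sub>M counting_space E" "g \<in> A \<rightarrow>\<^sub>M E"
  shows "(\<lambda>x. add_point (f x) (g x)) \<in> A \<rightarrow>\<^sub>M counting_space E"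
proof (rule measurable_counting_spaceI)
  have f: "f x \<in> counting_measures E" if "x \<in> space A" for x
    using measurable_space[OF assms(1) that] by simp
  show "add_point (f x) (g x) \<in> counting_measures E" if "x \<in> space A" for x
    using f[OF that] by (rule add_point_in_counting_measures)
  fix B assume B [measurable]: "B \<in> sets E"
  have [measurable]: "(\<lambda>x. emeasure (f x) B) \<in> borel_measurable A"
    by (rule measurable_emeasure_compose) fact+
  have "(\<lambda>x. emeasure (f x) B + indicator B (g x)) \<in> borel_measurable A" by measurable
  then show "(\<lambda>x. emeasure (add_point (f x) (g x)) B) \<in> borel_measurable A"
    by (rule measurable_cong[THEN iffD1, rotated])
       (use B counting_measuresD(1)[OF f] in \<open>auto simp: emeasure_add_point\<close>)
qed

lemma nn_integral_add_point:
  assumes "f \<in> borel_measurable \<eta>" "z \<in> space \<eta>"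
  shows "(\<integral>\<^sup>+w. f w \<partial>add_point \<eta> z) = (\<integral>\<^sup>+w. f w \<partial>\<eta>) + f z"
  using assms(1)
proof (induction rule: borel_measurable_induct)
  case (cong f g)
  then have "(\<integral>\<^sup>+w. f w \<partial>add_point \<eta> z) = (\<integral>\<^sup>+w. g w \<partial>add_point \<eta> z)" "(\<integral>\<^sup>+w. f w \<partial>\<eta>) = (\<integral>\<^sup>+w. g w \<partial>\<eta>)"
    by (intro nn_integral_cong; simp)+
  moreover have "f z = g z" using cong assms(2) by auto
  ultimately show ?case using cong by simp
next
  case (set A)
  then show ?case by (simp add: emeasure_add_point)
next
  case (mult u c)
  then show ?case by (simp add: nn_integral_cmult distrib_left)
next
  case (add u v)
  then show ?case by (simp add: nn_integral_add ac_simps)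
next
  case (seq U)
  have inc: "incseq (\<lambda>i. (\<integral>\<^sup>+w. U i w \<partial>\<eta>))" "incseq (\<lambda>i. U i z)"
    using seq(3) by (auto intro!: nn_integral_mono simp: mono_def le_fun_def)
  have U: "(SUP i. U i) = (\<lambda>w. SUP i. U i w)" by (auto simp: fun_eq_iff SUP_apply image_image)
  have "(\<integral>\<^sup>+w. (SUP i. U i) w \<partial>add_point \<eta> z) = (SUP i. (\<integral>\<^sup>+w. U i w \<partial>add_point \<eta> z))"
    using seq by (subst nn_integral_monotone_convergence_SUP[symmetric]) (auto simp: U)
  also have "\<dots> = (SUP i. (\<integral>\<^sup>+w. U i w \<partial>\<eta>) + U i z)" using seq by simp
  also have "\<dots> = (SUP i. (\<integral>\<^sup>+w. U i w \<partial>\<eta>)) + (SUP i. U i z)"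
    by (rule ennreal_SUP_add[OF inc])
  also have "\<dots> = (\<integral>\<^sup>+w. (SUP i. U i) w \<partial>\<eta>) + (SUP i. U i) z"
    using seq by (subst nn_integral_monotone_convergence_SUP[symmetric]) (auto simp: U)
  finally show ?case by simp
qed

lemma integrable_add_point_iff:
  fixes f :: "'a \<Rightarrow> 'b::{banach, second_countable_topology}"
  assumes "z \<in> space \<eta>"
  shows "integrable (add_point \<eta> z) f \<longleftrightarrow> integrable \<eta> f"
proof -
  have "f \<in> borel_measurable (add_point \<eta> z) \<longleftrightarrow> f \<in> borel_measurable \<eta>"
    by (rule arg_cong[where f="\<lambda>S. f \<in> S"], rule measurable_cong_sets) simp_all
  then show ?thesis
    unfolding integrable_iff_bounded using assms
    by (auto simp: nn_integral_add_point)
qed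

lemma integral_add_point:
  fixes f :: "'a \<Rightarrow> 'b::{banach, second_countable_topology}"
  assumes f: "integrable \<eta> f" and z: "z \<in> space \<eta>"
  shows "(\<integral>w. f w \<partial>add_point \<eta> z) = (\<integral>w. f w \<partial>\<eta>) + f z"
  using f
proof (induction rule: integrable_induct)
  case (base A c)
  then have "measure (add_point \<eta> z) A = measure \<eta> A + indicator A z"
    by (auto simp: measure_def emeasure_add_point enn2real_plus indicator_def)
  moreover have "A \<in> sets (add_point \<eta> z)" "emeasure (add_point \<eta> z) A \<noteq> \<infinity>"
    using base by (auto simp: emeasure_add_point indicator_def)
  ultimately show ?case using base by (simp add: scaleR_add_left less_top)
next
  case (add f g)
  then show ?case by (simp add: integrable_add_point_iff z)
next
  case (lim f s)
  have m: "f \<in> borel_measurable \<eta>" "\<And>i. s i \<in> borel_measurable \<eta>" using lim by auto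
  have b: "integrable \<eta> (\<lambda>x. 2 * norm (f x))" using lim(4) by simp
  have 1: "(\<lambda>i. integral\<^sup>L (add_point \<eta> z) (s i)) \<longlonglongrightarrow> integral\<^sup>L (add_point \<eta> z) f"
    using lim b m by (intro integral_dominated_convergence[where w="\<lambda>x. 2 * norm (f x)"])
      (auto simp: integrable_add_point_iff z)
  have 2: "(\<lambda>i. integral\<^sup>L \<eta> (s i)) \<longlonglongrightarrow> integral\<^sup>L \<eta> f"
    using lim b m by (intro integral_dominated_convergence[where w="\<lambda>x. 2 * norm (f x)"]) auto
  have "(\<lambda>i. integral\<^sup>L \<eta> (s i) + s i z) \<longlonglongrightarrow> integral\<^sup>L \<eta> f + f z"
    using 2 lim(2)[OF z] by (rule tendsto_add)
  then show ?case using 1 lim(5) by (auto intro: LIMSEQ_unique)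
qed

section \<open>The strict past and events determined up to null sets\<close>

lemma space_time_measure [simp]: "space (time_measure T) = {0..T}"
  by (simp add: time_measure_def space_restrict_space)

lemma measurable_time_ident: "(\<lambda>t. t) \<in> time_measure T \<rightarrow>\<^sub>M borel"
  unfolding time_measure_def by (intro measurable_restrict_space1) simp

lemma measurable_into_time:
  "f \<in> A \<rightarrow>\<^sub>M time_measure T \<longleftrightarrow> f \<in> A \<rightarrow>\<^sub>M borel \<and> f \<in> space A \<rightarrow> {0..T}"
proof -
  have "f \<in> A \<rightarrow>\<^sub>M time_measure T \<longleftrightarrow> f \<in> A \<rightarrow>\<^sub>M restrict_space borel {0..T}"
    unfolding time_measure_def by (intro arg_cong2[where f="(\<in>)"] refl measurable_cong_sets sets_restrict_space_cong) simp_all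
  then show ?thesis by (auto simp: measurable_restrict_space2_iff)
qed

lemma finite_measure_time: "finite_measure (time_measure T)"
  by (rule finite_measureI) (simp add: time_measure_def emeasure_restrict_space space_restrict_space emeasure_lborel_Icc_eq)

lemma null_time_singleton: "emeasure (time_measure T) ({t} \<inter> {0..T}) = 0"
proof -
  have "emeasure (time_measure T) ({t} \<inter> {0..T}) = emeasure lborel ({t} \<inter> {0..T})"
    unfolding time_measure_def by (subst emeasure_restrict_space) auto
  also have "\<dots> \<le> emeasure lborel {t}" by (rule emeasure_mono) auto
  finally show ?thesis by simp
qed

lemma measurable_fst_intensity: "fst \<in> intensity T \<nu> \<rightarrow>\<^sub>M borel"
  unfolding intensity_def by (rule measurable_compose[OF measurable_fst measurable_time_ident])

lemma time_cut_sets: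
  assumes "S \<in> sets borel" "B \<in> sets (intensity T \<nu>)"
  shows "(S \<times> UNIV) \<inter> B \<in> sets (intensity T \<nu>)"
proof -
  have "(S \<times> UNIV) \<inter> B = (fst -` S \<inter> space (intensity T \<nu>)) \<inter> B"
    using sets.sets_into_space[OF assms(2)] by auto
  then show ?thesis using sets.Int[OF measurable_sets[OF measurable_fst_intensity assms(1)] assms(2)] by simp
qed

definition before :: "(real \<times> 'u) measure \<Rightarrow> real \<Rightarrow> (real \<times> 'u) measure" where
  "before \<eta> s = density \<eta> (indicator ({..<s} \<times> UNIV))"

lemma sets_before [simp, measurable_cong]: "sets (before \<eta> s) = sets \<eta>"
  and space_before [simp]: "space (before \<eta> s) = space \<eta>"
  by (simp_all add: before_def)

lemma emeasure_before:
  assumes "sets \<eta> = sets (intensity T \<nu>)" "B \<in> sets (intensity T \<nu>)"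
  shows "emeasure (before \<eta> s) B = emeasure \<eta> (({..<s} \<times> UNIV) \<inter> B)"
proof -
  have sp: "space \<eta> = space (intensity T \<nu>)" using assms(1) by (rule sets_eq_imp_space_eq)
  have m: "({..<s} \<times> UNIV) \<inter> space \<eta> \<in> sets \<eta>"
    unfolding assms(1) sp by (rule time_cut_sets) auto
  have "emeasure (before \<eta> s) B = (\<integral>\<^sup>+z. indicator ({..<s} \<times> UNIV) z * indicator B z \<partial>\<eta>)"
    unfolding before_def
  proof (rule emeasure_density)
    show "(indicator ({..<s} \<times> UNIV) :: _ \<Rightarrow> ennreal) \<in> borel_measurable \<eta>"
      by (rule borel_measurable_indicator_iff[THEN iffD2, OF m])
    show "B \<in> sets \<eta>" using assms by simp
  qed
  also have "\<dots> = (\<integral>\<^sup>+z. indicator (({..<s} \<times> UNIV) \<inter> B) z \<partial>\<eta>)"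
    by (simp add: indicator_inter_arith)
  also have "\<dots> = emeasure \<eta> (({..<s} \<times> UNIV) \<inter> B)"
    using time_cut_sets[of "{..<s}" B T \<nu>] assms by (intro nn_integral_indicator) auto
  finally show ?thesis .
qed

text \<open>
  Only rational times occur and only closed intervals \<open>[0,q]\<close> with \<open>q < s\<close>. This is the form in
  which measurability in \<open>s\<close> and adaptedness to the filtration can be read off.
\<close>

lemma emeasure_before_SUP:
  assumes "sets \<eta> = sets (intensity T \<nu>)" "B \<in> sets (intensity T \<nu>)"
  shows "emeasure (before \<eta> s) B =
    (SUP q\<in>\<rat>. if q < s then emeasure \<eta> (({..q} \<times> UNIV) \<inter> B) else 0)" (is "_ = ?R")
proof (rule antisym)
  have cut: "({..q} \<times> UNIV) \<inter> B \<in> sets \<eta>" "({..<q} \<times> UNIV) \<inter> B \<in> sets \<eta>" for q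
    using time_cut_sets[of _ B T \<nu>] assms by auto
  have "(\<Union>n. ({..s - 1 / real (Suc n)} \<times> UNIV) \<inter> B) = ({..<s} \<times> UNIV) \<inter> B"
  proof (intro equalityI subsetI)
    fix z assume z: "z \<in> ({..<s} \<times> UNIV) \<inter> B"
    obtain n where "inverse (real (Suc n)) < s - fst z" using z reals_Archimedean[of "s - fst z"] by auto
    then show "z \<in> (\<Union>n. ({..s - 1 / real (Suc n)} \<times> UNIV) \<inter> B)"
      using z by (intro UN_I[of n]) (auto simp: field_simps inverse_eq_divide split: prod.splits)
  next
    fix z assume "z \<in> (\<Union>n. ({..s - 1 / real (Suc n)} \<times> UNIV) \<inter> B)"
    then obtain n where "z \<in> B" "fst z \<le> s - 1 / real (Suc n)" by auto
    moreover have "0 < 1 / real (Suc n)" by simp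
    ultimately have "fst z < s" "z \<in> B" by linarith+
    then show "z \<in> ({..<s} \<times> UNIV) \<inter> B" by (cases z) auto
  qed
  then have "emeasure (before \<eta> s) B = emeasure \<eta> (\<Union>n. ({..s - 1 / real (Suc n)} \<times> UNIV) \<inter> B)"
    by (simp add: emeasure_before[OF assms])
  also have "\<dots> = (SUP n. emeasure \<eta> (({..s - 1 / real (Suc n)} \<times> UNIV) \<inter> B))"
  proof (rule SUP_emeasure_incseq[symmetric])
    have le: "s - 1 / real (Suc m) \<le> s - 1 / real (Suc n)" if "m \<le> n" for m n
      using that by (simp add: frac_le)
    show "incseq (\<lambda>n. ({..s - 1 / real (Suc n)} \<times> UNIV) \<inter> B)"
      unfolding incseq_def using le by (fastforce intro: order_trans)
  qed (use cut in auto)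
  also have "\<dots> \<le> ?R"
  proof (rule SUP_least)
    fix n
    obtain q where q: "q \<in> \<rat>" "s - 1 / real (Suc n) < q" "q < s"
      using Rats_dense_in_real[of "s - 1 / real (Suc n)" s] by auto
    have "emeasure \<eta> (({..s - 1 / real (Suc n)} \<times> UNIV) \<inter> B) \<le> emeasure \<eta> (({..q} \<times> UNIV) \<inter> B)"
      using q cut by (intro emeasure_mono) auto
    also have "\<dots> \<le> ?R" using q by (intro SUP_upper2[of q]) auto
    finally show "emeasure \<eta> (({..s - 1 / real (Suc n)} \<times> UNIV) \<inter> B) \<le> ?R" .
  qed
  finally show "emeasure (before \<eta> s) B \<le> ?R" .
  show "?R \<le> emeasure (before \<eta> s) B"
    using cut by (intro SUP_least) (auto simp: emeasure_before[OF assms] intro!: emeasure_mono)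
qed

lemma before_in_counting_measures:
  assumes \<eta>: "\<eta> \<in> counting_measures (intensity T \<nu>)"
  shows "before \<eta> s \<in> counting_measures (intensity T \<nu>)"
proof -
  note D = counting_measuresD[OF \<eta>]
  interpret sigma_finite_measure \<eta> by (rule D)
  obtain A :: "(real \<times> 'a) set set" where A: "countable A" "A \<subseteq> sets \<eta>" "\<Union>A = space \<eta>" "\<forall>a\<in>A. emeasure \<eta> a \<noteq> \<infinity>"
    using sigma_finite_countable by blast
  have "emeasure (before \<eta> s) a \<noteq> \<infinity>" if "a \<in> A" for a
  proof -
    have "emeasure (before \<eta> s) a = emeasure \<eta> (({..<s} \<times> UNIV) \<inter> a)"
      by (rule emeasure_before) (use A that D in auto)
    also have "\<dots> \<le> emeasure \<eta> a" using A that by (intro emeasure_mono) auto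
    finally show ?thesis using A that by (auto simp: top_unique)
  qed
  then have "sigma_finite_measure (before \<eta> s)"
    using A by (intro sigma_finite_measure.intro exI[of _ A]) auto
  moreover have "emeasure (before \<eta> s) B \<in> range ennreal_of_enat" if B: "B \<in> sets (intensity T \<nu>)" for B
    using D(4)[OF time_cut_sets[OF _ B, of "{..<s}"]] emeasure_before[OF D(1) B, of s] by simp
  ultimately show ?thesis using D by (auto simp: counting_measures_def)
qed

lemma measurable_beforeI:
  assumes f: "\<And>x. x \<in> space A \<Longrightarrow> f x \<in> counting_measures (intensity T \<nu>)"
    and m: "\<And>q B. B \<in> sets (intensity T \<nu>) \<Longrightarrow>
      (\<lambda>x. if q < s x then emeasure (f x) (({..q} \<times> UNIV) \<inter> B) else 0) \<in> borel_measurable A"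
  shows "(\<lambda>x. before (f x) (s x)) \<in> A \<rightarrow>\<^sub>M counting_space (intensity T \<nu>)"
proof (rule measurable_counting_spaceI)
  show "before (f x) (s x) \<in> counting_measures (intensity T \<nu>)" if "x \<in> space A" for x
    using f[OF that] by (rule before_in_counting_measures)
  fix B assume B: "B \<in> sets (intensity T \<nu>)"
  have "(\<lambda>x. SUP q\<in>\<rat>. if q < s x then emeasure (f x) (({..q} \<times> UNIV) \<inter> B) else 0) \<in> borel_measurable A"
    using m[OF B] countable_rat by (intro borel_measurable_SUP) auto
  then show "(\<lambda>x. emeasure (before (f x) (s x)) B) \<in> borel_measurable A"
    by (rule measurable_cong[THEN iffD1, rotated])
      (use emeasure_before_SUP[OF counting_measuresD(1)[OF f] B] in auto)
qed

lemma measurable_before: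
  assumes [measurable]: "f \<in> A \<rightarrow>\<^sub>M counting_space (intensity T \<nu>)" "s \<in> borel_measurable A"
  shows "(\<lambda>x. before (f x) (s x)) \<in> A \<rightarrow>\<^sub>M counting_space (intensity T \<nu>)"
proof (rule measurable_beforeI)
  show "f x \<in> counting_measures (intensity T \<nu>)" if "x \<in> space A" for x
    using measurable_space[OF assms(1) that] by simp
  fix q :: real and B assume "B \<in> sets (intensity T \<nu>)"
  then have [measurable]: "(\<lambda>x. emeasure (f x) (({..q} \<times> UNIV) \<inter> B)) \<in> borel_measurable A"
    by (intro measurable_emeasure_compose[OF assms(1)] time_cut_sets) auto
  show "(\<lambda>x. if q < s x then emeasure (f x) (({..q} \<times> UNIV) \<inter> B) else 0) \<in> borel_measurable A"
    by measurable
qed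

lemma before_before:
  assumes "sets \<eta> = sets (intensity T \<nu>)" "r \<le> s"
  shows "before (before \<eta> s) r = before \<eta> r"
proof (rule measure_eqI)
  fix B assume "B \<in> sets (before (before \<eta> s) r)"
  then have B: "B \<in> sets (intensity T \<nu>)" using assms by simp
  have "({..<s} \<times> UNIV) \<inter> (({..<r} \<times> UNIV) \<inter> B) = ({..<r} \<times> UNIV) \<inter> B"
    using assms(2) by auto
  then show "emeasure (before (before \<eta> s) r) B = emeasure (before \<eta> r) B"
    using B assms time_cut_sets[OF _ B, of "{..<r}"] by (simp add: emeasure_before[of _ T \<nu>])
qed simp

text \<open>
  A point at time exactly \<open>s\<close> does not belong to the strict past, which is why an integrand is
  not affected at \<open>z\<close> itself when \<open>z\<close> is added to the configuration.
\<close>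

lemma before_add_point:
  assumes "sets \<eta> = sets (intensity T \<nu>)"
  shows "before (add_point \<eta> z) s = (if fst z < s then add_point (before \<eta> s) z else before \<eta> s)"
proof (rule measure_eqI)
  fix B assume "B \<in> sets (before (add_point \<eta> z) s)"
  then have B: "B \<in> sets (intensity T \<nu>)" using assms by simp
  have "emeasure (before (add_point \<eta> z) s) B = emeasure \<eta> (({..<s} \<times> UNIV) \<inter> B) + indicator (({..<s} \<times> UNIV) \<inter> B) z"
    using B assms time_cut_sets[OF _ B, of "{..<s}"]
    by (simp add: emeasure_before[of _ T \<nu>] emeasure_add_point)
  also have "\<dots> = emeasure (if fst z < s then add_point (before \<eta> s) z else before \<eta> s) B"
    using B assms by (cases z) (auto simp: emeasure_before[of _ T \<nu>] emeasure_add_point indicator_def)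
  finally show "emeasure (before (add_point \<eta> z) s) B = emeasure (if fst z < s then add_point (before \<eta> s) z else before \<eta> s) B" .
qed simp

text \<open>
  The completion of the \<open>\<sigma>\<close>-algebra generated by \<open>K\<close>, in a form from which Doob--Dynkin
  factorisations can be obtained.
\<close>

definition events_mod_null :: "'a measure \<Rightarrow> ('a \<Rightarrow> 'b) \<Rightarrow> 'b measure \<Rightarrow> 'a set set" where
  "events_mod_null \<mu> K B = {S. S \<subseteq> space \<mu> \<and> (\<exists>Z\<in>sets B. AE x in \<mu>. x \<in> S \<longleftrightarrow> K x \<in> Z)}"

lemma sigma_algebra_events_mod_null:
  assumes K: "K \<in> space \<mu> \<rightarrow> space B"
  shows "sigma_algebra (space \<mu>) (events_mod_null \<mu> K B)"
proof (rule sigma_algebra_iff2[THEN iffD2], safe)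
  show "x \<in> space \<mu>" if "S \<in> events_mod_null \<mu> K B" "x \<in> S" for x S using that by (auto simp: events_mod_null_def)
  show "{} \<in> events_mod_null \<mu> K B" by (auto simp: events_mod_null_def intro!: bexI[of _ "{}"])
next
  fix S assume "S \<in> events_mod_null \<mu> K B"
  then obtain Z where Z: "Z \<in> sets B" "AE x in \<mu>. x \<in> S \<longleftrightarrow> K x \<in> Z" by (auto simp: events_mod_null_def)
  have "AE x in \<mu>. x \<in> space \<mu> - S \<longleftrightarrow> K x \<in> space B - Z"
    using Z(2) AE_space by eventually_elim (use K in auto)
  then show "space \<mu> - S \<in> events_mod_null \<mu> K B" using Z by (auto simp: events_mod_null_def intro!: bexI[of _ "space B - Z"])
next
  fix A :: "nat \<Rightarrow> 'a set" assume "range A \<subseteq> events_mod_null \<mu> K B"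
  then have "\<forall>i. A i \<subseteq> space \<mu> \<and> (\<exists>Z\<in>sets B. AE x in \<mu>. x \<in> A i \<longleftrightarrow> K x \<in> Z)"
    by (auto simp: events_mod_null_def image_subset_iff)
  then obtain Z where Z: "\<And>i. A i \<subseteq> space \<mu>" "\<And>i. Z i \<in> sets B" "\<And>i. AE x in \<mu>. x \<in> A i \<longleftrightarrow> K x \<in> Z i"
    by metis
  have "AE x in \<mu>. \<forall>i. x \<in> A i \<longleftrightarrow> K x \<in> Z i" using Z(3) by (simp add: AE_all_countable)
  then have "AE x in \<mu>. x \<in> (\<Union>i. A i) \<longleftrightarrow> K x \<in> (\<Union>i. Z i)" by eventually_elim auto
  then show "(\<Union>i. A i) \<in> events_mod_null \<mu> K B" using Z by (auto simp: events_mod_null_def intro!: bexI[of _ "\<Union>i. Z i"])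
qed

text \<open>
  Doob--Dynkin factorisation up to null sets: a simple function factors level set by level set, and
  the pointwise limit of the factors is a factor of the limit.
\<close>

lemma factorisation_mod_null:
  fixes F :: "'a \<Rightarrow> 'h::{banach, second_countable_topology}"
  assumes F: "F \<in> borel_measurable A" and A: "space A = space \<mu>" "sets A \<subseteq> events_mod_null \<mu> K B"
  obtains f where "f \<in> borel_measurable B" "AE x in \<mu>. F x = f (K x)"
proof -
  obtain s where s: "\<And>i. simple_function A (s i)" "\<And>x. x \<in> space A \<Longrightarrow> (\<lambda>i. s i x) \<longlonglongrightarrow> F x"
    using borel_measurable_implies_sequence_metric[OF F, of 0] by metis
  have "\<exists>g. g \<in> borel_measurable B \<and> (AE x in \<mu>. s i x = g (K x))" for i
  proof -
    let ?S = "\<lambda>c. s i -` {c} \<inter> space A"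
    have fin: "finite (s i ` space A)" using s(1) by (simp add: simple_function_def)
    have "\<forall>c\<in>s i ` space A. \<exists>Z. Z \<in> sets B \<and> (AE x in \<mu>. x \<in> ?S c \<longleftrightarrow> K x \<in> Z)"
    proof
      fix c assume "c \<in> s i ` space A"
      then have "?S c \<in> events_mod_null \<mu> K B" using s(1)[of i] A(2) by (auto simp: simple_function_def)
      then show "\<exists>Z. Z \<in> sets B \<and> (AE x in \<mu>. x \<in> ?S c \<longleftrightarrow> K x \<in> Z)" by (auto simp: events_mod_null_def)
    qed
    then obtain Z where Z: "\<And>c. c \<in> s i ` space A \<Longrightarrow> Z c \<in> sets B"
      "\<And>c. c \<in> s i ` space A \<Longrightarrow> AE x in \<mu>. x \<in> ?S c \<longleftrightarrow> K x \<in> Z c" by metis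
    let ?g = "\<lambda>b. \<Sum>c\<in>s i ` space A. indicator (Z c) b *\<^sub>R c"
    have "?g \<in> borel_measurable B" using Z(1) by (intro borel_measurable_sum borel_measurable_scaleR) auto
    moreover have "AE x in \<mu>. \<forall>c\<in>s i ` space A. x \<in> ?S c \<longleftrightarrow> K x \<in> Z c"
      unfolding AE_finite_all[OF fin] using Z(2) by blast
    then have "AE x in \<mu>. s i x = ?g (K x)"
      using AE_space
    proof eventually_elim
      case (elim x)
      then have "?g (K x) = (\<Sum>c\<in>s i ` space A. if c = s i x then c else 0)"
        using A(1) by (intro sum.cong) (auto simp: indicator_def)
      also have "\<dots> = s i x" using elim A(1) fin by (simp add: sum.delta)
      finally show ?case by simp
    qed
    ultimately show ?thesis by auto
  qed
  then obtain g where g: "\<And>i. g i \<in> borel_measurable B" "\<And>i. AE x in \<mu>. s i x = g i (K x)" by metis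
  let ?f = "\<lambda>b. lim (\<lambda>i. g i b)"
  have m: "?f \<in> borel_measurable B" using g(1) by (rule borel_measurable_lim_metric)
  have "AE x in \<mu>. \<forall>i. s i x = g i (K x)" using g(2) by (simp add: AE_all_countable)
  then have "AE x in \<mu>. F x = ?f (K x)"
    using AE_space
  proof eventually_elim
    case (elim x)
    have l: "(\<lambda>i. g i (K x)) \<longlonglongrightarrow> F x" using s(2)[of x] elim A(1) by simp
    then show ?case by (simp add: limI)
  qed
  with m show ?thesis by (rule that)
qed

section \<open>Shift identities for Poisson variables\<close>

locale poisson = prob_space M for M :: "'w measure" +
  fixes E :: "'a measure" and N :: "'w \<Rightarrow> 'a measure"
  assumes sigma_finite_E: "sigma_finite_measure E"
    and nonempty_E: "space E \<noteq> {}"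
    and poisson: "poisson_random_measure M E N"
begin

sublocale E: sigma_finite_measure E by (rule sigma_finite_E)

lemma measurable_N [measurable]: "N \<in> M \<rightarrow>\<^sub>M counting_space E"
  using poisson by (simp add: poisson_random_measure_def)

lemma N_counting: "\<omega> \<in> space M \<Longrightarrow> N \<omega> \<in> counting_measures E"
  using measurable_space[OF measurable_N] by simp

lemma sets_N: "\<omega> \<in> space M \<Longrightarrow> sets (N \<omega>) = sets E"
  and space_N: "\<omega> \<in> space M \<Longrightarrow> space (N \<omega>) = space E"
  using counting_measuresD[OF N_counting] by auto

lemma measurable_N_emeasure: "B \<in> sets E \<Longrightarrow> (\<lambda>\<omega>. emeasure (N \<omega>) B) \<in> borel_measurable M"
  by (rule measurable_emeasure_compose[OF measurable_N])

lemma nn_integral_poisson: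
  assumes B: "B \<in> sets E" "emeasure E B < \<infinity>" and g [measurable]: "g \<in> borel_measurable borel"
  shows "(\<integral>\<^sup>+\<omega>. g (emeasure (N \<omega>) B) \<partial>M) =
    (\<Sum>k. ennreal (exp (- measure E B) * measure E B ^ k / fact k) * g (of_nat k))"
proof -
  note [measurable] = measurable_N_emeasure[OF B(1)]
  define m where "m = measure E B"
  define p where "p k = exp (- m) * m ^ k / fact k" for k :: nat
  define V where "V k = {\<omega> \<in> space M. emeasure (N \<omega>) B = of_nat k}" for k :: nat
  have p0: "0 \<le> p k" for k by (simp add: p_def m_def)
  have V [measurable]: "V k \<in> sets M" for k unfolding V_def by measurable
  have pV: "emeasure M (V k) = ennreal (p k)" for k
    using poisson B by (simp add: poisson_random_measure_def emeasure_eq_measure V_def p_def m_def)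
  have dis: "disjoint_family V" by (auto simp: disjoint_family_on_def V_def)
  have "p sums 1"
  proof -
    have "(\<lambda>k. exp (- m) * (inverse (fact k) * m ^ k)) sums (exp (- m) * exp m)"
      using exp_converges[of m] by (intro sums_mult) (simp add: scaleR_conv_of_real)
    then show ?thesis by (simp add: p_def[abs_def] exp_minus field_simps)
  qed
  then have "(\<Sum>k. ennreal (p k)) = 1"
    using p0 by (simp add: suminf_ennreal2 sums_iff)
  then have "emeasure M (\<Union>k. V k) = 1"
    using suminf_emeasure[of V M] dis pV by (simp add: image_subset_iff)
  then have ae: "AE \<omega> in M. \<omega> \<in> (\<Union>k. V k)"
    by (intro prob_eq_1[THEN iffD1]) (auto simp: emeasure_eq_measure)
  have "(\<integral>\<^sup>+\<omega>. g (emeasure (N \<omega>) B) \<partial>M) = (\<integral>\<^sup>+\<omega>. (\<Sum>k. g (of_nat k) * indicator (V k) \<omega>) \<partial>M)"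
  proof (rule nn_integral_cong_AE)
    show "AE \<omega> in M. g (emeasure (N \<omega>) B) = (\<Sum>k. g (of_nat k) * indicator (V k) \<omega>)"
      using ae
    proof eventually_elim
      case (elim \<omega>)
      then obtain j where j: "\<omega> \<in> V j" by auto
      have "indicator (V k) \<omega> = (0 :: ennreal)" if "k \<noteq> j" for k
        using j dis that by (auto simp: disjoint_family_on_def indicator_def)
      then have "(\<Sum>k. g (of_nat k) * indicator (V k) \<omega>) = (\<Sum>k\<in>{j}. g (of_nat k) * indicator (V k) \<omega>)"
        by (intro suminf_finite) simp_all
      moreover have "emeasure (N \<omega>) B = of_nat j" using j by (simp add: V_def)
      ultimately show ?case using j by simp
    qed
  qed
  also have "\<dots> = (\<Sum>k. \<integral>\<^sup>+\<omega>. g (of_nat k) * indicator (V k) \<omega> \<partial>M)"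
    by (rule nn_integral_suminf) measurable
  also have "\<dots> = (\<Sum>k. ennreal (p k) * g (of_nat k))"
    by (simp add: nn_integral_cmult_indicator pV mult.commute)
  finally show ?thesis by (simp add: p_def m_def)
qed

text \<open>
  Mecke's formula for a single Poisson variable with mean \<open>m\<close>; on the level of weights it says
  \<open>(k + 1) p\<^bsub>k+1\<^esub> = m p\<^sub>k\<close>.
\<close>

lemma nn_integral_poisson_shift:
  assumes B: "B \<in> sets E" "emeasure E B < \<infinity>" and h [measurable]: "h \<in> borel_measurable borel"
  shows "(\<integral>\<^sup>+\<omega>. emeasure (N \<omega>) B * h (emeasure (N \<omega>) B) \<partial>M) =
    emeasure E B * (\<integral>\<^sup>+\<omega>. h (emeasure (N \<omega>) B + 1) \<partial>M)"
proof -
  define m where "m = measure E B"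
  define p where "p k = exp (- m) * m ^ k / fact k" for k :: nat
  have EB: "emeasure E B = ennreal m" using B by (simp add: m_def emeasure_eq_ennreal_measure)
  have m0: "0 \<le> m" by (simp add: m_def)
  have Suc: "ennreal (p (Suc k)) * (of_nat (Suc k) * x) = ennreal m * (ennreal (p k) * x)" for k x
  proof -
    have eq: "p (Suc k) * real (Suc k) = m * p k"
      by (simp add: p_def fact_Suc field_simps del: of_nat_Suc)
    have "ennreal (p (Suc k)) * of_nat (Suc k) = ennreal (p (Suc k) * real (Suc k))"
      using m0 by (subst ennreal_mult) (auto simp: p_def ennreal_of_nat_eq_real_of_nat)
    also have "\<dots> = ennreal m * ennreal (p k)"
      unfolding eq using m0 by (subst ennreal_mult) (auto simp: p_def)
    finally show ?thesis by (simp add: mult.assoc[symmetric])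
  qed
  let ?f = "\<lambda>k. ennreal (p k) * (of_nat k * h (of_nat k))"
  have "(\<lambda>k. ?f (Suc k)) sums (\<Sum>k. ?f (Suc k))" by (intro summable_sums) auto
  then have "?f sums ((\<Sum>k. ?f (Suc k)) + ?f 0)" by (rule sums_Suc)
  then have split: "(\<Sum>k. ?f k) = (\<Sum>k. ?f (Suc k))" by (simp add: sums_iff)
  have "(\<integral>\<^sup>+\<omega>. emeasure (N \<omega>) B * h (emeasure (N \<omega>) B) \<partial>M) = (\<Sum>k. ?f k)"
    by (subst nn_integral_poisson[OF B, where g="\<lambda>x. x * h x"]) (simp_all add: p_def m_def)
  also have "\<dots> = (\<Sum>k. ennreal m * (ennreal (p k) * h (of_nat k + 1)))"
    unfolding split Suc by (simp add: add.commute)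
  also have "\<dots> = ennreal m * (\<Sum>k. ennreal (p k) * h (of_nat k + 1))" by simp
  also have "(\<Sum>k. ennreal (p k) * h (of_nat k + 1)) = (\<integral>\<^sup>+\<omega>. h (emeasure (N \<omega>) B + 1) \<partial>M)"
    by (subst nn_integral_poisson[OF B, where g="\<lambda>x. h (x + 1)"]) (simp_all add: p_def m_def)
  finally show ?thesis by (simp add: EB)
qed

text \<open>
  Independence turns the law of the vector into a product measure; Fubini isolates the coordinate
  \<open>i\<close>, to which the one-dimensional shift applies.
\<close>

lemma nn_integral_poisson_family_shift:
  fixes C :: "nat \<Rightarrow> 'a set"
  assumes C: "disjoint_family_on C {..<n}" "C ` {..<n} \<subseteq> sets E"
    and i: "i < n" "emeasure E (C i) < \<infinity>"
    and g [measurable]: "g \<in> borel_measurable (\<Pi>\<^sub>M j\<in>{..<n}. borel)"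
  shows "(\<integral>\<^sup>+\<omega>. emeasure (N \<omega>) (C i) * g (\<lambda>j\<in>{..<n}. emeasure (N \<omega>) (C j)) \<partial>M) =
    emeasure E (C i) * (\<integral>\<^sup>+\<omega>. g (\<lambda>j\<in>{..<n}. emeasure (N \<omega>) (C j) + (if j = i then 1 else 0)) \<partial>M)"
proof -
  let ?X = "\<lambda>j \<omega>. emeasure (N \<omega>) (C j)"
  let ?XX = "\<lambda>\<omega>. \<lambda>j\<in>{..<n}. ?X j \<omega>"
  let ?P = "(\<Pi>\<^sub>M j\<in>{..<n}. borel) :: (nat \<Rightarrow> ennreal) measure"
  define I where "I = {..<n} - {i}"
  have I: "finite I" "i \<notin> I" "insert i I = {..<n}" using i by (auto simp: I_def)
  have X: "random_variable borel (?X j)" if "j \<in> {..<n}" for j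
    using that C(2) by (intro measurable_N_emeasure) auto
  have Xi [measurable]: "?X i \<in> borel_measurable M" using X i by auto
  have XX [measurable]: "?XX \<in> M \<rightarrow>\<^sub>M ?P" using X by (intro measurable_restrict) auto
  define D where "D j = (if j < n then distr M borel (?X j) else return borel (0::ennreal))" for j
  have pD: "prob_space (D j)" for j
    unfolding D_def using X by (auto intro!: prob_space_distr prob_space_return)
  interpret D: product_prob_space D by (intro product_prob_spaceI pD)
  have sD [measurable_cong]: "sets (D j) = sets borel" for j by (simp add: D_def)
  have PD: "borel_measurable (PiM (insert i I) D) = (borel_measurable ?P :: (_ \<Rightarrow> ennreal) set)"
    by (intro measurable_cong_sets sets_PiM_cong) (simp_all add: sD I)
  have "indep_vars (\<lambda>_. borel) ?X {..<n}"
    using poisson C by (simp add: poisson_random_measure_def)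
  then have "distr M ?P ?XX = (\<Pi>\<^sub>M j\<in>{..<n}. distr M borel (?X j))"
    using i X by (subst (asm) indep_vars_iff_distr_eq_PiM') auto
  also have "\<dots> = PiM {..<n} D" by (rule PiM_cong) (auto simp: D_def)
  finally have dist: "distr M ?P ?XX = PiM {..<n} D" .
  have law: "(\<integral>\<^sup>+\<omega>. f (?XX \<omega>) \<partial>M) = (\<integral>\<^sup>+x. f x \<partial>PiM (insert i I) D)" if "f \<in> borel_measurable ?P" for f
  proof -
    have "(\<integral>\<^sup>+\<omega>. f (?XX \<omega>) \<partial>M) = (\<integral>\<^sup>+x. f x \<partial>distr M ?P ?XX)"
      using that by (intro nn_integral_distr[symmetric] XX) simp
    then show ?thesis by (simp only: dist I(3))
  qed
  let ?h = "\<lambda>y. \<integral>\<^sup>+x. g (x(i := y)) \<partial>PiM I D"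
  have gD [measurable]: "g \<in> borel_measurable (PiM (insert i I) D)"
    using g by (simp only: PD)
  interpret PI: prob_space "PiM I D" by (rule prob_space_PiM[OF pD])
  have h [measurable]: "?h \<in> borel_measurable borel"
  proof (rule PI.borel_measurable_nn_integral)
    have "(\<lambda>p. (snd p)(i := fst p)) \<in> borel \<Otimes>\<^sub>M PiM I D \<rightarrow>\<^sub>M PiM (insert i I) D"
      by (rule measurable_fun_upd[where J=I]) (auto simp: measurable_cong_sets[OF refl sD])
    from measurable_compose[OF this gD]
    show "(\<lambda>(y, x). g (x(i := y))) \<in> borel_measurable (borel \<Otimes>\<^sub>M PiM I D)"
      by (simp add: case_prod_beta')
  qed
  let ?s = "\<lambda>x. \<lambda>j\<in>{..<n}. x j + (if j = i then 1 else 0 :: ennreal)"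
  have s [measurable]: "?s \<in> ?P \<rightarrow>\<^sub>M ?P"
    by (rule measurable_restrict) measurable
  have xg: "(\<lambda>x. x i * g x) \<in> borel_measurable ?P"
    by (intro borel_measurable_times_ennreal measurable_component_singleton g) (use i in simp)
  have "(\<integral>\<^sup>+\<omega>. ?X i \<omega> * g (?XX \<omega>) \<partial>M) = (\<integral>\<^sup>+\<omega>. (\<lambda>x. x i * g x) (?XX \<omega>) \<partial>M)"
    using i by simp
  also have "\<dots> = (\<integral>\<^sup>+x. x i * g x \<partial>PiM (insert i I) D)"
    by (intro law xg)
  also have "\<dots> = (\<integral>\<^sup>+y. \<integral>\<^sup>+x. y * g (x(i := y)) \<partial>PiM I D \<partial>D i)"
    using xg unfolding PD[symmetric] by (subst D.product_nn_integral_insert_rev[OF I(1,2)]) simp_all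
  also have "\<dots> = (\<integral>\<^sup>+y. y * ?h y \<partial>D i)"
  proof (intro nn_integral_cong nn_integral_cmult)
    fix y
    have "(\<lambda>x. x(i := y)) \<in> PiM I D \<rightarrow>\<^sub>M PiM (insert i I) D"
      by (rule measurable_fun_upd[where J=I]) (auto simp: measurable_cong_sets[OF refl sD])
    from measurable_compose[OF this gD] show "(\<lambda>x. g (x(i := y))) \<in> borel_measurable (PiM I D)" .
  qed
  also have "\<dots> = (\<integral>\<^sup>+\<omega>. ?X i \<omega> * ?h (?X i \<omega>) \<partial>M)"
    using i by (simp add: D_def nn_integral_distr)
  also have "\<dots> = emeasure E (C i) * (\<integral>\<^sup>+\<omega>. ?h (?X i \<omega> + 1) \<partial>M)"
    using C(2) i by (intro nn_integral_poisson_shift h) auto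
  also have "(\<integral>\<^sup>+\<omega>. ?h (?X i \<omega> + 1) \<partial>M) = (\<integral>\<^sup>+y. ?h (y + 1) \<partial>D i)"
    using i by (simp add: D_def nn_integral_distr)
  also have "\<dots> = (\<integral>\<^sup>+y. \<integral>\<^sup>+x. g (?s (x(i := y))) \<partial>PiM I D \<partial>D i)"
  proof (intro nn_integral_cong arg_cong[where f=g])
    fix x y assume "x \<in> space (PiM I D)"
    then have "x \<in> extensional I" by (simp add: space_PiM PiE_def)
    then show "x(i := y + 1) = ?s (x(i := y))"
      using i by (auto simp: fun_eq_iff I_def extensional_def)
  qed
  also have "\<dots> = (\<integral>\<^sup>+x. g (?s x) \<partial>PiM (insert i I) D)"
  proof (subst D.product_nn_integral_insert_rev[OF I(1,2)])
    have "(\<lambda>x. g (?s x)) \<in> borel_measurable ?P" by (rule measurable_compose[OF s g])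
    then show "(\<lambda>x. g (?s x)) \<in> borel_measurable (PiM (insert i I) D)"
      by (simp only: PD)
  qed simp
  also have "\<dots> = (\<integral>\<^sup>+\<omega>. g (?s (?XX \<omega>)) \<partial>M)"
    by (rule law[symmetric]) (rule measurable_compose[OF s g])
  also have "\<dots> = (\<integral>\<^sup>+\<omega>. g (\<lambda>j\<in>{..<n}. ?X j \<omega> + (if j = i then 1 else 0)) \<partial>M)"
    by (intro nn_integral_cong arg_cong[where f=g]) (simp add: restrict_def fun_eq_iff)
  finally show ?thesis .
qed

end

text \<open>
  The atoms of the algebra generated by the given sets. On disjoint sets the values of a Poisson
  random measure are independent.
\<close>

lemma common_partition:
  assumes F: "finite F" "F \<subseteq> sets E"
  obtains n :: nat and C I where "disjoint_family_on C {..<n}" "C ` {..<n} \<subseteq> sets E"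
    "\<And>B. B \<in> F \<Longrightarrow> I B \<subseteq> {..<n}" "\<And>B. B \<in> F \<Longrightarrow> B = (\<Union>i\<in>I B. C i)"
proof -
  define cell where "cell S = {x \<in> space E. \<forall>B\<in>F. x \<in> B \<longleftrightarrow> B \<in> S}" for S
  obtain n h where h: "bij_betw h {0..<n::nat} (Pow F)"
    using ex_bij_betw_nat_finite[of "Pow F"] F by auto
  have sub: "h i \<subseteq> F" if "i < n" for i using bij_betwE[OF h] that by auto
  have inj: "h i \<noteq> h j" if "i < n" "j < n" "i \<noteq> j" for i j
    using inj_onD[OF bij_betw_imp_inj_on[OF h], of i j] that by auto
  have disj: "cell S \<inter> cell S' = {}" if "S \<subseteq> F" "S' \<subseteq> F" "S \<noteq> S'" for S S'
    using that unfolding cell_def by blast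
  have cellE: "cell S \<in> sets E" for S
  proof -
    have "cell S = {x \<in> space E. \<forall>B\<in>F. x \<in> (if B \<in> S then B else space E - B)}"
      by (auto simp: cell_def)
    also have "\<dots> \<in> sets E"
    proof (rule sets.sets_Collect_finite_All[OF _ F(1)])
      show "{x \<in> space E. x \<in> (if B \<in> S then B else space E - B)} \<in> sets E" if "B \<in> F" for B
        using F(2) that by (auto intro: sets.sets_Collect)
    qed
    finally show ?thesis .
  qed
  have "disjoint_family_on (\<lambda>i. cell (h i)) {..<n}"
    unfolding disjoint_family_on_def using disj[OF sub sub inj] by simp
  moreover have "B = (\<Union>i\<in>{i. i < n \<and> B \<in> h i}. cell (h i))" if B: "B \<in> F" for B
  proof (intro equalityI subsetI)
    fix x assume x: "x \<in> B"
    have "{B \<in> F. x \<in> B} \<in> h ` {0..<n}" using h by (auto simp: bij_betw_def)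
    then obtain i where "i < n" "h i = {B \<in> F. x \<in> B}" by auto
    then show "x \<in> (\<Union>i\<in>{i. i < n \<and> B \<in> h i}. cell (h i))"
      using x B F(2) sets.sets_into_space[of B E] by (intro UN_I[of i]) (auto simp: cell_def)
  qed (use B in \<open>auto simp: cell_def\<close>)
  ultimately show ?thesis
    using cellE by (intro that[of "\<lambda>i. cell (h i)" n "\<lambda>B. {i. i < n \<and> B \<in> h i}"]) auto
qed

section \<open>Cylinder events and kernels of integrals against configurations\<close>

lemma integral_measurable_subprob_kernel:
  fixes f :: "'a \<Rightarrow> 'b \<Rightarrow> 'h::{banach, second_countable_topology}"
  assumes f[measurable]: "(\<lambda>(x, y). f x y) \<in> borel_measurable (M \<Otimes>\<^sub>M N)"
    and L[measurable]: "L \<in> measurable M (subprob_algebra N)"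
  shows "(\<lambda>x. integral\<^sup>L (L x) (f x)) \<in> borel_measurable M"
proof -
  note integral_measurable_subprob_algebra[measurable]
  note measurable_distr2[measurable]
  have "(\<lambda>x. integral\<^sup>L (distr (L x) (M \<Otimes>\<^sub>M N) (\<lambda>y. (x, y))) (\<lambda>(x, y). f x y)) \<in> borel_measurable M"
    by measurable
  then show ?thesis
  proof (rule measurable_cong[THEN iffD1, rotated])
    fix x assume x: "x \<in> space M"
    then have "sets (L x) = sets N"
      using measurable_space[OF L, of x] by (simp add: space_subprob_algebra)
    have "(\<lambda>y. (x, y)) \<in> L x \<rightarrow>\<^sub>M M \<Otimes>\<^sub>M N"
      unfolding measurable_cong_sets[OF \<open>sets (L x) = sets N\<close> refl] using x by (rule measurable_Pair1')
    from integral_distr[OF this f]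
    show "integral\<^sup>L (distr (L x) (M \<Otimes>\<^sub>M N) (\<lambda>y. (x, y))) (\<lambda>(x, y). f x y) = integral\<^sup>L (L x) (f x)"
      by simp
  qed
qed

text \<open>
  A generator of the \<open>\<sigma>\<close>-algebra of configurations that is stable under intersections.
\<close>

definition cylinders :: "'a measure \<Rightarrow> 'a measure set set" where
  "cylinders E = {{\<eta> \<in> counting_measures E. \<forall>B\<in>F. emeasure \<eta> B \<in> W B} | F W.
     finite F \<and> F \<subseteq> sets E \<and> range W \<subseteq> sets (borel :: ennreal measure)}"

lemma Int_stable_cylinders: "Int_stable (cylinders E)"
proof (rule Int_stableI)
  fix a b assume "a \<in> cylinders E" "b \<in> cylinders E"
  then obtain F W F' W' where
    a: "a = {\<eta> \<in> counting_measures E. \<forall>B\<in>F. emeasure \<eta> B \<in> W B}"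
       "finite F" "F \<subseteq> sets E" "range W \<subseteq> sets (borel :: ennreal measure)" and
    b: "b = {\<eta> \<in> counting_measures E. \<forall>B\<in>F'. emeasure \<eta> B \<in> W' B}"
       "finite F'" "F' \<subseteq> sets E" "range W' \<subseteq> sets (borel :: ennreal measure)"
    by (auto simp: cylinders_def)
  let ?W = "\<lambda>B. (if B \<in> F then W B else UNIV) \<inter> (if B \<in> F' then W' B else UNIV)"
  have "?W B \<in> sets borel" for B
    using a(4) b(4) by (intro sets.Int) (auto simp: image_subset_iff)
  moreover have "a \<inter> b = {\<eta> \<in> counting_measures E. \<forall>B\<in>F \<union> F'. emeasure \<eta> B \<in> ?W B}"
    unfolding a(1) b(1) by auto
  ultimately show "a \<inter> b \<in> cylinders E"
    unfolding cylinders_def using a(2,3) b(2,3) by (intro CollectI exI[of _ "F \<union> F'"] exI[of _ ?W]) auto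
qed

lemma cylinder_in_sets: "Z \<in> cylinders E \<Longrightarrow> Z \<in> sets (counting_space E)"
proof -
  assume "Z \<in> cylinders E"
  then obtain F W where Z: "Z = {\<eta> \<in> space (counting_space E). \<forall>B\<in>F. emeasure \<eta> B \<in> W B}"
     "finite F" "F \<subseteq> sets E" "range W \<subseteq> sets (borel :: ennreal measure)"
    by (auto simp: cylinders_def)
  have "{\<eta> \<in> space (counting_space E). emeasure \<eta> B \<in> W B} \<in> sets (counting_space E)" if "B \<in> F" for B
    using measurable_sets[OF measurable_emeasure_counting_space[of B E], of "W B"] Z that
    by (auto simp: vimage_def Int_def conj_commute image_subset_iff)
  then show "Z \<in> sets (counting_space E)"
    unfolding Z(1) by (intro sets.sets_Collect_finite_All Z(2)) auto
qed

lemma sets_counting_space_cylinders: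
  "sets (counting_space E) = sigma_sets (counting_measures E) (cylinders E)"
proof
  have "sets (counting_space E) = sigma_sets (counting_measures E)
     {{\<eta> \<in> counting_measures E. emeasure \<eta> B \<in> A} | A B. A \<in> sets borel \<and> B \<in> sets E}"
    unfolding counting_space_def by (rule sets_measure_of) auto
  also have "\<dots> \<subseteq> sigma_sets (counting_measures E) (cylinders E)"
  proof (rule sigma_sets_mono, safe)
    fix A :: "ennreal set" and B assume "A \<in> sets borel" "B \<in> sets E"
    then have "{\<eta> \<in> counting_measures E. emeasure \<eta> B \<in> A} \<in> cylinders E"
      unfolding cylinders_def by (intro CollectI exI[of _ "{B}"] exI[of _ "\<lambda>_. A"]) auto
    then show "{\<eta> \<in> counting_measures E. emeasure \<eta> B \<in> A} \<in> sigma_sets (counting_measures E) (cylinders E)" ..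
  qed
  finally show "sets (counting_space E) \<subseteq> sigma_sets (counting_measures E) (cylinders E)" .
  show "sigma_sets (counting_measures E) (cylinders E) \<subseteq> sets (counting_space E)"
    using sets.sigma_sets_subset[of "cylinders E" "counting_space E"] cylinder_in_sets by auto
qed

lemma counting_measures_cylinder: "counting_measures E \<in> cylinders E"
  unfolding cylinders_def by (intro CollectI exI[of _ "{}"] exI[of _ "\<lambda>_. UNIV"]) auto

context poisson
begin

text \<open>
  All sets that occur are unions of cells of one finite partition, so the event is a function of
  the independent values of the random measure on the cells, and a point added in the cell \<open>C i\<close>
  raises exactly the coordinate \<open>i\<close> by one.
\<close>

lemma mecke_cylinder:
  assumes Z: "Z \<in> cylinders E" and A: "A \<in> sets E" "emeasure E A < \<infinity>"
  shows "(\<integral>\<^sup>+\<omega>. emeasure (N \<omega>) A * indicator Z (N \<omega>) \<partial>M) =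
    (\<integral>\<^sup>+\<omega>. \<integral>\<^sup>+z. indicator A z * indicator Z (add_point (N \<omega>) z) \<partial>E \<partial>M)"
proof -
  obtain F W where Z: "Z = {\<eta> \<in> counting_measures E. \<forall>B\<in>F. emeasure \<eta> B \<in> W B}"
     "finite F" "F \<subseteq> sets E" "range W \<subseteq> sets (borel :: ennreal measure)"
    using Z by (auto simp: cylinders_def)
  obtain n :: nat and C I where C: "disjoint_family_on C {..<n}" "C ` {..<n} \<subseteq> sets E"
    and I: "\<And>B. B \<in> insert A F \<Longrightarrow> I B \<subseteq> {..<n}" "\<And>B. B \<in> insert A F \<Longrightarrow> B = (\<Union>i\<in>I B. C i)"
  proof (rule common_partition[of "insert A F" E])
    show "finite (insert A F)" "insert A F \<subseteq> sets E" using Z A by auto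
  qed (rule that)
  have finI: "finite (I B)" if "B \<in> insert A F" for B using I(1)[OF that] by (rule finite_subset) simp
  have sum: "emeasure \<eta> B = (\<Sum>i\<in>I B. emeasure \<eta> (C i))" if "sets \<eta> = sets E" "B \<in> insert A F" for \<eta> B
  proof -
    have "(\<Sum>i\<in>I B. emeasure \<eta> (C i)) = emeasure \<eta> (\<Union>i\<in>I B. C i)"
      using I(1)[OF that(2)] C that(1) finI[OF that(2)]
      by (intro sum_emeasure) (auto intro: disjoint_family_on_mono)
    also have "(\<Union>i\<in>I B. C i) = B" using I(2)[OF that(2)] by simp
    finally show ?thesis by simp
  qed
  define g where "g x = (\<Prod>B\<in>F. indicator (W B) (\<Sum>i\<in>I B. x i) :: ennreal)" for x :: "nat \<Rightarrow> ennreal"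
  have [measurable]: "W B \<in> sets borel" for B using Z(4) by auto
  have g [measurable]: "g \<in> borel_measurable (\<Pi>\<^sub>M j\<in>{..<n}. borel)"
    unfolding g_def
  proof (rule borel_measurable_prod_ennreal)
    fix B assume B: "B \<in> F"
    have [measurable]: "(\<lambda>x. \<Sum>i\<in>I B. x i) \<in> borel_measurable (\<Pi>\<^sub>M j\<in>{..<n}. borel :: ennreal measure)"
      using I(1)[of B] B by (intro borel_measurable_sum measurable_component_singleton) auto
    show "(\<lambda>x. indicator (W B) (\<Sum>i\<in>I B. x i) :: ennreal) \<in> borel_measurable (\<Pi>\<^sub>M j\<in>{..<n}. borel)"
      by measurable
  qed
  \<comment> \<open>The indicator of the cylinder, as a function of the values on the cells of the partition.\<close>
  have gZ: "indicator Z \<eta> = g (\<lambda>j\<in>{..<n}. emeasure \<eta> (C j))" if "\<eta> \<in> counting_measures E" for \<eta>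
  proof -
    have "g (\<lambda>j\<in>{..<n}. emeasure \<eta> (C j)) = (\<Prod>B\<in>F. indicator (W B) (emeasure \<eta> B))"
      unfolding g_def
    proof (intro prod.cong refl arg_cong2[where f=indicator])
      fix B assume B: "B \<in> F"
      have "(\<Sum>i\<in>I B. (\<lambda>j\<in>{..<n}. emeasure \<eta> (C j)) i) = (\<Sum>i\<in>I B. emeasure \<eta> (C i))"
        using I(1)[of B] B by (intro sum.cong) auto
      then show "(\<Sum>i\<in>I B. (\<lambda>j\<in>{..<n}. emeasure \<eta> (C j)) i) = emeasure \<eta> B"
        using sum[OF counting_measuresD(1)[OF that], of B] B by simp
    qed
    also have "\<dots> = indicator Z \<eta>"
      using that Z(2) by (auto simp: Z(1) indicator_def prod_zero_iff intro!: prod.neutral)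
    finally show ?thesis by simp
  qed
  let ?X = "\<lambda>j \<omega>. emeasure (N \<omega>) (C j)"
  let ?s = "\<lambda>i \<omega>. g (\<lambda>j\<in>{..<n}. ?X j \<omega> + (if j = i then 1 else 0))"
  have IA: "i < n" "C i \<in> sets E" "emeasure E (C i) < \<infinity>" if "i \<in> I A" for i
  proof -
    show i: "i < n" using I(1)[of A] that by auto
    then show "C i \<in> sets E" using C by auto
    have "C i \<subseteq> A" using I(2)[of A] that by auto
    then show "emeasure E (C i) < \<infinity>"
      using A emeasure_mono[of "C i" A E] by (auto intro: le_less_trans)
  qed
  have mX: "?X i \<in> borel_measurable M" if "i < n" for i using that C(2) by (intro measurable_N_emeasure) auto
  have mg: "(\<lambda>\<omega>. g (\<lambda>j\<in>{..<n}. ?X j \<omega>)) \<in> borel_measurable M"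
    using mX by (intro measurable_compose[OF _ g] measurable_restrict) auto
  have ms: "?s i \<in> borel_measurable M" for i
    using mX by (intro measurable_compose[OF _ g] measurable_restrict borel_measurable_add) auto
  have "(\<integral>\<^sup>+\<omega>. emeasure (N \<omega>) A * indicator Z (N \<omega>) \<partial>M) =
      (\<integral>\<^sup>+\<omega>. (\<Sum>i\<in>I A. ?X i \<omega> * g (\<lambda>j\<in>{..<n}. ?X j \<omega>)) \<partial>M)"
    by (intro nn_integral_cong) (simp add: sum[OF sets_N, of _ A] gZ[OF N_counting] sum_distrib_right)
  also have "\<dots> = (\<Sum>i\<in>I A. \<integral>\<^sup>+\<omega>. ?X i \<omega> * g (\<lambda>j\<in>{..<n}. ?X j \<omega>) \<partial>M)"
    using mX mg IA by (intro nn_integral_sum borel_measurable_times_ennreal) auto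
  also have "\<dots> = (\<Sum>i\<in>I A. emeasure E (C i) * (\<integral>\<^sup>+\<omega>. ?s i \<omega> \<partial>M))"
    using IA by (intro sum.cong refl nn_integral_poisson_family_shift C g) auto
  also have "\<dots> = (\<integral>\<^sup>+\<omega>. (\<Sum>i\<in>I A. emeasure E (C i) * ?s i \<omega>) \<partial>M)"
    using ms by (subst nn_integral_sum) (auto simp: nn_integral_cmult)
  also have "\<dots> = (\<integral>\<^sup>+\<omega>. \<integral>\<^sup>+z. indicator A z * indicator Z (add_point (N \<omega>) z) \<partial>E \<partial>M)"
  proof (intro nn_integral_cong)
    fix \<omega> assume \<omega>: "\<omega> \<in> space M"
    have "indicator A z * indicator Z (add_point (N \<omega>) z) = (\<Sum>i\<in>I A. indicator (C i) z * ?s i \<omega>)" for z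
    proof (cases "z \<in> A")
      case True
      then obtain i where i: "i \<in> I A" "z \<in> C i" using I(2)[of A] by auto
      have z: "z \<in> C j \<longleftrightarrow> j = i" if "j < n" for j
        using C(1) i IA(1)[OF i(1)] that by (auto simp: disjoint_family_on_def)
      have "(\<lambda>j\<in>{..<n}. emeasure (add_point (N \<omega>) z) (C j)) = (\<lambda>j\<in>{..<n}. ?X j \<omega> + (if j = i then 1 else 0))"
      proof (rule restrict_ext)
        fix j assume "j \<in> {..<n}"
        then show "emeasure (add_point (N \<omega>) z) (C j) = ?X j \<omega> + (if j = i then 1 else 0)"
          using C(2) z[of j] sets_N[OF \<omega>] by (subst emeasure_add_point) (auto simp: indicator_def)
      qed
      then have "indicator Z (add_point (N \<omega>) z) = ?s i \<omega>"
        by (simp add: gZ[OF add_point_in_counting_measures[OF N_counting[OF \<omega>]]])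
      moreover have "(\<Sum>j\<in>I A. indicator (C j) z * ?s j \<omega>) = (\<Sum>j\<in>I A. if j = i then ?s i \<omega> else 0)"
        using z IA by (intro sum.cong) (auto simp: indicator_def)
      ultimately show ?thesis using True i finI[of A] by simp
    next
      case False
      then have "z \<notin> C i" if "i \<in> I A" for i using I(2)[of A] that by auto
      then show ?thesis using False by simp
    qed
    then show "(\<Sum>i\<in>I A. emeasure E (C i) * ?s i \<omega>) = (\<integral>\<^sup>+z. indicator A z * indicator Z (add_point (N \<omega>) z) \<partial>E)"
      using IA by (simp add: nn_integral_sum nn_integral_multc)
  qed
  finally show ?thesis .
qed

text \<open>
  Both sides are finite measures in \<open>Z\<close> that agree on the cylinders.
\<close>

lemma mecke_rectangle:
  assumes Z: "Z \<in> sets (counting_space E)" and A [measurable]: "A \<in> sets E" and fin: "emeasure E A < \<infinity>"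
  shows "(\<integral>\<^sup>+\<omega>. emeasure (N \<omega>) A * indicator Z (N \<omega>) \<partial>M) =
    (\<integral>\<^sup>+\<omega>. \<integral>\<^sup>+z. indicator A z * indicator Z (add_point (N \<omega>) z) \<partial>E \<partial>M)"
proof -
  note [measurable] = measurable_N_emeasure[OF A]
  let ?add = "\<lambda>(\<omega>, z). add_point (N \<omega>) z"
  have add [measurable]: "?add \<in> M \<Otimes>\<^sub>M E \<rightarrow>\<^sub>M counting_space E"
    unfolding case_prod_beta' by measurable
  define Q1 where "Q1 = distr (density M (\<lambda>\<omega>. emeasure (N \<omega>) A)) (counting_space E) N"
  define Q2 where "Q2 = distr (density (M \<Otimes>\<^sub>M E) (\<lambda>p. indicator A (snd p))) (counting_space E) ?add"
  have Q1: "emeasure Q1 Z = (\<integral>\<^sup>+\<omega>. emeasure (N \<omega>) A * indicator Z (N \<omega>) \<partial>M)" if [measurable]: "Z \<in> sets (counting_space E)" for Z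
  proof -
    have "emeasure Q1 Z = emeasure (density M (\<lambda>\<omega>. emeasure (N \<omega>) A)) (N -` Z \<inter> space M)"
      unfolding Q1_def by (subst emeasure_distr) auto
    also have "\<dots> = (\<integral>\<^sup>+\<omega>. emeasure (N \<omega>) A * indicator (N -` Z \<inter> space M) \<omega> \<partial>M)"
      by (rule emeasure_density) measurable
    also have "\<dots> = (\<integral>\<^sup>+\<omega>. emeasure (N \<omega>) A * indicator Z (N \<omega>) \<partial>M)"
      by (intro nn_integral_cong) (auto simp: indicator_def)
    finally show ?thesis .
  qed
  have Q2: "emeasure Q2 Z = (\<integral>\<^sup>+\<omega>. \<integral>\<^sup>+z. indicator A z * indicator Z (add_point (N \<omega>) z) \<partial>E \<partial>M)" if [measurable]: "Z \<in> sets (counting_space E)" for Z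
  proof -
    have m: "(\<lambda>p. indicator A (snd p) * indicator Z (add_point (N (fst p)) (snd p)) :: ennreal) \<in> borel_measurable (M \<Otimes>\<^sub>M E)"
      by measurable
    have "emeasure Q2 Z = emeasure (density (M \<Otimes>\<^sub>M E) (\<lambda>p. indicator A (snd p))) (?add -` Z \<inter> space (M \<Otimes>\<^sub>M E))"
      unfolding Q2_def by (subst emeasure_distr) auto
    also have "\<dots> = (\<integral>\<^sup>+p. indicator A (snd p) * indicator (?add -` Z \<inter> space (M \<Otimes>\<^sub>M E)) p \<partial>(M \<Otimes>\<^sub>M E))"
      by (rule emeasure_density) measurable
    also have "\<dots> = (\<integral>\<^sup>+p. indicator A (snd p) * indicator Z (add_point (N (fst p)) (snd p)) \<partial>(M \<Otimes>\<^sub>M E))"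
      by (intro nn_integral_cong) (auto simp: indicator_def)
    also have "\<dots> = (\<integral>\<^sup>+\<omega>. \<integral>\<^sup>+z. indicator A z * indicator Z (add_point (N \<omega>) z) \<partial>E \<partial>M)"
      using E.nn_integral_fst[OF m] by simp
    finally show ?thesis .
  qed
  have "Q1 = Q2"
  proof (rule measure_eqI_generator_eq[OF Int_stable_cylinders, where \<Omega>="counting_measures E" and A="\<lambda>_. counting_measures E"])
    show "emeasure Q1 Z = emeasure Q2 Z" if "Z \<in> cylinders E" for Z
      using cylinder_in_sets[OF that] by (simp add: Q1 Q2 mecke_cylinder[OF that A fin])
    have "emeasure Q1 (counting_measures E) = emeasure Q2 (counting_measures E)"
      using cylinder_in_sets[OF counting_measures_cylinder[of E]] mecke_cylinder[OF counting_measures_cylinder A fin]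
      by (simp only: Q1 Q2)
    also have "\<dots> = (\<integral>\<^sup>+\<omega>. \<integral>\<^sup>+z. indicator A z \<partial>E \<partial>M)"
      unfolding Q2[OF cylinder_in_sets[OF counting_measures_cylinder]]
      by (intro nn_integral_cong) (simp add: add_point_in_counting_measures N_counting)
    also have "\<dots> = emeasure E A" by (simp add: emeasure_space_1)
    finally show "emeasure Q1 (counting_measures E) \<noteq> \<infinity>" using fin by simp
  qed (auto simp: Q1_def Q2_def sets_counting_space_cylinders counting_measures_cylinder cylinders_def)
  then show ?thesis using Q1[OF Z] Q2[OF Z] by simp
qed

lemma expectation_N:
  assumes "A \<in> sets E" "emeasure E A < \<infinity>"
  shows "(\<integral>\<^sup>+\<omega>. emeasure (N \<omega>) A \<partial>M) = emeasure E A"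
proof -
  have "(\<integral>\<^sup>+\<omega>. emeasure (N \<omega>) A \<partial>M) = (\<integral>\<^sup>+\<omega>. emeasure (N \<omega>) A * indicator (counting_measures E) (N \<omega>) \<partial>M)"
    by (intro nn_integral_cong) (simp add: N_counting)
  also have "\<dots> = (\<integral>\<^sup>+\<omega>. \<integral>\<^sup>+z. indicator A z \<partial>E \<partial>M)"
    unfolding mecke_rectangle[OF cylinder_in_sets[OF counting_measures_cylinder] assms]
    by (intro nn_integral_cong) (simp add: add_point_in_counting_measures N_counting)
  also have "\<dots> = emeasure E A" using assms by (simp add: emeasure_space_1)
  finally show ?thesis .
qed

definition cells :: "nat \<Rightarrow> 'a set" where
  "cells = (SOME C. range C \<subseteq> sets E \<and> (\<Union>i. C i) = space E \<and> (\<forall>i. emeasure E (C i) < \<infinity>) \<and> disjoint_family C)"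

lemma cells: "cells n \<in> sets E" "(\<Union>i. cells i) = space E" "emeasure E (cells n) < \<infinity>" "disjoint_family cells"
proof -
  obtain C :: "nat \<Rightarrow> 'a set" where C: "range C \<subseteq> sets E" "(\<Union>i. C i) = space E"
    "\<And>i. emeasure E (C i) \<noteq> \<infinity>" "disjoint_family C"
    using E.sigma_finite_disjoint by metis
  have C3: "\<forall>i. emeasure E (C i) < \<infinity>" using C(3) top.not_eq_extremum[where 'a=ennreal] by simp
  let ?P = "\<lambda>C. range C \<subseteq> sets E \<and> (\<Union>i. C i) = space E \<and> (\<forall>i. emeasure E (C i) < \<infinity>) \<and> disjoint_family C"
  have "?P C" by (intro conjI C(1) C(2) C3 C(4))
  then have *: "?P cells" unfolding cells_def by (rule someI[of ?P])
  show "cells n \<in> sets E" using *[THEN conjunct1] by blast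
  show "(\<Union>i. cells i) = space E" by (rule *[THEN conjunct2, THEN conjunct1])
  show "emeasure E (cells n) < \<infinity>" by (rule *[THEN conjunct2, THEN conjunct2, THEN conjunct1, rule_format])
  show "disjoint_family cells" by (rule *[THEN conjunct2, THEN conjunct2, THEN conjunct2])
qed

text \<open>
  On such configurations the cells are a common exhausting sequence of finite mass, and integrals
  against the configuration depend measurably on it. Almost every path of \<open>N\<close> has this property.
\<close>

definition finite_on_cells :: "'a measure \<Rightarrow> bool" where
  "finite_on_cells \<eta> \<longleftrightarrow> (\<forall>n. emeasure \<eta> (cells n) < \<infinity>)"

lemma measurable_finite_on_cells [measurable]: "Measurable.pred (counting_space E) finite_on_cells"
proof -
  note measurable_emeasure_counting_space[OF cells(1), measurable]
  show ?thesis unfolding finite_on_cells_def by measurable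
qed

lemma finite_on_cells_add_point: "sets \<eta> = sets E \<Longrightarrow> finite_on_cells (add_point \<eta> z) \<longleftrightarrow> finite_on_cells \<eta>"
  unfolding finite_on_cells_def by (intro all_cong1) (auto simp: emeasure_add_point cells indicator_def)

lemma AE_finite_on_cells: "AE \<omega> in M. finite_on_cells (N \<omega>)"
  unfolding finite_on_cells_def AE_all_countable
proof
  fix n
  have "(\<integral>\<^sup>+\<omega>. emeasure (N \<omega>) (cells n) \<partial>M) \<noteq> \<infinity>" using expectation_N[OF cells(1,3), of n] cells(3)[of n] by (simp add: less_top)
  then have "AE \<omega> in M. emeasure (N \<omega>) (cells n) \<noteq> \<infinity>"
    by (intro nn_integral_PInf_AE measurable_N_emeasure cells)
  then show "AE \<omega> in M. emeasure (N \<omega>) (cells n) < \<infinity>" by (simp add: less_top)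
qed

definition cell_index :: "'a \<Rightarrow> nat" where "cell_index z = (LEAST n. z \<in> cells n)"

lemma measurable_cell_index [measurable]: "cell_index \<in> E \<rightarrow>\<^sub>M count_space UNIV"
  unfolding cell_index_def using cells by measurable

lemma cell_index_eq: "z \<in> cells n \<Longrightarrow> cell_index z = n"
  unfolding cell_index_def using cells(4)
  by (intro Least_equality) (simp, metis disjoint_family_onD disjoint_iff iso_tuple_UNIV_I order_refl)

text \<open>
  A density that turns every configuration that is finite on the cells into a subprobability
  measure: the cell \<open>n\<close> receives mass at most \<open>2\<^bsup>-(n+1)\<^esup>\<close>.
\<close>

definition weight :: "'a measure \<Rightarrow> 'a \<Rightarrow> real" where
  "weight \<eta> z = (1/2) ^ Suc (cell_index z) / (1 + measure \<eta> (cells (cell_index z)))"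

lemma weight_pos: "0 < weight \<eta> z"
  unfolding weight_def by (intro divide_pos_pos add_pos_nonneg) auto

lemma measurable_weight:
  assumes [measurable]: "f \<in> A \<rightarrow>\<^sub>M counting_space E" "g \<in> A \<rightarrow>\<^sub>M E"
  shows "(\<lambda>x. weight (f x) (g x)) \<in> borel_measurable A"
proof -
  have [measurable]: "(\<lambda>x. measure (f x) (cells n)) \<in> borel_measurable A" for n
    unfolding measure_def using measurable_emeasure_compose[OF assms(1) cells(1)] by measurable
  have [measurable]: "(\<lambda>x. measure (f x) (cells (cell_index (g x)))) \<in> borel_measurable A"
    by (rule measurable_compose_countable'[where I=UNIV and f="\<lambda>n x. measure (f x) (cells n)"]) auto
  show ?thesis unfolding weight_def by measurable
qed

text \<open>
  Measurability of integrals with respect to a varying measure is available for kernels with values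
  in the subprobability measures; the weight is divided out again in the integrand.
\<close>

definition finite_kernel :: "'a measure \<Rightarrow> 'a measure" where
  "finite_kernel \<eta> = (if finite_on_cells \<eta> then density \<eta> (\<lambda>z. ennreal (weight \<eta> z)) else null_measure E)"

lemma measurable_weight_snd:
  assumes "\<eta> \<in> counting_measures E"
  shows "weight \<eta> \<in> borel_measurable \<eta>"
proof -
  have "(\<lambda>z. weight ((\<lambda>_. \<eta>) z) z) \<in> borel_measurable E"
    by (rule measurable_weight) (use assms in auto)
  then show ?thesis using counting_measuresD(1)[OF assms] by (simp cong: measurable_cong_sets)
qed

lemma emeasure_finite_kernel:
  assumes \<eta>: "\<eta> \<in> counting_measures E" "finite_on_cells \<eta>" and B: "B \<in> sets E"
  shows "emeasure (finite_kernel \<eta>) B =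
    (\<Sum>n. ennreal ((1/2) ^ Suc n / (1 + measure \<eta> (cells n))) * emeasure \<eta> (cells n \<inter> B))"
proof -
  note D = counting_measuresD[OF \<eta>(1)]
  have m: "weight \<eta> \<in> borel_measurable \<eta>" using \<eta>(1) by (rule measurable_weight_snd)
  have "emeasure (finite_kernel \<eta>) B = (\<integral>\<^sup>+z. ennreal (weight \<eta> z) * indicator B z \<partial>\<eta>)"
    unfolding finite_kernel_def using \<eta>(2) m B D by (simp add: emeasure_density)
  also have "\<dots> = (\<integral>\<^sup>+z. (\<Sum>n. ennreal ((1/2) ^ Suc n / (1 + measure \<eta> (cells n))) * indicator (cells n \<inter> B) z) \<partial>\<eta>)"
  proof (rule nn_integral_cong)
    fix z assume "z \<in> space \<eta>"
    then obtain k where k: "z \<in> cells k" using cells(2) D(2) by auto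
    have "z \<notin> cells n" if "n \<noteq> k" for n using cells(4) k that by (auto simp: disjoint_family_on_def)
    then have "(\<Sum>n. ennreal ((1/2) ^ Suc n / (1 + measure \<eta> (cells n))) * indicator (cells n \<inter> B) z) =
      (\<Sum>n\<in>{k}. ennreal ((1/2) ^ Suc n / (1 + measure \<eta> (cells n))) * indicator (cells n \<inter> B) z)"
      by (intro suminf_finite) auto
    then show "ennreal (weight \<eta> z) * indicator B z =
      (\<Sum>n. ennreal ((1/2) ^ Suc n / (1 + measure \<eta> (cells n))) * indicator (cells n \<inter> B) z)"
      using k cell_index_eq[OF k] by (simp add: weight_def indicator_def)
  qed
  also have "\<dots> = (\<Sum>n. ennreal ((1/2) ^ Suc n / (1 + measure \<eta> (cells n))) * emeasure \<eta> (cells n \<inter> B))"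
    using cells B D by (subst nn_integral_suminf) (auto simp: nn_integral_cmult_indicator)
  finally show ?thesis .
qed

lemma subprob_finite_kernel:
  assumes \<eta>: "\<eta> \<in> counting_measures E"
  shows "subprob_space (finite_kernel \<eta>)"
proof (cases "finite_on_cells \<eta>")
  case True
  note D = counting_measuresD[OF \<eta>(1)]
  have "emeasure (finite_kernel \<eta>) (space E) \<le> (\<Sum>n. ennreal ((1/2) ^ Suc n))"
    unfolding emeasure_finite_kernel[OF \<eta> True sets.top]
  proof (rule suminf_le)
    fix n
    have "emeasure \<eta> (cells n \<inter> space E) = ennreal (measure \<eta> (cells n))"
      using True sets.Int_space_eq2[OF cells(1)[of n]] by (auto simp: finite_on_cells_def less_top emeasure_eq_ennreal_measure)
    then have "ennreal ((1/2) ^ Suc n / (1 + measure \<eta> (cells n))) * emeasure \<eta> (cells n \<inter> space E) =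
      ennreal ((1/2) ^ Suc n * (measure \<eta> (cells n) / (1 + measure \<eta> (cells n))))"
      by (simp add: ennreal_mult[symmetric] del: power_Suc)
    also have "\<dots> \<le> ennreal ((1/2) ^ Suc n)"
    proof (rule ennreal_leI)
      have "measure \<eta> (cells n) / (1 + measure \<eta> (cells n)) \<le> 1"
        by (simp add: divide_le_eq add_pos_nonneg)
      then show "(1/2) ^ Suc n * (measure \<eta> (cells n) / (1 + measure \<eta> (cells n))) \<le> (1/2) ^ Suc n"
        by (intro mult_left_le) auto
    qed
    finally show "ennreal ((1/2) ^ Suc n / (1 + measure \<eta> (cells n))) * emeasure \<eta> (cells n \<inter> space E) \<le> ennreal ((1/2) ^ Suc n)" .
  qed auto
  also have "\<dots> = 1" using power_half_series by (simp add: suminf_ennreal2 sums_iff)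
  finally show ?thesis using nonempty_E D True
    by (intro subprob_spaceI) (auto simp: finite_kernel_def)
next
  case False
  then show ?thesis using nonempty_E by (intro subprob_spaceI) (auto simp: finite_kernel_def)
qed

lemma measurable_finite_kernel [measurable]: "finite_kernel \<in> counting_space E \<rightarrow>\<^sub>M subprob_algebra E"
proof (rule measurable_subprob_algebra)
  fix B assume B: "B \<in> sets E"
  have m: "(\<lambda>\<eta>. measure \<eta> (cells n)) \<in> borel_measurable (counting_space E)" for n
    unfolding measure_def using measurable_emeasure_counting_space[OF cells(1)[of n]] by measurable
  have "(\<lambda>\<eta>. if finite_on_cells \<eta> then (\<Sum>n. ennreal ((1/2) ^ Suc n / (1 + measure \<eta> (cells n))) * emeasure \<eta> (cells n \<inter> B)) else 0)
    \<in> borel_measurable (counting_space E)"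
    using m measurable_emeasure_counting_space[OF sets.Int[OF cells(1) B]] by measurable
  then show "(\<lambda>\<eta>. emeasure (finite_kernel \<eta>) B) \<in> borel_measurable (counting_space E)"
  proof (rule measurable_cong[THEN iffD1, rotated])
    fix \<eta> assume "\<eta> \<in> space (counting_space E)"
    then show "(if finite_on_cells \<eta> then (\<Sum>n. ennreal ((1/2) ^ Suc n / (1 + measure \<eta> (cells n))) * emeasure \<eta> (cells n \<inter> B)) else 0) =
      emeasure (finite_kernel \<eta>) B"
      using emeasure_finite_kernel[OF _ _ B, of \<eta>] by (cases "finite_on_cells \<eta>") (simp_all only: if_True if_False space_counting_space, simp add: finite_kernel_def)
  qed
qed (simp_all add: subprob_finite_kernel, simp add: finite_kernel_def counting_measuresD)

lemma measurable_nn_integral_counting: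
  assumes f [measurable]: "case_prod f \<in> borel_measurable (counting_space E \<Otimes>\<^sub>M E)"
  shows "(\<lambda>\<eta>. if finite_on_cells \<eta> then \<integral>\<^sup>+z. f \<eta> z \<partial>\<eta> else 0 :: ennreal) \<in> borel_measurable (counting_space E)"
proof -
  note [measurable] = measurable_weight[OF measurable_fst measurable_snd]
  have "(\<lambda>(\<eta>, z). f \<eta> z * ennreal (1 / weight \<eta> z)) \<in> borel_measurable (counting_space E \<Otimes>\<^sub>M E)"
    unfolding case_prod_beta' by measurable
  from nn_integral_measurable_subprob_algebra2[OF this measurable_finite_kernel]
  have "(\<lambda>\<eta>. if finite_on_cells \<eta> then \<integral>\<^sup>+z. f \<eta> z * ennreal (1 / weight \<eta> z) \<partial>finite_kernel \<eta> else 0) \<in> borel_measurable (counting_space E)"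
    by measurable
  then show ?thesis
  proof (rule measurable_cong[THEN iffD1, rotated])
    fix \<eta> assume "\<eta> \<in> space (counting_space E)"
    then have \<eta>: "\<eta> \<in> counting_measures E" by simp
    have [measurable]: "weight \<eta> \<in> borel_measurable \<eta>" by (rule measurable_weight_snd[OF \<eta>])
    have "f \<eta> \<in> borel_measurable E" using measurable_compose[OF measurable_Pair1' f, of \<eta>] \<eta> by simp
    then have [measurable]: "f \<eta> \<in> borel_measurable \<eta>" using counting_measuresD(1)[OF \<eta>] by (simp cong: measurable_cong_sets)
    have c: "ennreal (weight \<eta> z) * (f \<eta> z * ennreal (1 / weight \<eta> z)) = f \<eta> z" for z
    proof -
      have "ennreal (weight \<eta> z) * ennreal (1 / weight \<eta> z) = 1"
        using weight_pos[of \<eta> z] by (simp add: ennreal_mult[symmetric])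
      then show ?thesis by (metis mult.commute mult.left_commute mult.right_neutral)
    qed
    show "(if finite_on_cells \<eta> then \<integral>\<^sup>+z. f \<eta> z * ennreal (1 / weight \<eta> z) \<partial>finite_kernel \<eta> else 0) = (if finite_on_cells \<eta> then \<integral>\<^sup>+z. f \<eta> z \<partial>\<eta> else 0)"
      by (simp add: finite_kernel_def nn_integral_density c)
  qed
qed

lemma measurable_integral_counting:
  fixes f :: "'a measure \<Rightarrow> 'a \<Rightarrow> 'h::{banach, second_countable_topology}"
  assumes f [measurable]: "case_prod f \<in> borel_measurable (counting_space E \<Otimes>\<^sub>M E)"
  shows "(\<lambda>\<eta>. if finite_on_cells \<eta> then \<integral>z. f \<eta> z \<partial>\<eta> else 0) \<in> borel_measurable (counting_space E)"
proof -
  note [measurable] = measurable_weight[OF measurable_fst measurable_snd]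
  have "(\<lambda>(\<eta>, z). (1 / weight \<eta> z) *\<^sub>R f \<eta> z) \<in> borel_measurable (counting_space E \<Otimes>\<^sub>M E)"
    unfolding case_prod_beta' by measurable
  from integral_measurable_subprob_kernel[OF this measurable_finite_kernel]
  have "(\<lambda>\<eta>. if finite_on_cells \<eta> then \<integral>z. (1 / weight \<eta> z) *\<^sub>R f \<eta> z \<partial>finite_kernel \<eta> else 0) \<in> borel_measurable (counting_space E)"
    by measurable
  then show ?thesis
  proof (rule measurable_cong[THEN iffD1, rotated])
    fix \<eta> assume "\<eta> \<in> space (counting_space E)"
    then have \<eta>: "\<eta> \<in> counting_measures E" by simp
    have [measurable]: "weight \<eta> \<in> borel_measurable \<eta>" by (rule measurable_weight_snd[OF \<eta>])
    have "f \<eta> \<in> borel_measurable E" using measurable_compose[OF measurable_Pair1' f, of \<eta>] \<eta> by simp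
    then have [measurable]: "f \<eta> \<in> borel_measurable \<eta>" using counting_measuresD(1)[OF \<eta>] by (simp cong: measurable_cong_sets)
    have "weight \<eta> z \<noteq> 0" for z using weight_pos[of \<eta> z] by simp
    then show "(if finite_on_cells \<eta> then \<integral>z. (1 / weight \<eta> z) *\<^sub>R f \<eta> z \<partial>finite_kernel \<eta> else 0) = (if finite_on_cells \<eta> then \<integral>z. f \<eta> z \<partial>\<eta> else 0)"
      by (simp add: finite_kernel_def integral_density less_imp_le[OF weight_pos])
  qed
qed

end

section \<open>Mecke's formula\<close>

context poisson
begin

sublocale ME: pair_sigma_finite M E by standard

definition mecke_kernel :: "'w \<Rightarrow> ('a measure \<times> 'a) measure" where
  "mecke_kernel \<omega> = distr (finite_kernel (N \<omega>)) (counting_space E \<Otimes>\<^sub>M E) (\<lambda>z. (N \<omega>, z))"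

text \<open>
  The Campbell measure \<open>E \<integral> 1\<^bsub>(N, z) \<in> \<cdot>\<^esub> N(dz)\<close>, as a density with respect to a finite measure.
\<close>

definition campbell :: "('a measure \<times> 'a) measure" where
  "campbell = density (M \<bind> mecke_kernel) (\<lambda>p. ennreal (1 / weight (fst p) (snd p)))"

definition shifted :: "('a measure \<times> 'a) measure" where
  "shifted = distr (M \<Otimes>\<^sub>M E) (counting_space E \<Otimes>\<^sub>M E) (\<lambda>(\<omega>, z). (add_point (N \<omega>) z, z))"

lemma measurable_mecke_kernel: "mecke_kernel \<in> M \<rightarrow>\<^sub>M subprob_algebra (counting_space E \<Otimes>\<^sub>M E)"
  unfolding mecke_kernel_def
  by (rule measurable_distr2[where M=E]) (simp_all add: case_prod_beta')

lemma sets_campbell: "sets campbell = sets (counting_space E \<Otimes>\<^sub>M E)"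
  unfolding campbell_def by (simp add: sets_bind[OF sets_kernel[OF measurable_mecke_kernel] not_empty])

lemma sets_shifted: "sets shifted = sets (counting_space E \<Otimes>\<^sub>M E)"
  by (simp add: shifted_def)

lemma measurable_section:
  assumes "h \<in> borel_measurable (counting_space E \<Otimes>\<^sub>M E)" "\<eta> \<in> counting_measures E"
  shows "(\<lambda>z. h (\<eta>, z)) \<in> borel_measurable E"
  using measurable_compose[OF measurable_Pair1' assms(1), of \<eta>] assms(2) by simp

lemma measurable_section_N:
  assumes "h \<in> borel_measurable (counting_space E \<Otimes>\<^sub>M E)" "\<omega> \<in> space M"
  shows "(\<lambda>z. h (N \<omega>, z)) \<in> borel_measurable (N \<omega>)"
  using measurable_section[OF assms(1) N_counting[OF assms(2)]]
  by (simp add: measurable_cong_sets[OF sets_N[OF assms(2)] refl])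

lemma nn_integral_campbell:
  assumes h [measurable]: "h \<in> borel_measurable (counting_space E \<Otimes>\<^sub>M E)"
  shows "(\<integral>\<^sup>+p. h p \<partial>campbell) = (\<integral>\<^sup>+\<omega>. \<integral>\<^sup>+z. h (N \<omega>, z) \<partial>N \<omega> \<partial>M)"
proof -
  note [measurable] = measurable_weight[OF measurable_fst measurable_snd] measurable_mecke_kernel
  let ?w = "\<lambda>p. ennreal (1 / weight (fst p) (snd p))"
  have w: "?w \<in> borel_measurable (counting_space E \<Otimes>\<^sub>M E)" by measurable
  have sb: "sets (M \<bind> mecke_kernel) = sets (counting_space E \<Otimes>\<^sub>M E)"
    by (simp add: sets_bind[OF sets_kernel[OF measurable_mecke_kernel] not_empty])
  have "(\<integral>\<^sup>+p. h p \<partial>campbell) = (\<integral>\<^sup>+p. ?w p * h p \<partial>(M \<bind> mecke_kernel))"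
    unfolding campbell_def
    by (rule nn_integral_density) (use h w in \<open>simp_all add: measurable_cong_sets[OF sb refl]\<close>)
  also have "\<dots> = (\<integral>\<^sup>+\<omega>. \<integral>\<^sup>+p. ?w p * h p \<partial>mecke_kernel \<omega> \<partial>M)"
    by (rule nn_integral_bind[OF _ measurable_mecke_kernel]) measurable
  also have "\<dots> = (\<integral>\<^sup>+\<omega>. \<integral>\<^sup>+z. h (N \<omega>, z) \<partial>N \<omega> \<partial>M)"
  proof (rule nn_integral_cong_AE)
    show "AE \<omega> in M. (\<integral>\<^sup>+p. ?w p * h p \<partial>mecke_kernel \<omega>) = (\<integral>\<^sup>+z. h (N \<omega>, z) \<partial>N \<omega>)"
      using AE_finite_on_cells AE_space
    proof eventually_elim
      case (elim \<omega>)
      note c = N_counting[OF elim(2)]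
      have sk: "sets (finite_kernel (N \<omega>)) = sets E" using sets_N[OF elim(2)] by (simp add: finite_kernel_def)
      have "(\<integral>\<^sup>+p. ?w p * h p \<partial>mecke_kernel \<omega>) = (\<integral>\<^sup>+z. ?w (N \<omega>, z) * h (N \<omega>, z) \<partial>finite_kernel (N \<omega>))"
        unfolding mecke_kernel_def
        by (rule nn_integral_distr) (use c in \<open>simp_all add: measurable_cong_sets[OF sk refl] del: fst_conv snd_conv\<close>)
      also have "\<dots> = (\<integral>\<^sup>+z. ennreal (weight (N \<omega>) z) * (?w (N \<omega>, z) * h (N \<omega>, z)) \<partial>N \<omega>)"
        using elim(1) measurable_section_N[OF h elim(2)] measurable_section_N[OF w elim(2)] measurable_weight_snd[OF c]
        unfolding finite_kernel_def by (simp add: nn_integral_density)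
      also have "\<dots> = (\<integral>\<^sup>+z. h (N \<omega>, z) \<partial>N \<omega>)"
      proof (intro nn_integral_cong)
        fix z
        have "ennreal (weight (N \<omega>) z) * ?w (N \<omega>, z) = 1"
          using weight_pos[of "N \<omega>" z] by (simp add: ennreal_mult[symmetric])
        then show "ennreal (weight (N \<omega>) z) * (?w (N \<omega>, z) * h (N \<omega>, z)) = h (N \<omega>, z)"
          by (metis mult.assoc mult.left_neutral)
      qed
      finally show ?case .
    qed
  qed
  finally show ?thesis .
qed

lemma measurable_shift: "(\<lambda>(\<omega>, z). (add_point (N \<omega>) z, z)) \<in> M \<Otimes>\<^sub>M E \<rightarrow>\<^sub>M counting_space E \<Otimes>\<^sub>M E"
  unfolding case_prod_beta' by measurable

lemma nn_integral_shifted: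
  assumes h [measurable]: "h \<in> borel_measurable (counting_space E \<Otimes>\<^sub>M E)"
  shows "(\<integral>\<^sup>+p. h p \<partial>shifted) = (\<integral>\<^sup>+\<omega>. \<integral>\<^sup>+z. h (add_point (N \<omega>) z, z) \<partial>E \<partial>M)"
proof -
  have "(\<integral>\<^sup>+p. h p \<partial>shifted) = (\<integral>\<^sup>+p. h ((\<lambda>(\<omega>, z). (add_point (N \<omega>) z, z)) p) \<partial>(M \<Otimes>\<^sub>M E))"
    unfolding shifted_def by (rule nn_integral_distr[OF measurable_shift]) simp
  also have "\<dots> = (\<integral>\<^sup>+\<omega>. \<integral>\<^sup>+z. h (add_point (N \<omega>) z, z) \<partial>E \<partial>M)"
    using E.nn_integral_fst[OF measurable_compose[OF measurable_shift h]] by simp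
  finally show ?thesis .
qed

text \<open>
  On rectangles with a factor of finite intensity this is Mecke's formula for indicators; the cells
  provide the exhaustion by such rectangles.
\<close>

lemma campbell_eq_shifted: "campbell = shifted"
proof -
  let ?G = "{a \<times> b | a b. a \<in> sets (counting_space E) \<and> b \<in> sets E}"
  have rect: "a \<times> b \<in> sets (counting_space E \<Otimes>\<^sub>M E)" if "a \<in> sets (counting_space E)" "b \<in> sets E" for a b
    using that by auto
  have fin: "emeasure campbell (a \<times> b) = emeasure shifted (a \<times> b) \<and> emeasure campbell (a \<times> b) \<noteq> \<infinity>"
    if a: "a \<in> sets (counting_space E)" and b: "b \<in> sets E" "emeasure E b < \<infinity>" for a b
  proof -
    have ind: "indicator (a \<times> b) (\<eta>, z) = (indicator b z * indicator a \<eta> :: ennreal)" for \<eta> z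
      by (auto simp: indicator_def)
    have "emeasure campbell (a \<times> b) = (\<integral>\<^sup>+p. indicator (a \<times> b) p \<partial>campbell)"
      using rect[OF a b(1)] sets_campbell by simp
    also have "\<dots> = (\<integral>\<^sup>+\<omega>. \<integral>\<^sup>+z. indicator b z * indicator a (N \<omega>) \<partial>N \<omega> \<partial>M)"
      using rect[OF a b(1)] by (subst nn_integral_campbell) (simp_all add: ind)
    also have "\<dots> = (\<integral>\<^sup>+\<omega>. emeasure (N \<omega>) b * indicator a (N \<omega>) \<partial>M)"
    proof (intro nn_integral_cong)
      fix \<omega> assume "\<omega> \<in> space M"
      then have "b \<in> sets (N \<omega>)" using b by (simp add: sets_N)
      then show "(\<integral>\<^sup>+z. indicator b z * indicator a (N \<omega>) \<partial>N \<omega>) = emeasure (N \<omega>) b * indicator a (N \<omega>)"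
        by (simp add: nn_integral_multc)
    qed
    finally have 1: "emeasure campbell (a \<times> b) = (\<integral>\<^sup>+\<omega>. emeasure (N \<omega>) b * indicator a (N \<omega>) \<partial>M)" .
    have "emeasure shifted (a \<times> b) = (\<integral>\<^sup>+p. indicator (a \<times> b) p \<partial>shifted)"
      using rect[OF a b(1)] sets_shifted by simp
    also have "\<dots> = (\<integral>\<^sup>+\<omega>. \<integral>\<^sup>+z. indicator b z * indicator a (add_point (N \<omega>) z) \<partial>E \<partial>M)"
      using rect[OF a b(1)] by (subst nn_integral_shifted) (simp_all add: ind)
    finally have 2: "emeasure shifted (a \<times> b) = (\<integral>\<^sup>+\<omega>. \<integral>\<^sup>+z. indicator b z * indicator a (add_point (N \<omega>) z) \<partial>E \<partial>M)" .
    have "(\<integral>\<^sup>+\<omega>. emeasure (N \<omega>) b * indicator a (N \<omega>) \<partial>M) \<le> (\<integral>\<^sup>+\<omega>. emeasure (N \<omega>) b \<partial>M)"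
      by (intro nn_integral_mono) (simp add: indicator_def)
    then have "emeasure campbell (a \<times> b) < \<infinity>" using b expectation_N[OF b] 1 by (auto intro: le_less_trans)
    then show ?thesis using 1 2 mecke_rectangle[OF a b] by simp
  qed
  show ?thesis
  proof (rule measure_eqI_generator_eq_countable[where E="?G" and \<Omega>="counting_measures E \<times> space E"
        and A="range (\<lambda>n. counting_measures E \<times> cells n)"])
    show "Int_stable ?G" by (rule Int_stable_pair_measure_generator)
    show "?G \<subseteq> Pow (counting_measures E \<times> space E)"
      using sets.sets_into_space[of _ "counting_space E"] sets.sets_into_space[of _ E] by (auto simp: subset_eq)
    show "sets campbell = sigma_sets (counting_measures E \<times> space E) ?G"
      "sets shifted = sigma_sets (counting_measures E \<times> space E) ?G"
      unfolding sets_campbell sets_shifted sets_pair_measure by simp_all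
    show "range (\<lambda>n. counting_measures E \<times> cells n) \<subseteq> ?G"
      using cells(1) cylinder_in_sets[OF counting_measures_cylinder] by blast
    show "\<Union> (range (\<lambda>n. counting_measures E \<times> cells n)) = counting_measures E \<times> space E"
      unfolding cells(2)[symmetric] by auto
    show "emeasure campbell c \<noteq> \<infinity>" if "c \<in> range (\<lambda>n. counting_measures E \<times> cells n)" for c
      using that fin[OF cylinder_in_sets[OF counting_measures_cylinder] cells(1,3)] by auto
    fix X assume "X \<in> ?G"
    then obtain a b where X: "X = a \<times> b" "a \<in> sets (counting_space E)" "b \<in> sets E" by auto
    have Un: "X = (\<Union>n. a \<times> (b \<inter> cells n))"
      using X sets.sets_into_space[OF X(3)] unfolding cells(2)[symmetric] by auto
    \<comment> \<open>General rectangles are cut along the cells, since only there both measures are known to be finite.\<close>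
    have dis: "disjoint_family (\<lambda>n. a \<times> (b \<inter> cells n))"
      using cells(4) by (auto simp: disjoint_family_on_def)
    have in_sets: "range (\<lambda>n. a \<times> (b \<inter> cells n)) \<subseteq> sets (counting_space E \<Otimes>\<^sub>M E)"
      using X cells(1) rect by (auto intro!: rect)
    have "emeasure E (b \<inter> cells n) < \<infinity>" for n
      using cells(3)[of n] emeasure_mono[of "b \<inter> cells n" "cells n" E] cells(1) by (auto intro: le_less_trans)
    then have eq: "emeasure campbell (a \<times> (b \<inter> cells n)) = emeasure shifted (a \<times> (b \<inter> cells n))" for n
      using fin[OF X(2) sets.Int[OF X(3) cells(1)]] by auto
    have "emeasure campbell X = (\<Sum>n. emeasure campbell (a \<times> (b \<inter> cells n)))"
      unfolding Un by (rule suminf_emeasure[symmetric]) (use in_sets dis sets_campbell in auto)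
    also have "\<dots> = (\<Sum>n. emeasure shifted (a \<times> (b \<inter> cells n)))" by (simp only: eq)
    also have "\<dots> = emeasure shifted X"
      unfolding Un by (rule suminf_emeasure) (use in_sets dis sets_shifted in auto)
    finally show "emeasure campbell X = emeasure shifted X" .
  qed auto
qed

theorem mecke:
  assumes "h \<in> borel_measurable (counting_space E \<Otimes>\<^sub>M E)"
  shows "(\<integral>\<^sup>+\<omega>. \<integral>\<^sup>+z. h (N \<omega>, z) \<partial>N \<omega> \<partial>M) = (\<integral>\<^sup>+\<omega>. \<integral>\<^sup>+z. h (add_point (N \<omega>) z, z) \<partial>E \<partial>M)"
  using nn_integral_campbell[OF assms] nn_integral_shifted[OF assms] by (simp add: campbell_eq_shifted)

text \<open>
  Mecke's formula for the indicator of the exceptional set: the expected number of points of \<open>N\<close>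
  at which it is hit is zero.
\<close>

lemma AE_add_point:
  assumes P [measurable]: "Measurable.pred (counting_space E) P" and ae: "AE \<omega> in M. P (N \<omega>)"
  shows "AE \<omega> in M. AE z in E. P (add_point (N \<omega>) z)"
proof -
  let ?h = "\<lambda>p. indicator {\<eta> \<in> space (counting_space E). \<not> P \<eta>} (fst p) :: ennreal"
  have h: "?h \<in> borel_measurable (counting_space E \<Otimes>\<^sub>M E)" by measurable
  have "(\<integral>\<^sup>+\<omega>. \<integral>\<^sup>+z. ?h (N \<omega>, z) \<partial>N \<omega> \<partial>M) = (\<integral>\<^sup>+\<omega>. 0 \<partial>M)"
    using ae by (intro nn_integral_cong_AE) (auto elim!: eventually_mono)
  then have "(\<integral>\<^sup>+\<omega>. \<integral>\<^sup>+z. ?h (add_point (N \<omega>) z, z) \<partial>E \<partial>M) = 0"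
    using mecke[OF h] by simp
  moreover have m: "(\<lambda>q. ?h (add_point (N (fst q)) (snd q), snd q)) \<in> borel_measurable (M \<Otimes>\<^sub>M E)"
    by measurable
  ultimately have "AE \<omega> in M. (\<integral>\<^sup>+z. ?h (add_point (N \<omega>) z, z) \<partial>E) = 0"
    using E.borel_measurable_nn_integral_fst[OF m] by (subst (asm) nn_integral_0_iff_AE) auto
  then show ?thesis
    using AE_space
  proof eventually_elim
    case (elim \<omega>)
    have "(\<lambda>z. ?h (add_point (N \<omega>) z, z)) \<in> borel_measurable E"
      using measurable_compose[OF measurable_Pair1' m, of \<omega>] elim(2) by simp
    then have "AE z in E. ?h (add_point (N \<omega>) z, z) = 0"
      using elim(1) by (subst (asm) nn_integral_0_iff_AE) auto
    then show ?case
      by eventually_elim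
        (use add_point_in_counting_measures[OF N_counting[OF elim(2)]] in \<open>auto simp: indicator_def split: if_splits\<close>)
  qed
qed

text \<open>
  The signed version, from the positive and negative parts. Outside the configurations that are
  finite on cells the inner integral is set to \<open>0\<close>, which makes it measurable.
\<close>

lemma mecke_integral:
  fixes g :: "'a measure \<times> 'a \<Rightarrow> real"
  assumes g [measurable]: "g \<in> borel_measurable (counting_space E \<Otimes>\<^sub>M E)"
    and fin: "(\<integral>\<^sup>+\<omega>. \<integral>\<^sup>+z. ennreal (norm (g (add_point (N \<omega>) z, z))) \<partial>E \<partial>M) < \<infinity>"
  shows "integrable M (\<lambda>\<omega>. if finite_on_cells (N \<omega>) then \<integral>z. g (N \<omega>, z) \<partial>N \<omega> else 0)"
    and "(\<integral>\<omega>. (if finite_on_cells (N \<omega>) then \<integral>z. g (N \<omega>, z) \<partial>N \<omega> else 0) \<partial>M) = (\<integral>\<omega>. \<integral>z. g (add_point (N \<omega>) z, z) \<partial>E \<partial>M)"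
proof -
  have gc: "case_prod (\<lambda>\<eta> z. g (\<eta>, z)) \<in> borel_measurable (counting_space E \<Otimes>\<^sub>M E)" by simp
  let ?F = "\<lambda>\<omega>. if finite_on_cells (N \<omega>) then \<integral>z. g (N \<omega>, z) \<partial>N \<omega> else 0"
  have F [measurable]: "?F \<in> borel_measurable M"
    using measurable_compose[OF measurable_N measurable_integral_counting[OF gc]] .
  define a where "a \<omega> = (if finite_on_cells (N \<omega>) then \<integral>\<^sup>+z. ennreal (g (N \<omega>, z)) \<partial>N \<omega> else 0)" for \<omega>
  define b where "b \<omega> = (if finite_on_cells (N \<omega>) then \<integral>\<^sup>+z. ennreal (- g (N \<omega>, z)) \<partial>N \<omega> else 0)" for \<omega>
  define c where "c \<omega> = (if finite_on_cells (N \<omega>) then \<integral>\<^sup>+z. ennreal (norm (g (N \<omega>, z))) \<partial>N \<omega> else 0)" for \<omega>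
  have [measurable]: "a \<in> borel_measurable M" "b \<in> borel_measurable M" "c \<in> borel_measurable M"
    unfolding a_def b_def c_def
    by (intro measurable_compose[OF measurable_N measurable_nn_integral_counting]; simp)+
  have mg: "(\<lambda>\<omega>. ennreal (u (g \<omega>))) \<in> borel_measurable (counting_space E \<Otimes>\<^sub>M E)" if "u \<in> borel_measurable borel" for u :: "real \<Rightarrow> real"
    using that by measurable
  have int: "(\<integral>\<^sup>+\<omega>. (if finite_on_cells (N \<omega>) then \<integral>\<^sup>+z. ennreal (u (g (N \<omega>, z))) \<partial>N \<omega> else 0) \<partial>M) = (\<integral>\<^sup>+p. ennreal (u (g p)) \<partial>campbell)"
    if "u \<in> borel_measurable borel" for u :: "real \<Rightarrow> real"
    unfolding nn_integral_campbell[OF mg[OF that]] using AE_finite_on_cells by (intro nn_integral_cong_AE) (auto elim!: eventually_mono)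
  have ia: "(\<integral>\<^sup>+\<omega>. a \<omega> \<partial>M) = (\<integral>\<^sup>+p. ennreal (g p) \<partial>campbell)"
    and ib: "(\<integral>\<^sup>+\<omega>. b \<omega> \<partial>M) = (\<integral>\<^sup>+p. ennreal (- g p) \<partial>campbell)"
    and ic: "(\<integral>\<^sup>+\<omega>. c \<omega> \<partial>M) = (\<integral>\<^sup>+p. ennreal (norm (g p)) \<partial>campbell)"
    unfolding a_def b_def c_def using int[of "\<lambda>x. x"] int[of "\<lambda>x. - x"] int[of norm] by simp_all
  have c_fin: "(\<integral>\<^sup>+\<omega>. c \<omega> \<partial>M) < \<infinity>"
    unfolding ic campbell_eq_shifted using fin by (subst nn_integral_shifted) measurable
  then have ip: "integrable campbell g"
    unfolding ic by (intro integrableI_bounded) (simp_all add: measurable_cong_sets[OF sets_campbell refl])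
  have ab: "a \<omega> \<le> c \<omega>" "b \<omega> \<le> c \<omega>" for \<omega>
    unfolding a_def b_def c_def by (auto intro!: nn_integral_mono ennreal_leI)
  have Fab: "?F \<omega> = enn2real (a \<omega>) - enn2real (b \<omega>)" "norm (?F \<omega>) \<le> enn2real (c \<omega>)"
    if "c \<omega> < \<infinity>" "\<omega> \<in> space M" for \<omega>
  proof -
    have i: "integrable (N \<omega>) (\<lambda>z. g (N \<omega>, z))" if "finite_on_cells (N \<omega>)"
      using measurable_section_N[OF g \<open>\<omega> \<in> space M\<close>] \<open>c \<omega> < \<infinity>\<close> that by (intro integrableI_bounded) (simp_all add: c_def)
    show "?F \<omega> = enn2real (a \<omega>) - enn2real (b \<omega>)"
      using real_lebesgue_integral_def[OF i] by (auto simp: a_def b_def)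
    show "norm (?F \<omega>) \<le> enn2real (c \<omega>)"
    proof (cases "finite_on_cells (N \<omega>)")
      case True
      have "norm (\<integral>z. g (N \<omega>, z) \<partial>N \<omega>) \<le> (\<integral>z. norm (g (N \<omega>, z)) \<partial>N \<omega>)" by (rule integral_norm_bound)
      also have "\<dots> = enn2real (c \<omega>)"
        using True by (subst integral_eq_nn_integral) (use measurable_section_N[OF g \<open>\<omega> \<in> space M\<close>] in \<open>auto simp: c_def\<close>)
      finally show ?thesis using True by simp
    qed simp
  qed
  have c_ae: "AE \<omega> in M. c \<omega> \<noteq> \<infinity>" using c_fin by (intro nn_integral_PInf_AE) auto
  have enn: "integrable M (\<lambda>\<omega>. enn2real (u \<omega>))" "(\<integral>\<omega>. enn2real (u \<omega>) \<partial>M) = enn2real (\<integral>\<^sup>+\<omega>. u \<omega> \<partial>M)"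
    if [measurable]: "u \<in> borel_measurable M" and u: "\<And>\<omega>. u \<omega> \<le> c \<omega>" for u
  proof -
    have eq: "(\<integral>\<^sup>+\<omega>. ennreal (enn2real (u \<omega>)) \<partial>M) = (\<integral>\<^sup>+\<omega>. u \<omega> \<partial>M)"
      using c_ae by (intro nn_integral_cong_AE) (auto elim!: eventually_mono simp: less_top dest!: le_less_trans[OF u])
    have "(\<integral>\<^sup>+\<omega>. u \<omega> \<partial>M) < \<infinity>" using c_fin nn_integral_mono[of M u c] u by (auto intro: le_less_trans)
    then show "integrable M (\<lambda>\<omega>. enn2real (u \<omega>))" by (intro integrableI_nonneg) (simp_all add: eq)
    show "(\<integral>\<omega>. enn2real (u \<omega>) \<partial>M) = enn2real (\<integral>\<^sup>+\<omega>. u \<omega> \<partial>M)"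
      by (subst integral_eq_nn_integral) (simp_all add: eq)
  qed
  show "integrable M ?F"
  proof (rule Bochner_Integration.integrable_bound[OF enn(1)[of c]])
    show "AE \<omega> in M. norm (?F \<omega>) \<le> norm (enn2real (c \<omega>))"
      using c_ae AE_space
    proof eventually_elim
      case (elim \<omega>)
      then show ?case using Fab(2)[of \<omega>] by (simp only: less_top real_norm_def abs_of_nonneg[OF enn2real_nonneg] infinity_ennreal_def)
    qed
  qed simp_all
  have "(\<integral>\<omega>. ?F \<omega> \<partial>M) = (\<integral>\<omega>. enn2real (a \<omega>) - enn2real (b \<omega>) \<partial>M)"
  proof (rule integral_cong_AE)
    show "AE \<omega> in M. ?F \<omega> = enn2real (a \<omega>) - enn2real (b \<omega>)"
      using c_ae AE_space by eventually_elim (use Fab(1) in \<open>simp add: less_top\<close>)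
  qed measurable
  also have "\<dots> = enn2real (\<integral>\<^sup>+p. ennreal (g p) \<partial>campbell) - enn2real (\<integral>\<^sup>+p. ennreal (- g p) \<partial>campbell)"
    using enn[of a] enn[of b] ab by (simp add: ia ib)
  also have "\<dots> = (\<integral>p. g p \<partial>campbell)" using real_lebesgue_integral_def[OF ip] by simp
  also have "\<dots> = (\<integral>q. g ((\<lambda>(\<omega>, z). (add_point (N \<omega>) z, z)) q) \<partial>(M \<Otimes>\<^sub>M E))"
    unfolding campbell_eq_shifted shifted_def by (rule integral_distr[OF measurable_shift g])
  also have "\<dots> = (\<integral>\<omega>. \<integral>z. g (add_point (N \<omega>) z, z) \<partial>E \<partial>M)"
  proof -
    have "integrable (M \<Otimes>\<^sub>M E) (\<lambda>q. g ((\<lambda>(\<omega>, z). (add_point (N \<omega>) z, z)) q))"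
      using ip unfolding campbell_eq_shifted shifted_def by (subst (asm) integrable_distr_eq[OF measurable_shift g])
    from ME.integral_fst'[OF this] show ?thesis by simp
  qed
  finally show "(\<integral>\<omega>. ?F \<omega> \<partial>M) = (\<integral>\<omega>. \<integral>z. g (add_point (N \<omega>) z, z) \<partial>E \<partial>M)" .
qed

end

section \<open>The pathwise compensated integral\<close>

lemma sigma_finite_intensity:
  assumes "sigma_finite_measure \<nu>" shows "sigma_finite_measure (intensity T \<nu>)"
proof -
  interpret \<nu>: sigma_finite_measure \<nu> by fact
  interpret t: finite_measure "time_measure T" by (rule finite_measure_time)
  interpret pair_sigma_finite "time_measure T" \<nu> ..
  show ?thesis unfolding intensity_def by standard (rule sigma_finite_countable)
qed

text \<open>
  An integrand takes a configuration, a time and a mark. A predictable process is represented by an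
  integrand evaluated at the configuration before the current time.
\<close>

type_synonym ('u, 'h) integrand = "((real \<times> 'u) measure \<times> real) \<times> 'u \<Rightarrow> 'h"
type_synonym ('w, 'u, 'h) process = "('w \<times> real) \<times> 'u \<Rightarrow> 'h"

locale time_poisson =
  fixes T :: real and \<nu> :: "'u measure" and M :: "'w measure" and N :: "'w \<Rightarrow> (real \<times> 'u) measure"
  assumes T_pos: "0 < T" and sigma_finite_nu: "sigma_finite_measure \<nu>" and space_nu: "space \<nu> \<noteq> {}"
    and prob: "prob_space M" and prm: "poisson_random_measure M (intensity T \<nu>) N"
begin

abbreviation "E \<equiv> intensity T \<nu>"
abbreviation "CS \<equiv> counting_space E"
abbreviation "CTU \<equiv> (CS \<Otimes>\<^sub>M time_measure T) \<Otimes>\<^sub>M \<nu>"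

sublocale poisson M E N
proof -
  have "space E \<noteq> {}" using T_pos space_nu by (auto simp: intensity_def space_pair_measure)
  then show "poisson M E N"
    using prob prm sigma_finite_intensity[OF sigma_finite_nu] by (simp add: poisson_def poisson_axioms_def)
qed

text \<open>
  Evaluating the integrand at the strict past builds predictability into the definition.
\<close>

definition at_past :: "('u, 'h) integrand \<Rightarrow> (real \<times> 'u) measure \<Rightarrow> real \<times> 'u \<Rightarrow> 'h" where
  "at_past \<phi> \<eta> z = \<phi> ((before \<eta> (fst z), fst z), snd z)"

text \<open>
  The integrand \<open>\<phi>\<^sup>z\<close> that sees the additional point \<open>z\<close> at all times strictly after that of \<open>z\<close>.
\<close>

definition with_point :: "real \<times> 'u \<Rightarrow> ('u, 'h) integrand \<Rightarrow> ('u, 'h) integrand" where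
  "with_point z \<phi> x = \<phi> ((if fst z < snd (fst x) then add_point (fst (fst x)) z else fst (fst x), snd (fst x)), snd x)"

text \<open>
  The compensated integral of \<open>\<phi>\<close> along the configuration \<open>\<eta>\<close>. On configurations that are not finite
  on cells the first integral is set to \<open>0\<close> in order to make \<open>J \<phi>\<close> measurable.
\<close>

definition J :: "('u, 'h::{banach, second_countable_topology}) integrand \<Rightarrow> (real \<times> 'u) measure \<Rightarrow> 'h" where
  "J \<phi> \<eta> = (if finite_on_cells \<eta> then \<integral>z. at_past \<phi> \<eta> z \<partial>\<eta> else 0) - (\<integral>z. at_past \<phi> \<eta> z \<partial>E)"

definition moment :: "real \<Rightarrow> ('u, 'h::real_normed_vector) integrand \<Rightarrow> ennreal" where
  "moment p \<phi> = (\<integral>\<^sup>+\<omega>. \<integral>\<^sup>+z. ennreal (norm (at_past \<phi> (N \<omega>) z) powr p) \<partial>E \<partial>M)"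

definition integrands :: "real \<Rightarrow> ('u, 'h::real_normed_vector) integrand set" where
  "integrands p = {\<phi> \<in> borel_measurable CTU. moment p \<phi> < \<infinity>}"

lemma measurable_fst_E [measurable]: "fst \<in> E \<rightarrow>\<^sub>M time_measure T"
  and measurable_snd_E [measurable]: "snd \<in> E \<rightarrow>\<^sub>M \<nu>"
  and measurable_PairE: "f \<in> A \<rightarrow>\<^sub>M time_measure T \<Longrightarrow> g \<in> A \<rightarrow>\<^sub>M \<nu> \<Longrightarrow> (\<lambda>x. (f x, g x)) \<in> A \<rightarrow>\<^sub>M E"
  unfolding intensity_def by measurable

lemma measurable_at_past_compose:
  assumes \<phi>: "\<phi> \<in> borel_measurable CTU" and [measurable]: "f \<in> A \<rightarrow>\<^sub>M CS" "g \<in> A \<rightarrow>\<^sub>M E"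
  shows "(\<lambda>x. at_past \<phi> (f x) (g x)) \<in> borel_measurable A"
proof -
  have [measurable]: "(\<lambda>x. fst (g x)) \<in> A \<rightarrow>\<^sub>M time_measure T" by measurable
  then have b: "(\<lambda>x. fst (g x)) \<in> borel_measurable A" by (simp add: measurable_into_time)
  note [measurable] = measurable_before[OF assms(2) b]
  have "(\<lambda>x. ((before (f x) (fst (g x)), fst (g x)), snd (g x))) \<in> A \<rightarrow>\<^sub>M CTU" by measurable
  from measurable_compose[OF this \<phi>] show ?thesis by (simp add: at_past_def)
qed

lemma measurable_at_past: "\<phi> \<in> borel_measurable CTU \<Longrightarrow> (\<lambda>p. at_past \<phi> (fst p) (snd p)) \<in> borel_measurable (CS \<Otimes>\<^sub>M E)"
  by (rule measurable_at_past_compose[OF _ measurable_fst measurable_snd])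

lemma measurable_at_past_N: "\<phi> \<in> borel_measurable CTU \<Longrightarrow> (\<lambda>p. at_past \<phi> (N (fst p)) (snd p)) \<in> borel_measurable (M \<Otimes>\<^sub>M E)"
  by (rule measurable_at_past_compose[OF _ measurable_compose[OF measurable_fst measurable_N] measurable_snd])

lemma measurable_at_past_E: "\<phi> \<in> borel_measurable CTU \<Longrightarrow> \<eta> \<in> counting_measures E \<Longrightarrow> at_past \<phi> \<eta> \<in> borel_measurable E"
  using measurable_at_past_compose[of \<phi> "\<lambda>_. \<eta>" E "\<lambda>z. z"] by simp

lemma measurable_at_past_self: "\<phi> \<in> borel_measurable CTU \<Longrightarrow> \<eta> \<in> counting_measures E \<Longrightarrow> at_past \<phi> \<eta> \<in> borel_measurable \<eta>"
  using measurable_at_past_E[of \<phi> \<eta>] by (simp add: measurable_cong_sets[OF counting_measuresD(1) refl])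

lemma measurable_at_past_N_self: "\<phi> \<in> borel_measurable CTU \<Longrightarrow> \<omega> \<in> space M \<Longrightarrow> at_past \<phi> (N \<omega>) \<in> borel_measurable (N \<omega>)"
  by (intro measurable_at_past_self N_counting)

lemma at_past_add_point_self:
  "sets \<eta> = sets E \<Longrightarrow> at_past \<phi> (add_point \<eta> z) z = at_past \<phi> \<eta> z"
  by (simp add: at_past_def before_add_point)

lemma at_past_add_point:
  "sets \<eta> = sets E \<Longrightarrow> at_past \<phi> (add_point \<eta> z) w = at_past (with_point z \<phi>) \<eta> w"
  by (simp add: at_past_def with_point_def before_add_point)

lemma measurable_with_point:
  assumes \<phi>: "\<phi> \<in> borel_measurable CTU" and z: "z \<in> space E"
  shows "with_point z \<phi> \<in> borel_measurable CTU"
proof -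
  have b: "(\<lambda>x. snd (fst x)) \<in> borel_measurable CTU"
  proof -
    have "(\<lambda>x. snd (fst x)) \<in> CTU \<rightarrow>\<^sub>M time_measure T" by measurable
    then show ?thesis by (simp add: measurable_into_time)
  qed
  have [measurable]: "(\<lambda>x. z) \<in> CTU \<rightarrow>\<^sub>M E" using z by simp
  have [measurable]: "Measurable.pred CTU (\<lambda>x. fst z < snd (fst x))" using b by measurable
  have "(\<lambda>x. ((if fst z < snd (fst x) then add_point (fst (fst x)) z else fst (fst x), snd (fst x)), snd x)) \<in> CTU \<rightarrow>\<^sub>M CTU"
    by measurable
  from measurable_compose[OF this \<phi>] show ?thesis by (simp add: with_point_def[abs_def])
qed

lemma at_past_comp2: "at_past (\<lambda>x. F (\<phi> x) (\<psi> x)) \<eta> z = F (at_past \<phi> \<eta> z) (at_past \<psi> \<eta> z)"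
  and at_past_comp: "at_past (\<lambda>x. G (\<phi> x)) \<eta> z = G (at_past \<phi> \<eta> z)"
  by (simp_all add: at_past_def)

lemma measurable_J:
  assumes \<phi>: "\<phi> \<in> borel_measurable CTU"
  shows "J \<phi> \<in> borel_measurable CS"
proof -
  have m: "case_prod (at_past \<phi>) \<in> borel_measurable (CS \<Otimes>\<^sub>M E)"
    using measurable_at_past[OF \<phi>] by (simp add: case_prod_beta')
  note [measurable] = measurable_integral_counting[OF m] E.borel_measurable_lebesgue_integral[OF m]
  show ?thesis unfolding J_def[abs_def] by measurable
qed

lemma measurable_J_N: "\<phi> \<in> borel_measurable CTU \<Longrightarrow> (\<lambda>\<omega>. J \<phi> (N \<omega>)) \<in> borel_measurable M"
  using measurable_compose[OF measurable_N measurable_J] .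

lemma moment_eq_pair:
  assumes \<phi>: "\<phi> \<in> borel_measurable CTU"
  shows "moment p \<phi> = (\<integral>\<^sup>+x. ennreal (norm (at_past \<phi> (N (fst x)) (snd x)) powr p) \<partial>(M \<Otimes>\<^sub>M E))"
  unfolding moment_def using measurable_at_past_N[OF \<phi>]
  by (subst E.nn_integral_fst[symmetric]) simp_all

text \<open>
  Adding \<open>z\<close> to the configuration does not change a predictable integrand at \<open>z\<close>, so that Mecke's
  formula exchanges \<open>N\<close> with its intensity.
\<close>

lemma nn_integral_compensation:
  assumes [measurable]: "\<phi> \<in> borel_measurable CTU" "u \<in> borel_measurable borel"
  shows "(\<integral>\<^sup>+\<omega>. \<integral>\<^sup>+z. u (at_past \<phi> (N \<omega>) z) \<partial>N \<omega> \<partial>M) = (\<integral>\<^sup>+\<omega>. \<integral>\<^sup>+z. u (at_past \<phi> (N \<omega>) z) \<partial>E \<partial>M)"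
proof -
  note [measurable] = measurable_at_past[OF assms(1)]
  have h: "(\<lambda>p. u (at_past \<phi> (fst p) (snd p)) :: ennreal) \<in> borel_measurable (CS \<Otimes>\<^sub>M E)" by measurable
  show ?thesis using mecke[OF h]
    by (simp add: at_past_add_point_self sets_N cong: nn_integral_cong)
qed

lemma nn_integral_measurable_M:
  assumes [measurable]: "\<phi> \<in> borel_measurable CTU" "u \<in> borel_measurable borel"
  shows "(\<lambda>\<omega>. \<integral>\<^sup>+z. u (at_past \<phi> (N \<omega>) z) \<partial>E) \<in> borel_measurable M"
proof -
  note [measurable] = measurable_at_past_N[OF assms(1)]
  have "(\<lambda>p. u (at_past \<phi> (N (fst p)) (snd p)) :: ennreal) \<in> borel_measurable (M \<Otimes>\<^sub>M E)" by measurable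
  from E.borel_measurable_nn_integral_fst[OF this] show ?thesis by simp
qed

lemma nn_integral_measurable_M_N:
  assumes [measurable]: "\<phi> \<in> borel_measurable CTU" "u \<in> borel_measurable borel"
  shows "(\<lambda>\<omega>. if finite_on_cells (N \<omega>) then \<integral>\<^sup>+z. u (at_past \<phi> (N \<omega>) z) \<partial>N \<omega> else (0::ennreal)) \<in> borel_measurable M"
proof -
  note [measurable] = measurable_at_past[OF assms(1)]
  have "case_prod (\<lambda>\<eta> z. u (at_past \<phi> \<eta> z) :: ennreal) \<in> borel_measurable (CS \<Otimes>\<^sub>M E)"
    unfolding case_prod_beta' by measurable
  from measurable_compose[OF measurable_N measurable_nn_integral_counting[OF this]] show ?thesis .
qed

definition integrable_at :: "('u, 'h::{banach, second_countable_topology}) integrand \<Rightarrow> (real \<times> 'u) measure \<Rightarrow> bool" where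
  "integrable_at \<phi> \<eta> \<longleftrightarrow> finite_on_cells \<eta> \<and> integrable \<eta> (at_past \<phi> \<eta>) \<and> integrable E (at_past \<phi> \<eta>)"

lemma AE_integrable_at:
  fixes \<phi> :: "_ \<Rightarrow> 'h::{banach, second_countable_topology}"
  assumes \<phi>: "\<phi> \<in> borel_measurable CTU" and fin: "moment 1 \<phi> < \<infinity>"
  shows "AE \<omega> in M. integrable_at \<phi> (N \<omega>)"
proof -
  have fin1: "(\<integral>\<^sup>+\<omega>. \<integral>\<^sup>+z. ennreal (norm (at_past \<phi> (N \<omega>) z)) \<partial>E \<partial>M) < \<infinity>"
    using fin by (simp add: moment_def)
  have "(\<integral>\<^sup>+\<omega>. (if finite_on_cells (N \<omega>) then \<integral>\<^sup>+z. ennreal (norm (at_past \<phi> (N \<omega>) z)) \<partial>N \<omega> else 0) \<partial>M) =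
    (\<integral>\<^sup>+\<omega>. \<integral>\<^sup>+z. ennreal (norm (at_past \<phi> (N \<omega>) z)) \<partial>N \<omega> \<partial>M)"
    using AE_finite_on_cells by (intro nn_integral_cong_AE) (auto elim!: eventually_mono)
  then have fin2: "(\<integral>\<^sup>+\<omega>. (if finite_on_cells (N \<omega>) then \<integral>\<^sup>+z. ennreal (norm (at_past \<phi> (N \<omega>) z)) \<partial>N \<omega> else 0) \<partial>M) < \<infinity>"
    using fin1 by (simp add: nn_integral_compensation[OF \<phi>, where u="\<lambda>x. ennreal (norm x)"])
  have 1: "AE \<omega> in M. (\<integral>\<^sup>+z. ennreal (norm (at_past \<phi> (N \<omega>) z)) \<partial>E) \<noteq> \<infinity>"
    using fin1 by (intro nn_integral_PInf_AE nn_integral_measurable_M[OF \<phi>]) auto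
  have 2: "AE \<omega> in M. (if finite_on_cells (N \<omega>) then \<integral>\<^sup>+z. ennreal (norm (at_past \<phi> (N \<omega>) z)) \<partial>N \<omega> else 0) \<noteq> \<infinity>"
    using fin2 by (intro nn_integral_PInf_AE nn_integral_measurable_M_N[OF \<phi>]) auto
  show ?thesis using 1 2 AE_finite_on_cells AE_space
  proof eventually_elim
    case (elim \<omega>)
    have "integrable (N \<omega>) (at_past \<phi> (N \<omega>))"
      using elim by (intro integrableI_bounded measurable_at_past_N_self[OF \<phi>]) (simp_all add: top.not_eq_extremum)
    moreover have "integrable E (at_past \<phi> (N \<omega>))"
      using elim N_counting by (intro integrableI_bounded measurable_at_past_E[OF \<phi>]) (simp_all add: top.not_eq_extremum)
    ultimately show ?case using elim by (simp add: integrable_at_def)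
  qed
qed

lemma integrable_at_lincomb:
  "integrable_at \<phi> \<eta> \<Longrightarrow> integrable_at \<psi> \<eta> \<Longrightarrow> integrable_at (\<lambda>x. a *\<^sub>R \<phi> x + b *\<^sub>R \<psi> x) \<eta>"
  "integrable_at \<phi> \<eta> \<Longrightarrow> integrable_at \<psi> \<eta> \<Longrightarrow> J (\<lambda>x. a *\<^sub>R \<phi> x + b *\<^sub>R \<psi> x) \<eta> = a *\<^sub>R J \<phi> \<eta> + b *\<^sub>R J \<psi> \<eta>"
proof -
  have l: "at_past (\<lambda>x. a *\<^sub>R \<phi> x + b *\<^sub>R \<psi> x) \<eta> = (\<lambda>z. a *\<^sub>R at_past \<phi> \<eta> z + b *\<^sub>R at_past \<psi> \<eta> z)"
    by (simp add: at_past_def fun_eq_iff)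
  show "integrable_at \<phi> \<eta> \<Longrightarrow> integrable_at \<psi> \<eta> \<Longrightarrow> integrable_at (\<lambda>x. a *\<^sub>R \<phi> x + b *\<^sub>R \<psi> x) \<eta>"
    by (simp add: integrable_at_def l)
  show "integrable_at \<phi> \<eta> \<Longrightarrow> integrable_at \<psi> \<eta> \<Longrightarrow> J (\<lambda>x. a *\<^sub>R \<phi> x + b *\<^sub>R \<psi> x) \<eta> = a *\<^sub>R J \<phi> \<eta> + b *\<^sub>R J \<psi> \<eta>"
    by (simp add: integrable_at_def J_def l algebra_simps)
qed

lemma integrable_at_diff:
  assumes "integrable_at \<phi> \<eta>" "integrable_at \<psi> \<eta>"
  shows "integrable_at (\<lambda>x. \<phi> x - \<psi> x) \<eta>" "J (\<lambda>x. \<phi> x - \<psi> x) \<eta> = J \<phi> \<eta> - J \<psi> \<eta>"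
  using integrable_at_lincomb[OF assms, of 1 "-1"] by simp_all

text \<open>
  The commutation relation for paths: the integral with respect to \<open>\<eta> + \<delta>\<^sub>z\<close> has the additional term
  at \<open>z\<close>, where the integrand does not see \<open>z\<close>, and elsewhere the integrand is replaced by the one
  that sees \<open>z\<close>.
\<close>

lemma J_add_point:
  assumes \<phi>: "\<phi> \<in> borel_measurable CTU" and \<eta>: "\<eta> \<in> counting_measures E" and z: "z \<in> space E"
    and integrable_at: "integrable_at \<phi> (add_point \<eta> z)"
  shows "integrable_at (with_point z \<phi>) \<eta>" "J \<phi> (add_point \<eta> z) = J (with_point z \<phi>) \<eta> + at_past \<phi> \<eta> z"
proof -
  note D = counting_measuresD[OF \<eta>]
  have z': "z \<in> space \<eta>" using z D by simp
  have l: "at_past \<phi> (add_point \<eta> z) = at_past (with_point z \<phi>) \<eta>" by (rule ext) (rule at_past_add_point[OF D(1)])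
  show k: "integrable_at (with_point z \<phi>) \<eta>" using integrable_at by (simp add: integrable_at_def l integrable_add_point_iff[OF z'] finite_on_cells_add_point[OF D(1)])
  have "at_past (with_point z \<phi>) \<eta> z = at_past \<phi> \<eta> z" using at_past_add_point[OF D(1), of \<phi> z z] at_past_add_point_self[OF D(1), of \<phi> z] by simp
  then show "J \<phi> (add_point \<eta> z) = J (with_point z \<phi>) \<eta> + at_past \<phi> \<eta> z"
    using k unfolding J_def l finite_on_cells_add_point[OF D(1)] by (simp add: integrable_at_def integral_add_point[OF _ z'])
qed

lemma norm_J_le:
  assumes integrable_at: "integrable_at \<phi> \<eta>"
  shows "ennreal (norm (J \<phi> \<eta>)) \<le> (\<integral>\<^sup>+z. ennreal (norm (at_past \<phi> \<eta> z)) \<partial>\<eta>) + (\<integral>\<^sup>+z. ennreal (norm (at_past \<phi> \<eta> z)) \<partial>E)"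
proof -
  have "norm (J \<phi> \<eta>) \<le> norm (\<integral>z. at_past \<phi> \<eta> z \<partial>\<eta>) + norm (\<integral>z. at_past \<phi> \<eta> z \<partial>E)"
    using integrable_at by (simp add: J_def integrable_at_def norm_triangle_ineq4)
  then have "ennreal (norm (J \<phi> \<eta>)) \<le> ennreal (norm (\<integral>z. at_past \<phi> \<eta> z \<partial>\<eta>)) + ennreal (norm (\<integral>z. at_past \<phi> \<eta> z \<partial>E))"
    by (simp add: ennreal_plus[symmetric] del: ennreal_plus)
  also have "\<dots> \<le> (\<integral>\<^sup>+z. ennreal (norm (at_past \<phi> \<eta> z)) \<partial>\<eta>) + (\<integral>\<^sup>+z. ennreal (norm (at_past \<phi> \<eta> z)) \<partial>E)"
    using integrable_at by (intro add_mono integral_norm_bound_ennreal) (auto simp: integrable_at_def)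
  finally show ?thesis .
qed

lemma L1_bound:
  assumes \<phi>: "\<phi> \<in> borel_measurable CTU" and fin: "moment 1 \<phi> < \<infinity>"
  shows "(\<integral>\<^sup>+\<omega>. ennreal (norm (J \<phi> (N \<omega>))) \<partial>M) \<le> 2 * moment 1 \<phi>"
proof -
  let ?a = "\<lambda>\<omega>. if finite_on_cells (N \<omega>) then \<integral>\<^sup>+z. ennreal (norm (at_past \<phi> (N \<omega>) z)) \<partial>N \<omega> else 0"
  let ?b = "\<lambda>\<omega>. \<integral>\<^sup>+z. ennreal (norm (at_past \<phi> (N \<omega>) z)) \<partial>E"
  have m: "?a \<in> borel_measurable M" "?b \<in> borel_measurable M"
    by (rule nn_integral_measurable_M_N[OF \<phi>], simp, rule nn_integral_measurable_M[OF \<phi>], simp)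
  have "(\<integral>\<^sup>+\<omega>. ennreal (norm (J \<phi> (N \<omega>))) \<partial>M) \<le> (\<integral>\<^sup>+\<omega>. ?a \<omega> + ?b \<omega> \<partial>M)"
  proof (rule nn_integral_mono_AE)
    show "AE \<omega> in M. ennreal (norm (J \<phi> (N \<omega>))) \<le> ?a \<omega> + ?b \<omega>"
      using AE_integrable_at[OF \<phi> fin] by eventually_elim (use norm_J_le integrable_at_def in force)
  qed
  also have "\<dots> = (\<integral>\<^sup>+\<omega>. ?a \<omega> \<partial>M) + (\<integral>\<^sup>+\<omega>. ?b \<omega> \<partial>M)" using m by (rule nn_integral_add)
  also have "(\<integral>\<^sup>+\<omega>. ?a \<omega> \<partial>M) = (\<integral>\<^sup>+\<omega>. \<integral>\<^sup>+z. ennreal (norm (at_past \<phi> (N \<omega>) z)) \<partial>N \<omega> \<partial>M)"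
    using AE_finite_on_cells by (intro nn_integral_cong_AE) (auto elim!: eventually_mono)
  also have "\<dots> = (\<integral>\<^sup>+\<omega>. ?b \<omega> \<partial>M)" by (rule nn_integral_compensation[OF \<phi>]) simp
  finally show ?thesis by (simp add: moment_def mult_2)
qed

text \<open>
  The martingale property at the terminal time, again from Mecke's formula at a predictable
  integrand.
\<close>

lemma expectation_J:
  fixes \<phi> :: "_ \<Rightarrow> real"
  assumes \<phi>: "\<phi> \<in> borel_measurable CTU" and fin: "moment 1 \<phi> < \<infinity>"
  shows "(\<integral>\<omega>. J \<phi> (N \<omega>) \<partial>M) = 0"
proof -
  have l: "at_past \<phi> (add_point (N \<omega>) z) z = at_past \<phi> (N \<omega>) z" if "\<omega> \<in> space M" for \<omega> z
    by (rule at_past_add_point_self[OF sets_N[OF that]])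
  have fin': "(\<integral>\<^sup>+\<omega>. \<integral>\<^sup>+z. ennreal (norm (at_past \<phi> (add_point (N \<omega>) z) z)) \<partial>E \<partial>M) < \<infinity>"
  proof -
    have "(\<integral>\<^sup>+\<omega>. \<integral>\<^sup>+z. ennreal (norm (at_past \<phi> (add_point (N \<omega>) z) z)) \<partial>E \<partial>M) = moment 1 \<phi>"
      unfolding moment_def by (intro nn_integral_cong) (simp add: l)
    then show ?thesis using fin by simp
  qed
  note M = mecke_integral[OF measurable_at_past[OF \<phi>], unfolded fst_conv snd_conv, OF fin']
  have i: "integrable (M \<Otimes>\<^sub>M E) (\<lambda>p. at_past \<phi> (N (fst p)) (snd p))"
    using fin measurable_at_past_N[OF \<phi>] by (intro integrableI_bounded) (simp_all add: moment_eq_pair[OF \<phi>])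
  have "(\<integral>\<omega>. J \<phi> (N \<omega>) \<partial>M) = (\<integral>\<omega>. (if finite_on_cells (N \<omega>) then \<integral>z. at_past \<phi> (N \<omega>) z \<partial>N \<omega> else 0) \<partial>M) - (\<integral>\<omega>. \<integral>z. at_past \<phi> (N \<omega>) z \<partial>E \<partial>M)"
    unfolding J_def using ME.integrable_fst'[OF i] M(1) by (intro Bochner_Integration.integral_diff) simp_all
  also have "(\<integral>\<omega>. \<integral>z. at_past \<phi> (N \<omega>) z \<partial>E \<partial>M) = (\<integral>\<omega>. \<integral>z. at_past \<phi> (add_point (N \<omega>) z) z \<partial>E \<partial>M)"
    by (intro Bochner_Integration.integral_cong refl) (simp add: l)
  finally show ?thesis using M(2) by simp
qed

end

section \<open>The isometric bound for bounded integrands\<close>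

lemma nn_integral_fatou_le:
  fixes u :: "nat \<Rightarrow> 'a \<Rightarrow> ennreal"
  assumes [measurable]: "\<And>n. u n \<in> borel_measurable M" and lim: "AE x in M. (\<lambda>n. u n x) \<longlonglongrightarrow> v x"
    and le: "\<And>n. (\<integral>\<^sup>+x. u n x \<partial>M) \<le> C"
  shows "(\<integral>\<^sup>+x. v x \<partial>M) \<le> C"
proof -
  have "(\<integral>\<^sup>+x. v x \<partial>M) = (\<integral>\<^sup>+x. liminf (\<lambda>n. u n x) \<partial>M)"
    using lim by (intro nn_integral_cong_AE) (auto elim!: eventually_mono dest!: lim_imp_Liminf[OF trivial_limit_sequentially])
  also have "\<dots> \<le> liminf (\<lambda>n. \<integral>\<^sup>+x. u n x \<partial>M)" by (rule nn_integral_liminf) simp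
  also have "\<dots> \<le> C" using le by (intro Liminf_le) (auto intro: always_eventually)
  finally show ?thesis .
qed

context time_poisson
begin

lemma emeasure_eq_measure_if_finite: "emeasure \<eta> A < \<infinity> \<Longrightarrow> emeasure \<eta> A = ennreal (measure \<eta> A)"
  by (simp add: emeasure_eq_ennreal_measure less_top)

lemma second_moment_N:
  assumes A [measurable]: "A \<in> sets E" and fin: "emeasure E A < \<infinity>"
  shows "(\<integral>\<^sup>+\<omega>. emeasure (N \<omega>) A * emeasure (N \<omega>) A \<partial>M) < \<infinity>"
proof -
  note [measurable] = measurable_emeasure_counting_space[OF A] measurable_N_emeasure[OF A]
  let ?h = "\<lambda>p. emeasure (fst p) A * indicator A (snd p)"
  have h: "?h \<in> borel_measurable (CS \<Otimes>\<^sub>M E)" by measurable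
  have "(\<integral>\<^sup>+\<omega>. emeasure (N \<omega>) A * emeasure (N \<omega>) A \<partial>M) = (\<integral>\<^sup>+\<omega>. \<integral>\<^sup>+z. ?h (N \<omega>, z) \<partial>N \<omega> \<partial>M)"
    by (intro nn_integral_cong) (simp add: nn_integral_cmult_indicator sets_N)
  also have "\<dots> = (\<integral>\<^sup>+\<omega>. \<integral>\<^sup>+z. ?h (add_point (N \<omega>) z, z) \<partial>E \<partial>M)" by (rule mecke[OF h])
  also have "\<dots> \<le> (\<integral>\<^sup>+\<omega>. \<integral>\<^sup>+z. (emeasure (N \<omega>) A + 1) * indicator A z \<partial>E \<partial>M)"
    by (intro nn_integral_mono) (simp add: emeasure_add_point sets_N indicator_def)
  also have "\<dots> = (\<integral>\<^sup>+\<omega>. emeasure (N \<omega>) A * emeasure E A + emeasure E A \<partial>M)"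
    by (intro nn_integral_cong, subst nn_integral_cmult_indicator) (simp_all add: distrib_right)
  also have "\<dots> = emeasure E A * emeasure E A + emeasure E A"
    by (subst nn_integral_add) (simp_all add: nn_integral_multc expectation_N[OF A fin] emeasure_space_1)
  also have "\<dots> < \<infinity>" using fin by (simp add: ennreal_mult_less_top)
  finally show ?thesis .
qed

text \<open>
  The bounds on \<open>\<phi>\<close> ensure that all terms are integrable. With \<open>X = J \<phi> N\<close>, \<open>Y z = J \<phi> (N + \<delta>\<^sub>z)\<close> and
  \<open>Z z\<close> the value of the integrand at \<open>z\<close>, Mecke's formula gives
  \<open>E \<parallel>X\<parallel>\<^sup>2 = E \<integral> \<langle>Y z - X, Z z\<rangle> \<E>(dz)\<close>. By \<open>J_add_point\<close> the difference \<open>Y z - X - Z z\<close> is the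
  integral of \<open>\<phi>\<^sup>z - \<phi>\<close>, an integrand that vanishes up to the time of \<open>z\<close>. Its inner product with
  \<open>Z z\<close> is therefore again a compensated integral and has expectation zero.
\<close>

lemma L2_bound_bounded:
  fixes \<phi> :: "_ \<Rightarrow> 'h::{real_inner, banach, second_countable_topology}"
  assumes \<phi>: "\<phi> \<in> borel_measurable CTU" and A: "A \<in> sets E" "emeasure E A < \<infinity>"
    and K: "0 \<le> K" and b: "\<And>\<eta> z. norm (at_past \<phi> \<eta> z) \<le> K * indicator A z"
  shows "(\<integral>\<^sup>+\<omega>. ennreal (norm (J \<phi> (N \<omega>)) powr 2) \<partial>M) \<le> moment 2 \<phi>"
proof -
  define m where "m = measure E A"
  define n where "n \<omega> = measure (N \<omega>) A" for \<omega>
  have m0: "0 \<le> m" "0 \<le> n \<omega>" for \<omega> by (simp_all add: m_def n_def)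
  have EA: "emeasure E A = ennreal m" using A by (simp add: m_def emeasure_eq_measure_if_finite)
  note [measurable] = A(1) measurable_N_emeasure[OF A(1)] measurable_J_N[OF \<phi>] measurable_at_past[OF \<phi>]
  have n_meas [measurable]: "n \<in> borel_measurable M" unfolding n_def measure_def by measurable
  have AEfin: "AE \<omega> in M. finite_on_cells (N \<omega>) \<and> emeasure (N \<omega>) A < \<infinity>"
  proof -
    have "AE \<omega> in M. emeasure (N \<omega>) A \<noteq> \<infinity>"
      using expectation_N[OF A] A by (intro nn_integral_PInf_AE) (auto simp: EA)
    with AE_finite_on_cells show ?thesis by eventually_elim (simp add: top.not_eq_extremum)
  qed
  have iE: "integrable \<eta> (at_past \<phi> \<eta>) \<and> norm (\<integral>z. at_past \<phi> \<eta> z \<partial>\<eta>) \<le> K * measure \<eta> A"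
    "integrable E (at_past \<phi> \<eta>) \<and> norm (\<integral>z. at_past \<phi> \<eta> z \<partial>E) \<le> K * m"
    if "\<eta> \<in> counting_measures E" "emeasure \<eta> A < \<infinity>" for \<eta>
  proof -
    have gen: "integrable \<mu> (at_past \<phi> \<eta>) \<and> norm (\<integral>z. at_past \<phi> \<eta> z \<partial>\<mu>) \<le> K * measure \<mu> A"
      if \<mu>: "sets \<mu> = sets E" "emeasure \<mu> A < \<infinity>" for \<mu>
    proof -
      have i: "integrable \<mu> (\<lambda>z. K * indicator A z)" using A \<mu> by (intro integrable_mult_right) simp
      have f: "at_past \<phi> \<eta> \<in> borel_measurable \<mu>"
        using measurable_at_past_E[OF \<phi> \<open>\<eta> \<in> counting_measures E\<close>] by (simp add: measurable_cong_sets[OF \<mu>(1) refl])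
      have i2: "integrable \<mu> (at_past \<phi> \<eta>)"
        using b K by (intro Bochner_Integration.integrable_bound[OF i f]) auto
      have "norm (\<integral>z. at_past \<phi> \<eta> z \<partial>\<mu>) \<le> (\<integral>z. norm (at_past \<phi> \<eta> z) \<partial>\<mu>)" by (rule integral_norm_bound)
      also have "\<dots> \<le> (\<integral>z. K * indicator A z \<partial>\<mu>)" using i2 i b by (intro integral_mono) auto
      also have "\<dots> = K * measure \<mu> A" using A \<mu> by (simp add: Int_absorb2 sets.sets_into_space)
      finally show ?thesis using i2 by simp
    qed
    show "integrable \<eta> (at_past \<phi> \<eta>) \<and> norm (\<integral>z. at_past \<phi> \<eta> z \<partial>\<eta>) \<le> K * measure \<eta> A"
      by (rule gen) (use that counting_measuresD in auto)
    show "integrable E (at_past \<phi> \<eta>) \<and> norm (\<integral>z. at_past \<phi> \<eta> z \<partial>E) \<le> K * m"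
      unfolding m_def by (rule gen) (use A in auto)
  qed
  have okJ: "integrable_at \<phi> \<eta> \<and> norm (J \<phi> \<eta>) \<le> K * (measure \<eta> A + m)"
    if "\<eta> \<in> counting_measures E" "finite_on_cells \<eta>" "emeasure \<eta> A < \<infinity>" for \<eta>
  proof -
    have "norm (J \<phi> \<eta>) \<le> norm (\<integral>z. at_past \<phi> \<eta> z \<partial>\<eta>) + norm (\<integral>z. at_past \<phi> \<eta> z \<partial>E)"
      using that by (simp add: J_def norm_triangle_ineq4)
    then show ?thesis using iE[OF that(1,3)] that(2) by (simp add: integrable_at_def distrib_left)
  qed
  define X where "X \<omega> = J \<phi> (N \<omega>)" for \<omega>
  define Y where "Y \<omega> z = J \<phi> (add_point (N \<omega>) z)" for \<omega> z
  define Z where "Z \<omega> z = at_past \<phi> (N \<omega>) z" for \<omega> z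
  have X_le: "integrable_at \<phi> (N \<omega>) \<and> norm (X \<omega>) \<le> K * (n \<omega> + 1 + m)"
    and Y_le: "integrable_at \<phi> (add_point (N \<omega>) z) \<and> norm (Y \<omega> z) \<le> K * (n \<omega> + 1 + m)"
    if "\<omega> \<in> space M" "finite_on_cells (N \<omega>)" "emeasure (N \<omega>) A < \<infinity>" for \<omega> z
  proof -
    note c = N_counting[OF that(1)]
    have "integrable_at \<phi> (N \<omega>) \<and> norm (X \<omega>) \<le> K * (n \<omega> + m)"
      unfolding X_def n_def using okJ[OF c that(2,3)] .
    moreover have "K * (n \<omega> + m) \<le> K * (n \<omega> + 1 + m)" using K by (intro mult_left_mono) auto
    ultimately show "integrable_at \<phi> (N \<omega>) \<and> norm (X \<omega>) \<le> K * (n \<omega> + 1 + m)" by linarith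
    have e: "emeasure (add_point (N \<omega>) z) A = emeasure (N \<omega>) A + indicator A z"
      using A sets_N[OF that(1)] by (simp add: emeasure_add_point)
    then have e2: "emeasure (add_point (N \<omega>) z) A < \<infinity>" using that(3) by (simp add: indicator_def)
    have "measure (add_point (N \<omega>) z) A \<le> n \<omega> + 1"
      using that(3) unfolding measure_def n_def e by (subst enn2real_plus) (auto simp: indicator_def)
    then have le: "K * (measure (add_point (N \<omega>) z) A + m) \<le> K * (n \<omega> + 1 + m)"
      using K by (intro mult_left_mono) auto
    have "integrable_at \<phi> (add_point (N \<omega>) z) \<and> norm (Y \<omega> z) \<le> K * (measure (add_point (N \<omega>) z) A + m)"
      unfolding Y_def
      by (rule okJ[OF add_point_in_counting_measures[OF c] _ e2]) (use that finite_on_cells_add_point[OF sets_N[OF that(1)]] in simp)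
    then show "integrable_at \<phi> (add_point (N \<omega>) z) \<and> norm (Y \<omega> z) \<le> K * (n \<omega> + 1 + m)" using le by linarith
  qed
  have X_meas [measurable]: "X \<in> borel_measurable M" unfolding X_def using measurable_J_N[OF \<phi>] .
  have Y_meas [measurable]: "(\<lambda>p. Y (fst p) (snd p)) \<in> borel_measurable (M \<Otimes>\<^sub>M E)"
    unfolding Y_def by (rule measurable_compose[OF _ measurable_J[OF \<phi>]]) measurable
  have Z_meas [measurable]: "(\<lambda>p. Z (fst p) (snd p)) \<in> borel_measurable (M \<Otimes>\<^sub>M E)"
    unfolding Z_def by (rule measurable_at_past_N[OF \<phi>])
  have Z_le: "norm (Z \<omega> z) \<le> K * indicator A z" for \<omega> z unfolding Z_def by (rule b)
  have n2: "(\<integral>\<^sup>+\<omega>. ennreal ((n \<omega>)\<^sup>2) \<partial>M) < \<infinity>"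
  proof -
    have "(\<integral>\<^sup>+\<omega>. ennreal ((n \<omega>)\<^sup>2) \<partial>M) = (\<integral>\<^sup>+\<omega>. emeasure (N \<omega>) A * emeasure (N \<omega>) A \<partial>M)"
    proof (rule nn_integral_cong_AE)
      show "AE \<omega> in M. ennreal ((n \<omega>)\<^sup>2) = emeasure (N \<omega>) A * emeasure (N \<omega>) A"
        using AEfin by eventually_elim (simp add: emeasure_eq_measure_if_finite n_def power2_eq_square ennreal_mult)
    qed
    then show ?thesis using second_moment_N[OF A] by simp
  qed
  have n_int: "integrable M (\<lambda>\<omega>. (n \<omega>)\<^sup>2)" using n2 by (intro integrableI_nonneg) auto
  have n_int1: "integrable M (\<lambda>\<omega>. n \<omega> + 1 + m)"
  proof -
    have "integrable M (\<lambda>\<omega>. n \<omega>)"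
    proof (rule Bochner_Integration.integrable_bound[where f="\<lambda>\<omega>. 1 + (n \<omega>)\<^sup>2"])
      have "n \<omega> \<le> 1 + (n \<omega>)\<^sup>2" for \<omega>
      proof -
        have "0 \<le> (n \<omega> - 1/2)\<^sup>2" by simp
        then show ?thesis by (simp add: power2_eq_square algebra_simps)
      qed
      then show "AE \<omega> in M. norm (n \<omega>) \<le> norm (1 + (n \<omega>)\<^sup>2)" using m0 by auto
    qed (use n_int in auto)
    then show ?thesis by simp
  qed
  \<comment> \<open>Criterion for the joint integrability of all inner products below: the norms are at most a
      constant times \<open>n \<omega> + 1 + m\<close>, where the \<open>1\<close> accounts for the added point.\<close>
  have bound_int: "integrable (M \<Otimes>\<^sub>M E) (\<lambda>p. f (fst p) (snd p))"
    if f: "(\<lambda>p. f (fst p) (snd p)) \<in> borel_measurable (M \<Otimes>\<^sub>M E)" and C: "0 \<le> C"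
      and le: "\<And>\<omega> z. \<omega> \<in> space M \<Longrightarrow> finite_on_cells (N \<omega>) \<Longrightarrow> emeasure (N \<omega>) A < \<infinity> \<Longrightarrow> z \<in> space E \<Longrightarrow> norm (f \<omega> z) \<le> C * (n \<omega> + 1 + m) * indicator A z"
    for f :: "'w \<Rightarrow> real \<times> 'u \<Rightarrow> real" and C
  proof (rule integrableI_bounded[OF f])
    have "(\<integral>\<^sup>+p. ennreal (norm (f (fst p) (snd p))) \<partial>(M \<Otimes>\<^sub>M E)) = (\<integral>\<^sup>+\<omega>. \<integral>\<^sup>+z. ennreal (norm (f \<omega> z)) \<partial>E \<partial>M)"
      using f by (subst E.nn_integral_fst[symmetric]) simp_all
    also have "\<dots> \<le> (\<integral>\<^sup>+\<omega>. \<integral>\<^sup>+z. ennreal (C * (n \<omega> + 1 + m)) * indicator A z \<partial>E \<partial>M)"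
    proof (rule nn_integral_mono_AE)
      show "AE \<omega> in M. (\<integral>\<^sup>+z. ennreal (norm (f \<omega> z)) \<partial>E) \<le> (\<integral>\<^sup>+z. ennreal (C * (n \<omega> + 1 + m)) * indicator A z \<partial>E)"
        using AEfin AE_space
      proof eventually_elim
        case (elim \<omega>)
        have "ennreal (norm (f \<omega> z)) \<le> ennreal (C * (n \<omega> + 1 + m)) * indicator A z" if "z \<in> space E" for z
          using le[of \<omega> z] elim that by (cases "z \<in> A") (auto intro: ennreal_leI)
        then show ?case by (intro nn_integral_mono) auto
      qed
    qed
    also have "\<dots> = (\<integral>\<^sup>+\<omega>. ennreal (C * m * (n \<omega> + 1 + m)) \<partial>M)"
    proof (intro nn_integral_cong)
      fix \<omega>
      have "(\<integral>\<^sup>+z. ennreal (C * (n \<omega> + 1 + m)) * indicator A z \<partial>E) = ennreal (C * (n \<omega> + 1 + m)) * emeasure E A"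
        by (rule nn_integral_cmult_indicator) (rule A)
      also have "\<dots> = ennreal (C * (n \<omega> + 1 + m) * m)"
        unfolding EA using C m0 by (intro ennreal_mult[symmetric]) auto
      finally show "(\<integral>\<^sup>+z. ennreal (C * (n \<omega> + 1 + m)) * indicator A z \<partial>E) = ennreal (C * m * (n \<omega> + 1 + m))"
        by (simp add: ac_simps)
    qed
    also have "\<dots> < \<infinity>"
    proof -
      have "integrable M (\<lambda>\<omega>. C * m * (n \<omega> + 1 + m))" using n_int1 by simp
      then have "(\<integral>\<^sup>+\<omega>. ennreal (norm (C * m * (n \<omega> + 1 + m))) \<partial>M) < \<infinity>" unfolding integrable_iff_bounded by blast
      moreover have "norm (C * m * (n \<omega> + 1 + m)) = C * m * (n \<omega> + 1 + m)" for \<omega>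
        using C m0 by (simp only: real_norm_def abs_of_nonneg mult_nonneg_nonneg add_nonneg_nonneg zero_le_one)
      ultimately show ?thesis by simp
    qed
    finally show "(\<integral>\<^sup>+p. ennreal (norm (f (fst p) (snd p))) \<partial>(M \<Otimes>\<^sub>M E)) < \<infinity>" .
  qed
  have bd: "norm (inner V (Z \<omega> z)) \<le> K * K * (n \<omega> + 1 + m) * indicator A z" if "norm V \<le> K * (n \<omega> + 1 + m)" for V \<omega> z
  proof -
    have "norm (inner V (Z \<omega> z)) \<le> norm V * norm (Z \<omega> z)" by (simp add: Cauchy_Schwarz_ineq2)
    also have "\<dots> \<le> (K * (n \<omega> + 1 + m)) * (K * indicator A z)"
      using that Z_le K m0 by (intro mult_mono) auto
    finally show ?thesis by (simp add: ac_simps)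
  qed
  have iYZ: "integrable (M \<Otimes>\<^sub>M E) (\<lambda>p. inner (Y (fst p) (snd p)) (Z (fst p) (snd p)))"
    by (rule bound_int[of "\<lambda>\<omega> z. inner (Y \<omega> z) (Z \<omega> z)" "K * K"]) (measurable, use K Y_le bd in auto)
  have iXZ: "integrable (M \<Otimes>\<^sub>M E) (\<lambda>p. inner (X (fst p)) (Z (fst p) (snd p)))"
    by (rule bound_int[of "\<lambda>\<omega> z. inner (X \<omega>) (Z \<omega> z)" "K * K"]) (measurable, use K X_le bd in auto)
  have iZZ: "integrable (M \<Otimes>\<^sub>M E) (\<lambda>p. inner (Z (fst p) (snd p)) (Z (fst p) (snd p)))"
  proof (rule bound_int[of "\<lambda>\<omega> z. inner (Z \<omega> z) (Z \<omega> z)" "K * K"])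
    fix \<omega> z
    have "K * indicator A z \<le> K * (n \<omega> + 1 + m)" using K m0 by (intro mult_left_mono) (auto simp: indicator_def add_nonneg_nonneg)
    then show "norm (inner (Z \<omega> z) (Z \<omega> z)) \<le> K * K * (n \<omega> + 1 + m) * indicator A z"
      using Z_le[of \<omega> z] by (intro bd) linarith
  qed (use K in \<open>auto intro!: borel_measurable_inner Z_meas\<close>)
  have "(\<integral>\<omega>. (norm (X \<omega>))\<^sup>2 \<partial>M) =
      (\<integral>\<omega>. (if finite_on_cells (N \<omega>) then \<integral>z. inner (J \<phi> (N \<omega>)) (at_past \<phi> (N \<omega>) z) \<partial>N \<omega> else 0) - (\<integral>z. inner (X \<omega>) (Z \<omega> z) \<partial>E) \<partial>M)
    \<and> integrable M (\<lambda>\<omega>. (norm (X \<omega>))\<^sup>2)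
    \<and> (\<integral>\<omega>. (if finite_on_cells (N \<omega>) then \<integral>z. inner (J \<phi> (N \<omega>)) (at_past \<phi> (N \<omega>) z) \<partial>N \<omega> else 0) - (\<integral>z. inner (X \<omega>) (Z \<omega> z) \<partial>E) \<partial>M)
      = (\<integral>\<omega>. \<integral>z. inner (Y \<omega> z) (Z \<omega> z) \<partial>E \<partial>M) - (\<integral>\<omega>. \<integral>z. inner (X \<omega>) (Z \<omega> z) \<partial>E \<partial>M)"
  proof -
    have g: "(\<lambda>p. inner (J \<phi> (fst p)) (at_past \<phi> (fst p) (snd p))) \<in> borel_measurable (CS \<Otimes>\<^sub>M E)"
      by (intro borel_measurable_inner measurable_compose[OF measurable_fst measurable_J[OF \<phi>]] measurable_at_past[OF \<phi>])
    have l: "inner (J \<phi> (add_point (N \<omega>) z)) (at_past \<phi> (add_point (N \<omega>) z) z) = inner (Y \<omega> z) (Z \<omega> z)" if "\<omega> \<in> space M" for \<omega> z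
      by (simp add: Y_def Z_def at_past_add_point_self[OF sets_N[OF that]])
    have "(\<integral>\<^sup>+\<omega>. \<integral>\<^sup>+z. ennreal (norm (inner (J \<phi> (add_point (N \<omega>) z)) (at_past \<phi> (add_point (N \<omega>) z) z))) \<partial>E \<partial>M) =
      (\<integral>\<^sup>+\<omega>. \<integral>\<^sup>+z. ennreal (norm (inner (Y \<omega> z) (Z \<omega> z))) \<partial>E \<partial>M)"
      by (intro nn_integral_cong) (simp add: l)
    also have "\<dots> = (\<integral>\<^sup>+p. ennreal (norm (inner (Y (fst p) (snd p)) (Z (fst p) (snd p)))) \<partial>(M \<Otimes>\<^sub>M E))"
      using iYZ by (subst E.nn_integral_fst[symmetric]) simp_all
    also have "\<dots> < \<infinity>" using iYZ by (simp add: integrable_iff_bounded)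
    finally have fin: "(\<integral>\<^sup>+\<omega>. \<integral>\<^sup>+z. ennreal (norm (inner (J \<phi> (add_point (N \<omega>) z)) (at_past \<phi> (add_point (N \<omega>) z) z))) \<partial>E \<partial>M) < \<infinity>" .
    note R = mecke_integral[OF g, unfolded fst_conv snd_conv, OF fin]
    have i2: "integrable M (\<lambda>\<omega>. \<integral>z. inner (X \<omega>) (Z \<omega> z) \<partial>E)" using ME.integrable_fst'[OF iXZ] by simp
    have e: "AE \<omega> in M. (norm (X \<omega>))\<^sup>2 = (if finite_on_cells (N \<omega>) then \<integral>z. inner (J \<phi> (N \<omega>)) (at_past \<phi> (N \<omega>) z) \<partial>N \<omega> else 0) - (\<integral>z. inner (X \<omega>) (Z \<omega> z) \<partial>E)"
      using AEfin AE_space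
    proof eventually_elim
      case (elim \<omega>)
      then have o: "integrable (N \<omega>) (at_past \<phi> (N \<omega>))" "integrable E (at_past \<phi> (N \<omega>))" using X_le[of \<omega>] by (auto simp: integrable_at_def)
      have "(norm (X \<omega>))\<^sup>2 = inner (X \<omega>) ((\<integral>z. at_past \<phi> (N \<omega>) z \<partial>N \<omega>) - (\<integral>z. at_past \<phi> (N \<omega>) z \<partial>E))"
        using elim by (simp add: X_def J_def power2_norm_eq_inner)
      also have "\<dots> = (\<integral>z. inner (X \<omega>) (at_past \<phi> (N \<omega>) z) \<partial>N \<omega>) - (\<integral>z. inner (X \<omega>) (at_past \<phi> (N \<omega>) z) \<partial>E)"
        using o by (simp add: inner_diff_right)
      finally show ?case using elim by (simp add: X_def Z_def)
    qed
    have i3: "integrable M (\<lambda>\<omega>. (if finite_on_cells (N \<omega>) then \<integral>z. inner (J \<phi> (N \<omega>)) (at_past \<phi> (N \<omega>) z) \<partial>N \<omega> else 0) - (\<integral>z. inner (X \<omega>) (Z \<omega> z) \<partial>E))"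
      using R(1) i2 by (rule Bochner_Integration.integrable_diff)
    have "(\<integral>\<omega>. \<integral>z. inner (J \<phi> (add_point (N \<omega>) z)) (at_past \<phi> (add_point (N \<omega>) z) z) \<partial>E \<partial>M) = (\<integral>\<omega>. \<integral>z. inner (Y \<omega> z) (Z \<omega> z) \<partial>E \<partial>M)"
      by (intro Bochner_Integration.integral_cong refl) (simp add: l)
    then show ?thesis
      using integral_cong_AE[OF _ _ e] integrable_cong_AE[OF _ _ e] i3 R i2 borel_measurable_integrable[OF i3]
      by (simp add: Bochner_Integration.integral_diff)
  qed
  then have iX: "integrable M (\<lambda>\<omega>. (norm (X \<omega>))\<^sup>2)" and
    "(\<integral>\<omega>. (norm (X \<omega>))\<^sup>2 \<partial>M) = (\<integral>\<omega>. \<integral>z. inner (Y \<omega> z) (Z \<omega> z) \<partial>E \<partial>M) - (\<integral>\<omega>. \<integral>z. inner (X \<omega>) (Z \<omega> z) \<partial>E \<partial>M)" by simp_all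
  note this(2)
  also have "\<dots> = (\<integral>p. inner (Y (fst p) (snd p)) (Z (fst p) (snd p)) \<partial>(M \<Otimes>\<^sub>M E)) - (\<integral>p. inner (X (fst p)) (Z (fst p) (snd p)) \<partial>(M \<Otimes>\<^sub>M E))"
    using ME.integral_fst'[OF iYZ] ME.integral_fst'[OF iXZ] by simp
  also have "\<dots> = (\<integral>p. inner (Y (fst p) (snd p) - X (fst p) - Z (fst p) (snd p)) (Z (fst p) (snd p)) \<partial>(M \<Otimes>\<^sub>M E))
     + (\<integral>p. inner (Z (fst p) (snd p)) (Z (fst p) (snd p)) \<partial>(M \<Otimes>\<^sub>M E))"
    using iYZ iXZ iZZ by (simp add: inner_diff_left)
  also have "(\<integral>p. inner (Y (fst p) (snd p) - X (fst p) - Z (fst p) (snd p)) (Z (fst p) (snd p)) \<partial>(M \<Otimes>\<^sub>M E)) = 0"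
  proof -
    let ?D = "\<lambda>p. inner (Y (fst p) (snd p) - X (fst p) - Z (fst p) (snd p)) (Z (fst p) (snd p))"
    have iD: "integrable (M \<Otimes>\<^sub>M E) (\<lambda>(\<omega>, z). ?D (\<omega>, z))"
      using iYZ iXZ iZZ by (simp add: inner_diff_left case_prod_beta')
    have "(\<integral>\<omega>. ?D (\<omega>, z) \<partial>M) = 0" if z: "z \<in> space E" for z
    proof -
      \<comment> \<open>The past before the time of \<open>z\<close> is contained in the past of every later point, so that the factor
          belonging to \<open>z\<close> may be read off from the configuration that the integrand sees.\<close>
      define \<psi> where "\<psi> x = inner (with_point z \<phi> x - \<phi> x) (at_past \<phi> (fst (fst x)) z)" for x
      have [measurable]: "(\<lambda>x. at_past \<phi> (fst (fst x)) z) \<in> borel_measurable CTU"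
        by (rule measurable_at_past_compose[OF \<phi>]) (use z in measurable)
      have \<psi>: "\<psi> \<in> borel_measurable CTU" unfolding \<psi>_def using measurable_with_point[OF \<phi> z] \<phi> by measurable
      have at_past\<psi>: "at_past \<psi> \<eta> w = inner (at_past (\<lambda>x. with_point z \<phi> x - \<phi> x) \<eta> w) (at_past \<phi> \<eta> z)" if "sets \<eta> = sets E" for \<eta> w
      proof (cases "fst z < fst w")
        case True
        then show ?thesis using that by (simp add: at_past_def \<psi>_def before_before)
      next
        case False
        then show ?thesis by (simp add: at_past_def \<psi>_def with_point_def)
      qed
      have \<psi>_le: "norm (at_past \<psi> \<eta> w) \<le> 2 * K * K * indicator A w" if \<eta>: "sets \<eta> = sets E" for \<eta> w
      proof -
        have "norm (at_past (\<lambda>x. with_point z \<phi> x - \<phi> x) \<eta> w) \<le> norm (at_past (with_point z \<phi>) \<eta> w) + norm (at_past \<phi> \<eta> w)"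
          by (simp add: at_past_def norm_triangle_ineq4)
        also have "\<dots> \<le> 2 * K * indicator A w"
          using b[of "add_point \<eta> z" w] b[of \<eta> w] at_past_add_point[OF \<eta>, of \<phi> z w] by simp
        finally have 1: "norm (at_past (\<lambda>x. with_point z \<phi> x - \<phi> x) \<eta> w) \<le> 2 * K * indicator A w" .
        have 2: "norm (at_past \<phi> \<eta> z) \<le> K" using b[of \<eta> z] K by (cases "z \<in> A") auto
        have "norm (at_past \<psi> \<eta> w) \<le> norm (at_past (\<lambda>x. with_point z \<phi> x - \<phi> x) \<eta> w) * norm (at_past \<phi> \<eta> z)"
          unfolding at_past\<psi>[OF \<eta>] by (simp add: Cauchy_Schwarz_ineq2)
        also have "\<dots> \<le> (2 * K * indicator A w) * K" using 1 2 K by (intro mult_mono) auto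
        finally show ?thesis by (simp add: ac_simps)
      qed
      have fin: "moment 1 \<psi> < \<infinity>"
      proof -
        have "moment 1 \<psi> \<le> (\<integral>\<^sup>+\<omega>. \<integral>\<^sup>+w. ennreal (2 * K * K) * indicator A w \<partial>E \<partial>M)"
          unfolding moment_def
        proof (intro nn_integral_mono)
          fix \<omega> w assume "\<omega> \<in> space M"
          then show "ennreal (norm (at_past \<psi> (N \<omega>) w) powr 1) \<le> ennreal (2 * K * K) * indicator A w"
            using \<psi>_le[OF sets_N, of \<omega> w] by (cases "w \<in> A") (auto intro: ennreal_leI)
        qed
        also have "\<dots> = ennreal (2 * K * K) * emeasure E A"
          by (simp add: nn_integral_cmult_indicator A(1) emeasure_space_1)
        also have "\<dots> < \<infinity>" using A by (simp add: ennreal_mult_less_top)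
        finally show ?thesis .
      qed
      have "(\<integral>\<omega>. ?D (\<omega>, z) \<partial>M) = (\<integral>\<omega>. J \<psi> (N \<omega>) \<partial>M)"
      proof (rule integral_cong_AE)
        have "(\<lambda>\<omega>. Y \<omega> z) \<in> borel_measurable M" "(\<lambda>\<omega>. Z \<omega> z) \<in> borel_measurable M"
          using measurable_compose[OF measurable_Pair2' Y_meas, of z] measurable_compose[OF measurable_Pair2' Z_meas, of z] z by simp_all
        then show "(\<lambda>\<omega>. ?D (\<omega>, z)) \<in> borel_measurable M" by simp
        show "(\<lambda>\<omega>. J \<psi> (N \<omega>)) \<in> borel_measurable M" by (rule measurable_J_N[OF \<psi>])
        show "AE \<omega> in M. ?D (\<omega>, z) = J \<psi> (N \<omega>)"
          using AEfin AE_space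
        proof eventually_elim
          case (elim \<omega>)
          note c = N_counting[OF elim(2)]
          note o = J_add_point[OF \<phi> c z]
          have oY: "integrable_at \<phi> (add_point (N \<omega>) z)" and oX: "integrable_at \<phi> (N \<omega>)" using X_le[of \<omega>] Y_le[of \<omega> z] elim by auto
          note d = integrable_at_diff[OF o(1)[OF oY] oX]
          have e: "Y \<omega> z - X \<omega> - Z \<omega> z = J (\<lambda>x. with_point z \<phi> x - \<phi> x) (N \<omega>)"
            using o(2)[OF oY] d by (simp add: X_def Y_def Z_def)
          have "at_past \<psi> (N \<omega>) = (\<lambda>w. inner (at_past (\<lambda>x. with_point z \<phi> x - \<phi> x) (N \<omega>) w) (at_past \<phi> (N \<omega>) z))"
            by (rule ext) (rule at_past\<psi>[OF sets_N[OF elim(2)]])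
          then have "J \<psi> (N \<omega>) = inner (J (\<lambda>x. with_point z \<phi> x - \<phi> x) (N \<omega>)) (Z \<omega> z)"
            using d(1) by (simp add: J_def integrable_at_def Z_def inner_diff_left)
          then show ?case by (simp add: e)
        qed
      qed
      then show ?thesis using expectation_J[OF \<psi> fin] by simp
    qed
    moreover have "(\<integral>z. \<integral>\<omega>. ?D (\<omega>, z) \<partial>M \<partial>E) = (\<integral>p. ?D p \<partial>(M \<Otimes>\<^sub>M E))"
      using ME.integral_snd[OF iD] by (simp add: case_prod_beta')
    moreover have "(\<integral>z. \<integral>\<omega>. ?D (\<omega>, z) \<partial>M \<partial>E) = (\<integral>z. 0 \<partial>E)"
      by (rule Bochner_Integration.integral_cong[OF refl]) (use calculation(1) in blast)
    ultimately show ?thesis by simp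
  qed
  finally have fin: "(\<integral>\<omega>. (norm (X \<omega>))\<^sup>2 \<partial>M) = (\<integral>p. inner (Z (fst p) (snd p)) (Z (fst p) (snd p)) \<partial>(M \<Otimes>\<^sub>M E))" by simp
  have "(\<integral>\<^sup>+\<omega>. ennreal (norm (J \<phi> (N \<omega>)) powr 2) \<partial>M) = ennreal (\<integral>\<omega>. (norm (X \<omega>))\<^sup>2 \<partial>M)"
    using nn_integral_eq_integral[OF iX] by (simp add: X_def powr_numeral)
  also have "\<dots> = (\<integral>\<^sup>+p. ennreal (inner (Z (fst p) (snd p)) (Z (fst p) (snd p))) \<partial>(M \<Otimes>\<^sub>M E))"
    unfolding fin by (rule nn_integral_eq_integral[symmetric, OF iZZ]) simp
  also have "\<dots> = moment 2 \<phi>"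
    unfolding moment_eq_pair[OF \<phi>] Z_def by (simp add: powr_numeral power2_norm_eq_inner)
  finally show ?thesis by simp
qed

end

section \<open>Moment bounds by truncation and interpolation\<close>

lemma nn_integral_powr_from_0:
  assumes "a > -1" "0 \<le> x"
  shows "(\<integral>\<^sup>+t. ennreal (t powr a) * indicator {0..x} t \<partial>lborel) = ennreal (x powr (a + 1) / (a + 1))"
  by (rule nn_integral_has_integral_lebesgue'[OF _ has_integral_powr_from_0[OF assms]]) simp

lemma nn_integral_powr_to_inf:
  assumes "a < -1" "0 < x"
  shows "(\<integral>\<^sup>+t. ennreal (t powr a) * indicator {x..} t \<partial>lborel) = ennreal (- (x powr (a + 1)) / (a + 1))"
  by (rule nn_integral_has_integral_lebesgue'[OF _ has_integral_powr_to_inf[OF assms]]) simp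

lemma pred_in_Icc:
  fixes f a b :: "'a \<Rightarrow> real"
  assumes [measurable]: "f \<in> borel_measurable M" "a \<in> borel_measurable M" "b \<in> borel_measurable M"
  shows "Measurable.pred M (\<lambda>x. f x \<in> {a x..b x})" "Measurable.pred M (\<lambda>x. f x \<in> {a x..})"
  unfolding atLeastAtMost_iff atLeast_iff by measurable

context time_poisson
begin

lemma measurable_time_point: "(\<lambda>x. (snd (fst x), snd x)) \<in> CTU \<rightarrow>\<^sub>M E"
  by (intro measurable_PairE) measurable

lemma moment_mono:
  assumes "\<And>\<eta> z. z \<in> space E \<Longrightarrow> norm (at_past \<phi> \<eta> z) \<le> norm (at_past \<psi> \<eta> z)" "0 \<le> p"
  shows "moment p \<phi> \<le> moment p \<psi>"
  unfolding moment_def using assms by (intro nn_integral_mono ennreal_leI powr_mono2) auto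

text \<open>
  The integrands cut off outside a set of finite intensity and above the level \<open>n\<close> are bounded; their
  integrals converge along paths by dominated convergence.
\<close>

lemma L2_bound:
  fixes \<phi> :: "_ \<Rightarrow> 'h::{real_inner, banach, second_countable_topology}"
  assumes \<phi> [measurable]: "\<phi> \<in> borel_measurable CTU" and fin: "moment 1 \<phi> < \<infinity>"
  shows "(\<integral>\<^sup>+\<omega>. ennreal (norm (J \<phi> (N \<omega>)) powr 2) \<partial>M) \<le> moment 2 \<phi>"
proof -
  define A where "A n = (\<Union>i\<le>n. cells i)" for n :: nat
  have A [measurable]: "A n \<in> sets E" for n unfolding A_def using cells by auto
  have Afin: "emeasure E (A n) < \<infinity>" for n
  proof -
    have "emeasure E (A n) \<le> (\<Sum>i\<le>n. emeasure E (cells i))"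
      unfolding A_def using cells by (intro emeasure_subadditive_finite) auto
    also have "\<dots> < \<infinity>" using cells by (simp add: ennreal_sum_less_top)
    finally show ?thesis .
  qed
  define \<psi> where "\<psi> n x = (if norm (\<phi> x) \<le> real n \<and> (snd (fst x), snd x) \<in> A n then \<phi> x else 0)" for n x
  note [measurable] = measurable_time_point
  have \<psi> [measurable]: "\<psi> n \<in> borel_measurable CTU" for n unfolding \<psi>_def by measurable
  have at_past\<psi>: "at_past (\<psi> n) \<eta> z = (if norm (at_past \<phi> \<eta> z) \<le> real n \<and> z \<in> A n then at_past \<phi> \<eta> z else 0)" for n \<eta> z
    by (simp add: at_past_def \<psi>_def)
  have le: "norm (at_past (\<psi> n) \<eta> z) \<le> norm (at_past \<phi> \<eta> z)" for n \<eta> z by (simp add: at_past\<psi>)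
  have lim: "(\<lambda>n. at_past (\<psi> n) \<eta> z) \<longlonglongrightarrow> at_past \<phi> \<eta> z" if "z \<in> space E" for \<eta> z
  proof -
    have "z \<in> (\<Union>i. cells i)" using that by (simp only: cells(2))
    then obtain k where k: "z \<in> cells k" by auto
    obtain l where l: "norm (at_past \<phi> \<eta> z) \<le> real l" using real_arch_simple by blast
    have "eventually (\<lambda>n. at_past (\<psi> n) \<eta> z = at_past \<phi> \<eta> z) sequentially"
      using eventually_ge_at_top[of "max k l"] by eventually_elim (use k l in \<open>auto simp: at_past\<psi> A_def\<close>)
    then show ?thesis by (rule tendsto_eventually)
  qed
  show ?thesis
  proof (rule nn_integral_fatou_le[where u="\<lambda>n \<omega>. ennreal (norm (J (\<psi> n) (N \<omega>)) powr 2)"])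
    show "(\<lambda>\<omega>. ennreal (norm (J (\<psi> n) (N \<omega>)) powr 2)) \<in> borel_measurable M" for n
      using measurable_J_N[OF \<psi>] by measurable
    have "(\<integral>\<^sup>+\<omega>. ennreal (norm (J (\<psi> n) (N \<omega>)) powr 2) \<partial>M) \<le> moment 2 (\<psi> n)" for n
      by (rule L2_bound_bounded[OF \<psi> A[of n] Afin, where K="real n"]) (auto simp: at_past\<psi>)
    also have "moment 2 (\<psi> n) \<le> moment 2 \<phi>" for n by (rule moment_mono) (simp_all add: le)
    finally show "(\<integral>\<^sup>+\<omega>. ennreal (norm (J (\<psi> n) (N \<omega>)) powr 2) \<partial>M) \<le> moment 2 \<phi>" for n .
    show "AE \<omega> in M. (\<lambda>n. ennreal (norm (J (\<psi> n) (N \<omega>)) powr 2)) \<longlonglongrightarrow> ennreal (norm (J \<phi> (N \<omega>)) powr 2)"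
      using AE_integrable_at[OF \<phi> fin] AE_space
    proof eventually_elim
      case (elim \<omega>)
      have i: "finite_on_cells (N \<omega>)" "integrable (N \<omega>) (at_past \<phi> (N \<omega>))" "integrable E (at_past \<phi> (N \<omega>))"
        using elim by (auto simp: integrable_at_def)
      have ae: "AE z in N \<omega>. (\<lambda>n. at_past (\<psi> n) (N \<omega>) z) \<longlonglongrightarrow> at_past \<phi> (N \<omega>) z"
        by (rule AE_I2) (simp add: lim space_N[OF elim(2)])
      have "(\<lambda>n. \<integral>z. at_past (\<psi> n) (N \<omega>) z \<partial>N \<omega>) \<longlonglongrightarrow> (\<integral>z. at_past \<phi> (N \<omega>) z \<partial>N \<omega>)"
        by (rule integral_dominated_convergence[where w="\<lambda>z. norm (at_past \<phi> (N \<omega>) z)"])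
           (simp_all add: i le ae measurable_at_past_N_self[OF \<psi> elim(2)] measurable_at_past_N_self[OF \<phi> elim(2)])
      moreover have "(\<lambda>n. \<integral>z. at_past (\<psi> n) (N \<omega>) z \<partial>E) \<longlonglongrightarrow> (\<integral>z. at_past \<phi> (N \<omega>) z \<partial>E)"
        by (rule integral_dominated_convergence[where w="\<lambda>z. norm (at_past \<phi> (N \<omega>) z)"])
           (simp_all add: i le lim measurable_at_past_E[OF \<psi> N_counting[OF elim(2)]] measurable_at_past_E[OF \<phi> N_counting[OF elim(2)]])
      ultimately have "(\<lambda>n. J (\<psi> n) (N \<omega>)) \<longlonglongrightarrow> J \<phi> (N \<omega>)"
        using i(1) by (simp add: J_def tendsto_diff)
      then have "(\<lambda>n. (norm (J (\<psi> n) (N \<omega>)))\<^sup>2) \<longlonglongrightarrow> (norm (J \<phi> (N \<omega>)))\<^sup>2"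
        by (intro tendsto_intros)
      then show ?case by (simp add: powr_numeral tendsto_ennrealI)
    qed
  qed
qed

text \<open>
  Marcinkiewicz interpolation between the exponents \<open>1\<close> and \<open>2\<close>. At the level \<open>t\<close> the integrand is
  split into the part with norm above \<open>t\<close>, which is controlled in \<open>L\<^sup>1\<close>, and the part with norm at
  most \<open>t\<close>, which is controlled in \<open>L\<^sup>2\<close>. This bounds the probability that \<open>\<parallel>J \<phi> N\<parallel> \<ge> 2 t\<close>, and
  integration against \<open>t\<^bsup>p-1\<^esup> dt\<close> gives the moment of order \<open>p\<close>.
\<close>

lemma Lp_bound_interpolated:
  fixes \<phi> :: "_ \<Rightarrow> 'h::{real_inner, banach, second_countable_topology}"
  assumes \<phi> [measurable]: "\<phi> \<in> borel_measurable CTU" and fin: "moment 1 \<phi> < \<infinity>" and p: "1 < p" "p < 2"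
  shows "(\<integral>\<^sup>+\<omega>. ennreal (norm (J \<phi> (N \<omega>)) powr p) \<partial>M) \<le> ennreal (2 powr p * (2 * p / (p - 1) + p / (2 - p))) * moment p \<phi>"
proof -
  define big where "big t x = (if t < norm (\<phi> x) then \<phi> x else 0)" for t x
  define small where "small t x = (if norm (\<phi> x) \<le> t then \<phi> x else 0)" for t x
  have m [measurable]: "big t \<in> borel_measurable CTU" "small t \<in> borel_measurable CTU" for t
    unfolding big_def small_def by measurable
  have lfb: "at_past (big t) \<eta> z = (if t < norm (at_past \<phi> \<eta> z) then at_past \<phi> \<eta> z else 0)"
    and lfs: "at_past (small t) \<eta> z = (if norm (at_past \<phi> \<eta> z) \<le> t then at_past \<phi> \<eta> z else 0)" for t \<eta> z
    by (simp_all add: at_past_def big_def small_def)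
  have "moment 1 (big t) \<le> moment 1 \<phi>" "moment 1 (small t) \<le> moment 1 \<phi>" for t
    by (rule moment_mono; simp add: lfb lfs)+
  then have f1: "moment 1 (big t) < \<infinity>" "moment 1 (small t) < \<infinity>" for t
    using fin by (auto intro: le_less_trans)
  define X where "X \<omega> = norm (J \<phi> (N \<omega>))" for \<omega>
  define f where "f q = norm (at_past \<phi> (N (fst q)) (snd q))" for q
  have X [measurable]: "X \<in> borel_measurable M" unfolding X_def using measurable_J_N[OF \<phi>] by measurable
  have f [measurable]: "f \<in> borel_measurable (M \<Otimes>\<^sub>M E)" unfolding f_def using measurable_at_past_N[OF \<phi>] by measurable
  have f0: "0 \<le> f q" for q by (simp add: f_def)
  note [measurable] = measurable_J_N[OF m(1)] measurable_J_N[OF m(2)] pred_in_Icc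
  \<comment> \<open>Markov's inequality for both parts: if \<open>X \<ge> 2 t\<close>, one of the two integrals has norm at least \<open>t\<close>.\<close>
  have tail: "(\<integral>\<^sup>+\<omega>. indicator {0..X \<omega> / 2} t \<partial>M) \<le>
      ennreal (2 / t) * (\<integral>\<^sup>+q. ennreal (f q) * indicator {0..f q} t \<partial>(M \<Otimes>\<^sub>M E)) +
      ennreal (1 / t\<^sup>2) * (\<integral>\<^sup>+q. ennreal ((f q)\<^sup>2) * indicator {f q..} t \<partial>(M \<Otimes>\<^sub>M E))" if t: "0 < t" for t
  proof -
    have "(\<integral>\<^sup>+\<omega>. indicator {0..X \<omega> / 2} t \<partial>M) \<le>
      (\<integral>\<^sup>+\<omega>. ennreal (1 / t) * ennreal (norm (J (big t) (N \<omega>))) + ennreal (1 / t\<^sup>2) * ennreal (norm (J (small t) (N \<omega>)) powr 2) \<partial>M)"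
    proof (rule nn_integral_mono_AE)
      show "AE \<omega> in M. indicator {0..X \<omega> / 2} t \<le>
        ennreal (1 / t) * ennreal (norm (J (big t) (N \<omega>))) + ennreal (1 / t\<^sup>2) * ennreal (norm (J (small t) (N \<omega>)) powr 2)"
        using AE_integrable_at[OF m(1) f1(1)[of t]] AE_integrable_at[OF m(2) f1(2)[of t]]
      proof eventually_elim
        case (elim \<omega>)
        have "(\<lambda>x. 1 *\<^sub>R big t x + 1 *\<^sub>R small t x) = \<phi>" by (auto simp: big_def small_def)
        then have "J \<phi> (N \<omega>) = J (big t) (N \<omega>) + J (small t) (N \<omega>)"
          using integrable_at_lincomb(2)[OF elim, of 1 1] by simp
        then have le: "X \<omega> \<le> norm (J (big t) (N \<omega>)) + norm (J (small t) (N \<omega>))"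
          unfolding X_def by (simp add: norm_triangle_ineq)
        let ?a = "norm (J (big t) (N \<omega>))" and ?b = "norm (J (small t) (N \<omega>))"
        have "indicator {0..X \<omega> / 2} t \<le> 1 / t * ?a + 1 / t\<^sup>2 * ?b\<^sup>2"
        proof (cases "t \<le> X \<omega> / 2")
          case True
          then consider "t \<le> ?a" | "t \<le> ?b" using le by linarith
          then have "1 \<le> 1 / t * ?a + 1 / t\<^sup>2 * ?b\<^sup>2"
          proof cases
            case 1
            then have "1 \<le> 1 / t * ?a" using t by (simp add: field_simps)
            moreover have "0 \<le> 1 / t\<^sup>2 * ?b\<^sup>2" by simp
            ultimately show ?thesis by linarith
          next
            case 2
            then have "t\<^sup>2 \<le> ?b\<^sup>2" using t by (intro power_mono) auto
            then have "1 \<le> 1 / t\<^sup>2 * ?b\<^sup>2" using t by (simp add: field_simps)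
            moreover have "0 \<le> 1 / t * ?a" using t by simp
            ultimately show ?thesis by linarith
          qed
          then show ?thesis by (auto simp: indicator_def)
        qed (use t in \<open>simp add: add_nonneg_nonneg\<close>)
        then have "ennreal (indicator {0..X \<omega> / 2} t) \<le> ennreal (1 / t * ?a + 1 / t\<^sup>2 * ?b\<^sup>2)" by (rule ennreal_leI)
        also have "\<dots> = ennreal (1 / t) * ennreal ?a + ennreal (1 / t\<^sup>2) * ennreal (?b powr 2)"
          using t by (simp add: powr_numeral ennreal_mult' del: times_divide_eq_left)
        finally show ?case by (simp add: ennreal_indicator)
      qed
    qed
    also have "\<dots> = ennreal (1 / t) * (\<integral>\<^sup>+\<omega>. ennreal (norm (J (big t) (N \<omega>))) \<partial>M) +
        ennreal (1 / t\<^sup>2) * (\<integral>\<^sup>+\<omega>. ennreal (norm (J (small t) (N \<omega>)) powr 2) \<partial>M)"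
      by (simp add: nn_integral_add nn_integral_cmult)
    also have "\<dots> \<le> ennreal (1 / t) * (2 * moment 1 (big t)) + ennreal (1 / t\<^sup>2) * moment 2 (small t)"
      by (intro add_mono mult_left_mono L1_bound L2_bound m f1) auto
    also have "moment 1 (big t) \<le> (\<integral>\<^sup>+q. ennreal (f q) * indicator {0..f q} t \<partial>(M \<Otimes>\<^sub>M E))"
      unfolding moment_eq_pair[OF m(1)] using t by (intro nn_integral_mono) (auto simp: lfb f_def indicator_def)
    also have "moment 2 (small t) \<le> (\<integral>\<^sup>+q. ennreal ((f q)\<^sup>2) * indicator {f q..} t \<partial>(M \<Otimes>\<^sub>M E))"
      unfolding moment_eq_pair[OF m(2)] by (intro nn_integral_mono) (auto simp: lfs f_def indicator_def powr_numeral)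
    finally have "(\<integral>\<^sup>+\<omega>. indicator {0..X \<omega> / 2} t \<partial>M) \<le> ennreal (1 / t) * (2 * (\<integral>\<^sup>+q. ennreal (f q) * indicator {0..f q} t \<partial>(M \<Otimes>\<^sub>M E))) +
      ennreal (1 / t\<^sup>2) * (\<integral>\<^sup>+q. ennreal ((f q)\<^sup>2) * indicator {f q..} t \<partial>(M \<Otimes>\<^sub>M E))"
      by (simp add: add_mono mult_left_mono)
    moreover have "ennreal (2 / t) = ennreal (1 / t) * 2"
      using t ennreal_mult[of "1 / t" 2] by simp
    ultimately show ?thesis by (simp add: mult.assoc)
  qed
  interpret PL: pair_sigma_finite M lborel ..
  interpret QL: pair_sigma_finite "M \<Otimes>\<^sub>M E" lborel
    by (intro pair_sigma_finite.intro ME.sigma_finite_measure_axioms sigma_finite_lborel)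
  \<comment> \<open>The two contributions of \<open>tail\<close>, multiplied by \<open>t\<^bsup>p-1\<^esup>\<close>, before the order of integration is exchanged.\<close>
  define k1 where "k1 q t = ennreal (2 * t powr (p - 2)) * (ennreal (f q) * indicator {0..f q} t)" for q and t :: real
  define k2 where "k2 q t = ennreal (t powr (p - 3)) * (ennreal ((f q)\<^sup>2) * indicator {f q..} t * indicator {0<..} t)" for q and t :: real
  have mf [measurable]: "(\<lambda>x. f (fst x)) \<in> borel_measurable ((M \<Otimes>\<^sub>M E) \<Otimes>\<^sub>M lborel)"
    by (rule measurable_compose[OF measurable_fst f])
  have mi [measurable]: "(\<lambda>x. indicator {0..f (fst x)} (snd x) :: ennreal) \<in> borel_measurable ((M \<Otimes>\<^sub>M E) \<Otimes>\<^sub>M lborel)"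
    "(\<lambda>x. indicator {f (fst x)..} (snd x) :: ennreal) \<in> borel_measurable ((M \<Otimes>\<^sub>M E) \<Otimes>\<^sub>M lborel)"
    by measurable
  have mk1: "case_prod k1 \<in> borel_measurable ((M \<Otimes>\<^sub>M E) \<Otimes>\<^sub>M lborel)"
    unfolding k1_def case_prod_beta' by measurable
  have mk2: "case_prod k2 \<in> borel_measurable ((M \<Otimes>\<^sub>M E) \<Otimes>\<^sub>M lborel)"
    unfolding k2_def case_prod_beta' by measurable
  have "(\<integral>\<^sup>+t. \<integral>\<^sup>+q. k1 q t \<partial>(M \<Otimes>\<^sub>M E) \<partial>lborel) = (\<integral>\<^sup>+q. \<integral>\<^sup>+t. k1 q t \<partial>lborel \<partial>(M \<Otimes>\<^sub>M E))"
    by (rule QL.Fubini'[OF mk1])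
  also have "\<dots> = (\<integral>\<^sup>+q. ennreal (2 / (p - 1)) * ennreal (f q powr p) \<partial>(M \<Otimes>\<^sub>M E))"
    unfolding k1_def
  proof (intro nn_integral_cong)
    fix q
    have "(\<integral>\<^sup>+t. ennreal (2 * t powr (p - 2)) * (ennreal (f q) * indicator {0..f q} t) \<partial>lborel) =
      (\<integral>\<^sup>+t. ennreal (2 * f q) * (ennreal (t powr (p - 2)) * indicator {0..f q} t) \<partial>lborel)"
      using f0 by (intro nn_integral_cong) (simp add: ennreal_mult ac_simps)
    also have "\<dots> = ennreal (2 * f q) * ennreal (f q powr (p - 1) / (p - 1))"
      using nn_integral_powr_from_0[of "p - 2" "f q"] p f0 by (subst nn_integral_cmult) simp_all
    also have "\<dots> = ennreal (2 / (p - 1)) * ennreal (f q powr p)"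
      using p f0[of q] by (cases "f q = 0") (simp_all add: ennreal_mult[symmetric] powr_diff field_simps)
    finally show "(\<integral>\<^sup>+t. ennreal (2 * t powr (p - 2)) * (ennreal (f q) * indicator {0..f q} t) \<partial>lborel) = ennreal (2 / (p - 1)) * ennreal (f q powr p)" .
  qed
  also have "\<dots> = ennreal (2 / (p - 1)) * moment p \<phi>"
    unfolding moment_eq_pair[OF \<phi>] f_def[symmetric] by (rule nn_integral_cmult) measurable
  finally have A1: "(\<integral>\<^sup>+t. \<integral>\<^sup>+q. k1 q t \<partial>(M \<Otimes>\<^sub>M E) \<partial>lborel) = ennreal (2 / (p - 1)) * moment p \<phi>" .
  have "(\<integral>\<^sup>+t. \<integral>\<^sup>+q. k2 q t \<partial>(M \<Otimes>\<^sub>M E) \<partial>lborel) = (\<integral>\<^sup>+q. \<integral>\<^sup>+t. k2 q t \<partial>lborel \<partial>(M \<Otimes>\<^sub>M E))"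
    by (rule QL.Fubini'[OF mk2])
  also have "\<dots> = (\<integral>\<^sup>+q. ennreal (1 / (2 - p)) * ennreal (f q powr p) \<partial>(M \<Otimes>\<^sub>M E))"
    unfolding k2_def
  proof (intro nn_integral_cong)
    fix q
    show "(\<integral>\<^sup>+t. ennreal (t powr (p - 3)) * (ennreal ((f q)\<^sup>2) * indicator {f q..} t * indicator {0<..} t) \<partial>lborel) = ennreal (1 / (2 - p)) * ennreal (f q powr p)"
    proof (cases "f q = 0")
      case False
      then have f1: "0 < f q" using f0[of q] by simp
      have "(\<integral>\<^sup>+t. ennreal (t powr (p - 3)) * (ennreal ((f q)\<^sup>2) * indicator {f q..} t * indicator {0<..} t) \<partial>lborel) =
        (\<integral>\<^sup>+t. ennreal ((f q)\<^sup>2) * (ennreal (t powr (p - 3)) * indicator {f q..} t) \<partial>lborel)"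
        using f1 by (intro nn_integral_cong) (auto simp: indicator_def ac_simps)
      also have "\<dots> = ennreal ((f q)\<^sup>2) * ennreal (- (f q powr (p - 2)) / (p - 2))"
        using nn_integral_powr_to_inf[of "p - 3" "f q"] p f1 by (subst nn_integral_cmult) simp_all
      also have "- (f q powr (p - 2)) / (p - 2) = f q powr (p - 2) / (2 - p)" using p by (simp add: field_simps)
      also have "ennreal ((f q)\<^sup>2) * ennreal (f q powr (p - 2) / (2 - p)) = ennreal (1 / (2 - p)) * ennreal (f q powr p)"
        using p f1 by (simp add: ennreal_mult[symmetric] powr_diff powr_numeral field_simps)
      finally show ?thesis .
    qed simp
  qed
  also have "\<dots> = ennreal (1 / (2 - p)) * moment p \<phi>"
    unfolding moment_eq_pair[OF \<phi>] f_def[symmetric] by (rule nn_integral_cmult) measurable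
  finally have A2: "(\<integral>\<^sup>+t. \<integral>\<^sup>+q. k2 q t \<partial>(M \<Otimes>\<^sub>M E) \<partial>lborel) = ennreal (1 / (2 - p)) * moment p \<phi>" .
  have mk1': "(\<lambda>(t, q). k1 q t) \<in> borel_measurable (lborel \<Otimes>\<^sub>M (M \<Otimes>\<^sub>M E))"
    and mk2': "(\<lambda>(t, q). k2 q t) \<in> borel_measurable (lborel \<Otimes>\<^sub>M (M \<Otimes>\<^sub>M E))"
    using measurable_compose[OF measurable_pair_swap' mk1] measurable_compose[OF measurable_pair_swap' mk2]
    by (simp_all add: case_prod_beta')
  \<comment> \<open>Layer-cake formula, written for half of \<open>X\<close> because \<open>tail\<close> controls the event \<open>t \<le> X / 2\<close>.\<close>
  have c2: "ennreal (X \<omega> powr p) = ennreal (2 powr p * p) * (\<integral>\<^sup>+t. ennreal (t powr (p - 1)) * indicator {0..X \<omega> / 2} t \<partial>lborel)" for \<omega>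
  proof -
    have X0: "0 \<le> X \<omega>" by (simp add: X_def)
    have "(\<integral>\<^sup>+t. ennreal (t powr (p - 1)) * indicator {0..X \<omega> / 2} t \<partial>lborel) = ennreal ((X \<omega> / 2) powr p / p)"
      using nn_integral_powr_from_0[of "p - 1" "X \<omega> / 2"] p X0 by simp
    moreover have "2 powr p * p * ((X \<omega> / 2) powr p / p) = X \<omega> powr p"
      using p X0 by (simp add: powr_divide)
    ultimately show ?thesis using p by (simp add: ennreal_mult[symmetric])
  qed
  have "(\<integral>\<^sup>+\<omega>. ennreal (X \<omega> powr p) \<partial>M) =
      ennreal (2 powr p * p) * (\<integral>\<^sup>+\<omega>. \<integral>\<^sup>+t. ennreal (t powr (p - 1)) * indicator {0..X \<omega> / 2} t \<partial>lborel \<partial>M)"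
    unfolding c2 by (rule nn_integral_cmult) measurable
  moreover have "(\<integral>\<^sup>+\<omega>. \<integral>\<^sup>+t. ennreal (t powr (p - 1)) * indicator {0..X \<omega> / 2} t \<partial>lborel \<partial>M)
    \<le> ennreal (2 / (p - 1)) * moment p \<phi> + ennreal (1 / (2 - p)) * moment p \<phi>"
  proof -
    have "(\<integral>\<^sup>+\<omega>. \<integral>\<^sup>+t. ennreal (t powr (p - 1)) * indicator {0..X \<omega> / 2} t \<partial>lborel \<partial>M) =
        (\<integral>\<^sup>+t. \<integral>\<^sup>+\<omega>. ennreal (t powr (p - 1)) * indicator {0..X \<omega> / 2} t \<partial>M \<partial>lborel)"
      by (rule PL.Fubini'[symmetric]) measurable
    also have "\<dots> = (\<integral>\<^sup>+t. ennreal (t powr (p - 1)) * (\<integral>\<^sup>+\<omega>. indicator {0..X \<omega> / 2} t \<partial>M) \<partial>lborel)"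
      by (intro nn_integral_cong nn_integral_cmult) measurable
    also have "\<dots> \<le> (\<integral>\<^sup>+t. ((\<integral>\<^sup>+q. k1 q t \<partial>(M \<Otimes>\<^sub>M E)) +
        (\<integral>\<^sup>+q. k2 q t \<partial>(M \<Otimes>\<^sub>M E))) \<partial>lborel)"
    proof (intro nn_integral_mono)
      fix t :: real
      show "ennreal (t powr (p - 1)) * (\<integral>\<^sup>+\<omega>. indicator {0..X \<omega> / 2} t \<partial>M) \<le>
        (\<integral>\<^sup>+q. k1 q t \<partial>(M \<Otimes>\<^sub>M E)) +
        (\<integral>\<^sup>+q. k2 q t \<partial>(M \<Otimes>\<^sub>M E))"
      proof (cases "0 < t")
        case False
        then have eq: "ennreal (t powr (p - 1)) * (\<integral>\<^sup>+\<omega>. indicator {0..X \<omega> / 2} t \<partial>M) = 0"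
          by (cases "t = 0") (auto simp: indicator_def)
        show ?thesis unfolding eq by (rule zero_le)
      next
        case True
        have t1: "ennreal (t powr (p - 1)) * ennreal (2 / t) = ennreal (2 * t powr (p - 2))"
          using True by (simp add: ennreal_mult[symmetric] powr_diff powr_numeral field_simps power2_eq_square)
        have t2: "ennreal (t powr (p - 1)) * ennreal (1 / t\<^sup>2) = ennreal (t powr (p - 3))"
          using True by (simp add: ennreal_mult[symmetric] powr_diff powr_numeral field_simps power2_eq_square power3_eq_cube)
        have "ennreal (t powr (p - 1)) * (\<integral>\<^sup>+\<omega>. indicator {0..X \<omega> / 2} t \<partial>M) \<le> ennreal (t powr (p - 1)) *
          (ennreal (2 / t) * (\<integral>\<^sup>+q. ennreal (f q) * indicator {0..f q} t \<partial>(M \<Otimes>\<^sub>M E)) +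
        ennreal (1 / t\<^sup>2) * (\<integral>\<^sup>+q. ennreal ((f q)\<^sup>2) * indicator {f q..} t \<partial>(M \<Otimes>\<^sub>M E)))"
          by (intro mult_left_mono tail True) simp
        also have "\<dots> = ennreal (2 * t powr (p - 2)) * (\<integral>\<^sup>+q. ennreal (f q) * indicator {0..f q} t \<partial>(M \<Otimes>\<^sub>M E)) +
          ennreal (t powr (p - 3)) * (\<integral>\<^sup>+q. ennreal ((f q)\<^sup>2) * indicator {f q..} t \<partial>(M \<Otimes>\<^sub>M E))"
          unfolding distrib_left mult.assoc[symmetric] t1 t2 ..
        also have "\<dots> = (\<integral>\<^sup>+q. k1 q t \<partial>(M \<Otimes>\<^sub>M E)) +
          (\<integral>\<^sup>+q. k2 q t \<partial>(M \<Otimes>\<^sub>M E))"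
          unfolding k1_def k2_def using True by (subst (1 2) nn_integral_cmult) simp_all
        finally show ?thesis .
      qed
    qed
    also have "\<dots> = (\<integral>\<^sup>+t. \<integral>\<^sup>+q. k1 q t \<partial>(M \<Otimes>\<^sub>M E) \<partial>lborel) + (\<integral>\<^sup>+t. \<integral>\<^sup>+q. k2 q t \<partial>(M \<Otimes>\<^sub>M E) \<partial>lborel)"
      by (intro nn_integral_add sigma_finite_measure.borel_measurable_nn_integral[OF ME.sigma_finite_measure_axioms]) (use mk1' mk2' in simp_all)
    also have "\<dots> = ennreal (2 / (p - 1)) * moment p \<phi> + ennreal (1 / (2 - p)) * moment p \<phi>"
      by (simp only: A1 A2)
    finally show ?thesis .
  qed
  ultimately have "(\<integral>\<^sup>+\<omega>. ennreal (X \<omega> powr p) \<partial>M) \<le> ennreal (2 powr p * p) * (ennreal (2 / (p - 1)) * moment p \<phi> + ennreal (1 / (2 - p)) * moment p \<phi>)"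
    by (simp add: mult_left_mono)
  also have "\<dots> = ennreal (2 powr p * p) * ennreal (2 / (p - 1) + 1 / (2 - p)) * moment p \<phi>"
    using p by (simp add: distrib_right mult.assoc)
  also have "ennreal (2 powr p * p) * ennreal (2 / (p - 1) + 1 / (2 - p)) = ennreal (2 powr p * (2 * p / (p - 1) + p / (2 - p)))"
    using p by (subst ennreal_mult[symmetric]) (auto simp: algebra_simps)
  finally show ?thesis by (simp add: X_def)
qed

lemma Lp_bound:
  assumes p: "p \<in> {1..2}"
  obtains c where "0 < c" "\<And>\<phi> :: _ \<Rightarrow> 'h::{real_inner, banach, second_countable_topology}. \<phi> \<in> borel_measurable CTU \<Longrightarrow> moment 1 \<phi> < \<infinity> \<Longrightarrow>
    (\<integral>\<^sup>+\<omega>. ennreal (norm (J \<phi> (N \<omega>)) powr p) \<partial>M) \<le> ennreal c * moment p \<phi>"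
proof -
  consider "p = 1" | "1 < p" "p < 2" | "p = 2" using p by fastforce
  then show ?thesis
  proof cases
    case 1
    show ?thesis by (rule that[of 2]) (use 1 L1_bound in auto)
  next
    case 2
    have "0 < 2 powr p * (2 * p / (p - 1) + p / (2 - p))"
      using 2 by (intro mult_pos_pos add_pos_pos divide_pos_pos) auto
    then show ?thesis using Lp_bound_interpolated[OF _ _ 2] that by blast
  next
    case 3
    show ?thesis by (rule that[of 1]) (use 3 L2_bound in auto)
  qed
qed

end

section \<open>Extension of the compensated integral to all exponents\<close>

lemma ennreal_tendsto_0_le:
  fixes f g :: "nat \<Rightarrow> ennreal"
  assumes "g \<longlonglongrightarrow> 0" "\<And>n. f n \<le> g n"
  shows "f \<longlonglongrightarrow> 0"
  by (rule tendsto_sandwich[OF _ _ tendsto_const assms(1)]) (use assms(2) in auto)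

lemma powr_norm_add_le:
  assumes "0 \<le> p"
  shows "ennreal (norm (x + y) powr p) \<le> ennreal (2 powr p) * (ennreal (norm x powr p) + ennreal (norm y powr p))"
proof -
  let ?m = "max (norm x) (norm y)"
  have "norm (x + y) \<le> 2 * ?m" using norm_triangle_ineq[of x y] by linarith
  then have "norm (x + y) powr p \<le> (2 * ?m) powr p" using assms by (intro powr_mono2) auto
  also have "\<dots> = 2 powr p * ?m powr p" by (simp add: powr_mult)
  also have "\<dots> \<le> 2 powr p * (norm x powr p + norm y powr p)"
    by (intro mult_left_mono) (auto simp: max_def)
  finally have "ennreal (norm (x + y) powr p) \<le> ennreal (2 powr p * (norm x powr p + norm y powr p))" by (rule ennreal_leI)
  then show ?thesis by (simp add: ennreal_mult)
qed

context prob_space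
begin

text \<open>
  The \<open>p\<close>-th power of the \<open>L\<^sup>p\<close> norm. All estimates use the quasi-triangle inequality with the factor
  \<open>2\<^sup>p\<close>, which is enough for questions of convergence.
\<close>

definition mean_pow :: "real \<Rightarrow> ('a \<Rightarrow> 'h::real_normed_vector) \<Rightarrow> ennreal" where
  "mean_pow p X = (\<integral>\<^sup>+\<omega>. ennreal (norm (X \<omega>) powr p) \<partial>M)"

lemma mean_pow_add:
  fixes X Y :: "'a \<Rightarrow> 'h::{banach, second_countable_topology}"
  assumes [measurable]: "X \<in> borel_measurable M" "Y \<in> borel_measurable M" and "0 \<le> p"
  shows "mean_pow p (\<lambda>\<omega>. X \<omega> + Y \<omega>) \<le> ennreal (2 powr p) * (mean_pow p X + mean_pow p Y)"
proof -
  have "mean_pow p (\<lambda>\<omega>. X \<omega> + Y \<omega>) \<le> (\<integral>\<^sup>+\<omega>. ennreal (2 powr p) * (ennreal (norm (X \<omega>) powr p) + ennreal (norm (Y \<omega>) powr p)) \<partial>M)"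
    unfolding mean_pow_def using assms(3) by (intro nn_integral_mono powr_norm_add_le)
  also have "\<dots> = ennreal (2 powr p) * (mean_pow p X + mean_pow p Y)"
    unfolding mean_pow_def by (subst nn_integral_cmult) (simp_all add: nn_integral_add)
  finally show ?thesis .
qed

lemma mean_pow_cong_AE: "AE \<omega> in M. X \<omega> = Y \<omega> \<Longrightarrow> mean_pow p X = mean_pow p Y"
  unfolding mean_pow_def by (intro nn_integral_cong_AE) (auto elim!: eventually_mono)

lemma mean_pow_minus: "mean_pow p (\<lambda>\<omega>. X \<omega> - Y \<omega>) = mean_pow p (\<lambda>\<omega>. Y \<omega> - X \<omega>)"
  unfolding mean_pow_def by (simp add: norm_minus_commute)

lemma mean_pow_scaleR:
  fixes X :: "'a \<Rightarrow> 'h::{banach, second_countable_topology}"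
  assumes [measurable]: "X \<in> borel_measurable M"
  shows "mean_pow p (\<lambda>\<omega>. a *\<^sub>R X \<omega>) = ennreal (\<bar>a\<bar> powr p) * mean_pow p X"
  unfolding mean_pow_def by (subst nn_integral_cmult[symmetric]) (simp_all add: powr_mult ennreal_mult)

text \<open>
  From \<open>x \<le> e + e\<^bsup>1-p\<^esup> x\<^sup>p\<close>. It replaces the inclusion \<open>L\<^sup>p \<subseteq> L\<^sup>1\<close> where only \<open>p\<close>-th powers are
  controlled.
\<close>

lemma mean_pow_L1:
  fixes X :: "'a \<Rightarrow> 'h::{banach, second_countable_topology}"
  assumes [measurable]: "X \<in> borel_measurable M" and p: "1 \<le> p" and e: "0 < e"
  shows "(\<integral>\<^sup>+\<omega>. ennreal (norm (X \<omega>)) \<partial>M) \<le> ennreal e + ennreal (e powr (1 - p)) * mean_pow p X"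
proof -
  have "ennreal (norm x) \<le> ennreal e + ennreal (e powr (1 - p)) * ennreal (norm x powr p)" for x :: 'h
  proof -
    have "norm x \<le> e + e powr (1 - p) * norm x powr p"
    proof (cases "norm x \<le> e")
      case True
      then show ?thesis by (simp add: add_increasing2)
    next
      case False
      then have x: "e < norm x" by simp
      have "norm x = norm x powr (1 - p) * norm x powr p" using x e by (simp add: powr_add[symmetric])
      also have "norm x powr (1 - p) \<le> e powr (1 - p)" using x e p by (intro powr_mono2') auto
      finally show ?thesis using e by (simp add: add_increasing mult_right_mono)
    qed
    then have "ennreal (norm x) \<le> ennreal (e + e powr (1 - p) * norm x powr p)" by (rule ennreal_leI)
    also have "\<dots> = ennreal e + ennreal (e powr (1 - p)) * ennreal (norm x powr p)"
      using e by (simp add: ennreal_mult)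
    finally show ?thesis .
  qed
  then have "(\<integral>\<^sup>+\<omega>. ennreal (norm (X \<omega>)) \<partial>M) \<le> (\<integral>\<^sup>+\<omega>. ennreal e + ennreal (e powr (1 - p)) * ennreal (norm (X \<omega>) powr p) \<partial>M)"
    by (intro nn_integral_mono)
  also have "\<dots> = ennreal e + ennreal (e powr (1 - p)) * mean_pow p X"
    by (simp add: nn_integral_add nn_integral_cmult mean_pow_def emeasure_space_1)
  finally show ?thesis .
qed

lemma fast_subseq:
  fixes e :: "nat \<Rightarrow> ennreal"
  assumes "e \<longlonglongrightarrow> 0"
  obtains r :: "nat \<Rightarrow> nat" where "strict_mono r" "\<And>k. e (r k) \<le> ennreal ((1/4) ^ k)"
proof -
  have "\<exists>n. \<forall>m\<ge>n. e m < ennreal ((1/4) ^ k)" for k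
    using order_tendstoD(2)[OF assms, of "ennreal ((1/4) ^ k)"] by (auto simp: eventually_sequentially)
  then obtain n where n: "\<And>k m. n k \<le> m \<Longrightarrow> e m < ennreal ((1/4) ^ k)" by metis
  define r where "r k = k + Max (n ` {..k})" for k
  have "n k \<le> r k" for k
  proof -
    have "n k \<le> Max (n ` {..k})" by (intro Max_ge) auto
    then show ?thesis unfolding r_def by linarith
  qed
  then have "e (r k) \<le> ennreal ((1/4) ^ k)" for k using n[of k "r k"] by (simp add: less_imp_le)
  moreover have "strict_mono r"
  proof (rule strict_monoI_Suc)
    fix k
    have "Max (n ` {..k}) \<le> Max (n ` {..Suc k})" by (intro Max_mono) auto
    then show "r k < r (Suc k)" unfolding r_def by linarith
  qed
  ultimately show ?thesis using that by blast
qed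

text \<open>
  With \<open>e = 2\<^bsup>-k\<^esup>\<close> in \<open>mean_pow_L1\<close> and \<open>p \<le> 2\<close> the factor \<open>e\<^bsup>1-p\<^esup>\<close> is at most \<open>2\<^sup>k\<close>, so that a rate
  \<open>4\<^bsup>-k\<^esup>\<close> makes the first moments summable.
\<close>

lemma mean_pow_fast_AE_summable:
  fixes X :: "nat \<Rightarrow> 'a \<Rightarrow> 'h::{banach, second_countable_topology}"
  assumes [measurable]: "\<And>k. X k \<in> borel_measurable M" and p: "1 \<le> p" "p \<le> 2"
    and le: "\<And>k. mean_pow p (X k) \<le> ennreal ((1/4) ^ k)"
  shows "AE \<omega> in M. summable (\<lambda>k. norm (X k \<omega>))"
proof -
  have "(\<integral>\<^sup>+\<omega>. ennreal (norm (X k \<omega>)) \<partial>M) \<le> ennreal (2 * (1/2) ^ k)" for k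
  proof -
    have "(\<integral>\<^sup>+\<omega>. ennreal (norm (X k \<omega>)) \<partial>M) \<le> ennreal ((1/2)^k) + ennreal (((1/2)^k) powr (1 - p)) * mean_pow p (X k)"
      by (rule mean_pow_L1) (use p in auto)
    also have "\<dots> \<le> ennreal ((1/2)^k) + ennreal (((1/2)^k) powr (1 - p)) * ennreal ((1/4) ^ k)"
      by (intro add_left_mono mult_left_mono le) simp
    also have "\<dots> = ennreal ((1/2)^k + ((1/2)^k) powr (1 - p) * (1/4) ^ k)"
      by (simp add: ennreal_mult)
    also have "\<dots> \<le> ennreal (2 * (1/2) ^ k)"
    proof (rule ennreal_leI)
      have "((1/2::real)^k) powr (1 - p) \<le> ((1/2::real)^k) powr (-1)"
        using p by (intro powr_mono') (auto simp: power_le_one)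
      also have "\<dots> = 2 ^ k" by (simp add: powr_minus power_one_over)
      finally have "((1/2::real)^k) powr (1 - p) * (1/4) ^ k \<le> 2 ^ k * (1/4) ^ k" by (intro mult_right_mono) auto
      also have "\<dots> = (1/2) ^ k" by (simp add: power_mult_distrib[symmetric])
      finally show "(1/2)^k + ((1/2)^k) powr (1 - p) * (1/4) ^ k \<le> 2 * (1/2::real) ^ k" by simp
    qed
    finally show ?thesis .
  qed
  then have "(\<Sum>k. \<integral>\<^sup>+\<omega>. ennreal (norm (X k \<omega>)) \<partial>M) \<le> (\<Sum>k. ennreal (2 * (1/2) ^ k))"
    by (intro suminf_le) auto
  also have "\<dots> < \<infinity>" by (subst suminf_ennreal2) (auto intro!: summable_mult summable_geometric)
  finally have "(\<integral>\<^sup>+\<omega>. (\<Sum>k. ennreal (norm (X k \<omega>))) \<partial>M) < \<infinity>" by (subst nn_integral_suminf) auto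
  then have "AE \<omega> in M. (\<Sum>k. ennreal (norm (X k \<omega>))) \<noteq> \<infinity>" by (intro nn_integral_PInf_AE) auto
  then show ?thesis by eventually_elim (simp add: summable_suminf_not_top)
qed

lemma mean_pow_AE_subseq:
  fixes X :: "nat \<Rightarrow> 'a \<Rightarrow> 'h::{banach, second_countable_topology}"
  assumes m: "\<And>k. X k \<in> borel_measurable M" and p: "1 \<le> p" "p \<le> 2" and lim: "(\<lambda>k. mean_pow p (X k)) \<longlonglongrightarrow> 0"
  obtains r :: "nat \<Rightarrow> nat" where "strict_mono r" "AE \<omega> in M. (\<lambda>k. X (r k) \<omega>) \<longlonglongrightarrow> 0"
proof -
  obtain r :: "nat \<Rightarrow> nat" where r: "strict_mono r" "\<And>k. mean_pow p (X (r k)) \<le> ennreal ((1/4) ^ k)"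
    using fast_subseq[OF lim] by blast
  have "AE \<omega> in M. summable (\<lambda>k. norm (X (r k) \<omega>))"
    by (rule mean_pow_fast_AE_summable[OF m p r(2)])
  then have "AE \<omega> in M. (\<lambda>k. X (r k) \<omega>) \<longlonglongrightarrow> 0"
    by eventually_elim (auto dest!: summable_LIMSEQ_zero simp: tendsto_norm_zero_iff)
  with r(1) show ?thesis by (rule that)
qed

lemma mean_pow_complete:
  fixes X :: "nat \<Rightarrow> 'a \<Rightarrow> 'h::{banach, second_countable_topology}"
  assumes m [measurable]: "\<And>k. X k \<in> borel_measurable M" and p: "1 \<le> p" "p \<le> 2"
    and e: "e \<longlonglongrightarrow> 0" and le: "\<And>k l. k \<le> l \<Longrightarrow> mean_pow p (\<lambda>\<omega>. X l \<omega> - X k \<omega>) \<le> e k"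
  obtains Y where "Y \<in> borel_measurable M" "(\<lambda>k. mean_pow p (\<lambda>\<omega>. Y \<omega> - X k \<omega>)) \<longlonglongrightarrow> 0"
proof -
  obtain r :: "nat \<Rightarrow> nat" where r: "strict_mono r" "\<And>k. e (r k) \<le> ennreal ((1/4) ^ k)"
    using fast_subseq[OF e] by blast
  have "AE \<omega> in M. summable (\<lambda>k. norm (X (r (Suc k)) \<omega> - X (r k) \<omega>))"
  proof (rule mean_pow_fast_AE_summable[OF _ p])
    show "mean_pow p (\<lambda>\<omega>. X (r (Suc k)) \<omega> - X (r k) \<omega>) \<le> ennreal ((1/4) ^ k)" for k
      using le[of "r k" "r (Suc k)"] r(2)[of k] strict_mono_less_eq[OF r(1), of k "Suc k"] by (auto intro: order_trans)
  qed measurable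
  then have conv: "AE \<omega> in M. convergent (\<lambda>k. X (r k) \<omega>)"
  proof eventually_elim
    case (elim \<omega>)
    then have "summable (\<lambda>k. X (r (Suc k)) \<omega> - X (r k) \<omega>)" by (rule summable_norm_cancel)
    then have "convergent (\<lambda>n. \<Sum>k<n. X (r (Suc k)) \<omega> - X (r k) \<omega>)" by (simp add: summable_iff_convergent)
    then have "convergent (\<lambda>n. X (r n) \<omega> - X (r 0) \<omega>)" by (simp add: sum_lessThan_telescope[of "\<lambda>k. X (r k) \<omega>"])
    then have "convergent (\<lambda>n. (X (r n) \<omega> - X (r 0) \<omega>) + X (r 0) \<omega>)" by (intro convergent_add convergent_const)
    then show ?case by simp
  qed
  define Y where "Y \<omega> = lim (\<lambda>k. X (r k) \<omega>)" for \<omega>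
  have Y [measurable]: "Y \<in> borel_measurable M" unfolding Y_def by (rule borel_measurable_lim_metric) measurable
  have "mean_pow p (\<lambda>\<omega>. Y \<omega> - X k \<omega>) \<le> e k" for k
    unfolding mean_pow_def
  proof (rule nn_integral_fatou_le[where u="\<lambda>j \<omega>. ennreal (norm (X (r (j + k)) \<omega> - X k \<omega>) powr p)"])
    show "(\<integral>\<^sup>+\<omega>. ennreal (norm (X (r (j + k)) \<omega> - X k \<omega>) powr p) \<partial>M) \<le> e k" for j
      using le[of k "r (j + k)"] seq_suble[OF r(1), of "j + k"] by (simp add: mean_pow_def)
    show "AE \<omega> in M. (\<lambda>j. ennreal (norm (X (r (j + k)) \<omega> - X k \<omega>) powr p)) \<longlonglongrightarrow> ennreal (norm (Y \<omega> - X k \<omega>) powr p)"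
      using conv
    proof eventually_elim
      case (elim \<omega>)
      then have "(\<lambda>j. X (r j) \<omega>) \<longlonglongrightarrow> Y \<omega>" by (simp add: Y_def convergent_LIMSEQ_iff)
      then have "(\<lambda>j. X (r (j + k)) \<omega>) \<longlonglongrightarrow> Y \<omega>" by (rule LIMSEQ_ignore_initial_segment)
      then have "(\<lambda>j. norm (X (r (j + k)) \<omega> - X k \<omega>)) \<longlonglongrightarrow> norm (Y \<omega> - X k \<omega>)" by (intro tendsto_intros)
      then have "(\<lambda>j. norm (X (r (j + k)) \<omega> - X k \<omega>) powr p) \<longlonglongrightarrow> norm (Y \<omega> - X k \<omega>) powr p"
        using p by (intro tendsto_powr2) auto
      then show ?case by (rule tendsto_ennrealI)
    qed
  qed measurable
  then have "(\<lambda>k. mean_pow p (\<lambda>\<omega>. Y \<omega> - X k \<omega>)) \<longlonglongrightarrow> 0" by (rule ennreal_tendsto_0_le[OF e])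
  with Y show ?thesis by (rule that)
qed

text \<open>
  Localised uniqueness: two limits, possibly with different exponents, coincide on every event on
  which the approximating sequences coincide. The event enters as a predicate that need not be
  measurable.
\<close>

lemma mean_pow_limit_unique:
  fixes X X' :: "'a \<Rightarrow> 'h::{banach, second_countable_topology}"
  assumes X: "X \<in> borel_measurable M" "X' \<in> borel_measurable M"
    and Y: "\<And>k. Y k \<in> borel_measurable M" "\<And>k. Y' k \<in> borel_measurable M"
    and p: "1 \<le> p" "p \<le> 2" "1 \<le> q" "q \<le> 2"
    and lim: "(\<lambda>k. mean_pow p (\<lambda>\<omega>. X \<omega> - Y k \<omega>)) \<longlonglongrightarrow> 0" "(\<lambda>k. mean_pow q (\<lambda>\<omega>. X' \<omega> - Y' k \<omega>)) \<longlonglongrightarrow> 0"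
    and eq: "AE \<omega> in M. P \<omega> \<longrightarrow> (\<forall>k. Y k \<omega> = Y' k \<omega>)"
  shows "AE \<omega> in M. P \<omega> \<longrightarrow> X \<omega> = X' \<omega>"
proof -
  have mX: "(\<lambda>\<omega>. X \<omega> - Y k \<omega>) \<in> borel_measurable M" for k using X Y by measurable
  obtain r :: "nat \<Rightarrow> nat" where r: "strict_mono r" "AE \<omega> in M. (\<lambda>k. X \<omega> - Y (r k) \<omega>) \<longlonglongrightarrow> 0"
    by (rule mean_pow_AE_subseq[OF mX p(1,2) lim(1)])
  have lim2: "(\<lambda>k. mean_pow q (\<lambda>\<omega>. X' \<omega> - Y' (r k) \<omega>)) \<longlonglongrightarrow> 0"
    using LIMSEQ_subseq_LIMSEQ[OF lim(2) r(1)] by (simp add: comp_def)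
  have mX': "(\<lambda>\<omega>. X' \<omega> - Y' (r k) \<omega>) \<in> borel_measurable M" for k using X Y by measurable
  obtain r' :: "nat \<Rightarrow> nat" where r': "strict_mono r'" "AE \<omega> in M. (\<lambda>k. X' \<omega> - Y' (r (r' k)) \<omega>) \<longlonglongrightarrow> 0"
    by (rule mean_pow_AE_subseq[OF mX' p(3,4) lim2])
  show ?thesis using r(2) r'(2) eq
  proof eventually_elim
    case (elim \<omega>)
    show ?case
    proof
      assume "P \<omega>"
      then have e: "Y k \<omega> = Y' k \<omega>" for k using elim by blast
      have "(\<lambda>k. X \<omega> - Y (r (r' k)) \<omega>) \<longlonglongrightarrow> 0"
        using LIMSEQ_subseq_LIMSEQ[OF elim(1) r'(1)] by (simp add: comp_def)
      from tendsto_diff[OF this elim(2)] have "(\<lambda>k. X \<omega> - X' \<omega>) \<longlonglongrightarrow> 0" by (simp add: e)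
      then show "X \<omega> = X' \<omega>" by (simp add: LIMSEQ_const_iff)
    qed
  qed
qed

end

context time_poisson
begin

lemma moment_add:
  fixes \<phi> \<psi> :: "_ \<Rightarrow> 'h::{banach, second_countable_topology}"
  assumes \<phi>: "\<phi> \<in> borel_measurable CTU" and \<psi>: "\<psi> \<in> borel_measurable CTU" and "0 \<le> p"
  shows "moment p (\<lambda>x. \<phi> x + \<psi> x) \<le> ennreal (2 powr p) * (moment p \<phi> + moment p \<psi>)"
proof -
  note [measurable] = measurable_at_past_N[OF \<phi>] measurable_at_past_N[OF \<psi>]
  have s: "(\<lambda>x. \<phi> x + \<psi> x) \<in> borel_measurable CTU" using \<phi> \<psi> by measurable
  have "moment p (\<lambda>x. \<phi> x + \<psi> x) \<le> (\<integral>\<^sup>+q. ennreal (2 powr p) * (ennreal (norm (at_past \<phi> (N (fst q)) (snd q)) powr p) + ennreal (norm (at_past \<psi> (N (fst q)) (snd q)) powr p)) \<partial>(M \<Otimes>\<^sub>M E))"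
    unfolding moment_eq_pair[OF s] at_past_comp2[of "(+)"] using assms(3) by (intro nn_integral_mono powr_norm_add_le)
  also have "\<dots> = ennreal (2 powr p) * (moment p \<phi> + moment p \<psi>)"
    unfolding moment_eq_pair[OF \<phi>] moment_eq_pair[OF \<psi>] by (subst nn_integral_cmult) (simp_all add: nn_integral_add)
  finally show ?thesis .
qed

lemma moment_minus: "moment p (\<lambda>x. \<phi> x - \<psi> x) = moment p (\<lambda>x. \<psi> x - \<phi> x)"
  unfolding moment_def at_past_def by (simp add: norm_minus_commute)

lemma moment_scaleR:
  fixes \<phi> :: "_ \<Rightarrow> 'h::{banach, second_countable_topology}"
  assumes \<phi>: "\<phi> \<in> borel_measurable CTU"
  shows "moment p (\<lambda>x. a *\<^sub>R \<phi> x) = ennreal (\<bar>a\<bar> powr p) * moment p \<phi>"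
proof -
  note [measurable] = measurable_at_past_N[OF \<phi>]
  have s: "(\<lambda>x. a *\<^sub>R \<phi> x) \<in> borel_measurable CTU" using \<phi> by measurable
  show ?thesis unfolding moment_eq_pair[OF s] moment_eq_pair[OF \<phi>] at_past_comp[of "\<lambda>x. a *\<^sub>R x"]
    by (subst nn_integral_cmult[symmetric]) (simp_all add: powr_mult ennreal_mult)
qed

lemma moment_triangle:
  fixes \<phi> \<psi> \<theta> :: "_ \<Rightarrow> 'h::{banach, second_countable_topology}"
  assumes [measurable]: "\<phi> \<in> borel_measurable CTU" "\<psi> \<in> borel_measurable CTU" "\<theta> \<in> borel_measurable CTU" and "0 \<le> p"
  shows "moment p (\<lambda>x. \<phi> x - \<psi> x) \<le> ennreal (2 powr p) * (moment p (\<lambda>x. \<phi> x - \<theta> x) + moment p (\<lambda>x. \<theta> x - \<psi> x))"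
  using moment_add[of "\<lambda>x. \<phi> x - \<theta> x" "\<lambda>x. \<theta> x - \<psi> x" p] assms by simp

lemma integrandsD: "\<phi> \<in> integrands p \<Longrightarrow> \<phi> \<in> borel_measurable CTU" "\<phi> \<in> integrands p \<Longrightarrow> moment p \<phi> < \<infinity>"
  by (simp_all add: integrands_def)

lemma integrands_lincomb:
  fixes \<phi> \<psi> :: "_ \<Rightarrow> 'h::{banach, second_countable_topology}"
  assumes "\<phi> \<in> integrands p" "\<psi> \<in> integrands p" "0 \<le> p"
  shows "(\<lambda>x. a *\<^sub>R \<phi> x + b *\<^sub>R \<psi> x) \<in> integrands p"
proof -
  note [measurable] = integrandsD(1)[OF assms(1)] integrandsD(1)[OF assms(2)]
  have "moment p (\<lambda>x. a *\<^sub>R \<phi> x + b *\<^sub>R \<psi> x) \<le> ennreal (2 powr p) * (moment p (\<lambda>x. a *\<^sub>R \<phi> x) + moment p (\<lambda>x. b *\<^sub>R \<psi> x))"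
    by (rule moment_add) (use assms in measurable)
  also have "\<dots> < \<infinity>" using integrandsD(2)[OF assms(1)] integrandsD(2)[OF assms(2)]
    by (simp add: moment_scaleR ennreal_mult_less_top)
  finally show ?thesis by (simp add: integrands_def)
qed

lemma integrands_diff:
  fixes \<phi> \<psi> :: "_ \<Rightarrow> 'h::{banach, second_countable_topology}"
  assumes "\<phi> \<in> integrands p" "\<psi> \<in> integrands p" "0 \<le> p"
  shows "(\<lambda>x. \<phi> x - \<psi> x) \<in> integrands p"
  using integrands_lincomb[OF assms, of 1 "-1"] by simp

text \<open>
  Removing the small values makes an integrand with a finite moment of order \<open>p\<close> integrable. The
  truncation depends only on the value, hence it commutes with adding a point and with
  stopping, and it does not depend on \<open>p\<close>.
\<close>

definition trunc :: "nat \<Rightarrow> ('x \<Rightarrow> 'h::real_normed_vector) \<Rightarrow> 'x \<Rightarrow> 'h" where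
  "trunc k \<phi> x = (if 1 / real (Suc k) < norm (\<phi> x) then \<phi> x else 0)"

lemma measurable_trunc:
  fixes \<phi> :: "_ \<Rightarrow> 'h::{banach, second_countable_topology}"
  assumes [measurable]: "\<phi> \<in> borel_measurable A" shows "trunc k \<phi> \<in> borel_measurable A"
  unfolding trunc_def[abs_def] by measurable

lemma trunc_tendsto: "(\<lambda>k. trunc k \<phi> x) \<longlonglongrightarrow> \<phi> x"
proof (cases "\<phi> x = 0")
  case False
  then obtain k0 where k0: "inverse (real (Suc k0)) < norm (\<phi> x)" using reals_Archimedean[of "norm (\<phi> x)"] by auto
  have "eventually (\<lambda>k. trunc k \<phi> x = \<phi> x) sequentially"
    using eventually_ge_at_top[of k0]
  proof eventually_elim
    case (elim k)
    have "1 / real (Suc k) \<le> inverse (real (Suc k0))" using elim by (simp add: field_simps)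
    then show ?case using k0 by (auto simp: trunc_def)
  qed
  then show ?thesis by (rule tendsto_eventually)
qed (simp add: trunc_def)

lemma norm_trunc_le: "norm (trunc k \<phi> x) \<le> norm (\<phi> x)" "norm (\<phi> x - trunc k \<phi> x) \<le> norm (\<phi> x)"
  by (simp_all add: trunc_def)

lemma norm_trunc_diff_le: "k \<le> l \<Longrightarrow> norm (trunc l \<phi> x - trunc k \<phi> x) \<le> norm (\<phi> x - trunc k \<phi> x)"
proof -
  assume "k \<le> l"
  then have "1 / real (Suc l) \<le> 1 / real (Suc k)" by (simp add: frac_le)
  then show ?thesis by (auto simp: trunc_def)
qed

lemma trunc_le_powr:
  assumes "1 \<le> p"
  shows "norm (trunc k \<phi> x) \<le> (1 / real (Suc k)) powr (1 - p) * norm (\<phi> x) powr p"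
proof (cases "1 / real (Suc k) < norm (\<phi> x)")
  case True
  have pos: "0 < 1 / real (Suc k)" by simp
  have "norm (\<phi> x) = norm (\<phi> x) powr (1 - p) * norm (\<phi> x) powr p"
    using less_trans[OF pos True] by (simp add: powr_add[symmetric])
  also have "norm (\<phi> x) powr (1 - p) \<le> (1 / real (Suc k)) powr (1 - p)"
    using True pos assms by (intro powr_mono2') auto
  finally show ?thesis using True by (simp add: trunc_def mult_right_mono)
qed (simp add: trunc_def)

lemma trunc_integrands:
  fixes \<phi> :: "_ \<Rightarrow> 'h::{banach, second_countable_topology}"
  assumes \<phi>: "\<phi> \<in> integrands p" and p: "1 \<le> p"
  shows "trunc k \<phi> \<in> integrands 1 \<inter> integrands p"
proof
  have m: "trunc k \<phi> \<in> borel_measurable CTU" using integrandsD(1)[OF \<phi>] by (rule measurable_trunc)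
  have "moment p (trunc k \<phi>) \<le> moment p \<phi>" by (rule moment_mono) (use p in \<open>auto simp: at_past_def norm_trunc_le\<close>)
  then show "trunc k \<phi> \<in> integrands p" using m integrandsD(2)[OF \<phi>] by (auto simp: integrands_def intro: le_less_trans)
  let ?c = "(1 / real (Suc k)) powr (1 - p)"
  have "moment 1 (trunc k \<phi>) \<le> (\<integral>\<^sup>+q. ennreal ?c * ennreal (norm (at_past \<phi> (N (fst q)) (snd q)) powr p) \<partial>(M \<Otimes>\<^sub>M E))"
    unfolding moment_eq_pair[OF m]
  proof (intro nn_integral_mono)
    fix q
    have "norm (at_past (trunc k \<phi>) (N (fst q)) (snd q)) \<le> ?c * norm (at_past \<phi> (N (fst q)) (snd q)) powr p"
      unfolding at_past_def by (rule trunc_le_powr[OF p])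
    then have "ennreal (norm (at_past (trunc k \<phi>) (N (fst q)) (snd q))) \<le> ennreal (?c * norm (at_past \<phi> (N (fst q)) (snd q)) powr p)"
      by (rule ennreal_leI)
    then show "ennreal (norm (at_past (trunc k \<phi>) (N (fst q)) (snd q)) powr 1) \<le> ennreal ?c * ennreal (norm (at_past \<phi> (N (fst q)) (snd q)) powr p)"
      by (simp add: ennreal_mult)
  qed
  also have "\<dots> = ennreal ?c * moment p \<phi>"
    unfolding moment_eq_pair[OF integrandsD(1)[OF \<phi>]] using measurable_at_past_N[OF integrandsD(1)[OF \<phi>]] by (intro nn_integral_cmult) measurable
  also have "\<dots> < \<infinity>" using integrandsD(2)[OF \<phi>] by (simp add: ennreal_mult_less_top)
  finally show "trunc k \<phi> \<in> integrands 1" using m by (simp add: integrands_def)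
qed

lemma moment_dominated:
  fixes \<phi> :: "_ \<Rightarrow> 'h::{banach, second_countable_topology}"
  assumes \<psi>: "\<And>k. \<psi> k \<in> borel_measurable CTU" and \<phi>: "\<phi> \<in> integrands p" and p: "0 < p"
    and le: "\<And>k \<eta> z. z \<in> space E \<Longrightarrow> norm (at_past (\<psi> k) \<eta> z) \<le> norm (at_past \<phi> \<eta> z)"
    and lim: "\<And>\<eta> z. z \<in> space E \<Longrightarrow> (\<lambda>k. at_past (\<psi> k) \<eta> z) \<longlonglongrightarrow> 0"
  shows "(\<lambda>k. moment p (\<psi> k)) \<longlonglongrightarrow> 0"
proof -
  have "(\<lambda>k. \<integral>\<^sup>+q. ennreal (norm (at_past (\<psi> k) (N (fst q)) (snd q)) powr p) \<partial>(M \<Otimes>\<^sub>M E)) \<longlonglongrightarrow> (\<integral>\<^sup>+q. 0 \<partial>(M \<Otimes>\<^sub>M E))"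
  proof (rule nn_integral_dominated_convergence[where w="\<lambda>q. ennreal (norm (at_past \<phi> (N (fst q)) (snd q)) powr p)"])
    show "(\<lambda>q. ennreal (norm (at_past (\<psi> k) (N (fst q)) (snd q)) powr p)) \<in> borel_measurable (M \<Otimes>\<^sub>M E)" for k
      using measurable_at_past_N[OF \<psi>] by measurable
    show "(\<lambda>q. ennreal (norm (at_past \<phi> (N (fst q)) (snd q)) powr p)) \<in> borel_measurable (M \<Otimes>\<^sub>M E)"
      using measurable_at_past_N[OF integrandsD(1)[OF \<phi>]] by measurable
    show "(\<integral>\<^sup>+q. ennreal (norm (at_past \<phi> (N (fst q)) (snd q)) powr p) \<partial>(M \<Otimes>\<^sub>M E)) < \<infinity>"
      using integrandsD(2)[OF \<phi>] moment_eq_pair[OF integrandsD(1)[OF \<phi>]] by simp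
    show "AE q in M \<Otimes>\<^sub>M E. ennreal (norm (at_past (\<psi> k) (N (fst q)) (snd q)) powr p) \<le> ennreal (norm (at_past \<phi> (N (fst q)) (snd q)) powr p)" for k
      using p le by (intro AE_I2 ennreal_leI powr_mono2) (auto simp: space_pair_measure)
    show "AE q in M \<Otimes>\<^sub>M E. (\<lambda>k. ennreal (norm (at_past (\<psi> k) (N (fst q)) (snd q)) powr p)) \<longlonglongrightarrow> 0"
    proof (rule AE_I2)
      fix q assume "q \<in> space (M \<Otimes>\<^sub>M E)"
      then have "(\<lambda>k. at_past (\<psi> k) (N (fst q)) (snd q)) \<longlonglongrightarrow> 0" by (intro lim) (auto simp: space_pair_measure)
      then have n0: "(\<lambda>k. norm (at_past (\<psi> k) (N (fst q)) (snd q))) \<longlonglongrightarrow> 0" by (rule tendsto_norm_zero)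
      have "(\<lambda>k. norm (at_past (\<psi> k) (N (fst q)) (snd q)) powr p) \<longlonglongrightarrow> 0 powr p"
        by (rule tendsto_powr2[OF n0 tendsto_const]) (use p in auto)
      then have "(\<lambda>k. ennreal (norm (at_past (\<psi> k) (N (fst q)) (snd q)) powr p)) \<longlonglongrightarrow> ennreal (0 powr p)" by (rule tendsto_ennrealI)
      then show "(\<lambda>k. ennreal (norm (at_past (\<psi> k) (N (fst q)) (snd q)) powr p)) \<longlonglongrightarrow> 0" by simp
    qed
  qed simp
  then show ?thesis by (simp add: moment_eq_pair[OF \<psi>])
qed

lemma moment_trunc_tendsto:
  fixes \<phi> :: "_ \<Rightarrow> 'h::{banach, second_countable_topology}"
  assumes \<phi>: "\<phi> \<in> integrands p" and p: "0 < p"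
  shows "(\<lambda>k. moment p (\<lambda>x. \<phi> x - trunc k \<phi> x)) \<longlonglongrightarrow> 0"
proof (rule moment_dominated[OF _ \<phi> p])
  show "(\<lambda>x. \<phi> x - trunc k \<phi> x) \<in> borel_measurable CTU" for k
    using integrandsD(1)[OF \<phi>] measurable_trunc[OF integrandsD(1)[OF \<phi>], of k] by measurable
  show "norm (at_past (\<lambda>x. \<phi> x - trunc k \<phi> x) \<eta> z) \<le> norm (at_past \<phi> \<eta> z)" for k \<eta> z
    by (simp add: at_past_def norm_trunc_le)
  show "(\<lambda>k. at_past (\<lambda>x. \<phi> x - trunc k \<phi> x) \<eta> z) \<longlonglongrightarrow> 0" for \<eta> z
    unfolding at_past_def
    using tendsto_diff[OF tendsto_const trunc_tendsto, of "\<phi> ((before \<eta> (fst z), fst z), snd z)" \<phi> "((before \<eta> (fst z), fst z), snd z)"] by simp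
qed

text \<open>
  \<open>X\<close> is the value at \<open>\<phi>\<close> of the continuous extension of \<open>\<phi> \<mapsto> J \<phi> N\<close> to the integrands with a finite
  moment of order \<open>p\<close>. All approximating sequences are admitted, so that convenient ones may be
  chosen; \<open>is_integralI\<close> shows that one suffices.
\<close>

definition is_integral :: "real \<Rightarrow> ('u, 'h::{real_inner, banach, second_countable_topology}) integrand \<Rightarrow> ('w \<Rightarrow> 'h) \<Rightarrow> bool" where
  "is_integral p \<phi> X \<longleftrightarrow> \<phi> \<in> integrands p \<and> X \<in> borel_measurable M \<and>
    (\<forall>\<psi>. (\<forall>k. \<psi> k \<in> integrands 1 \<inter> integrands p) \<and> (\<lambda>k. moment p (\<lambda>x. \<phi> x - \<psi> k x)) \<longlonglongrightarrow> 0 \<longrightarrow>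
       (\<lambda>k. mean_pow p (\<lambda>\<omega>. X \<omega> - J (\<psi> k) (N \<omega>))) \<longlonglongrightarrow> 0)"

lemma is_integralD:
  assumes "is_integral p \<phi> X"
  shows "\<phi> \<in> integrands p" "X \<in> borel_measurable M"
    "(\<And>k. \<psi> k \<in> integrands 1 \<inter> integrands p) \<Longrightarrow> (\<lambda>k. moment p (\<lambda>x. \<phi> x - \<psi> k x)) \<longlonglongrightarrow> 0 \<Longrightarrow>
       (\<lambda>k. mean_pow p (\<lambda>\<omega>. X \<omega> - J (\<psi> k) (N \<omega>))) \<longlonglongrightarrow> 0"
  using assms unfolding is_integral_def by blast+

lemma is_integral_trunc:
  assumes "is_integral p \<phi> X" "1 \<le> p"
  shows "(\<lambda>k. mean_pow p (\<lambda>\<omega>. X \<omega> - J (trunc k \<phi>) (N \<omega>))) \<longlonglongrightarrow> 0"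
  using is_integralD(1)[OF assms(1)] assms(2)
  by (intro is_integralD(3)[OF assms(1)] trunc_integrands moment_trunc_tendsto) auto

lemma mean_pow_J_diff:
  fixes \<phi> \<psi> :: "_ \<Rightarrow> 'h::{real_inner, banach, second_countable_topology}"
  assumes "\<phi> \<in> integrands 1" "\<psi> \<in> integrands 1"
  shows "mean_pow p (\<lambda>\<omega>. J \<phi> (N \<omega>) - J \<psi> (N \<omega>)) = mean_pow p (\<lambda>\<omega>. J (\<lambda>x. \<phi> x - \<psi> x) (N \<omega>))"
proof (rule mean_pow_cong_AE)
  show "AE \<omega> in M. J \<phi> (N \<omega>) - J \<psi> (N \<omega>) = J (\<lambda>x. \<phi> x - \<psi> x) (N \<omega>)"
    using AE_integrable_at[OF integrandsD[OF assms(1)]] AE_integrable_at[OF integrandsD[OF assms(2)]]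
    by eventually_elim (simp add: integrable_at_diff)
qed

lemma is_integralI:
  fixes \<phi> :: "_ \<Rightarrow> 'h::{real_inner, banach, second_countable_topology}"
  assumes p: "p \<in> {1..2}" and \<phi>: "\<phi> \<in> integrands p" and X: "X \<in> borel_measurable M"
    and \<psi>: "\<And>k. \<psi> k \<in> integrands 1 \<inter> integrands p" and lim: "(\<lambda>k. moment p (\<lambda>x. \<phi> x - \<psi> k x)) \<longlonglongrightarrow> 0"
    and limX: "(\<lambda>k. mean_pow p (\<lambda>\<omega>. X \<omega> - J (\<psi> k) (N \<omega>))) \<longlonglongrightarrow> 0"
  shows "is_integral p \<phi> X"
  unfolding is_integral_def
proof (intro conjI \<phi> X allI impI)
  obtain c where c: "0 < c" "\<And>\<phi> :: _ \<Rightarrow> 'h. \<phi> \<in> borel_measurable CTU \<Longrightarrow> moment 1 \<phi> < \<infinity> \<Longrightarrow>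
    (\<integral>\<^sup>+\<omega>. ennreal (norm (J \<phi> (N \<omega>)) powr p) \<partial>M) \<le> ennreal c * moment p \<phi>"
    using Lp_bound[OF p] by blast
  fix \<theta> assume \<theta>: "(\<forall>k. \<theta> k \<in> integrands 1 \<inter> integrands p) \<and> (\<lambda>k. moment p (\<lambda>x. \<phi> x - \<theta> k x)) \<longlonglongrightarrow> 0"
  let ?A = "ennreal (2 powr p)"
  have p0: "0 \<le> p" using p by simp
  have le: "mean_pow p (\<lambda>\<omega>. X \<omega> - J (\<theta> k) (N \<omega>)) \<le>
    ?A * (mean_pow p (\<lambda>\<omega>. X \<omega> - J (\<psi> k) (N \<omega>)) + ennreal c * (?A * (moment p (\<lambda>x. \<phi> x - \<psi> k x) + moment p (\<lambda>x. \<phi> x - \<theta> k x))))" for k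
  proof -
    have i: "\<psi> k \<in> integrands 1" "\<theta> k \<in> integrands 1" "\<psi> k \<in> borel_measurable CTU" "\<theta> k \<in> borel_measurable CTU"
      using \<psi> \<theta> integrandsD by blast+
    have d: "(\<lambda>x. \<psi> k x - \<theta> k x) \<in> integrands 1" by (rule integrands_diff) (use i in auto)
    have "mean_pow p (\<lambda>\<omega>. X \<omega> - J (\<theta> k) (N \<omega>)) = mean_pow p (\<lambda>\<omega>. (X \<omega> - J (\<psi> k) (N \<omega>)) + (J (\<psi> k) (N \<omega>) - J (\<theta> k) (N \<omega>)))" by simp
    also have "\<dots> \<le> ?A * (mean_pow p (\<lambda>\<omega>. X \<omega> - J (\<psi> k) (N \<omega>)) + mean_pow p (\<lambda>\<omega>. J (\<psi> k) (N \<omega>) - J (\<theta> k) (N \<omega>)))"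
      using measurable_J_N[OF i(3)] measurable_J_N[OF i(4)] X p0 by (intro mean_pow_add borel_measurable_diff) auto
    also have "mean_pow p (\<lambda>\<omega>. J (\<psi> k) (N \<omega>) - J (\<theta> k) (N \<omega>)) \<le> ennreal c * moment p (\<lambda>x. \<psi> k x - \<theta> k x)"
      unfolding mean_pow_J_diff[OF i(1,2)] using c(2)[OF integrandsD[OF d]] by (simp add: mean_pow_def)
    also have "moment p (\<lambda>x. \<psi> k x - \<theta> k x) \<le> ?A * (moment p (\<lambda>x. \<phi> x - \<psi> k x) + moment p (\<lambda>x. \<phi> x - \<theta> k x))"
      using moment_triangle[OF i(3,4) integrandsD(1)[OF \<phi>] p0] moment_minus[of p "\<psi> k" \<phi>] by simp
    finally show ?thesis by (simp add: mult_left_mono add_left_mono)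
  qed
  show "(\<lambda>k. mean_pow p (\<lambda>\<omega>. X \<omega> - J (\<theta> k) (N \<omega>))) \<longlonglongrightarrow> 0"
  proof (rule ennreal_tendsto_0_le[OF _ le])
    have "(\<lambda>k. ?A * (mean_pow p (\<lambda>\<omega>. X \<omega> - J (\<psi> k) (N \<omega>)) + ennreal c * (?A * (moment p (\<lambda>x. \<phi> x - \<psi> k x) + moment p (\<lambda>x. \<phi> x - \<theta> k x))))) \<longlonglongrightarrow> ?A * (0 + ennreal c * (?A * (0 + 0)))"
      using \<theta> lim limX by (intro ennreal_tendsto_cmult tendsto_add) auto
    then show "(\<lambda>k. ?A * (mean_pow p (\<lambda>\<omega>. X \<omega> - J (\<psi> k) (N \<omega>)) + ennreal c * (?A * (moment p (\<lambda>x. \<phi> x - \<psi> k x) + moment p (\<lambda>x. \<phi> x - \<theta> k x))))) \<longlonglongrightarrow> 0"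
      by simp
  qed
qed

lemma is_integral_exists:
  fixes \<phi> :: "_ \<Rightarrow> 'h::{real_inner, banach, second_countable_topology}"
  assumes p: "p \<in> {1..2}" and \<phi>: "\<phi> \<in> integrands p"
  obtains X where "is_integral p \<phi> X"
proof -
  obtain c where c: "0 < c" "\<And>\<phi> :: _ \<Rightarrow> 'h. \<phi> \<in> borel_measurable CTU \<Longrightarrow> moment 1 \<phi> < \<infinity> \<Longrightarrow>
    (\<integral>\<^sup>+\<omega>. ennreal (norm (J \<phi> (N \<omega>)) powr p) \<partial>M) \<le> ennreal c * moment p \<phi>"
    using Lp_bound[OF p] by blast
  have p1: "1 \<le> p" "p \<le> 2" "0 < p" "0 \<le> p" using p by auto
  note t = trunc_integrands[OF \<phi> p1(1)]
  have m: "(\<lambda>\<omega>. J (trunc k \<phi>) (N \<omega>)) \<in> borel_measurable M" for k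
    by (rule measurable_J_N[OF measurable_trunc[OF integrandsD(1)[OF \<phi>]]])
  define e where "e k = ennreal c * moment p (\<lambda>x. \<phi> x - trunc k \<phi> x)" for k
  have e: "e \<longlonglongrightarrow> 0"
    unfolding e_def using ennreal_tendsto_cmult[OF _ moment_trunc_tendsto[OF \<phi> p1(3)], of "ennreal c"] by simp
  have cau: "mean_pow p (\<lambda>\<omega>. J (trunc l \<phi>) (N \<omega>) - J (trunc k \<phi>) (N \<omega>)) \<le> e k" if "k \<le> l" for k l
  proof -
    have i: "trunc l \<phi> \<in> integrands 1" "trunc k \<phi> \<in> integrands 1" using t by auto
    have d: "(\<lambda>x. trunc l \<phi> x - trunc k \<phi> x) \<in> integrands 1" by (rule integrands_diff[OF i]) simp
    have "mean_pow p (\<lambda>\<omega>. J (trunc l \<phi>) (N \<omega>) - J (trunc k \<phi>) (N \<omega>)) \<le> ennreal c * moment p (\<lambda>x. trunc l \<phi> x - trunc k \<phi> x)"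
      unfolding mean_pow_J_diff[OF i] using c(2)[OF integrandsD[OF d]] by (simp add: mean_pow_def)
    also have "\<dots> \<le> e k" unfolding e_def
      by (intro mult_left_mono moment_mono) (use p1 norm_trunc_diff_le[OF that] in \<open>auto simp: at_past_def\<close>)
    finally show ?thesis .
  qed
  obtain X where X: "X \<in> borel_measurable M" "(\<lambda>k. mean_pow p (\<lambda>\<omega>. X \<omega> - J (trunc k \<phi>) (N \<omega>))) \<longlonglongrightarrow> 0"
    by (rule mean_pow_complete[OF m p1(1,2) e cau])
  show ?thesis
    by (rule that, rule is_integralI[OF p \<phi> X(1) t moment_trunc_tendsto[OF \<phi> p1(3)] X(2)])
qed

lemma is_integral_lincomb:
  fixes \<phi> \<psi> :: "_ \<Rightarrow> 'h::{real_inner, banach, second_countable_topology}"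
  assumes p: "p \<in> {1..2}" and X: "is_integral p \<phi> X" and Y: "is_integral p \<psi> Y"
  shows "is_integral p (\<lambda>x. a *\<^sub>R \<phi> x + b *\<^sub>R \<psi> x) (\<lambda>\<omega>. a *\<^sub>R X \<omega> + b *\<^sub>R Y \<omega>)"
proof -
  have p1: "1 \<le> p" "p \<le> 2" "0 < p" "0 \<le> p" using p by auto
  note C = is_integralD(1)[OF X] is_integralD(1)[OF Y]
  note t = trunc_integrands[OF C(1) p1(1)] trunc_integrands[OF C(2) p1(1)]
  note mt = measurable_trunc[OF integrandsD(1)[OF C(1)]] measurable_trunc[OF integrandsD(1)[OF C(2)]]
  note [measurable] = is_integralD(2)[OF X] is_integralD(2)[OF Y] integrandsD(1)[OF C(1)] integrandsD(1)[OF C(2)] mt measurable_J_N[OF mt(1)] measurable_J_N[OF mt(2)]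
  let ?A = "ennreal (2 powr p)"
  let ?t = "\<lambda>k x. a *\<^sub>R trunc k \<phi> x + b *\<^sub>R trunc k \<psi> x"
  have md: "(\<lambda>x. \<phi> x - trunc k \<phi> x) \<in> borel_measurable CTU" "(\<lambda>x. \<psi> x - trunc k \<psi> x) \<in> borel_measurable CTU"
    "(\<lambda>\<omega>. X \<omega> - J (trunc k \<phi>) (N \<omega>)) \<in> borel_measurable M" "(\<lambda>\<omega>. Y \<omega> - J (trunc k \<psi>) (N \<omega>)) \<in> borel_measurable M" for k
    by measurable
  have L: "(\<lambda>k. ?A * (ennreal (\<bar>a\<bar> powr p) * u k + ennreal (\<bar>b\<bar> powr p) * v k)) \<longlonglongrightarrow> 0"
    if "u \<longlonglongrightarrow> 0" "v \<longlonglongrightarrow> 0" for u v :: "nat \<Rightarrow> ennreal"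
  proof -
    have "(\<lambda>k. ?A * (ennreal (\<bar>a\<bar> powr p) * u k + ennreal (\<bar>b\<bar> powr p) * v k)) \<longlonglongrightarrow> ?A * (ennreal (\<bar>a\<bar> powr p) * 0 + ennreal (\<bar>b\<bar> powr p) * 0)"
      using that by (intro ennreal_tendsto_cmult tendsto_add) auto
    then show ?thesis by simp
  qed
  show ?thesis
  proof (rule is_integralI[OF p, where \<psi>="?t"])
    show "(\<lambda>x. a *\<^sub>R \<phi> x + b *\<^sub>R \<psi> x) \<in> integrands p" by (rule integrands_lincomb[OF C p1(4)])
    show "?t k \<in> integrands 1 \<inter> integrands p" for k using t p1 by (intro IntI integrands_lincomb) auto
    show "(\<lambda>k. moment p (\<lambda>x. a *\<^sub>R \<phi> x + b *\<^sub>R \<psi> x - ?t k x)) \<longlonglongrightarrow> 0"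
    proof (rule ennreal_tendsto_0_le[OF L[OF moment_trunc_tendsto[OF C(1) p1(3)] moment_trunc_tendsto[OF C(2) p1(3)]]])
      fix k
      have "moment p (\<lambda>x. a *\<^sub>R \<phi> x + b *\<^sub>R \<psi> x - ?t k x) = moment p (\<lambda>x. a *\<^sub>R (\<phi> x - trunc k \<phi> x) + b *\<^sub>R (\<psi> x - trunc k \<psi> x))"
        by (simp add: algebra_simps)
      also have "\<dots> \<le> ?A * (moment p (\<lambda>x. a *\<^sub>R (\<phi> x - trunc k \<phi> x)) + moment p (\<lambda>x. b *\<^sub>R (\<psi> x - trunc k \<psi> x)))"
        by (rule moment_add) (measurable, fact)
      also have "\<dots> = ?A * (ennreal (\<bar>a\<bar> powr p) * moment p (\<lambda>x. \<phi> x - trunc k \<phi> x) + ennreal (\<bar>b\<bar> powr p) * moment p (\<lambda>x. \<psi> x - trunc k \<psi> x))"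
        by (simp only: moment_scaleR[OF md(1)] moment_scaleR[OF md(2)])
      finally show "moment p (\<lambda>x. a *\<^sub>R \<phi> x + b *\<^sub>R \<psi> x - ?t k x) \<le> ?A * (ennreal (\<bar>a\<bar> powr p) * moment p (\<lambda>x. \<phi> x - trunc k \<phi> x) + ennreal (\<bar>b\<bar> powr p) * moment p (\<lambda>x. \<psi> x - trunc k \<psi> x))" .
    qed
    show "(\<lambda>k. mean_pow p (\<lambda>\<omega>. a *\<^sub>R X \<omega> + b *\<^sub>R Y \<omega> - J (?t k) (N \<omega>))) \<longlonglongrightarrow> 0"
    proof (rule ennreal_tendsto_0_le[OF L[OF is_integral_trunc[OF X p1(1)] is_integral_trunc[OF Y p1(1)]]])
      fix k
      have i: "trunc k \<phi> \<in> integrands 1" "trunc k \<psi> \<in> integrands 1" using t by auto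
      have "mean_pow p (\<lambda>\<omega>. a *\<^sub>R X \<omega> + b *\<^sub>R Y \<omega> - J (?t k) (N \<omega>)) =
        mean_pow p (\<lambda>\<omega>. a *\<^sub>R (X \<omega> - J (trunc k \<phi>) (N \<omega>)) + b *\<^sub>R (Y \<omega> - J (trunc k \<psi>) (N \<omega>)))"
      proof (rule mean_pow_cong_AE)
        show "AE \<omega> in M. a *\<^sub>R X \<omega> + b *\<^sub>R Y \<omega> - J (?t k) (N \<omega>) =
          a *\<^sub>R (X \<omega> - J (trunc k \<phi>) (N \<omega>)) + b *\<^sub>R (Y \<omega> - J (trunc k \<psi>) (N \<omega>))"
          using AE_integrable_at[OF integrandsD[OF i(1)]] AE_integrable_at[OF integrandsD[OF i(2)]]
          by eventually_elim (simp add: integrable_at_lincomb algebra_simps)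
      qed
      also have "\<dots> \<le> ?A * (mean_pow p (\<lambda>\<omega>. a *\<^sub>R (X \<omega> - J (trunc k \<phi>) (N \<omega>))) + mean_pow p (\<lambda>\<omega>. b *\<^sub>R (Y \<omega> - J (trunc k \<psi>) (N \<omega>))))"
        by (rule mean_pow_add) (measurable, fact)
      also have "\<dots> = ?A * (ennreal (\<bar>a\<bar> powr p) * mean_pow p (\<lambda>\<omega>. X \<omega> - J (trunc k \<phi>) (N \<omega>)) + ennreal (\<bar>b\<bar> powr p) * mean_pow p (\<lambda>\<omega>. Y \<omega> - J (trunc k \<psi>) (N \<omega>)))"
        by (simp only: mean_pow_scaleR[OF md(3)] mean_pow_scaleR[OF md(4)])
      finally show "mean_pow p (\<lambda>\<omega>. a *\<^sub>R X \<omega> + b *\<^sub>R Y \<omega> - J (?t k) (N \<omega>)) \<le> ?A * (ennreal (\<bar>a\<bar> powr p) * mean_pow p (\<lambda>\<omega>. X \<omega> - J (trunc k \<phi>) (N \<omega>)) + ennreal (\<bar>b\<bar> powr p) * mean_pow p (\<lambda>\<omega>. Y \<omega> - J (trunc k \<psi>) (N \<omega>)))" .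
    qed
  qed measurable
qed

lemma is_integral_bound:
  assumes p: "p \<in> {1..2}"
  obtains c where "0 < c" "\<And>(\<phi> :: _ \<Rightarrow> 'h::{real_inner, banach, second_countable_topology}) X. is_integral p \<phi> X \<Longrightarrow> mean_pow p X \<le> ennreal c * moment p \<phi>"
proof -
  obtain c where c: "0 < c" "\<And>\<phi> :: _ \<Rightarrow> 'h. \<phi> \<in> borel_measurable CTU \<Longrightarrow> moment 1 \<phi> < \<infinity> \<Longrightarrow>
    (\<integral>\<^sup>+\<omega>. ennreal (norm (J \<phi> (N \<omega>)) powr p) \<partial>M) \<le> ennreal c * moment p \<phi>"
    using Lp_bound[OF p] by blast
  have p1: "1 \<le> p" "p \<le> 2" "0 < p" "0 \<le> p" using p by auto
  let ?A = "ennreal (2 powr p)"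
  have "mean_pow p X \<le> ennreal (2 powr p * c) * moment p \<phi>" if X: "is_integral p \<phi> X" for \<phi> :: "_ \<Rightarrow> 'h" and X
  proof -
    note C = is_integralD(1)[OF X]
    have le: "mean_pow p X \<le> ?A * (mean_pow p (\<lambda>\<omega>. X \<omega> - J (trunc k \<phi>) (N \<omega>)) + ennreal c * moment p \<phi>)" for k
    proof -
      have t: "trunc k \<phi> \<in> integrands 1" using trunc_integrands[OF C p1(1)] by auto
      have "mean_pow p X = mean_pow p (\<lambda>\<omega>. (X \<omega> - J (trunc k \<phi>) (N \<omega>)) + J (trunc k \<phi>) (N \<omega>))" by simp
      also have "\<dots> \<le> ?A * (mean_pow p (\<lambda>\<omega>. X \<omega> - J (trunc k \<phi>) (N \<omega>)) + mean_pow p (\<lambda>\<omega>. J (trunc k \<phi>) (N \<omega>)))"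
        using is_integralD(2)[OF X] measurable_J_N[OF integrandsD(1)[OF t]] p1 by (intro mean_pow_add borel_measurable_diff) auto
      also have "mean_pow p (\<lambda>\<omega>. J (trunc k \<phi>) (N \<omega>)) \<le> ennreal c * moment p (trunc k \<phi>)"
        using c(2)[OF integrandsD[OF t]] by (simp add: mean_pow_def)
      also have "moment p (trunc k \<phi>) \<le> moment p \<phi>"
        by (rule moment_mono) (use p1 in \<open>auto simp: at_past_def norm_trunc_le\<close>)
      finally show ?thesis by (simp add: mult_left_mono add_left_mono)
    qed
    have "(\<lambda>k. ?A * (mean_pow p (\<lambda>\<omega>. X \<omega> - J (trunc k \<phi>) (N \<omega>)) + ennreal c * moment p \<phi>)) \<longlonglongrightarrow> ?A * (0 + ennreal c * moment p \<phi>)"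
      using is_integral_trunc[OF X p1(1)] by (intro ennreal_tendsto_cmult tendsto_add tendsto_const) auto
    then have "mean_pow p X \<le> ?A * (0 + ennreal c * moment p \<phi>)"
      by (rule LIMSEQ_le_const) (use le in auto)
    then show ?thesis using c(1) by (simp add: ennreal_mult mult.assoc)
  qed
  then show ?thesis using c(1) by (intro that[of "2 powr p * c"]) auto
qed

lemma is_integral_cong:
  fixes \<phi> \<psi> :: "_ \<Rightarrow> 'h::{real_inner, banach, second_countable_topology}"
  assumes p: "p \<in> {1..2}" and X: "is_integral p \<phi> X" and \<psi>: "\<psi> \<in> borel_measurable CTU" and eq: "moment p (\<lambda>x. \<phi> x - \<psi> x) = 0"
  shows "is_integral p \<psi> X"
proof -
  have p1: "1 \<le> p" "p \<le> 2" "0 < p" "0 \<le> p" using p by auto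
  note C = is_integralD(1)[OF X]
  note m = integrandsD(1)[OF C]
  let ?A = "ennreal (2 powr p)"
  have eq': "moment p (\<lambda>x. \<psi> x - \<phi> x) = 0" using eq moment_minus[of p \<phi> \<psi>] by simp
  have "moment p (\<lambda>x. (\<psi> x - \<phi> x) + \<phi> x) \<le> ?A * (moment p (\<lambda>x. \<psi> x - \<phi> x) + moment p \<phi>)"
    using m \<psi> p1 by (intro moment_add borel_measurable_diff) auto
  also have "\<dots> < \<infinity>" using integrandsD(2)[OF C] by (simp add: eq' ennreal_mult_less_top)
  finally have "\<psi> \<in> integrands p" using \<psi> by (simp add: integrands_def)
  moreover have "(\<lambda>k. moment p (\<lambda>x. \<psi> x - trunc k \<phi> x)) \<longlonglongrightarrow> 0"
  proof (rule ennreal_tendsto_0_le)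
    show "moment p (\<lambda>x. \<psi> x - trunc k \<phi> x) \<le> ?A * moment p (\<lambda>x. \<phi> x - trunc k \<phi> x)" for k
      using moment_triangle[OF \<psi> measurable_trunc[OF m] m p1(4), of k] by (simp add: eq')
    show "(\<lambda>k. ?A * moment p (\<lambda>x. \<phi> x - trunc k \<phi> x)) \<longlonglongrightarrow> 0"
      using ennreal_tendsto_cmult[OF _ moment_trunc_tendsto[OF C p1(3)], of ?A] by simp
  qed
  ultimately show ?thesis
    by (intro is_integralI[OF p _ is_integralD(2)[OF X] trunc_integrands[OF C p1(1)] _ is_integral_trunc[OF X p1(1)]])
qed

text \<open>
  The two exponents may differ, since the truncations approximate in both senses.
\<close>

lemma is_integral_unique:
  fixes \<phi> :: "_ \<Rightarrow> 'h::{real_inner, banach, second_countable_topology}"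
  assumes p: "p \<in> {1..2}" "q \<in> {1..2}" and X: "is_integral p \<phi> X" and Y: "is_integral q \<phi> Y"
  shows "AE \<omega> in M. X \<omega> = Y \<omega>"
proof -
  note m = measurable_J_N[OF measurable_trunc[OF integrandsD(1)[OF is_integralD(1)[OF X]]]]
  have "AE \<omega> in M. True \<longrightarrow> X \<omega> = Y \<omega>"
    by (rule mean_pow_limit_unique[OF is_integralD(2)[OF X] is_integralD(2)[OF Y] m m _ _ _ _ is_integral_trunc[OF X] is_integral_trunc[OF Y]])
       (use p in auto)
  then show ?thesis by simp
qed

end

section \<open>Predictable processes as functionals of the strict past\<close>

lemma AE_pair_fst:
  assumes "sigma_finite_measure B" and ae: "AE x in A. P x"
  shows "AE p in A \<Otimes>\<^sub>M B. P (fst p)"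
proof -
  interpret B: sigma_finite_measure B by fact
  obtain n where n: "{x \<in> space A. \<not> P x} \<subseteq> n" "n \<in> sets A" "emeasure A n = 0" using ae by (auto elim!: AE_E)
  show ?thesis
  proof (rule AE_I[where N="n \<times> space B"])
    show "{p \<in> space (A \<Otimes>\<^sub>M B). \<not> P (fst p)} \<subseteq> n \<times> space B" using n(1) by (auto simp: space_pair_measure)
    show "emeasure (A \<Otimes>\<^sub>M B) (n \<times> space B) = 0" using n by (simp add: B.emeasure_pair_measure_Times)
  qed (use n in auto)
qed

lemma (in pair_sigma_finite) AE_pair_swap:
  assumes "AE p in M1 \<Otimes>\<^sub>M M2. P p"
  shows "AE y in M2. AE x in M1. P (x, y)"
proof -
  interpret Q: pair_sigma_finite M2 M1 ..
  have "AE p in distr (M2 \<Otimes>\<^sub>M M1) (M1 \<Otimes>\<^sub>M M2) (\<lambda>(x, y). (y, x)). P p"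
    using assms by (simp only: distr_pair_swap[symmetric])
  then have "AE q in M2 \<Otimes>\<^sub>M M1. P (case q of (x, y) \<Rightarrow> (y, x))"
    by (rule AE_distrD[rotated]) (rule measurable_pair_swap')
  from Q.AE_pair[OF this] show ?thesis by simp
qed

lemma sets_P_completion:
  assumes "sets G \<subseteq> Pow (space M)"
  shows "sets (P_completion M G) = sigma_sets (space M) (sets G \<union> null_sets M)" "space (P_completion M G) = space M"
proof -
  have "sets G \<union> null_sets M \<subseteq> Pow (space M)" using assms sets.sets_into_space[of _ M] by auto
  then show "sets (P_completion M G) = sigma_sets (space M) (sets G \<union> null_sets M)" "space (P_completion M G) = space M"
    by (simp_all add: P_completion_def)
qed

lemma null_set_in_events: "n \<in> null_sets \<mu> \<Longrightarrow> n \<in> events_mod_null \<mu> K B"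
  using AE_not_in[of n \<mu>] sets.sets_into_space[of n \<mu>]
  by (auto simp: events_mod_null_def null_sets_def intro!: bexI[of _ "{}"])

locale poisson_setting = time_poisson T \<nu> M N
  for T :: real and \<nu> :: "'u::topological_space measure" and M :: "'w measure" and N +
  assumes sets_nu: "sets \<nu> = sets borel"
begin

abbreviation "PM \<equiv> process_measure T \<nu> M"
abbreviation "tm \<equiv> time_measure T"
abbreviation "PT \<equiv> predictable T \<nu> M N"
abbreviation "Hist \<equiv> history T \<nu> M N"
abbreviation "Ft \<equiv> Filt T \<nu> M N"

sublocale nu: sigma_finite_measure \<nu> by (rule sigma_finite_nu)
sublocale tm: finite_measure tm by (rule finite_measure_time)
sublocale Mt: pair_sigma_finite M tm ..
sublocale Mt\<nu>: pair_sigma_finite "M \<Otimes>\<^sub>M tm" \<nu> ..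

lemma before_N: "\<omega> \<in> space M \<Longrightarrow> before (N \<omega>) s \<in> counting_measures E"
  by (rule before_in_counting_measures[OF N_counting])

definition regroup :: "'w \<times> real \<times> 'u \<Rightarrow> ('w \<times> real) \<times> 'u" where
  "regroup p = ((fst p, fst (snd p)), snd (snd p))"

lemma measurable_regroup: "regroup \<in> M \<Otimes>\<^sub>M E \<rightarrow>\<^sub>M PM"
  unfolding regroup_def[abs_def] process_measure_def by measurable

lemma nn_integral_PM_iterated:
  assumes g: "g \<in> borel_measurable PM"
  shows "(\<integral>\<^sup>+\<xi>. g \<xi> \<partial>PM) = (\<integral>\<^sup>+\<omega>. \<integral>\<^sup>+t. \<integral>\<^sup>+y. g ((\<omega>, t), y) \<partial>\<nu> \<partial>tm \<partial>M)"
proof -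
  have [measurable]: "g \<in> borel_measurable ((M \<Otimes>\<^sub>M tm) \<Otimes>\<^sub>M \<nu>)" using g by (simp add: process_measure_def)
  have h: "(\<lambda>p. \<integral>\<^sup>+y. g (p, y) \<partial>\<nu>) \<in> borel_measurable (M \<Otimes>\<^sub>M tm)" by measurable
  have "(\<integral>\<^sup>+\<xi>. g \<xi> \<partial>PM) = (\<integral>\<^sup>+p. \<integral>\<^sup>+y. g (p, y) \<partial>\<nu> \<partial>(M \<Otimes>\<^sub>M tm))"
    unfolding process_measure_def by (subst nu.nn_integral_fst[symmetric]) simp_all
  also have "\<dots> = (\<integral>\<^sup>+\<omega>. \<integral>\<^sup>+t. \<integral>\<^sup>+y. g ((\<omega>, t), y) \<partial>\<nu> \<partial>tm \<partial>M)"
    using tm.nn_integral_fst[OF h] by simp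
  finally show ?thesis .
qed

lemma nn_integral_PM:
  assumes g: "g \<in> borel_measurable PM"
  shows "(\<integral>\<^sup>+\<xi>. g \<xi> \<partial>PM) = (\<integral>\<^sup>+\<omega>. \<integral>\<^sup>+z. g ((\<omega>, fst z), snd z) \<partial>E \<partial>M)"
proof -
  have [measurable]: "g \<in> borel_measurable ((M \<Otimes>\<^sub>M tm) \<Otimes>\<^sub>M \<nu>)" using g by (simp add: process_measure_def)
  have "(\<integral>\<^sup>+\<xi>. g \<xi> \<partial>PM) = (\<integral>\<^sup>+\<omega>. \<integral>\<^sup>+t. \<integral>\<^sup>+y. g ((\<omega>, t), y) \<partial>\<nu> \<partial>tm \<partial>M)"
    by (rule nn_integral_PM_iterated[OF g])
  also have "\<dots> = (\<integral>\<^sup>+\<omega>. \<integral>\<^sup>+z. g ((\<omega>, fst z), snd z) \<partial>E \<partial>M)"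
  proof (intro nn_integral_cong)
    fix \<omega> assume \<omega>: "\<omega> \<in> space M"
    have "(\<lambda>z. ((\<omega>, fst z), snd z)) \<in> tm \<Otimes>\<^sub>M \<nu> \<rightarrow>\<^sub>M (M \<Otimes>\<^sub>M tm) \<Otimes>\<^sub>M \<nu>" using \<omega> by measurable
    from measurable_compose[OF this, of g borel]
    have "(\<lambda>z. g ((\<omega>, fst z), snd z)) \<in> borel_measurable (tm \<Otimes>\<^sub>M \<nu>)" by simp
    from nu.nn_integral_fst[OF this] show "(\<integral>\<^sup>+t. \<integral>\<^sup>+y. g ((\<omega>, t), y) \<partial>\<nu> \<partial>tm) = (\<integral>\<^sup>+z. g ((\<omega>, fst z), snd z) \<partial>E)"
      by (simp add: intensity_def)
  qed
  finally show ?thesis .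
qed

lemma PM_distr: "PM = distr (M \<Otimes>\<^sub>M E) PM regroup"
proof (rule measure_eqI)
  fix A assume A: "A \<in> sets PM"
  then have i: "(indicator A :: _ \<Rightarrow> ennreal) \<in> borel_measurable PM" by simp
  have "emeasure PM A = (\<integral>\<^sup>+\<xi>. indicator A \<xi> \<partial>PM)" using A by simp
  also have "\<dots> = (\<integral>\<^sup>+\<omega>. \<integral>\<^sup>+z. indicator A (regroup (\<omega>, z)) \<partial>E \<partial>M)"
    unfolding nn_integral_PM[OF i] by (simp add: regroup_def)
  also have "\<dots> = (\<integral>\<^sup>+p. indicator A (regroup p) \<partial>(M \<Otimes>\<^sub>M E))"
    using E.nn_integral_fst[OF measurable_compose[OF measurable_regroup i]] .
  also have "\<dots> = (\<integral>\<^sup>+p. indicator A p \<partial>distr (M \<Otimes>\<^sub>M E) PM regroup)"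
    by (rule nn_integral_distr[OF measurable_regroup, symmetric]) (use i in simp)
  finally show "emeasure PM A = emeasure (distr (M \<Otimes>\<^sub>M E) PM regroup) A" using A by simp
qed simp

lemma AE_PM_D:
  assumes "AE \<xi> in PM. P \<xi>"
  shows "AE \<omega> in M. AE z in E. P ((\<omega>, fst z), snd z)" "AE z in E. AE \<omega> in M. P ((\<omega>, fst z), snd z)"
    "AE p in M \<Otimes>\<^sub>M E. P (regroup p)"
proof -
  have "AE \<xi> in distr (M \<Otimes>\<^sub>M E) PM regroup. P \<xi>" using assms by (simp only: PM_distr[symmetric])
  from AE_distrD[OF measurable_regroup this] show *: "AE p in M \<Otimes>\<^sub>M E. P (regroup p)" .
  from ME.AE_pair[OF *] show "AE \<omega> in M. AE z in E. P ((\<omega>, fst z), snd z)" by (simp add: regroup_def)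
  from ME.AE_pair_swap[OF *] show "AE z in E. AE \<omega> in M. P ((\<omega>, fst z), snd z)" by (simp add: regroup_def)
qed

lemma AE_PM_I:
  assumes P: "Measurable.pred PM P" and ae: "AE z in E. AE \<omega> in M. P ((\<omega>, fst z), snd z)"
  shows "AE \<xi> in PM. P \<xi>"
proof -
  have m: "Measurable.pred (M \<Otimes>\<^sub>M E) (\<lambda>p. P (regroup p))"
    by (rule measurable_compose[OF measurable_regroup P])
  have ms: "{x \<in> space (M \<Otimes>\<^sub>M E). P (regroup x)} \<in> sets (M \<Otimes>\<^sub>M E)" using m by (simp add: pred_def)
  have "AE \<omega> in M. AE z in E. P (regroup (\<omega>, z))"
    using ae ME.AE_commute[of "\<lambda>\<omega> z. P (regroup (\<omega>, z))"] m by (simp add: regroup_def pred_def)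
  then have "AE p in M \<Otimes>\<^sub>M E. P (regroup p)"
    by (rule ME.AE_pair_measure[OF ms])
  then have "AE \<xi> in distr (M \<Otimes>\<^sub>M E) PM regroup. P \<xi>"
    using P by (subst AE_distr_iff[OF measurable_regroup]) (simp_all add: pred_def)
  then show ?thesis by (simp only: PM_distr[symmetric])
qed

lemma hist_cut_measurable:
  assumes "B \<in> sets E"
  shows "(\<lambda>\<omega>. emeasure (N \<omega>) (({0..u} \<times> UNIV) \<inter> B)) \<in> borel_measurable M"
  by (intro measurable_N_emeasure time_cut_sets assms) simp

lemma hist_gen_sets:
  assumes "A \<in> sets borel" "B \<in> sets E"
  shows "{\<omega> \<in> space M. emeasure (N \<omega>) (({0..u} \<times> UNIV) \<inter> B) \<in> A} \<in> sets M"
  using measurable_sets[OF hist_cut_measurable[OF assms(2)] assms(1), of u] by (simp add: vimage_def Int_def conj_commute)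

lemma history_props:
  "space (Hist u) = space M" "sets (Hist u) \<subseteq> sets M"
  "A \<in> sets borel \<Longrightarrow> B \<in> sets E \<Longrightarrow> {\<omega> \<in> space M. emeasure (N \<omega>) (({0..u} \<times> UNIV) \<inter> B) \<in> A} \<in> sets (Hist u)"
  "sets (Hist u) = sigma_sets (space M) (sigma_sets (space M) {{\<omega> \<in> space M. emeasure (N \<omega>) (({0..u} \<times> UNIV) \<inter> B) \<in> A} | A B.
        A \<in> sets borel \<and> B \<in> sets E} \<union> null_sets M)"
proof -
  let ?G = "{{\<omega> \<in> space M. emeasure (N \<omega>) (({0..u} \<times> UNIV) \<inter> B) \<in> A} | A B. A \<in> sets borel \<and> B \<in> sets E}"
  have G: "?G \<subseteq> Pow (space M)" by auto
  have s: "sets (sigma (space M) ?G) = sigma_sets (space M) ?G" using G by simp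
  have sub: "sets (sigma (space M) ?G) \<subseteq> Pow (space M)" unfolding s using sigma_sets_into_sp[OF G] by auto
  show e: "sets (Hist u) = sigma_sets (space M) (sigma_sets (space M) ?G \<union> null_sets M)"
    unfolding history_def using sets_P_completion(1)[OF sub] s by simp
  show "space (Hist u) = space M" unfolding history_def by (rule sets_P_completion(2)[OF sub])
  have "sigma_sets (space M) ?G \<subseteq> sets M" using hist_gen_sets by (intro sets.sigma_sets_subset) auto
  then show "sets (Hist u) \<subseteq> sets M" unfolding e by (intro sets.sigma_sets_subset) auto
  show "{\<omega> \<in> space M. emeasure (N \<omega>) (({0..u} \<times> UNIV) \<inter> B) \<in> A} \<in> sets (Hist u)" if "A \<in> sets borel" "B \<in> sets E" for A B
    unfolding e using that by (intro sigma_sets.Basic UnI1) blast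
qed

lemma Filt_gen: "t < T \<Longrightarrow> sets (Ft t) = sigma_sets (space M) (\<Inter>u\<in>{t<..T}. sets (Hist u))"
  and Filt_space: "space (Ft t) = space M"
proof -
  have sub: "(\<Inter>u\<in>{t<..T}. sets (Hist u)) \<subseteq> Pow (space M)" if "t < T"
  proof -
    have "(\<Inter>u\<in>{t<..T}. sets (Hist u)) \<subseteq> sets (Hist T)" using that by auto
    then show ?thesis using history_props(2)[of T] sets.space_closed[of M] by blast
  qed
  show "t < T \<Longrightarrow> sets (Ft t) = sigma_sets (space M) (\<Inter>u\<in>{t<..T}. sets (Hist u))"
    using sub by (simp add: Filt_def)
  show "space (Ft t) = space M" using sub by (simp add: Filt_def)
qed

lemma Filt_sub_history: "t < u \<Longrightarrow> u \<le> T \<Longrightarrow> sets (Ft t) \<subseteq> sets (Hist u)"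
proof -
  assume u: "t < u" "u \<le> T"
  have "sigma_sets (space (Hist u)) (\<Inter>u\<in>{t<..T}. sets (Hist u)) \<subseteq> sets (Hist u)"
    using u by (intro sets.sigma_sets_subset) auto
  then show ?thesis using u by (simp add: Filt_gen history_props(1))
qed

lemma Filt_sub_M: "sets (Ft t) \<subseteq> sets M"
  using Filt_sub_history[of t T] history_props(2)[of T] by (cases "t < T") (auto simp: Filt_def)

lemma Filt_mono: "r \<le> s \<Longrightarrow> sets (Ft r) \<subseteq> sets (Ft s)"
proof (cases "s < T")
  case True
  assume rs: "r \<le> s"
  have "sigma_sets (space M) (\<Inter>u\<in>{r<..T}. sets (Hist u)) \<subseteq> sigma_sets (space M) (\<Inter>u\<in>{s<..T}. sets (Hist u))"
    using rs by (intro sigma_sets_mono') auto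
  then show ?thesis using True rs by (simp add: Filt_gen)
next
  case False
  then have "Ft s = M" by (simp add: Filt_def)
  then show ?thesis using Filt_sub_M by simp
qed

text \<open>
  At time \<open>q\<close> the filtration contains the closed past \<open>[0,q] \<times> U\<close>; predictability of the strict
  past follows from the supremum formula over rational \<open>q\<close>.
\<close>

lemma past_event_in_Filt:
  assumes "0 \<le> q" "q < T" "A \<in> sets borel" "B \<in> sets E"
  shows "{\<omega> \<in> space M. emeasure (N \<omega>) (({..q} \<times> UNIV) \<inter> B) \<in> A} \<in> sets (Ft q)"
proof -
  have cut: "({..q} \<times> UNIV) \<inter> B \<in> sets E" by (rule time_cut_sets) (use assms in auto)
  have "B \<subseteq> {0..T} \<times> UNIV"
    using sets.sets_into_space[OF assms(4)] by (auto simp: intensity_def space_pair_measure)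
  then have eq: "({0..u} \<times> UNIV) \<inter> (({..q} \<times> UNIV) \<inter> B) = ({..q} \<times> UNIV) \<inter> B" if "q < u" for u
    using that by auto
  have "{\<omega> \<in> space M. emeasure (N \<omega>) (({..q} \<times> UNIV) \<inter> B) \<in> A} \<in> sets (Hist u)" if "q < u" for u
    using history_props(3)[OF assms(3) cut, of u] by (simp only: eq[OF that])
  then show ?thesis using assms by (auto simp: Filt_gen intro!: sigma_sets.Basic)
qed

definition PT_gen :: "('w \<times> real) set set" where
  "PT_gen = {A \<times> {0} | A. A \<in> sets (Ft 0)} \<union>
      {A \<times> {s<..t} | A s t. 0 \<le> s \<and> s \<le> t \<and> t \<le> T \<and> A \<in> sets (Ft s)}"

lemma PT_gen_sub: "PT_gen \<subseteq> Pow (space M \<times> {0..T})"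
proof -
  have "A \<subseteq> space M" if "A \<in> sets (Ft s)" for A s using sets.sets_into_space[OF that] by (simp add: Filt_space)
  then show ?thesis using T_pos unfolding PT_gen_def by fastforce
qed

lemma sets_PT: "sets PT = sigma_sets (space M \<times> {0..T}) PT_gen"
  and space_PT: "space PT = space M \<times> {0..T}"
  using PT_gen_sub by (simp_all add: predictable_def PT_gen_def)

lemma Ioc_sets_tm: "0 \<le> s \<Longrightarrow> t \<le> T \<Longrightarrow> {s<..t} \<in> sets tm" "{0} \<in> sets tm"
proof -
  have *: "S \<in> sets tm" if "S \<in> sets borel" "S \<subseteq> {0..T}" for S
    using that unfolding time_measure_def by (auto simp: sets_restrict_space image_iff intro!: bexI[of _ S])
  show "0 \<le> s \<Longrightarrow> t \<le> T \<Longrightarrow> {s<..t} \<in> sets tm" "{0} \<in> sets tm" using T_pos by (auto intro!: *)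
qed

lemma sets_PT_sub: "sets PT \<subseteq> sets (M \<Otimes>\<^sub>M tm)"
proof -
  have "PT_gen \<subseteq> sets (M \<Otimes>\<^sub>M tm)"
    using Filt_sub_M Ioc_sets_tm unfolding PT_gen_def by (auto intro!: pair_measureI)
  then have "sigma_sets (space (M \<Otimes>\<^sub>M tm)) PT_gen \<subseteq> sets (M \<Otimes>\<^sub>M tm)" by (rule sets.sigma_sets_subset)
  then show ?thesis by (simp add: sets_PT space_pair_measure)
qed

lemma measurable_PT_PM: "f \<in> A \<rightarrow>\<^sub>M B \<Longrightarrow> sets A = sets (PT \<Otimes>\<^sub>M borel) \<Longrightarrow> f \<in> PM \<rightarrow>\<^sub>M B"
proof -
  assume f: "f \<in> A \<rightarrow>\<^sub>M B" "sets A = sets (PT \<Otimes>\<^sub>M borel)"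
  have id: "(\<lambda>\<xi>. \<xi>) \<in> PM \<rightarrow>\<^sub>M PT \<Otimes>\<^sub>M borel"
  proof -
    have id0: "(\<lambda>p. p) \<in> M \<Otimes>\<^sub>M tm \<rightarrow>\<^sub>M PT"
    proof (rule measurableI)
      fix A assume "A \<in> sets PT"
      then have "A \<in> sets (M \<Otimes>\<^sub>M tm)" using sets_PT_sub by blast
      then show "(\<lambda>p. p) -` A \<inter> space (M \<Otimes>\<^sub>M tm) \<in> sets (M \<Otimes>\<^sub>M tm)" by (simp add: vimage_def)
    qed (simp add: space_PT space_pair_measure)
    have "(\<lambda>\<xi>. fst \<xi>) \<in> (M \<Otimes>\<^sub>M tm) \<Otimes>\<^sub>M \<nu> \<rightarrow>\<^sub>M PT" by (rule measurable_compose[OF measurable_fst id0])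
    moreover have "snd \<in> (M \<Otimes>\<^sub>M tm) \<Otimes>\<^sub>M \<nu> \<rightarrow>\<^sub>M borel"
      using measurable_snd[of "M \<Otimes>\<^sub>M tm" \<nu>] by (simp add: measurable_cong_sets[OF refl sets_nu])
    ultimately show ?thesis unfolding process_measure_def by (simp add: measurable_pair_iff comp_def)
  qed
  show ?thesis using measurable_compose[OF id, of f B] f by (simp add: measurable_cong_sets[OF f(2) refl])
qed

lemma measurable_PT_step:
  fixes F :: "'w \<Rightarrow> 'b::{topological_space, zero}"
  assumes F: "F \<in> borel_measurable (Ft r)" and rs: "0 \<le> r" "r \<le> s" "s \<le> T"
  shows "(\<lambda>p. if r < snd p \<and> snd p \<le> s then F (fst p) else 0) \<in> borel_measurable PT" (is "?f \<in> _")
proof (rule measurableI)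
  have rect: "A \<times> {r<..s} \<in> sets PT" if "A \<in> sets (Ft r)" for A
    unfolding sets_PT PT_gen_def using that rs by (intro sigma_sets.Basic UnI2) auto
  fix A :: "'b set" assume A: "A \<in> sets borel"
  have FA: "F -` A \<inter> space M \<in> sets (Ft r)" using measurable_sets[OF F A] by (simp add: Filt_space)
  have top: "space M \<times> {r<..s} \<in> sets PT" using rect[of "space M"] sets.top[of "Ft r"] by (simp add: Filt_space)
  have "?f -` A \<inter> space PT = (F -` A \<inter> space M) \<times> {r<..s} \<union> (if 0 \<in> A then space PT - space M \<times> {r<..s} else {})"
    using rs by (auto simp: space_PT split: if_splits)
  also have "\<dots> \<in> sets PT" using rect[OF FA] top by auto
  finally show "?f -` A \<inter> space PT \<in> sets PT" .
qed simp

text \<open>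
  By \<open>emeasure_before_SUP\<close> the mass of the strict past is a countable supremum of elementary
  predictable processes.
\<close>

lemma measurable_before_PT: "(\<lambda>p. before (N (fst p)) (snd p)) \<in> PT \<rightarrow>\<^sub>M CS"
proof (rule measurable_beforeI)
  show "N (fst x) \<in> counting_measures E" if "x \<in> space PT" for x
    using that N_counting by (auto simp: space_PT)
  fix q :: real and B assume B: "B \<in> sets E"
  let ?g = "\<lambda>\<omega>. emeasure (N \<omega>) (({..q} \<times> UNIV) \<inter> B)"
  have Bsub: "B \<subseteq> {0..T} \<times> UNIV"
    using sets.sets_into_space[OF B] by (auto simp: intensity_def space_pair_measure)
  consider "q < 0" | "0 \<le> q" "q < T" | "T \<le> q" by linarith
  then show "(\<lambda>x. if q < snd x then emeasure (N (fst x)) (({..q} \<times> UNIV) \<inter> B) else 0) \<in> borel_measurable PT"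
  proof cases
    case 1
    then have e: "({..q} \<times> UNIV) \<inter> B = {}" using Bsub by auto
    have "(\<lambda>_. 0) \<in> borel_measurable PT" by simp
    then show ?thesis by (rule measurable_cong[THEN iffD1, rotated]) (simp only: e emeasure_empty if_cancel)
  next
    case 2
    have "?g \<in> borel_measurable (Ft q)"
    proof (rule measurableI)
      show "?g -` A \<inter> space (Ft q) \<in> sets (Ft q)" if "A \<in> sets borel" for A
        using past_event_in_Filt[OF 2 that B] by (simp add: Filt_space vimage_def Int_def conj_commute)
    qed simp
    from measurable_PT_step[OF this, of T] 2 have "(\<lambda>p. if q < snd p \<and> snd p \<le> T then ?g (fst p) else 0) \<in> borel_measurable PT" by simp
    then show ?thesis by (rule measurable_cong[THEN iffD1, rotated]) (auto simp: space_PT)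
  next
    case 3
    have "(\<lambda>_. 0) \<in> borel_measurable PT" by simp
    then show ?thesis by (rule measurable_cong[THEN iffD1, rotated]) (use 3 in \<open>auto simp: space_PT\<close>)
  qed
qed

lemma measurable_snd_PT: "snd \<in> PT \<rightarrow>\<^sub>M tm"
proof -
  have "snd \<in> borel_measurable PT"
  proof (rule borel_measurableI_greater)
    fix y :: real
    consider "y < 0" | "0 \<le> y" "y \<le> T" | "T < y" by linarith
    then show "{x \<in> space PT. y < snd x} \<in> sets PT"
    proof cases
      case 1
      then have e: "{x \<in> space PT. y < snd x} = space PT" by (auto simp: space_PT)
      show ?thesis unfolding e by (rule sets.top)
    next
      case 2
      then have e: "{x \<in> space PT. y < snd x} = space M \<times> {y<..T}" by (auto simp: space_PT)
      show ?thesis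
        unfolding e sets_PT PT_gen_def using 2 sets.top[of "Ft y"] by (intro sigma_sets.Basic UnI2) (auto simp: Filt_space)
    next
      case 3
      then have e: "{x \<in> space PT. y < snd x} = {}" by (auto simp: space_PT)
      show ?thesis unfolding e by (rule sets.empty_sets)
    qed
  qed
  then show ?thesis by (auto simp: measurable_into_time space_PT)
qed

lemma measurable_canonical:
  fixes \<phi> :: "_ \<Rightarrow> 'h::topological_space"
  assumes \<phi>: "\<phi> \<in> borel_measurable CTU"
  shows "(\<lambda>\<xi>. at_past \<phi> (N (fst (fst \<xi>))) (snd (fst \<xi>), snd \<xi>)) \<in> borel_measurable (PT \<Otimes>\<^sub>M borel)"
proof -
  note [measurable] = measurable_before_PT measurable_snd_PT
  have [measurable]: "snd \<in> PT \<Otimes>\<^sub>M borel \<rightarrow>\<^sub>M \<nu>"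
    using measurable_snd[of PT borel] by (simp add: measurable_cong_sets[OF refl sets_nu])
  have "(\<lambda>\<xi>. ((before (N (fst (fst \<xi>))) (snd (fst \<xi>)), snd (fst \<xi>)), snd \<xi>)) \<in> PT \<Otimes>\<^sub>M borel \<rightarrow>\<^sub>M CTU"
    by measurable
  from measurable_compose[OF this \<phi>] show ?thesis by (simp add: at_past_def)
qed

lemma measurable_canonical_shift:
  fixes \<phi> :: "_ \<Rightarrow> 'h::topological_space"
  assumes \<phi>: "\<phi> \<in> borel_measurable CTU"
  shows "(\<lambda>p. at_past (with_point (snd p) \<phi>) (N (fst (fst (fst p)))) (snd (fst (fst p)), snd (fst p))) \<in> borel_measurable ((PT \<Otimes>\<^sub>M (borel :: 'u measure)) \<Otimes>\<^sub>M E)"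
proof -
  have [measurable]: "(\<lambda>p. before (N (fst (fst (fst p)))) (snd (fst (fst p)))) \<in> (PT \<Otimes>\<^sub>M (borel :: 'u measure)) \<Otimes>\<^sub>M E \<rightarrow>\<^sub>M CS"
    by (rule measurable_compose[OF measurable_compose[OF measurable_fst measurable_fst] measurable_before_PT])
  have t [measurable]: "(\<lambda>p. snd (fst (fst p))) \<in> (PT \<Otimes>\<^sub>M (borel :: 'u measure)) \<Otimes>\<^sub>M E \<rightarrow>\<^sub>M tm"
    by (rule measurable_compose[OF measurable_compose[OF measurable_fst measurable_fst] measurable_snd_PT])
  then have [measurable]: "(\<lambda>p. snd (fst (fst p))) \<in> borel_measurable ((PT \<Otimes>\<^sub>M (borel :: 'u measure)) \<Otimes>\<^sub>M E)"
    by (simp add: measurable_into_time)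
  have "(\<lambda>p. fst (snd p)) \<in> (PT \<Otimes>\<^sub>M (borel :: 'u measure)) \<Otimes>\<^sub>M E \<rightarrow>\<^sub>M tm" by measurable
  then have [measurable]: "(\<lambda>p. fst (snd p)) \<in> borel_measurable ((PT \<Otimes>\<^sub>M (borel :: 'u measure)) \<Otimes>\<^sub>M E)"
    by (simp add: measurable_into_time)
  have "(\<lambda>p. snd (fst p)) \<in> (PT \<Otimes>\<^sub>M (borel :: 'u measure)) \<Otimes>\<^sub>M E \<rightarrow>\<^sub>M borel" by measurable
  then have [measurable]: "(\<lambda>p. snd (fst p)) \<in> (PT \<Otimes>\<^sub>M (borel :: 'u measure)) \<Otimes>\<^sub>M E \<rightarrow>\<^sub>M \<nu>"
    by (simp add: measurable_cong_sets[OF refl sets_nu])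
  have "(\<lambda>p. ((if fst (snd p) < snd (fst (fst p)) then add_point (before (N (fst (fst (fst p)))) (snd (fst (fst p)))) (snd p)
      else before (N (fst (fst (fst p)))) (snd (fst (fst p))), snd (fst (fst p))), snd (fst p))) \<in> (PT \<Otimes>\<^sub>M (borel :: 'u measure)) \<Otimes>\<^sub>M E \<rightarrow>\<^sub>M CTU"
    by measurable
  from measurable_compose[OF this \<phi>] show ?thesis unfolding at_past_def with_point_def fst_conv snd_conv .
qed

lemma measurable_canonical_PM:
  "\<phi> \<in> borel_measurable CTU \<Longrightarrow> (\<lambda>\<xi>. at_past \<phi> (N (fst (fst \<xi>))) (snd (fst \<xi>), snd \<xi>)) \<in> borel_measurable PM"
  using measurable_PT_PM[OF measurable_canonical refl] .

text \<open>
  The strict inequality \<open>u < v\<close> is needed, because the history contains the events at time \<open>u\<close> itself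
  and the strict past at time \<open>u\<close> does not.
\<close>

lemma history_determined_by_past:
  assumes "u < v"
  shows "sets (Hist u) \<subseteq> events_mod_null M (\<lambda>\<omega>. before (N \<omega>) v) CS"
proof -
  let ?G = "{{\<omega> \<in> space M. emeasure (N \<omega>) (({0..u} \<times> UNIV) \<inter> B) \<in> A} | A B. A \<in> sets borel \<and> B \<in> sets E}"
  have "(\<lambda>\<omega>. before (N \<omega>) v) \<in> space M \<rightarrow> space CS" using before_N by auto
  then interpret sigma_algebra "space M" "events_mod_null M (\<lambda>\<omega>. before (N \<omega>) v) CS" by (rule sigma_algebra_events_mod_null)
  have "?G \<subseteq> events_mod_null M (\<lambda>\<omega>. before (N \<omega>) v) CS"
  proof safe
    fix A :: "ennreal set" and B assume A: "A \<in> sets borel" "B \<in> sets E"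
    let ?C = "({0..u} \<times> UNIV) \<inter> B"
    let ?Z = "{\<eta> \<in> space CS. emeasure \<eta> ?C \<in> A}"
    have C: "?C \<in> sets E" by (rule time_cut_sets) (use A in auto)
    have "?Z \<in> sets CS" using measurable_sets[OF measurable_emeasure_counting_space[OF C] A(1)] by (simp add: vimage_def Int_def conj_commute)
    moreover have "emeasure (before (N \<omega>) v) ?C = emeasure (N \<omega>) ?C" if "\<omega> \<in> space M" for \<omega>
    proof -
      have "({..<v} \<times> UNIV) \<inter> ?C = ?C" using assms by auto
      then show ?thesis by (simp only: emeasure_before[OF sets_N[OF that] C])
    qed
    ultimately show "{\<omega> \<in> space M. emeasure (N \<omega>) ?C \<in> A} \<in> events_mod_null M (\<lambda>\<omega>. before (N \<omega>) v) CS"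
      unfolding events_mod_null_def using before_N
      by (auto intro!: bexI[of _ ?Z] AE_I2)
  qed
  then have "sigma_sets (space M) ?G \<subseteq> events_mod_null M (\<lambda>\<omega>. before (N \<omega>) v) CS" by (rule sigma_sets_subset)
  then show ?thesis unfolding history_props(4) using null_set_in_events by (intro sigma_sets_subset) auto
qed

definition past :: "('w \<times> real) \<times> 'u \<Rightarrow> ((real \<times> 'u) measure \<times> real) \<times> 'u" where
  "past \<xi> = ((before (N (fst (fst \<xi>))) (snd (fst \<xi>)), snd (fst \<xi>)), snd \<xi>)"

text \<open>
  A generating rectangle \<open>A \<times> (s,t]\<close> with \<open>A\<close> in the right-continuous \<open>\<sigma>\<close>-algebra at \<open>s\<close> is the union
  of the rectangles \<open>A \<times> (v,t]\<close> over a sequence \<open>v \<down> s\<close>, and for these \<open>A\<close> belongs to the strict past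
  of \<open>v\<close>, hence to that of every later time, up to null sets. The generators at time \<open>0\<close> are null sets.
\<close>

lemma predictable_determined_by_past: "sets PT \<subseteq> events_mod_null (M \<Otimes>\<^sub>M tm) (\<lambda>p. (before (N (fst p)) (snd p), snd p)) (CS \<Otimes>\<^sub>M tm)" (is "_ \<subseteq> ?G")
proof -
  let ?K = "\<lambda>p. (before (N (fst p)) (snd p), snd p)"
  have K: "?K \<in> space (M \<Otimes>\<^sub>M tm) \<rightarrow> space (CS \<Otimes>\<^sub>M tm)"
    using before_N by (auto simp: space_pair_measure)
  then interpret sigma_algebra "space (M \<Otimes>\<^sub>M tm)" ?G by (rule sigma_algebra_events_mod_null)
  have step: "C \<times> {v<..t} \<in> ?G" if C: "C \<in> sets (Hist u)" and uv: "u < v" "0 \<le> v" "t \<le> T" for C u v t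
  proof -
    have CM: "C \<subseteq> space M" using sets.sets_into_space[OF C] by (simp add: history_props(1))
    have "C \<in> events_mod_null M (\<lambda>\<omega>. before (N \<omega>) v) CS" using C history_determined_by_past[OF uv(1)] by blast
    then obtain Z where Z [measurable]: "Z \<in> sets CS" and ae: "AE \<omega> in M. \<omega> \<in> C \<longleftrightarrow> before (N \<omega>) v \<in> Z"
      by (auto simp: events_mod_null_def)
    let ?Z = "{p \<in> space (CS \<Otimes>\<^sub>M tm). before (fst p) v \<in> Z \<and> snd p \<in> {v<..t}}"
    have [measurable]: "(\<lambda>p. before (fst p) v) \<in> CS \<Otimes>\<^sub>M tm \<rightarrow>\<^sub>M CS" by (intro measurable_before) measurable
    have [measurable]: "{v<..t} \<in> sets tm" using uv by (intro Ioc_sets_tm) auto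
    have "?Z \<in> sets (CS \<Otimes>\<^sub>M tm)" by measurable
    moreover have "AE p in M \<Otimes>\<^sub>M tm. p \<in> C \<times> {v<..t} \<longleftrightarrow> ?K p \<in> ?Z"
      using AE_pair_fst[OF tm.sigma_finite_measure_axioms ae] AE_space
    proof eventually_elim
      case (elim p)
      then have s: "sets (N (fst p)) = sets E" and Ks: "?K p \<in> space (CS \<Otimes>\<^sub>M tm)"
        using sets_N K by (auto simp: space_pair_measure)
      show ?case
      proof (cases "snd p \<in> {v<..t}")
        case True
        then have "before (before (N (fst p)) (snd p)) v = before (N (fst p)) v"
          using s by (intro before_before) auto
        then show ?thesis using elim Ks True by (cases p) auto
      qed (cases p, auto)
    qed
    moreover have "C \<times> {v<..t} \<subseteq> space (M \<Otimes>\<^sub>M tm)" using CM uv by (auto simp: space_pair_measure)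
    ultimately show ?thesis unfolding events_mod_null_def by blast
  qed
  have "PT_gen \<subseteq> ?G"
    unfolding PT_gen_def
  proof (intro Un_least subsetI)
    fix P :: "('w \<times> real) set" assume "P \<in> {A \<times> {0} | A. A \<in> sets (Ft 0)}"
    then obtain A where P: "P = A \<times> {0}" "A \<in> sets M" using Filt_sub_M by auto
    have "emeasure (M \<Otimes>\<^sub>M tm) P = emeasure M A * emeasure tm {0}"
      unfolding P(1) using P(2) Ioc_sets_tm(2) by (rule tm.emeasure_pair_measure_Times)
    also have "emeasure tm {0} = 0" using null_time_singleton[of T 0] T_pos by simp
    finally have "P \<in> null_sets (M \<Otimes>\<^sub>M tm)" using P Ioc_sets_tm(2) by (auto simp: null_sets_def intro!: pair_measureI)
    then show "P \<in> ?G" by (rule null_set_in_events)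
  next
    fix P assume "P \<in> {A \<times> {s<..t} | A s t. 0 \<le> s \<and> s \<le> t \<and> t \<le> T \<and> A \<in> sets (Ft s)}"
    then obtain A s t where P: "P = A \<times> {s<..t}" "0 \<le> s" "s \<le> t" "t \<le> T" "A \<in> sets (Ft s)" by auto
    show "P \<in> ?G"
    proof (cases "s < T")
      case False
      then have "P = {}" using P by auto
      then show ?thesis by simp
    next
      case True
      \<comment> \<open>A sequence in \<open>(s,T]\<close> that decreases to \<open>s\<close>.\<close>
      define v where "v n = s + (T - s) / real (n + 1)" for n :: nat
      have v: "s < v n" "v n \<le> T" for n
      proof -
        have "0 < (T - s) / real (n + 1)" "(T - s) / real (n + 1) \<le> T - s"
          using True by (auto simp: divide_le_eq mult_le_cancel_left1)
        then show "s < v n" "v n \<le> T" unfolding v_def by linarith+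
      qed
      have "P = (\<Union>n. A \<times> {v n<..t})"
      proof (intro equalityI subsetI)
        fix x assume x: "x \<in> P"
        then have "0 < (snd x - s) / (T - s)" using P True by auto
        then obtain n where "inverse (real (Suc n)) < (snd x - s) / (T - s)" using reals_Archimedean by blast
        then have "v n < snd x" using True by (simp add: v_def field_simps)
        then show "x \<in> (\<Union>n. A \<times> {v n<..t})" using x P by (intro UN_I[of n]) auto
      next
        fix x assume "x \<in> (\<Union>n. A \<times> {v n<..t})"
        then obtain n where "x \<in> A \<times> {v n<..t}" by auto
        then show "x \<in> P" using P v(1)[of n] by auto
      qed
      moreover have "A \<times> {v n<..t} \<in> ?G" for n
      \<comment> \<open>A time strictly between \<open>s\<close> and \<open>v n\<close>: its history contains \<open>A\<close> and is contained in the strict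
        past of \<open>v n\<close>.\<close>
      proof (rule step[of A "(s + v n) / 2"])
        show "A \<in> sets (Hist ((s + v n) / 2))"
          using P(5) Filt_sub_history[of s "(s + v n) / 2"] v[of n] by auto
      qed (use v[of n] P in auto)
      ultimately show ?thesis by auto
    qed
  qed
  then have "sigma_sets (space (M \<Otimes>\<^sub>M tm)) PT_gen \<subseteq> ?G" by (rule sigma_sets_subset)
  then show ?thesis by (simp add: sets_PT space_pair_measure)
qed

lemma process_sets_determined_by_past: "sets (PT \<Otimes>\<^sub>M borel) \<subseteq> events_mod_null PM past CTU"
proof -
  have "past \<in> space PM \<rightarrow> space CTU"
    using before_N by (auto simp: space_pair_measure past_def process_measure_def)
  then interpret sigma_algebra "space PM" "events_mod_null PM past CTU" by (rule sigma_algebra_events_mod_null)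
  have sp: "space PM = space PT \<times> space borel"
    using sets_eq_imp_space_eq[OF sets_nu] by (auto simp: process_measure_def space_pair_measure space_PT)
  have "a \<times> b \<in> events_mod_null PM past CTU" if a: "a \<in> sets PT" and b: "b \<in> sets borel" for a b
  proof -
    have "a \<in> events_mod_null (M \<Otimes>\<^sub>M tm) (\<lambda>p. (before (N (fst p)) (snd p), snd p)) (CS \<Otimes>\<^sub>M tm)" using a predictable_determined_by_past by blast
    then obtain Z where Z: "Z \<in> sets (CS \<Otimes>\<^sub>M tm)" and ae: "AE p in M \<Otimes>\<^sub>M tm. p \<in> a \<longleftrightarrow> (before (N (fst p)) (snd p), snd p) \<in> Z"
      by (auto simp: events_mod_null_def)
    have "Z \<times> b \<in> sets CTU" using Z b sets_nu by auto
    moreover have "AE \<xi> in PM. \<xi> \<in> a \<times> b \<longleftrightarrow> past \<xi> \<in> Z \<times> b"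
      unfolding process_measure_def using AE_pair_fst[OF sigma_finite_nu ae]
      by eventually_elim (auto simp: past_def)
    moreover have "a \<times> b \<subseteq> space PM" unfolding sp using sets.sets_into_space[OF a] by auto
    ultimately show ?thesis unfolding events_mod_null_def by blast
  qed
  then have "sigma_sets (space PM) {a \<times> b | a b. a \<in> sets PT \<and> b \<in> sets borel} \<subseteq> events_mod_null PM past CTU"
    by (intro sigma_sets_subset) auto
  then show ?thesis unfolding sets_pair_measure sp .
qed

text \<open>
  The integrand \<open>\<phi>\<close> is a canonical form of the process: a function of the strict past of \<open>N\<close>.
\<close>

definition rep_by :: "('w, 'u, 'h::topological_space) process \<Rightarrow> ('u, 'h) integrand \<Rightarrow> bool" where
  "rep_by \<Phi> \<phi> \<longleftrightarrow> \<phi> \<in> borel_measurable CTU \<and> (AE \<xi> in PM. \<Phi> \<xi> = at_past \<phi> (N (fst (fst \<xi>))) (snd (fst \<xi>), snd \<xi>))"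

lemma ex_rep_by:
  fixes \<Phi> :: "_ \<Rightarrow> 'h::{banach, second_countable_topology}"
  assumes "\<Phi> \<in> borel_measurable (PT \<Otimes>\<^sub>M borel)"
  obtains \<phi> where "rep_by \<Phi> \<phi>"
proof -
  have "space (PT \<Otimes>\<^sub>M borel) = space PM"
    using sets_eq_imp_space_eq[OF sets_nu] by (auto simp: process_measure_def space_pair_measure space_PT)
  from factorisation_mod_null[OF assms this process_sets_determined_by_past]
  obtain \<phi> where "\<phi> \<in> borel_measurable CTU" "AE \<xi> in PM. \<Phi> \<xi> = \<phi> (past \<xi>)" .
  then show ?thesis by (intro that[of \<phi>]) (simp add: rep_by_def at_past_def past_def)
qed

end

section \<open>Existence of the stochastic integral\<close>

context poisson_setting
begin

abbreviation LP :: "real \<Rightarrow> ('w, 'u, 'h::real_normed_vector) process set" where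
  "LP p \<equiv> Lp_pr T \<nu> M N p"

lemma LP_D:
  assumes "\<Phi> \<in> LP p"
  shows "\<Phi> \<in> borel_measurable (PT \<Otimes>\<^sub>M borel)" "\<Phi> \<in> borel_measurable PM" "(\<integral>\<^sup>+\<xi>. ennreal (norm (\<Phi> \<xi>) powr p) \<partial>PM) < \<infinity>"
proof -
  show m: "\<Phi> \<in> borel_measurable (PT \<Otimes>\<^sub>M borel)" and "(\<integral>\<^sup>+\<xi>. ennreal (norm (\<Phi> \<xi>) powr p) \<partial>PM) < \<infinity>"
    using assms by (auto simp: Lp_pr_def Lp_fun_def)
  show "\<Phi> \<in> borel_measurable PM" using measurable_PT_PM[OF m refl] .
qed

lemma LP_I: "\<Phi> \<in> borel_measurable (PT \<Otimes>\<^sub>M borel) \<Longrightarrow> (\<integral>\<^sup>+\<xi>. ennreal (norm (\<Phi> \<xi>) powr p) \<partial>PM) < \<infinity> \<Longrightarrow> \<Phi> \<in> LP p"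
  by (auto simp: Lp_pr_def Lp_fun_def)

text \<open>
  Since the norms agree, \<open>L\<^sup>p\<close> statements about predictable processes translate into statements about
  integrands.
\<close>

lemma rep_by_moment:
  fixes \<Phi> :: "_ \<Rightarrow> 'h::{banach, second_countable_topology}"
  assumes "rep_by \<Phi> \<phi>"
  shows "moment p \<phi> = (\<integral>\<^sup>+\<xi>. ennreal (norm (\<Phi> \<xi>) powr p) \<partial>PM)"
proof -
  have m: "(\<lambda>\<xi>. at_past \<phi> (N (fst (fst \<xi>))) (snd (fst \<xi>), snd \<xi>)) \<in> borel_measurable PM"
    using assms by (intro measurable_canonical_PM) (simp add: rep_by_def)
  have "(\<integral>\<^sup>+\<xi>. ennreal (norm (\<Phi> \<xi>) powr p) \<partial>PM) = (\<integral>\<^sup>+\<xi>. ennreal (norm (at_past \<phi> (N (fst (fst \<xi>))) (snd (fst \<xi>), snd \<xi>)) powr p) \<partial>PM)"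
    using assms by (intro nn_integral_cong_AE) (auto simp: rep_by_def elim!: eventually_mono)
  also have "\<dots> = moment p \<phi>"
    unfolding moment_def using m by (subst nn_integral_PM) simp_all
  finally show ?thesis by simp
qed

lemma rep_by_integrands:
  fixes \<Phi> :: "_ \<Rightarrow> 'h::{banach, second_countable_topology}"
  assumes "rep_by \<Phi> \<phi>" "\<Phi> \<in> LP p" shows "\<phi> \<in> integrands p"
  using assms LP_D(3)[OF assms(2)] rep_by_moment[OF assms(1)] by (simp add: integrands_def rep_by_def)

lemma rep_by_lincomb:
  fixes \<Phi> \<Psi> :: "_ \<Rightarrow> 'h::{banach, second_countable_topology}"
  assumes "rep_by \<Phi> \<phi>" "rep_by \<Psi> \<psi>"
  shows "rep_by (\<lambda>\<xi>. a *\<^sub>R \<Phi> \<xi> + b *\<^sub>R \<Psi> \<xi>) (\<lambda>x. a *\<^sub>R \<phi> x + b *\<^sub>R \<psi> x)"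
proof -
  have [measurable]: "\<phi> \<in> borel_measurable CTU" "\<psi> \<in> borel_measurable CTU" using assms by (simp_all add: rep_by_def)
  have "AE \<xi> in PM. a *\<^sub>R \<Phi> \<xi> + b *\<^sub>R \<Psi> \<xi> = at_past (\<lambda>x. a *\<^sub>R \<phi> x + b *\<^sub>R \<psi> x) (N (fst (fst \<xi>))) (snd (fst \<xi>), snd \<xi>)"
    using assms[unfolded rep_by_def, THEN conjunct2] by eventually_elim (simp add: at_past_def)
  then show ?thesis by (simp add: rep_by_def)
qed

lemma rep_by_diff:
  fixes \<Phi> \<Psi> :: "_ \<Rightarrow> 'h::{banach, second_countable_topology}"
  assumes "rep_by \<Phi> \<phi>" "rep_by \<Psi> \<psi>"
  shows "rep_by (\<lambda>\<xi>. \<Phi> \<xi> - \<Psi> \<xi>) (\<lambda>x. \<phi> x - \<psi> x)"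
  using rep_by_lincomb[OF assms, of 1 "-1"] by simp

text \<open>
  Independent of the chosen \<open>\<phi>\<close> up to null sets, because \<open>is_integral\<close> respects almost everywhere
  equality of integrands.
\<close>

definition the_integral :: "real \<Rightarrow> ('w, 'u, 'h::{real_inner, banach, second_countable_topology}) process \<Rightarrow> 'w \<Rightarrow> 'h" where
  "the_integral p \<Phi> = (SOME X. \<exists>\<phi>. rep_by \<Phi> \<phi> \<and> is_integral p \<phi> X)"

lemma the_integral_is_integral:
  assumes p: "p \<in> {1..2}" and \<Phi>: "\<Phi> \<in> LP p" and r: "rep_by \<Phi> \<phi>"
  shows "is_integral p \<phi> (the_integral p \<Phi>)"
proof -
  obtain X where "is_integral p \<phi> X" using is_integral_exists[OF p rep_by_integrands[OF r \<Phi>]] by blast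
  then have "\<exists>X \<psi>. rep_by \<Phi> \<psi> \<and> is_integral p \<psi> X" using r by blast
  from someI_ex[OF this] obtain \<psi> where \<psi>: "rep_by \<Phi> \<psi>" "is_integral p \<psi> (the_integral p \<Phi>)" unfolding the_integral_def by blast
  have "moment p (\<lambda>x. \<psi> x - \<phi> x) = 0"
    using p by (simp add: rep_by_moment[OF rep_by_diff[OF \<psi>(1) r]])
  then show ?thesis using r by (intro is_integral_cong[OF p \<psi>(2)]) (auto simp: rep_by_def)
qed

lemma ex_rep_by_LP:
  fixes \<Phi> :: "_ \<Rightarrow> 'h::{banach, second_countable_topology}"
  assumes "\<Phi> \<in> LP p" obtains \<phi> where "rep_by \<Phi> \<phi>"
  using ex_rep_by[OF LP_D(1)[OF assms]] .

lemma LP_lincomb: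
  fixes \<Phi> \<Psi> :: "_ \<Rightarrow> 'h::{banach, second_countable_topology}"
  assumes \<Phi>: "\<Phi> \<in> LP p" and \<Psi>: "\<Psi> \<in> LP p" and p: "0 \<le> p"
  shows "(\<lambda>\<xi>. a *\<^sub>R \<Phi> \<xi> + b *\<^sub>R \<Psi> \<xi>) \<in> LP p"
proof (rule LP_I)
  note [measurable] = LP_D(1)[OF \<Phi>] LP_D(1)[OF \<Psi>]
  show "(\<lambda>\<xi>. a *\<^sub>R \<Phi> \<xi> + b *\<^sub>R \<Psi> \<xi>) \<in> borel_measurable (PT \<Otimes>\<^sub>M borel)" by measurable
  obtain \<phi> where \<phi>: "rep_by \<Phi> \<phi>" by (rule ex_rep_by_LP[OF \<Phi>])
  obtain \<psi> where \<psi>: "rep_by \<Psi> \<psi>" by (rule ex_rep_by_LP[OF \<Psi>])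
  show "(\<integral>\<^sup>+\<xi>. ennreal (norm (a *\<^sub>R \<Phi> \<xi> + b *\<^sub>R \<Psi> \<xi>) powr p) \<partial>PM) < \<infinity>"
    unfolding rep_by_moment[OF rep_by_lincomb[OF \<phi> \<psi>, of a b], symmetric]
    using integrandsD(2)[OF integrands_lincomb[OF rep_by_integrands[OF \<phi> \<Phi>] rep_by_integrands[OF \<psi> \<Psi>] p, of a b]] .
qed

lemma moment_le_indicator:
  fixes \<phi> :: "_ \<Rightarrow> 'h::{banach, second_countable_topology}"
  assumes A: "A \<in> sets E" and K: "0 \<le> K" and q: "0 < q"
    and le: "AE \<omega> in M. AE z in E. norm (at_past \<phi> (N \<omega>) z) \<le> K * indicator A z"
  shows "moment q \<phi> \<le> ennreal (K powr q) * emeasure E A"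
proof -
  have "moment q \<phi> \<le> (\<integral>\<^sup>+\<omega>. \<integral>\<^sup>+z. ennreal (K powr q) * indicator A z \<partial>E \<partial>M)"
    unfolding moment_def
  proof (rule nn_integral_mono_AE)
    show "AE \<omega> in M. (\<integral>\<^sup>+z. ennreal (norm (at_past \<phi> (N \<omega>) z) powr q) \<partial>E) \<le> (\<integral>\<^sup>+z. ennreal (K powr q) * indicator A z \<partial>E)"
      using le
    proof eventually_elim
      case (elim \<omega>)
      show ?case
      proof (rule nn_integral_mono_AE)
        show "AE z in E. ennreal (norm (at_past \<phi> (N \<omega>) z) powr q) \<le> ennreal (K powr q) * indicator A z"
          using elim
        proof eventually_elim
          case (elim z)
          then show ?case using q by (cases "z \<in> A") (auto intro!: ennreal_leI powr_mono2)
        qed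
      qed
    qed
  qed
  also have "\<dots> = ennreal (K powr q) * emeasure E A"
    using A by (simp add: nn_integral_cmult_indicator emeasure_space_1)
  finally show ?thesis .
qed

lemma measurable_elementary:
  fixes F :: "'w \<Rightarrow> 'h::{banach, second_countable_topology}"
  assumes F: "F \<in> borel_measurable (Ft r)" and rs: "0 \<le> r" "r \<le> s" "s \<le> T" and B: "B \<in> sets \<nu>"
  shows "(\<lambda>((\<omega>, t), y). indicator ({r<..s} \<times> B) (t, y) *\<^sub>R F \<omega>) \<in> borel_measurable (PT \<Otimes>\<^sub>M borel)"
proof -
  have [measurable]: "B \<in> sets borel" using B sets_nu by simp
  have [measurable]: "(\<lambda>\<xi>. if r < snd (fst \<xi>) \<and> snd (fst \<xi>) \<le> s then F (fst (fst \<xi>)) else 0) \<in> borel_measurable (PT \<Otimes>\<^sub>M (borel :: 'u measure))"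
    by (rule measurable_compose[OF measurable_fst measurable_PT_step[OF F rs]])
  have "(\<lambda>\<xi>. indicator B (snd \<xi>) *\<^sub>R (if r < snd (fst \<xi>) \<and> snd (fst \<xi>) \<le> s then F (fst (fst \<xi>)) else 0)) \<in> borel_measurable (PT \<Otimes>\<^sub>M borel)"
    by measurable
  also have "(\<lambda>\<xi>. indicator B (snd \<xi>) *\<^sub>R (if r < snd (fst \<xi>) \<and> snd (fst \<xi>) \<le> s then F (fst (fst \<xi>)) else 0)) =
    (\<lambda>((\<omega>, t), y). indicator ({r<..s} \<times> B) (t, y) *\<^sub>R F \<omega>)"
    by (auto simp: fun_eq_iff indicator_def)
  finally show ?thesis .
qed

lemma cylinder_sets: "0 \<le> r \<Longrightarrow> s \<le> T \<Longrightarrow> B \<in> sets \<nu> \<Longrightarrow> {r<..s} \<times> B \<in> sets E"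
  unfolding intensity_def using Ioc_sets_tm by (intro pair_measureI) auto

lemma emeasure_cylinder:
  assumes "0 \<le> r" "r \<le> s" "s \<le> T" "B \<in> sets \<nu>"
  shows "emeasure E ({r<..s} \<times> B) = ennreal (s - r) * emeasure \<nu> B"
proof -
  have "emeasure tm {r<..s} = emeasure lborel {r<..s}"
    unfolding time_measure_def using assms by (subst emeasure_restrict_space) auto
  then show ?thesis using assms Ioc_sets_tm
    unfolding intensity_def by (subst nu.emeasure_pair_measure_Times) auto
qed

lemma LP_elementary:
  fixes F :: "'w \<Rightarrow> 'h::{banach, second_countable_topology}"
  assumes F: "F \<in> borel_measurable (Ft r)" "bounded (F ` space M)" and rs: "0 \<le> r" "r \<le> s" "s \<le> T"
    and B: "B \<in> sets \<nu>" "emeasure \<nu> B < \<infinity>" and p: "0 < p"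
  shows "(\<lambda>((\<omega>, t), y). indicator ({r<..s} \<times> B) (t, y) *\<^sub>R F \<omega>) \<in> LP p" (is "?\<Phi> \<in> _")
proof (rule LP_I)
  show m: "?\<Phi> \<in> borel_measurable (PT \<Otimes>\<^sub>M borel)" by (rule measurable_elementary[OF F(1) rs B(1)])
  obtain \<phi> where \<phi>: "rep_by ?\<Phi> \<phi>" using ex_rep_by[OF m] .
  obtain K where K: "0 < K" "\<And>\<omega>. \<omega> \<in> space M \<Longrightarrow> norm (F \<omega>) \<le> K"
    using F(2) unfolding bounded_pos by auto
  have "AE \<omega> in M. AE z in E. norm (at_past \<phi> (N \<omega>) z) \<le> K * indicator ({r<..s} \<times> B) z"
    using AE_PM_D(1)[OF \<phi>[unfolded rep_by_def, THEN conjunct2]] AE_space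
  proof eventually_elim
    case (elim \<omega>)
    from elim(1) show ?case
    proof eventually_elim
      case (elim z)
      then have "norm (at_past \<phi> (N \<omega>) z) = norm (indicator ({r<..s} \<times> B) z *\<^sub>R F \<omega>)" by (simp add: case_prod_beta)
      then show ?case using K(2)[OF \<open>\<omega> \<in> space M\<close>] by (simp add: indicator_def)
    qed
  qed
  from moment_le_indicator[OF cylinder_sets[OF rs(1,3) B(1)] _ p this] K
  have "moment p \<phi> \<le> ennreal (K powr p) * emeasure E ({r<..s} \<times> B)" by simp
  also have "\<dots> < \<infinity>" using B by (simp add: emeasure_cylinder[OF rs B(1)] ennreal_mult_less_top)
  finally show "(\<integral>\<^sup>+\<xi>. ennreal (norm (?\<Phi> \<xi>) powr p) \<partial>PM) < \<infinity>" by (simp only: rep_by_moment[OF \<phi>])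
qed

text \<open>
  The random factor \<open>F\<close> is determined by the closed past at all times slightly after \<open>r\<close>, but not by the
  strict past at \<open>r\<close>. Therefore the interval is shortened to \<open>(v n, s]\<close> with \<open>v n \<down> r\<close>, where \<open>F\<close> is a
  function of the strict past of \<open>v n\<close>; there \<open>J\<close> can be computed, and the values converge as \<open>n \<rightarrow> \<infinity>\<close>.
\<close>

lemma the_integral_elementary:
  fixes F :: "'w \<Rightarrow> 'h::{real_inner, banach, second_countable_topology}"
  assumes p: "p \<in> {1..2}" and F: "F \<in> borel_measurable (Ft r)" "bounded (F ` space M)" and rs: "0 \<le> r" "r \<le> s" "s \<le> T"
    and B: "B \<in> sets \<nu>" "emeasure \<nu> B < \<infinity>"
  shows "AE \<omega> in M. the_integral p (\<lambda>((\<omega>, t), y). indicator ({r<..s} \<times> B) (t, y) *\<^sub>R F \<omega>) \<omega> =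
    (measure (N \<omega>) ({r<..s} \<times> B) - measure E ({r<..s} \<times> B)) *\<^sub>R F \<omega>"
proof -
  let ?\<Phi> = "\<lambda>((\<omega>, t), y). indicator ({r<..s} \<times> B) (t, y) *\<^sub>R F \<omega>"
  have p1: "1 \<le> p" "p \<le> 2" "0 < p" "0 \<le> p" using p by auto
  have \<Phi>: "?\<Phi> \<in> LP p" by (rule LP_elementary[OF F rs B p1(3)])
  obtain \<phi> where \<phi>: "rep_by ?\<Phi> \<phi>" by (rule ex_rep_by_LP[OF \<Phi>])
  have L: "is_integral p \<phi> (the_integral p ?\<Phi>)" by (rule the_integral_is_integral[OF p \<Phi> \<phi>])
  obtain K where K: "0 < K" "\<And>\<omega>. \<omega> \<in> space M \<Longrightarrow> norm (F \<omega>) \<le> K"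
    using F(2) unfolding bounded_pos by auto
  \<comment> \<open>A sequence in \<open>[r,s]\<close> that decreases to \<open>r\<close>, strictly above \<open>r\<close> if \<open>r < s\<close>.\<close>
  define v where "v n = r + (s - r) / real (n + 1)" for n :: nat
  define cyl where "cyl n = {v n<..s} \<times> B" for n
  have v: "r \<le> v n" "v n \<le> s" for n
  proof -
    have "0 \<le> (s - r) / real (n + 1)" "(s - r) / real (n + 1) \<le> s - r"
      using rs by (auto simp: divide_le_eq mult_le_cancel_left1)
    then show "r \<le> v n" "v n \<le> s" unfolding v_def by linarith+
  qed
  have v_strict: "r < v n" if "r < s" for n using that by (simp add: v_def)
  have cyl [measurable]: "cyl n \<in> sets E" and full: "{r<..s} \<times> B \<in> sets E" for n
    unfolding cyl_def using v[of n] rs B by (auto intro!: cylinder_sets)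
  have cylfin: "emeasure E (cyl n) < \<infinity>" "emeasure E ({r<..s} \<times> B) < \<infinity>" for n
    unfolding cyl_def using v[of n] rs B emeasure_cylinder[of "v n" s B] emeasure_cylinder[of r s B]
    by (simp_all add: ennreal_mult_less_top)
  have ex: "\<exists>f. f \<in> borel_measurable CS \<and> (AE \<omega> in M. v n < s \<longrightarrow> F \<omega> = f (before (N \<omega>) (v n)))" for n
  proof (cases "r < s")
    case True
    \<comment> \<open>A time strictly between \<open>r\<close> and \<open>v n\<close>, as required for its history to belong to the strict past
      of \<open>v n\<close>.\<close>
    let ?u = "(r + v n) / 2"
    have u: "r < ?u" "?u < v n" "?u \<le> T" using v_strict[OF True, of n] v[of n] rs by auto
    have "F \<in> borel_measurable (Hist ?u)"
    proof (rule measurableI)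
      fix A :: "'h set" assume "A \<in> sets borel"
      then have "F -` A \<inter> space M \<in> sets (Ft r)" using measurable_sets[OF F(1)] by (simp add: Filt_space)
      then show "F -` A \<inter> space (Hist ?u) \<in> sets (Hist ?u)"
        using Filt_sub_history[OF u(1,3)] by (auto simp: history_props(1))
    qed simp
    from factorisation_mod_null[OF this history_props(1) history_determined_by_past[OF u(2)]]
    obtain f where "f \<in> borel_measurable CS" "AE \<omega> in M. F \<omega> = f (before (N \<omega>) (v n))" .
    then show ?thesis by (intro exI[of _ f]) auto
  next
    case False
    then have "\<not> v n < s" using v[of n] rs by auto
    then show ?thesis by (intro exI[of _ "\<lambda>_. 0"]) simp
  qed
  obtain f where f0: "\<forall>n. f n \<in> borel_measurable CS \<and> (AE \<omega> in M. v n < s \<longrightarrow> F \<omega> = f n (before (N \<omega>) (v n)))"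
    using choice[OF allI[OF ex]] by (rule exE)
  have f [measurable]: "f n \<in> borel_measurable CS"
    and fF: "AE \<omega> in M. v n < s \<longrightarrow> F \<omega> = f n (before (N \<omega>) (v n))" for n
    using f0[rule_format, of n] by (rule conjunct1, rule conjunct2)
  define \<psi> where "\<psi> n x = indicator (cyl n) (snd (fst x), snd x) *\<^sub>R f n (before (fst (fst x)) (v n))" for n x
  note [measurable] = measurable_time_point
  have [measurable]: "(\<lambda>x. before (fst (fst x)) (v n)) \<in> CTU \<rightarrow>\<^sub>M CS" for n by (rule measurable_before) measurable
  have \<psi>m: "\<psi> n \<in> borel_measurable CTU" for n unfolding \<psi>_def by measurable
  have at_past\<psi>: "AE \<omega> in M. \<forall>n. \<forall>z. at_past (\<psi> n) (N \<omega>) z = indicator (cyl n) z *\<^sub>R F \<omega>"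
    unfolding AE_all_countable
  proof
    fix n
    show "AE \<omega> in M. \<forall>z. at_past (\<psi> n) (N \<omega>) z = indicator (cyl n) z *\<^sub>R F \<omega>"
      using fF[of n] AE_space
    proof eventually_elim
      case (elim \<omega>)
      show ?case
      proof
        fix z
        show "at_past (\<psi> n) (N \<omega>) z = indicator (cyl n) z *\<^sub>R F \<omega>"
        proof (cases "z \<in> cyl n")
          case True
          then have "v n < fst z" "v n < s" by (auto simp: cyl_def)
          then have "before (before (N \<omega>) (fst z)) (v n) = before (N \<omega>) (v n)"
            using sets_N[OF elim(2)] by (intro before_before) auto
          then show ?thesis using elim(1) \<open>v n < s\<close> by (simp add: at_past_def \<psi>_def)
        qed (simp add: at_past_def \<psi>_def)
      qed
    qed
  qed
  have \<psi>C: "\<psi> n \<in> integrands q" if "0 < q" for n q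
  proof -
    have "AE \<omega> in M. AE z in E. norm (at_past (\<psi> n) (N \<omega>) z) \<le> K * indicator (cyl n) z"
      using at_past\<psi> AE_space by eventually_elim (use K in \<open>auto simp: indicator_def\<close>)
    from moment_le_indicator[OF cyl _ that this] K
    have "moment q (\<psi> n) \<le> ennreal (K powr q) * emeasure E (cyl n)" by simp
    also have "\<dots> < \<infinity>" using cylfin by (simp add: ennreal_mult_less_top)
    finally show ?thesis using \<psi>m by (simp add: integrands_def)
  qed
  have lim\<psi>: "(\<lambda>n. moment p (\<lambda>x. \<phi> x - \<psi> n x)) \<longlonglongrightarrow> 0"
  proof (rule ennreal_tendsto_0_le)
    fix n
    have "AE \<omega> in M. AE z in E. norm (at_past (\<lambda>x. \<phi> x - \<psi> n x) (N \<omega>) z) \<le> K * indicator ({r<..v n} \<times> B) z"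
      using AE_PM_D(1)[OF \<phi>[unfolded rep_by_def, THEN conjunct2]] at_past\<psi> AE_space
    proof eventually_elim
      case (elim \<omega>)
      note e = elim
      from elim(1) show ?case
      proof eventually_elim
        case (elim z)
        then have "at_past (\<lambda>x. \<phi> x - \<psi> n x) (N \<omega>) z = indicator ({r<..s} \<times> B) z *\<^sub>R F \<omega> - indicator (cyl n) z *\<^sub>R F \<omega>"
          using e(2)[rule_format, of n z] by (simp add: at_past_comp2[of "(-)"] case_prod_beta)
        then show ?case using K(2)[OF e(3)] K(1) v[of n] by (cases z) (auto simp: indicator_def cyl_def)
      qed
    qed
    from moment_le_indicator[OF _ _ p1(3) this] K v[of n] rs
    show "moment p (\<lambda>x. \<phi> x - \<psi> n x) \<le> ennreal (K powr p) * (emeasure \<nu> B * ennreal ((s - r) / real (n + 1)))"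
      using cylinder_sets[of r "v n" B] B emeasure_cylinder[of r "v n" B] by (simp add: v_def mult.commute)
  next
    have "(\<lambda>n. (s - r) / real (n + 1)) \<longlonglongrightarrow> 0"
      using tendsto_mult_right_zero[OF LIMSEQ_inverse_real_of_nat, of "s - r"] by (simp add: divide_inverse)
    then have "(\<lambda>n. ennreal ((s - r) / real (n + 1))) \<longlonglongrightarrow> ennreal 0" by (rule tendsto_ennrealI)
    then have "(\<lambda>n. ennreal (K powr p) * (emeasure \<nu> B * ennreal ((s - r) / real (n + 1)))) \<longlonglongrightarrow> ennreal (K powr p) * (emeasure \<nu> B * ennreal 0)"
      using B by (intro ennreal_tendsto_cmult) auto
    then show "(\<lambda>n. ennreal (K powr p) * (emeasure \<nu> B * ennreal ((s - r) / real (n + 1)))) \<longlonglongrightarrow> 0" by simp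
  qed
  have lim: "(\<lambda>n. mean_pow p (\<lambda>\<omega>. the_integral p ?\<Phi> \<omega> - J (\<psi> n) (N \<omega>))) \<longlonglongrightarrow> 0"
    by (rule is_integralD(3)[OF L _ lim\<psi>]) (use \<psi>C p1 in auto)
  obtain g :: "nat \<Rightarrow> nat" where g: "strict_mono g" "AE \<omega> in M. (\<lambda>k. the_integral p ?\<Phi> \<omega> - J (\<psi> (g k)) (N \<omega>)) \<longlonglongrightarrow> 0"
  proof (rule mean_pow_AE_subseq[OF _ p1(1,2) lim])
    show "(\<lambda>\<omega>. the_integral p ?\<Phi> \<omega> - J (\<psi> k) (N \<omega>)) \<in> borel_measurable M" for k
      by (intro borel_measurable_diff is_integralD(2)[OF L] measurable_J_N \<psi>m)
  qed (rule that)
  have finN: "AE \<omega> in M. emeasure (N \<omega>) ({r<..s} \<times> B) \<noteq> \<infinity>"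
    using expectation_N[OF full cylfin(2)] cylfin(2) by (intro nn_integral_PInf_AE measurable_N_emeasure full) auto
  have cyl_inc: "incseq cyl" and cyl_Un: "(\<Union>n. cyl n) = {r<..s} \<times> B"
  proof -
    have "v n \<le> v m" if "m \<le> n" for m n
      using that rs unfolding v_def by (intro add_left_mono frac_le) auto
    then show "incseq cyl" unfolding incseq_def cyl_def by (fastforce intro: le_less_trans)
    show "(\<Union>n. cyl n) = {r<..s} \<times> B"
    proof (intro equalityI subsetI)
      fix z assume z: "z \<in> {r<..s} \<times> B"
      show "z \<in> (\<Union>n. cyl n)"
      proof -
        have "0 < (fst z - r) / (s - r)" using z by auto
        then obtain n where "inverse (real (Suc n)) < (fst z - r) / (s - r)" using reals_Archimedean by blast
        then have "v n < fst z" using z by (auto simp: v_def field_simps)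
        then show ?thesis using z by (intro UN_I[of n]) (auto simp: cyl_def)
      qed
    next
      fix z assume "z \<in> (\<Union>n. cyl n)"
      then obtain n where "z \<in> cyl n" by auto
      then show "z \<in> {r<..s} \<times> B" using v(1)[of n] by (auto simp: cyl_def)
    qed
  qed
  show ?thesis
    using g(2) at_past\<psi> AE_finite_on_cells finN AE_space
  proof eventually_elim
    case (elim \<omega>)
    have sN: "sets (N \<omega>) = sets E" by (rule sets_N[OF elim(5)])
    have subc: "cyl n \<subseteq> {r<..s} \<times> B" for n unfolding cyl_Un[symmetric] by auto
    have finc: "emeasure (N \<omega>) (cyl n) < \<infinity>" for n
      using emeasure_mono[OF subc, of "N \<omega>" n] full sN elim(4) by (auto simp: top.not_eq_extremum intro: le_less_trans)
    have int: "(\<integral>z. indicator (cyl n) z *\<^sub>R F \<omega> \<partial>\<mu>) = measure \<mu> (cyl n) *\<^sub>R F \<omega>"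
      if "sets \<mu> = sets E" "emeasure \<mu> (cyl n) < \<infinity>" for \<mu> n
    proof -
      have "(\<integral>z. indicator (cyl n) z *\<^sub>R F \<omega> \<partial>\<mu>) = (\<integral>z. indicator (cyl n) z \<partial>\<mu>) *\<^sub>R F \<omega>"
        using that cyl[of n] by (intro integral_scaleR_left) auto
      also have "(\<integral>z. indicator (cyl n) z \<partial>\<mu>) = measure \<mu> (cyl n)"
        using that cyl[of n] sets.sets_into_space[of "cyl n" \<mu>] by (simp add: Int_absorb2)
      finally show ?thesis .
    qed
    have Jeq: "J (\<psi> n) (N \<omega>) = (measure (N \<omega>) (cyl n) - measure E (cyl n)) *\<^sub>R F \<omega>" for n
    proof -
      have l: "at_past (\<psi> n) (N \<omega>) = (\<lambda>z. indicator (cyl n) z *\<^sub>R F \<omega>)" using elim(2) by (auto simp: fun_eq_iff)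
      show ?thesis unfolding J_def l
        using elim(3) int[OF sN finc] int[OF refl cylfin(1)] by (simp add: scaleR_diff_left)
    qed
    have "(\<lambda>n. measure (N \<omega>) (cyl n)) \<longlonglongrightarrow> measure (N \<omega>) (\<Union>n. cyl n)"
      by (rule Lim_measure_incseq[OF _ cyl_inc]) (use cyl sN elim(4) cyl_Un in auto)
    moreover have "(\<lambda>n. measure E (cyl n)) \<longlonglongrightarrow> measure E (\<Union>n. cyl n)"
      by (rule Lim_measure_incseq[OF _ cyl_inc]) (use cyl cylfin(2) cyl_Un in auto)
    ultimately have "(\<lambda>n. (measure (N \<omega>) (cyl n) - measure E (cyl n)) *\<^sub>R F \<omega>) \<longlonglongrightarrow>
      (measure (N \<omega>) (\<Union>n. cyl n) - measure E (\<Union>n. cyl n)) *\<^sub>R F \<omega>" by (intro tendsto_intros)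
    then have "(\<lambda>n. J (\<psi> n) (N \<omega>)) \<longlonglongrightarrow> (measure (N \<omega>) ({r<..s} \<times> B) - measure E ({r<..s} \<times> B)) *\<^sub>R F \<omega>"
      by (simp only: Jeq cyl_Un)
    from LIMSEQ_subseq_LIMSEQ[OF this g(1)]
    have l1: "(\<lambda>k. J (\<psi> (g k)) (N \<omega>)) \<longlonglongrightarrow> (measure (N \<omega>) ({r<..s} \<times> B) - measure E ({r<..s} \<times> B)) *\<^sub>R F \<omega>"
      by (simp add: comp_def)
    have "(\<lambda>k. (the_integral p ?\<Phi> \<omega> - J (\<psi> (g k)) (N \<omega>)) + J (\<psi> (g k)) (N \<omega>)) \<longlonglongrightarrow> 0 + (measure (N \<omega>) ({r<..s} \<times> B) - measure E ({r<..s} \<times> B)) *\<^sub>R F \<omega>"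
      by (rule tendsto_add[OF elim(1) l1])
    then show ?case by (simp add: LIMSEQ_const_iff)
  qed
qed

theorem the_integral_is_stochastic_integral_map:
  assumes p: "p \<in> {1..2}"
  shows "stochastic_integral_map T \<nu> M N p (the_integral p :: ('w, 'u, 'h::{real_inner, banach, second_countable_topology}) process \<Rightarrow> _)"
  unfolding stochastic_integral_map_def
proof (intro conjI ballI allI impI)
  have p1: "1 \<le> p" "p \<le> 2" "0 < p" "0 \<le> p" using p by auto
  obtain c where c: "0 < c" "\<And>(\<phi> :: _ \<Rightarrow> 'h) X. is_integral p \<phi> X \<Longrightarrow> mean_pow p X \<le> ennreal c * moment p \<phi>"
    using is_integral_bound[OF p] by blast
  {
    fix \<Phi> :: "_ \<Rightarrow> 'h" assume \<Phi>: "\<Phi> \<in> LP p"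
    obtain \<phi> where \<phi>: "rep_by \<Phi> \<phi>" by (rule ex_rep_by_LP[OF \<Phi>])
    note L = the_integral_is_integral[OF p \<Phi> \<phi>]
    have "mean_pow p (the_integral p \<Phi>) \<le> ennreal c * moment p \<phi>" by (rule c(2)[OF L])
    also have "\<dots> < \<infinity>" using integrandsD(2)[OF is_integralD(1)[OF L]] by (simp add: ennreal_mult_less_top)
    finally show "the_integral p \<Phi> \<in> Lp_fun M M p" using is_integralD(2)[OF L] by (simp add: Lp_fun_def mean_pow_def)
  }
  {
    fix \<Phi> \<Psi> :: "_ \<Rightarrow> 'h" and a b :: real assume \<Phi>: "\<Phi> \<in> LP p" and \<Psi>: "\<Psi> \<in> LP p"
    obtain \<phi> where \<phi>: "rep_by \<Phi> \<phi>" by (rule ex_rep_by_LP[OF \<Phi>])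
    obtain \<psi> where \<psi>: "rep_by \<Psi> \<psi>" by (rule ex_rep_by_LP[OF \<Psi>])
    show "AE \<omega> in M. the_integral p (\<lambda>\<xi>. a *\<^sub>R \<Phi> \<xi> + b *\<^sub>R \<Psi> \<xi>) \<omega> = a *\<^sub>R the_integral p \<Phi> \<omega> + b *\<^sub>R the_integral p \<Psi> \<omega>"
      by (rule is_integral_unique[OF p p the_integral_is_integral[OF p LP_lincomb[OF \<Phi> \<Psi> p1(4)] rep_by_lincomb[OF \<phi> \<psi>]]
          is_integral_lincomb[OF p the_integral_is_integral[OF p \<Phi> \<phi>] the_integral_is_integral[OF p \<Psi> \<psi>]]])
  }
  {
    fix \<Phi>s :: "nat \<Rightarrow> _ \<Rightarrow> 'h" and \<Phi>
    assume \<Phi>: "\<Phi> \<in> LP p" and *: "(\<forall>n. \<Phi>s n \<in> LP p) \<and> (\<lambda>n. \<integral>\<^sup>+\<xi>. ennreal (norm (\<Phi>s n \<xi> - \<Phi> \<xi>) powr p) \<partial>PM) \<longlonglongrightarrow> 0"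
    obtain \<phi> where \<phi>: "rep_by \<Phi> \<phi>" by (rule ex_rep_by_LP[OF \<Phi>])
    show "(\<lambda>n. \<integral>\<^sup>+\<omega>. ennreal (norm (the_integral p (\<Phi>s n) \<omega> - the_integral p \<Phi> \<omega>) powr p) \<partial>M) \<longlonglongrightarrow> 0"
    proof (rule ennreal_tendsto_0_le)
      show "(\<lambda>n. ennreal c * (\<integral>\<^sup>+\<xi>. ennreal (norm (\<Phi>s n \<xi> - \<Phi> \<xi>) powr p) \<partial>PM)) \<longlonglongrightarrow> 0"
        using ennreal_tendsto_cmult[OF _ *[THEN conjunct2], of "ennreal c"] by simp
      fix n
      have \<Phi>n: "\<Phi>s n \<in> LP p" using * by blast
      obtain \<psi> where \<psi>: "rep_by (\<Phi>s n) \<psi>" by (rule ex_rep_by_LP[OF \<Phi>n])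
      have "is_integral p (\<lambda>x. 1 *\<^sub>R \<psi> x + (-1) *\<^sub>R \<phi> x) (\<lambda>\<omega>. 1 *\<^sub>R the_integral p (\<Phi>s n) \<omega> + (-1) *\<^sub>R the_integral p \<Phi> \<omega>)"
        by (rule is_integral_lincomb[OF p the_integral_is_integral[OF p \<Phi>n \<psi>] the_integral_is_integral[OF p \<Phi> \<phi>]])
      then have "is_integral p (\<lambda>x. \<psi> x - \<phi> x) (\<lambda>\<omega>. the_integral p (\<Phi>s n) \<omega> - the_integral p \<Phi> \<omega>)" by simp
      from c(2)[OF this] show "(\<integral>\<^sup>+\<omega>. ennreal (norm (the_integral p (\<Phi>s n) \<omega> - the_integral p \<Phi> \<omega>) powr p) \<partial>M) \<le>
        ennreal c * (\<integral>\<^sup>+\<xi>. ennreal (norm (\<Phi>s n \<xi> - \<Phi> \<xi>) powr p) \<partial>PM)"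
        by (simp only: mean_pow_def rep_by_moment[OF rep_by_diff[OF \<psi> \<phi>]])
    qed
  }
  fix r s :: real and F :: "'w \<Rightarrow> 'h" and B :: "'u set"
  assume "0 \<le> r \<and> r \<le> s \<and> s \<le> T \<and> F \<in> borel_measurable (Ft r) \<and> bounded (F ` space M) \<and> B \<in> sets \<nu> \<and> emeasure \<nu> B < \<infinity>"
  then show "AE \<omega> in M. the_integral p (\<lambda>((\<omega>, t), y). indicator ({r<..s} \<times> B) (t, y) *\<^sub>R F \<omega>) \<omega> =
    (measure (N \<omega>) ({r<..s} \<times> B) - measure E ({r<..s} \<times> B)) *\<^sub>R F \<omega>"
    by (intro the_integral_elementary p) auto
qed

end

section \<open>Uniqueness of the stochastic integral\<close>

context poisson_setting
begin

lemma stochastic_integral_mapD: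
  fixes I :: "('w, 'u, 'h::real_normed_vector) process \<Rightarrow> 'w \<Rightarrow> 'h"
  assumes I: "stochastic_integral_map T \<nu> M N p I"
  shows "\<Phi> \<in> LP p \<Longrightarrow> I \<Phi> \<in> Lp_fun M M p"
    and "\<Phi> \<in> LP p \<Longrightarrow> \<Psi> \<in> LP p \<Longrightarrow> AE \<omega> in M. I (\<lambda>\<xi>. a *\<^sub>R \<Phi> \<xi> + b *\<^sub>R \<Psi> \<xi>) \<omega> = a *\<^sub>R I \<Phi> \<omega> + b *\<^sub>R I \<Psi> \<omega>"
    and "\<Phi> \<in> LP p \<Longrightarrow> (\<forall>n::nat. \<Phi>s n \<in> LP p) \<Longrightarrow>
      (\<lambda>n. \<integral>\<^sup>+\<xi>. ennreal (norm (\<Phi>s n \<xi> - \<Phi> \<xi>) powr p) \<partial>PM) \<longlonglongrightarrow> 0 \<Longrightarrow>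
      (\<lambda>n. \<integral>\<^sup>+\<omega>. ennreal (norm (I (\<Phi>s n) \<omega> - I \<Phi> \<omega>) powr p) \<partial>M) \<longlonglongrightarrow> 0"
    and "0 \<le> r \<Longrightarrow> r \<le> s \<Longrightarrow> s \<le> T \<Longrightarrow> F \<in> borel_measurable (Ft r) \<Longrightarrow> bounded (F ` space M) \<Longrightarrow>
      B \<in> sets \<nu> \<Longrightarrow> emeasure \<nu> B < \<infinity> \<Longrightarrow>
      AE \<omega> in M. I (\<lambda>((\<omega>, t), y). indicator ({r<..s} \<times> B) (t, y) *\<^sub>R F \<omega>) \<omega> =
        (measure (N \<omega>) ({r<..s} \<times> B) - measure E ({r<..s} \<times> B)) *\<^sub>R F \<omega>"
proof -
  note c = I[unfolded stochastic_integral_map_def]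
  show "\<Phi> \<in> LP p \<Longrightarrow> I \<Phi> \<in> Lp_fun M M p" by (rule c[THEN conjunct1, rule_format])
  show "\<Phi> \<in> LP p \<Longrightarrow> \<Psi> \<in> LP p \<Longrightarrow> AE \<omega> in M. I (\<lambda>\<xi>. a *\<^sub>R \<Phi> \<xi> + b *\<^sub>R \<Psi> \<xi>) \<omega> = a *\<^sub>R I \<Phi> \<omega> + b *\<^sub>R I \<Psi> \<omega>"
    by (rule c[THEN conjunct2, THEN conjunct1, rule_format])
  show "\<Phi> \<in> LP p \<Longrightarrow> (\<forall>n::nat. \<Phi>s n \<in> LP p) \<Longrightarrow>
      (\<lambda>n. \<integral>\<^sup>+\<xi>. ennreal (norm (\<Phi>s n \<xi> - \<Phi> \<xi>) powr p) \<partial>PM) \<longlonglongrightarrow> 0 \<Longrightarrow>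
      (\<lambda>n. \<integral>\<^sup>+\<omega>. ennreal (norm (I (\<Phi>s n) \<omega> - I \<Phi> \<omega>) powr p) \<partial>M) \<longlonglongrightarrow> 0"
    by (rule c[THEN conjunct2, THEN conjunct2, THEN conjunct1, THEN spec, THEN bspec, THEN mp, OF _ conjI])
  show "0 \<le> r \<Longrightarrow> r \<le> s \<Longrightarrow> s \<le> T \<Longrightarrow> F \<in> borel_measurable (Ft r) \<Longrightarrow> bounded (F ` space M) \<Longrightarrow>
      B \<in> sets \<nu> \<Longrightarrow> emeasure \<nu> B < \<infinity> \<Longrightarrow>
      AE \<omega> in M. I (\<lambda>((\<omega>, t), y). indicator ({r<..s} \<times> B) (t, y) *\<^sub>R F \<omega>) \<omega> =
        (measure (N \<omega>) ({r<..s} \<times> B) - measure E ({r<..s} \<times> B)) *\<^sub>R F \<omega>"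
    by (rule c[THEN conjunct2, THEN conjunct2, THEN conjunct2, THEN spec, THEN spec, THEN spec, THEN spec, THEN mp]) (intro conjI)
qed

text \<open>
  The processes at which two candidates for the stochastic integral coincide; a linear space that is
  closed in \<open>L\<^sup>p\<close>.
\<close>

definition agree :: "real \<Rightarrow> (('w, 'u, 'h) process \<Rightarrow> 'w \<Rightarrow> 'h) \<Rightarrow> (('w, 'u, 'h) process \<Rightarrow> 'w \<Rightarrow> 'h) \<Rightarrow>
    ('w, 'u, 'h::real_normed_vector) process set" where
  "agree p I I' = {\<Phi> \<in> LP p. AE \<omega> in M. I \<Phi> \<omega> = I' \<Phi> \<omega>}"

context
  fixes p :: real and I I' :: "('w, 'u, 'h::{real_inner, banach, second_countable_topology}) process \<Rightarrow> 'w \<Rightarrow> 'h"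
  assumes p: "p \<in> {1..2}" and I: "stochastic_integral_map T \<nu> M N p I" and I': "stochastic_integral_map T \<nu> M N p I'"
begin

lemma p_bounds: "1 \<le> p" "p \<le> 2" "0 < p" "0 \<le> p"
  using p by auto

lemma map_measurable: "\<Phi> \<in> LP p \<Longrightarrow> I \<Phi> \<in> borel_measurable M" "\<Phi> \<in> LP p \<Longrightarrow> I' \<Phi> \<in> borel_measurable M"
  using stochastic_integral_mapD(1)[OF I, of \<Phi>] stochastic_integral_mapD(1)[OF I', of \<Phi>] by (simp_all add: Lp_fun_def)

lemma agree_lincomb:
  assumes "\<Phi> \<in> agree p I I'" "\<Psi> \<in> agree p I I'"
  shows "(\<lambda>\<xi>. a *\<^sub>R \<Phi> \<xi> + b *\<^sub>R \<Psi> \<xi>) \<in> agree p I I'"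
proof -
  have LP: "\<Phi> \<in> LP p" "\<Psi> \<in> LP p" and eq: "AE \<omega> in M. I \<Phi> \<omega> = I' \<Phi> \<omega>" "AE \<omega> in M. I \<Psi> \<omega> = I' \<Psi> \<omega>"
    using assms by (auto simp: agree_def)
  have lin: "AE \<omega> in M. I (\<lambda>\<xi>. a *\<^sub>R \<Phi> \<xi> + b *\<^sub>R \<Psi> \<xi>) \<omega> = a *\<^sub>R I \<Phi> \<omega> + b *\<^sub>R I \<Psi> \<omega>"
    "AE \<omega> in M. I' (\<lambda>\<xi>. a *\<^sub>R \<Phi> \<xi> + b *\<^sub>R \<Psi> \<xi>) \<omega> = a *\<^sub>R I' \<Phi> \<omega> + b *\<^sub>R I' \<Psi> \<omega>"
    by (rule stochastic_integral_mapD(2)[OF I LP], rule stochastic_integral_mapD(2)[OF I' LP])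
  have "AE \<omega> in M. I (\<lambda>\<xi>. a *\<^sub>R \<Phi> \<xi> + b *\<^sub>R \<Psi> \<xi>) \<omega> = I' (\<lambda>\<xi>. a *\<^sub>R \<Phi> \<xi> + b *\<^sub>R \<Psi> \<xi>) \<omega>"
    using eq lin by eventually_elim simp
  then show ?thesis using LP_lincomb[OF LP p_bounds(4)] by (simp add: agree_def)
qed

lemma agree_limit:
  assumes \<Phi>s: "\<And>n. \<Phi>s n \<in> agree p I I'" and \<Phi>: "\<Phi> \<in> LP p"
    and lim: "(\<lambda>n. \<integral>\<^sup>+\<xi>. ennreal (norm (\<Phi>s n \<xi> - \<Phi> \<xi>) powr p) \<partial>PM) \<longlonglongrightarrow> 0"
  shows "\<Phi> \<in> agree p I I'"
proof -
  have LPs: "\<Phi>s n \<in> LP p" and eq: "AE \<omega> in M. I (\<Phi>s n) \<omega> = I' (\<Phi>s n) \<omega>" for n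
    using \<Phi>s[of n] by (auto simp: agree_def)
  have l: "(\<lambda>n. mean_pow p (\<lambda>\<omega>. I (\<Phi>s n) \<omega> - I \<Phi> \<omega>)) \<longlonglongrightarrow> 0" "(\<lambda>n. mean_pow p (\<lambda>\<omega>. I' (\<Phi>s n) \<omega> - I' \<Phi> \<omega>)) \<longlonglongrightarrow> 0"
    unfolding mean_pow_def
    by (rule stochastic_integral_mapD(3)[OF I \<Phi> allI[OF LPs] lim], rule stochastic_integral_mapD(3)[OF I' \<Phi> allI[OF LPs] lim])
  have "AE \<omega> in M. \<forall>n. I (\<Phi>s n) \<omega> = I' (\<Phi>s n) \<omega>" using eq by (simp add: AE_all_countable)
  then have "AE \<omega> in M. True \<longrightarrow> (\<forall>n. I (\<Phi>s n) \<omega> = I' (\<Phi>s n) \<omega>)" by simp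
  from mean_pow_limit_unique[OF map_measurable[OF \<Phi>] map_measurable(1)[OF LPs] map_measurable(2)[OF LPs] p_bounds(1,2) p_bounds(1,2)
      l(1)[unfolded mean_pow_minus[of p "I (\<Phi>s _)"]] l(2)[unfolded mean_pow_minus[of p "I' (\<Phi>s _)"]] this]
  show ?thesis using \<Phi> by (simp add: agree_def)
qed

lemma agree_null:
  assumes \<Phi>: "\<Phi> \<in> LP p" and ae: "AE \<xi> in PM. \<Phi> \<xi> = 0" and \<Psi>: "\<Psi> \<in> agree p I I'"
  shows "\<Phi> \<in> agree p I I'"
proof (rule agree_limit[OF _ \<Phi>])
  show "(\<lambda>\<xi>. 0) \<in> agree p I I'" for n :: nat using agree_lincomb[OF \<Psi> \<Psi>, of 0 0] by simp
  have "(\<integral>\<^sup>+\<xi>. ennreal (norm (0 - \<Phi> \<xi>) powr p) \<partial>PM) = (\<integral>\<^sup>+\<xi>. 0 \<partial>PM)"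
    using ae by (intro nn_integral_cong_AE) (auto elim!: eventually_mono)
  then show "(\<lambda>n::nat. \<integral>\<^sup>+\<xi>. ennreal (norm (0 - \<Phi> \<xi>) powr p) \<partial>PM) \<longlonglongrightarrow> 0" by simp
qed

lemma agree_dominated:
  assumes \<Phi>s: "\<And>n. \<Phi>s n \<in> agree p I I'" and \<Phi>: "\<Phi> \<in> borel_measurable (PT \<Otimes>\<^sub>M borel)" and \<Psi>: "\<Psi> \<in> LP p"
    and le: "\<And>n \<xi>. norm (\<Phi>s n \<xi>) \<le> norm (\<Psi> \<xi>)" and lim: "\<And>\<xi>. \<xi> \<in> space PM \<Longrightarrow> (\<lambda>n. \<Phi>s n \<xi>) \<longlonglongrightarrow> \<Phi> \<xi>"
  shows "\<Phi> \<in> agree p I I'"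
proof (rule agree_limit[OF \<Phi>s])
  have \<Phi>PM: "\<Phi> \<in> borel_measurable PM" by (rule measurable_PT_PM[OF \<Phi> refl])
  have mn: "\<Phi>s n \<in> borel_measurable PM" for n using \<Phi>s[of n] LP_D(2) by (auto simp: agree_def)
  have \<Phi>le: "norm (\<Phi> \<xi>) \<le> norm (\<Psi> \<xi>)" if "\<xi> \<in> space PM" for \<xi>
    by (rule LIMSEQ_le_const2[OF tendsto_norm[OF lim[OF that]]]) (intro exI allI impI le)
  show "\<Phi> \<in> LP p"
  proof (rule LP_I[OF \<Phi>])
    have "(\<integral>\<^sup>+\<xi>. ennreal (norm (\<Phi> \<xi>) powr p) \<partial>PM) \<le> (\<integral>\<^sup>+\<xi>. ennreal (norm (\<Psi> \<xi>) powr p) \<partial>PM)"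
      using \<Phi>le p_bounds by (intro nn_integral_mono ennreal_leI powr_mono2) auto
    then show "(\<integral>\<^sup>+\<xi>. ennreal (norm (\<Phi> \<xi>) powr p) \<partial>PM) < \<infinity>" using LP_D(3)[OF \<Psi>] by (rule le_less_trans)
  qed
  have "(\<lambda>n. \<integral>\<^sup>+\<xi>. ennreal (norm (\<Phi>s n \<xi> - \<Phi> \<xi>) powr p) \<partial>PM) \<longlonglongrightarrow> (\<integral>\<^sup>+\<xi>. 0 \<partial>PM)"
  proof (rule nn_integral_dominated_convergence[where w="\<lambda>\<xi>. ennreal (2 powr p) * ennreal (norm (\<Psi> \<xi>) powr p)"])
    show "(\<lambda>\<xi>. ennreal (norm (\<Phi>s n \<xi> - \<Phi> \<xi>) powr p)) \<in> borel_measurable PM" for n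
      using mn[of n] \<Phi>PM by measurable
    show "(\<lambda>\<xi>. ennreal (2 powr p) * ennreal (norm (\<Psi> \<xi>) powr p)) \<in> borel_measurable PM"
      using LP_D(2)[OF \<Psi>] by measurable
    show "(\<integral>\<^sup>+\<xi>. ennreal (2 powr p) * ennreal (norm (\<Psi> \<xi>) powr p) \<partial>PM) < \<infinity>"
      using LP_D(2,3)[OF \<Psi>] by (subst nn_integral_cmult) (auto simp: ennreal_mult_less_top)
    show "AE \<xi> in PM. ennreal (norm (\<Phi>s n \<xi> - \<Phi> \<xi>) powr p) \<le> ennreal (2 powr p) * ennreal (norm (\<Psi> \<xi>) powr p)" for n
    proof (rule AE_I2)
      fix \<xi> assume \<xi>: "\<xi> \<in> space PM"
      have "norm (\<Phi>s n \<xi> - \<Phi> \<xi>) \<le> norm (\<Phi>s n \<xi>) + norm (\<Phi> \<xi>)" by (rule norm_triangle_ineq4)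
      also have "\<dots> \<le> 2 * norm (\<Psi> \<xi>)" using le[of n \<xi>] \<Phi>le[OF \<xi>] by simp
      finally have "norm (\<Phi>s n \<xi> - \<Phi> \<xi>) powr p \<le> (2 * norm (\<Psi> \<xi>)) powr p" using p_bounds by (intro powr_mono2) auto
      then show "ennreal (norm (\<Phi>s n \<xi> - \<Phi> \<xi>) powr p) \<le> ennreal (2 powr p) * ennreal (norm (\<Psi> \<xi>) powr p)"
        by (simp add: powr_mult ennreal_mult[symmetric] ennreal_leI)
    qed
    show "AE \<xi> in PM. (\<lambda>n. ennreal (norm (\<Phi>s n \<xi> - \<Phi> \<xi>) powr p)) \<longlonglongrightarrow> 0"
    proof (rule AE_I2)
      fix \<xi> assume \<xi>: "\<xi> \<in> space PM"
      have n0: "(\<lambda>n. norm (\<Phi>s n \<xi> - \<Phi> \<xi>)) \<longlonglongrightarrow> 0"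
        by (rule tendsto_norm_zero) (use lim[OF \<xi>] in \<open>simp add: LIM_zero\<close>)
      have "(\<lambda>n. norm (\<Phi>s n \<xi> - \<Phi> \<xi>) powr p) \<longlonglongrightarrow> 0 powr p"
        by (rule tendsto_powr2[OF n0 tendsto_const]) (use p_bounds in auto)
      then have "(\<lambda>n. ennreal (norm (\<Phi>s n \<xi> - \<Phi> \<xi>) powr p)) \<longlonglongrightarrow> ennreal (0 powr p)" by (rule tendsto_ennrealI)
      then show "(\<lambda>n. ennreal (norm (\<Phi>s n \<xi> - \<Phi> \<xi>) powr p)) \<longlonglongrightarrow> 0" by simp
    qed
  qed simp
  then show "(\<lambda>n. \<integral>\<^sup>+\<xi>. ennreal (norm (\<Phi>s n \<xi> - \<Phi> \<xi>) powr p) \<partial>PM) \<longlonglongrightarrow> 0" by simp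
qed

text \<open>
  Dynkin's \<open>\<pi>\<close>-\<open>\<lambda>\<close> argument inside the set \<open>R\<close>. The localisation to \<open>R\<close> provides the dominating
  function, as \<open>\<nu>\<close> may be infinite; the map \<open>k\<close> selects the coordinates in which the generator is
  given.
\<close>

lemma agree_sigma:
  fixes h :: 'h
  assumes R: "(\<lambda>\<xi>. indicator R \<xi> *\<^sub>R h) \<in> agree p I I'"
    and k: "\<And>\<xi>. \<xi> \<in> R \<Longrightarrow> k \<xi> \<in> \<Omega>" and G: "Int_stable G" "G \<subseteq> Pow \<Omega>"
    and m: "\<And>A. A \<in> sigma_sets \<Omega> G \<Longrightarrow> k -` A \<inter> R \<in> sets (PT \<Otimes>\<^sub>M borel)"
    and gen: "\<And>A. A \<in> G \<Longrightarrow> (\<lambda>\<xi>. indicator (k -` A \<inter> R) \<xi> *\<^sub>R h) \<in> agree p I I'"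
    and A: "A \<in> sigma_sets \<Omega> G"
  shows "(\<lambda>\<xi>. indicator (k -` A \<inter> R) \<xi> *\<^sub>R h) \<in> agree p I I'"
proof -
  have RLP: "(\<lambda>\<xi>. indicator R \<xi> *\<^sub>R h) \<in> LP p" using R by (simp add: agree_def)
  from G A show ?thesis
  proof (induction rule: sigma_sets_induct_disjoint)
    case (basic A)
    then show ?case by (rule gen)
  next
    case empty
    show ?case using agree_lincomb[OF R R, of 0 0] by simp
  next
    case (compl A)
    have "(\<lambda>\<xi>. 1 *\<^sub>R (indicator R \<xi> *\<^sub>R h) + (-1) *\<^sub>R (indicator (k -` A \<inter> R) \<xi> *\<^sub>R h)) =
      (\<lambda>\<xi>. indicator (k -` (\<Omega> - A) \<inter> R) \<xi> *\<^sub>R h)"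
      using k by (auto simp: fun_eq_iff indicator_def)
    then show ?case using agree_lincomb[OF R compl(2), of 1 "-1"] by simp
  next
    case (union A)
    let ?S = "\<lambda>n \<xi>. indicator (k -` (\<Union>i<n. A i) \<inter> R) \<xi> *\<^sub>R h"
    show ?case
    proof (rule agree_dominated[where \<Phi>s="?S" and \<Psi>="\<lambda>\<xi>. indicator R \<xi> *\<^sub>R h"])
      fix n show "?S n \<in> agree p I I'"
      proof (induction n)
        case 0
        show ?case using agree_lincomb[OF R R, of 0 0] by simp
      next
        case (Suc n)
        have "x \<notin> A n" if "i < n" "x \<in> A i" for i x
          using disjoint_family_onD[OF union(1), of i n] that by auto
        then have "(\<lambda>\<xi>. 1 *\<^sub>R ?S n \<xi> + 1 *\<^sub>R (indicator (k -` (A n) \<inter> R) \<xi> *\<^sub>R h)) = ?S (Suc n)"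
          by (auto simp: fun_eq_iff indicator_def lessThan_Suc)
        then show ?case using agree_lincomb[OF Suc union(3)[of n], of 1 1] by simp
      qed
    next
      have "k -` (\<Union>i. A i) \<inter> R \<in> sets (PT \<Otimes>\<^sub>M borel)" using union(2) by (intro m sigma_sets.Union) auto
      then show "(\<lambda>\<xi>. indicator (k -` (\<Union>i. A i) \<inter> R) \<xi> *\<^sub>R h) \<in> borel_measurable (PT \<Otimes>\<^sub>M borel)"
        by (intro borel_measurable_scaleR borel_measurable_indicator) auto
      show "norm (?S n \<xi>) \<le> norm (indicator R \<xi> *\<^sub>R h)" for n \<xi> by (simp add: indicator_def)
      show "(\<lambda>n. ?S n \<xi>) \<longlonglongrightarrow> indicator (k -` (\<Union>i. A i) \<inter> R) \<xi> *\<^sub>R h" for \<xi>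
      proof (cases "\<exists>j. k \<xi> \<in> A j")
        case True
        then obtain j where j: "k \<xi> \<in> A j" by blast
        have "eventually (\<lambda>n. ?S n \<xi> = indicator (k -` (\<Union>i. A i) \<inter> R) \<xi> *\<^sub>R h) sequentially"
          using eventually_gt_at_top[of j] by eventually_elim (use j in \<open>auto simp: indicator_def\<close>)
        then show ?thesis by (rule tendsto_eventually)
      qed (simp add: indicator_def)
    qed (rule RLP)
  qed
qed

lemma PT_gen_cases:
  assumes "x \<in> PT_gen"
  obtains A where "x = A \<times> {0}" "A \<in> sets (Ft 0)"
  | A s t where "x = A \<times> {s<..t}" "0 \<le> s" "s \<le> t" "t \<le> T" "A \<in> sets (Ft s)"
  using assms unfolding PT_gen_def by auto

lemma PT_gen_zeroI: "A \<in> sets (Ft 0) \<Longrightarrow> A \<times> {0} \<in> PT_gen"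
  unfolding PT_gen_def by blast

lemma PT_genI: "A \<in> sets (Ft s) \<Longrightarrow> 0 \<le> s \<Longrightarrow> s \<le> t \<Longrightarrow> t \<le> T \<Longrightarrow> A \<times> {s<..t} \<in> PT_gen"
  unfolding PT_gen_def by blast

lemma Int_stable_PT_gen: "Int_stable PT_gen"
proof (rule Int_stableI)
  fix a b assume a: "a \<in> PT_gen" and b: "b \<in> PT_gen"
  have e0: "{} \<in> PT_gen" using PT_gen_zeroI[of "{}"] by simp
  show "a \<inter> b \<in> PT_gen"
    using a
  proof (cases rule: PT_gen_cases)
    case (1 A)
    note a1 = 1
    show ?thesis using b
    proof (cases rule: PT_gen_cases)
      case (1 B)
      have "a \<inter> b = (A \<inter> B) \<times> {0}" unfolding a1(1) 1(1) by auto
      then show ?thesis using PT_gen_zeroI[OF sets.Int[OF a1(2) 1(2)]] by simp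
    next
      case (2 B s t)
      have "a \<inter> b = {}" unfolding a1(1) 2(1) using 2(2) by auto
      then show ?thesis using e0 by simp
    qed
  next
    case (2 A s t)
    note a2 = 2
    show ?thesis using b
    proof (cases rule: PT_gen_cases)
      case (1 B)
      have "a \<inter> b = {}" unfolding a2(1) 1(1) using a2(2) by auto
      then show ?thesis using e0 by simp
    next
      case (2 B s' t')
      let ?r = "max s s'" and ?v = "min t t'"
      have AB: "A \<inter> B \<in> sets (Ft ?r)"
        using a2(5) 2(5) Filt_mono[of s ?r] Filt_mono[of s' ?r] by (intro sets.Int) auto
      have eq: "a \<inter> b = (A \<inter> B) \<times> {?r<..?v}" unfolding a2(1) 2(1) by auto
      show ?thesis
      proof (cases "?r \<le> ?v")
        case True
        have "(A \<inter> B) \<times> {?r<..?v} \<in> PT_gen"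
          by (rule PT_genI[OF AB _ True]) (use a2(2,4) in auto)
        then show ?thesis by (simp only: eq)
      next
        case False
        then have "{?r<..?v} = {}" by auto
        then have "a \<inter> b = {}" unfolding eq by blast
        then show ?thesis using e0 by simp
      qed
    qed
  qed
qed

lemma agree_elementary:
  assumes C: "C \<in> sets (Ft r)" and rs: "0 \<le> r" "r \<le> s" "s \<le> T" and B: "B \<in> sets borel" "emeasure \<nu> B < \<infinity>"
  shows "(\<lambda>\<xi>. indicator ((C \<times> {r<..s}) \<times> B) \<xi> *\<^sub>R h) \<in> agree p I I'"
proof -
  let ?F = "\<lambda>\<omega>. indicator C \<omega> *\<^sub>R h"
  have B': "B \<in> sets \<nu>" using B sets_nu by simp
  have F: "?F \<in> borel_measurable (Ft r)" using C by measurable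
  have bF: "bounded (?F ` space M)" by (rule boundedI[where B="norm h"]) (auto simp: indicator_def)
  have eq: "(\<lambda>\<xi>. indicator ((C \<times> {r<..s}) \<times> B) \<xi> *\<^sub>R h) = (\<lambda>((\<omega>, t), y). indicator ({r<..s} \<times> B) (t, y) *\<^sub>R ?F \<omega>)"
    by (auto simp: fun_eq_iff indicator_def)
  have LPe: "(\<lambda>((\<omega>, t), y). indicator ({r<..s} \<times> B) (t, y) *\<^sub>R ?F \<omega>) \<in> LP p"
    by (rule LP_elementary[OF F bF rs B' B(2) p_bounds(3)])
  have "AE \<omega> in M. I (\<lambda>((\<omega>, t), y). indicator ({r<..s} \<times> B) (t, y) *\<^sub>R ?F \<omega>) \<omega> = (measure (N \<omega>) ({r<..s} \<times> B) - measure E ({r<..s} \<times> B)) *\<^sub>R ?F \<omega>"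
    "AE \<omega> in M. I' (\<lambda>((\<omega>, t), y). indicator ({r<..s} \<times> B) (t, y) *\<^sub>R ?F \<omega>) \<omega> = (measure (N \<omega>) ({r<..s} \<times> B) - measure E ({r<..s} \<times> B)) *\<^sub>R ?F \<omega>"
    by (rule stochastic_integral_mapD(4)[OF I rs F bF B' B(2)], rule stochastic_integral_mapD(4)[OF I' rs F bF B' B(2)])
  then have "AE \<omega> in M. I (\<lambda>((\<omega>, t), y). indicator ({r<..s} \<times> B) (t, y) *\<^sub>R ?F \<omega>) \<omega> = I' (\<lambda>((\<omega>, t), y). indicator ({r<..s} \<times> B) (t, y) *\<^sub>R ?F \<omega>) \<omega>"
    by eventually_elim simp
  then show ?thesis unfolding eq using LPe by (simp add: agree_def)
qed

text \<open>
  The generators at time \<open>0\<close> are not elementary processes, but they are null sets.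
\<close>

lemma agree_rectangle:
  assumes P: "P \<in> sets PT" and B: "B \<in> sets borel" "emeasure \<nu> B < \<infinity>"
  shows "(\<lambda>\<xi>. indicator (P \<times> B) \<xi> *\<^sub>R h) \<in> agree p I I'"
proof -
  let ?R = "(space M \<times> {0..T}) \<times> B"
  have B': "B \<in> sets \<nu>" using B sets_nu by simp
  have top: "space M \<in> sets (Ft s)" for s using sets.top[of "Ft s"] by (simp add: Filt_space)
  have zero: "(\<lambda>\<xi>. indicator ((C \<times> {0}) \<times> B) \<xi> *\<^sub>R h) \<in> agree p I I'" if C: "C \<in> sets (Ft 0)" for C
  proof (rule agree_null[OF _ _ agree_elementary[OF top, of 0 T B h]])
    have "C \<times> {0} \<in> sets PT" unfolding sets_PT PT_gen_def using C by (intro sigma_sets.Basic) auto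
    then have m: "(\<lambda>\<xi>. indicator ((C \<times> {0}) \<times> B) \<xi> *\<^sub>R h) \<in> borel_measurable (PT \<Otimes>\<^sub>M borel)" using B by measurable
    have CM: "C \<in> sets M" using C Filt_sub_M by blast
    have "emeasure (M \<Otimes>\<^sub>M tm) (C \<times> {0}) = emeasure M C * emeasure tm {0}"
      using CM Ioc_sets_tm(2) by (rule tm.emeasure_pair_measure_Times)
    also have "emeasure tm {0} = 0" using null_time_singleton[of T 0] T_pos by simp
    finally have "emeasure PM ((C \<times> {0}) \<times> B) = 0"
      unfolding process_measure_def using CM Ioc_sets_tm(2) B' by (subst nu.emeasure_pair_measure_Times) auto
    moreover have "(C \<times> {0}) \<times> B \<in> sets PM" unfolding process_measure_def using CM Ioc_sets_tm(2) B' by auto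
    ultimately have "(C \<times> {0}) \<times> B \<in> null_sets PM" by (simp add: null_sets_def)
    from AE_not_in[OF this] show ae: "AE \<xi> in PM. indicator ((C \<times> {0}) \<times> B) \<xi> *\<^sub>R h = 0" by eventually_elim simp
    show "(\<lambda>\<xi>. indicator ((C \<times> {0}) \<times> B) \<xi> *\<^sub>R h) \<in> LP p"
    proof (rule LP_I[OF m])
      have "(\<integral>\<^sup>+\<xi>. ennreal (norm (indicator ((C \<times> {0}) \<times> B) \<xi> *\<^sub>R h) powr p) \<partial>PM) = (\<integral>\<^sup>+\<xi>. 0 \<partial>PM)"
        using ae by (intro nn_integral_cong_AE) (auto elim!: eventually_mono)
      then show "(\<integral>\<^sup>+\<xi>. ennreal (norm (indicator ((C \<times> {0}) \<times> B) \<xi> *\<^sub>R h) powr p) \<partial>PM) < \<infinity>" by simp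
    qed
  qed (use T_pos B in auto)
  have R: "(\<lambda>\<xi>. indicator ?R \<xi> *\<^sub>R h) \<in> agree p I I'"
  proof -
    have "(\<lambda>\<xi>. 1 *\<^sub>R (indicator ((space M \<times> {0}) \<times> B) \<xi> *\<^sub>R h) + 1 *\<^sub>R (indicator ((space M \<times> {0<..T}) \<times> B) \<xi> *\<^sub>R h)) = (\<lambda>\<xi>. indicator ?R \<xi> *\<^sub>R h)"
      using T_pos by (auto simp: fun_eq_iff indicator_def)
    then show ?thesis
      using agree_lincomb[OF zero[OF top] agree_elementary[OF top, of 0 T B h], of 1 1] T_pos B by simp
  qed
  have cut: "fst -` A \<inter> ?R = A \<times> B" if "A \<subseteq> space M \<times> {0..T}" for A using that by auto
  have sub: "A \<subseteq> space M \<times> {0..T}" if "A \<in> sigma_sets (space M \<times> {0..T}) PT_gen" for A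
    using sigma_sets_into_sp[OF PT_gen_sub that] .
  have "(\<lambda>\<xi>. indicator (fst -` P \<inter> ?R) \<xi> *\<^sub>R h) \<in> agree p I I'"
  proof (rule agree_sigma[OF R _ Int_stable_PT_gen PT_gen_sub])
    show "fst \<xi> \<in> space M \<times> {0..T}" if "\<xi> \<in> ?R" for \<xi> using that by auto
    show "fst -` A \<inter> ?R \<in> sets (PT \<Otimes>\<^sub>M borel)" if "A \<in> sigma_sets (space M \<times> {0..T}) PT_gen" for A
      unfolding cut[OF sub[OF that]] using that B by (auto simp: sets_PT)
    show "P \<in> sigma_sets (space M \<times> {0..T}) PT_gen" using P by (simp add: sets_PT)
    fix A assume A: "A \<in> PT_gen"
    have "(\<lambda>\<xi>. indicator (A \<times> B) \<xi> *\<^sub>R h) \<in> agree p I I'"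
      using A
    proof (cases rule: PT_gen_cases)
      case (1 C)
      show ?thesis unfolding 1(1) by (rule zero[OF 1(2)])
    next
      case (2 C s t)
      show ?thesis unfolding 2(1) by (rule agree_elementary[OF 2(5,2,3,4) B])
    qed
    then show "(\<lambda>\<xi>. indicator (fst -` A \<inter> ?R) \<xi> *\<^sub>R h) \<in> agree p I I'"
      using A PT_gen_sub by (subst cut) auto
  qed
  then show ?thesis using cut[OF sub] P by (simp add: sets_PT)
qed

lemma agree_set:
  assumes S: "S \<in> sets (PT \<Otimes>\<^sub>M borel)" and V: "V \<in> sets borel" "emeasure \<nu> V < \<infinity>"
  shows "(\<lambda>\<xi>. indicator (S \<inter> (space PT \<times> V)) \<xi> *\<^sub>R h) \<in> agree p I I'"
proof -
  let ?R = "space PT \<times> V"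
  let ?G = "{a \<times> b | a b. a \<in> sets PT \<and> b \<in> sets (borel :: 'u measure)}"
  have sig: "sigma_sets (space PT \<times> space borel) ?G = sets (PT \<Otimes>\<^sub>M borel)" by (simp add: sets_pair_measure)
  have "(\<lambda>\<xi>. indicator ((\<lambda>x. x) -` S \<inter> ?R) \<xi> *\<^sub>R h) \<in> agree p I I'"
  proof (rule agree_sigma[where \<Omega>="space PT \<times> space borel" and G="?G"])
    show "(\<lambda>\<xi>. indicator ?R \<xi> *\<^sub>R h) \<in> agree p I I'" by (rule agree_rectangle[OF sets.top V])
    show "Int_stable ?G" by (rule Int_stable_pair_measure_generator)
    show "?G \<subseteq> Pow (space PT \<times> space borel)" using sets.sets_into_space[of _ PT] by auto
    show "(\<lambda>x. x) -` A \<inter> ?R \<in> sets (PT \<Otimes>\<^sub>M borel)" if "A \<in> sigma_sets (space PT \<times> space borel) ?G" for A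
      using that V unfolding sig by (auto intro!: sets.Int)
    show "S \<in> sigma_sets (space PT \<times> space borel) ?G" using S unfolding sig .
    fix A assume "A \<in> ?G"
    then obtain a b where A: "A = a \<times> b" "a \<in> sets PT" "b \<in> sets borel" by auto
    have "(\<lambda>x. x) -` A \<inter> ?R = a \<times> (b \<inter> V)" using A sets.sets_into_space[OF A(2)] by auto
    moreover have "emeasure \<nu> (b \<inter> V) < \<infinity>"
      using V A sets_nu emeasure_mono[of "b \<inter> V" V \<nu>] by (auto intro: le_less_trans)
    ultimately show "(\<lambda>\<xi>. indicator ((\<lambda>x. x) -` A \<inter> ?R) \<xi> *\<^sub>R h) \<in> agree p I I'"
      using agree_rectangle[OF A(2), of "b \<inter> V" h] A V by auto
  qed auto
  then show ?thesis by simp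
qed

text \<open>
  Approximation by simple functions restricted to marks in sets of finite \<open>\<nu>\<close> measure.
\<close>

lemma agree_LP:
  assumes \<Phi>: "\<Phi> \<in> LP p"
  shows "\<Phi> \<in> agree p I I'"
proof -
  obtain V :: "nat \<Rightarrow> 'u set" where V: "range V \<subseteq> sets \<nu>" "(\<Union>i. V i) = space \<nu>" "\<And>i. emeasure \<nu> (V i) \<noteq> \<infinity>" "incseq V"
    by (rule nu.sigma_finite_incseq) (rule that)
  have Vb: "V i \<in> sets borel" "emeasure \<nu> (V i) < \<infinity>" for i using V(1,3) sets_nu by (auto simp: top.not_eq_extremum)
  obtain s where s: "\<And>i. simple_function (PT \<Otimes>\<^sub>M borel) (s i)" "\<And>x. x \<in> space (PT \<Otimes>\<^sub>M borel) \<Longrightarrow> (\<lambda>i. s i x) \<longlonglongrightarrow> \<Phi> x"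
    "\<And>i x. x \<in> space (PT \<Otimes>\<^sub>M borel) \<Longrightarrow> dist (s i x) 0 \<le> 2 * dist (\<Phi> x) 0"
    using borel_measurable_implies_sequence_metric[OF LP_D(1)[OF \<Phi>], of 0] by blast
  have sp: "space (PT \<Otimes>\<^sub>M borel) = space PM"
    using sets_eq_imp_space_eq[OF sets_nu] by (auto simp: process_measure_def space_pair_measure space_PT)
  define \<Phi>s where "\<Phi>s i \<xi> = (\<Sum>c\<in>s i ` space PM. indicator ((s i -` {c} \<inter> space PM) \<inter> (space PT \<times> V i)) \<xi> *\<^sub>R c)" for i \<xi>
  have fin: "finite (s i ` space PM)" for i using s(1)[of i] sp by (simp add: simple_function_def)
  have mem: "\<Phi>s i \<in> agree p I I'" for i
  proof -
    have "(\<lambda>\<xi>. \<Sum>c\<in>A. indicator ((s i -` {c} \<inter> space PM) \<inter> (space PT \<times> V i)) \<xi> *\<^sub>R c) \<in> agree p I I'"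
      if "A \<subseteq> s i ` space PM" for A
      using finite_subset[OF that fin] that
    proof (induction A rule: finite_induct)
      case empty
      have "(\<lambda>\<xi>. indicator ({} \<inter> (space PT \<times> V i)) \<xi> *\<^sub>R (0::'h)) \<in> agree p I I'" by (rule agree_set[OF _ Vb]) simp
      then show ?case by simp
    next
      case (insert c A)
      have c: "s i -` {c} \<inter> space PM \<in> sets (PT \<Otimes>\<^sub>M borel)" using s(1)[of i] insert sp by (auto simp: simple_function_def)
      have A: "(\<lambda>\<xi>. \<Sum>c\<in>A. indicator ((s i -` {c} \<inter> space PM) \<inter> (space PT \<times> V i)) \<xi> *\<^sub>R c) \<in> agree p I I'"
        using insert by auto
      show ?case using agree_lincomb[OF agree_set[OF c Vb, of i c] A, of 1 1]
        unfolding sum.insert[OF insert(1,2)] by (simp only: scaleR_one)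
    qed
    then show ?thesis unfolding \<Phi>s_def by simp
  qed
  have val: "\<Phi>s i \<xi> = (if \<xi> \<in> space PM \<and> snd \<xi> \<in> V i then s i \<xi> else 0)" for i \<xi>
  proof (cases "\<xi> \<in> space PM \<and> snd \<xi> \<in> V i")
    case True
    then have "fst \<xi> \<in> space PT" unfolding sp[symmetric] by (auto simp: space_pair_measure)
    then have "\<Phi>s i \<xi> = (\<Sum>c\<in>s i ` space PM. if c = s i \<xi> then c else 0)"
      unfolding \<Phi>s_def using True by (intro sum.cong) (auto simp: indicator_def mem_Times_iff)
    then show ?thesis using True fin by (simp add: sum.delta)
  next
    case False
    then have nin: "\<xi> \<notin> (s i -` {c} \<inter> space PM) \<inter> (space PT \<times> V i)" for c by (auto simp: mem_Times_iff)
    have "indicator ((s i -` {c} \<inter> space PM) \<inter> (space PT \<times> V i)) \<xi> *\<^sub>R c = 0" for c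
      using nin[of c] by (auto simp: indicator_def)
    then have "\<Phi>s i \<xi> = 0" unfolding \<Phi>s_def by (intro sum.neutral ballI)
    then show ?thesis using False by (simp only: if_False)
  qed
  show ?thesis
  proof (rule agree_dominated[OF mem LP_D(1)[OF \<Phi>]])
    show "(\<lambda>\<xi>. 2 *\<^sub>R \<Phi> \<xi>) \<in> LP p" using LP_lincomb[OF \<Phi> \<Phi> p_bounds(4), of 2 0] by simp
    show "norm (\<Phi>s i \<xi>) \<le> norm (2 *\<^sub>R \<Phi> \<xi>)" for i \<xi> using s(3)[of \<xi> i] sp by (simp add: val)
    fix \<xi> assume \<xi>: "\<xi> \<in> space PM"
    then have "snd \<xi> \<in> space \<nu>" by (auto simp: process_measure_def space_pair_measure)
    then obtain j where j: "snd \<xi> \<in> V j" unfolding V(2)[symmetric] by auto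
    have "eventually (\<lambda>i. \<Phi>s i \<xi> = s i \<xi>) sequentially"
      using eventually_ge_at_top[of j]
    proof eventually_elim
      case (elim i)
      then have "snd \<xi> \<in> V i" using j V(4) by (auto simp: incseq_def)
      then show ?case using \<xi> by (simp add: val)
    qed
    then show "(\<lambda>i. \<Phi>s i \<xi>) \<longlonglongrightarrow> \<Phi> \<xi>"
      using s(2)[of \<xi>] \<xi> sp by (simp add: tendsto_cong)
  qed
qed

end

text \<open>
  The abstractly chosen stochastic integral agrees with the extension of the pathwise integral.
\<close>

theorem stochastic_integral_is_integral:
  fixes \<Phi> :: "_ \<Rightarrow> 'h::{real_inner, banach, second_countable_topology}"
  assumes p: "p \<in> {1..2}" and \<Phi>: "\<Phi> \<in> LP p" and r: "rep_by \<Phi> \<phi>" and X: "X \<in> borel_measurable M"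
    and eq: "AE \<omega> in M. X \<omega> = stochastic_integral T \<nu> M N p \<Phi> \<omega>"
  shows "is_integral p \<phi> X"
proof -
  let ?I = "stochastic_integral T \<nu> M N p :: ('w, 'u, 'h) process \<Rightarrow> _"
  have I: "stochastic_integral_map T \<nu> M N p ?I"
    unfolding stochastic_integral_def by (rule someI[of _ "the_integral p"]) (rule the_integral_is_stochastic_integral_map[OF p])
  have "\<Phi> \<in> agree p ?I (the_integral p)" by (rule agree_LP[OF p I the_integral_is_stochastic_integral_map[OF p] \<Phi>])
  then have "AE \<omega> in M. X \<omega> = the_integral p \<Phi> \<omega>" using eq by (auto simp: agree_def elim: eventually_elim2)
  then have e: "mean_pow p (\<lambda>\<omega>. X \<omega> - Y \<omega>) = mean_pow p (\<lambda>\<omega>. the_integral p \<Phi> \<omega> - Y \<omega>)" for Y :: "'w \<Rightarrow> 'h"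
    by (intro mean_pow_cong_AE) (auto elim!: eventually_mono)
  show ?thesis using the_integral_is_integral[OF p \<Phi> r] X unfolding is_integral_def e by blast
qed

lemma stochastic_integral_measurable:
  fixes \<Phi> :: "_ \<Rightarrow> 'h::{real_inner, banach, second_countable_topology}"
  assumes p: "p \<in> {1..2}" and \<Phi>: "\<Phi> \<in> LP p"
  shows "stochastic_integral T \<nu> M N p \<Phi> \<in> borel_measurable M"
proof -
  have I: "stochastic_integral_map T \<nu> M N p (stochastic_integral T \<nu> M N p :: ('w, 'u, 'h) process \<Rightarrow> _)"
    unfolding stochastic_integral_def by (rule someI[of _ "the_integral p"]) (rule the_integral_is_stochastic_integral_map[OF p])
  from stochastic_integral_mapD(1)[OF this \<Phi>] show ?thesis by (simp add: Lp_fun_def)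
qed

end

section \<open>Localisation and the commutation relation at a fixed point\<close>

text \<open>
  Exhibits convergence to \<open>0\<close> as a countable combination of inequalities, hence as a measurable
  condition.
\<close>

lemma tendsto_zero_iff_countable:
  fixes u :: "nat \<Rightarrow> 'a::real_normed_vector"
  shows "u \<longlonglongrightarrow> 0 \<longleftrightarrow> (\<forall>k. \<exists>n0. \<forall>n\<ge>n0. norm (u n) < inverse (real (Suc k)))"
proof
  assume "u \<longlonglongrightarrow> 0"
  then show "\<forall>k. \<exists>n0. \<forall>n\<ge>n0. norm (u n) < inverse (real (Suc k))"
    using LIMSEQ_D[of u 0 "inverse (real (Suc _))"] by fastforce
next
  assume *: "\<forall>k. \<exists>n0. \<forall>n\<ge>n0. norm (u n) < inverse (real (Suc k))"
  show "u \<longlonglongrightarrow> 0"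
  proof (rule LIMSEQ_I)
    fix r :: real assume "0 < r"
    then obtain k where k: "inverse (real (Suc k)) < r" using reals_Archimedean by blast
    obtain n0 where "\<forall>n\<ge>n0. norm (u n) < inverse (real (Suc k))" using * by blast
    then have "\<forall>n\<ge>n0. norm (u n - 0) < r" using k by fastforce
    then show "\<exists>no. \<forall>n\<ge>no. norm (u n - 0) < r" by blast
  qed
qed

context poisson_setting
begin

lemma AE_add_point_swap:
  assumes P [measurable]: "Measurable.pred CS P" and ae: "AE \<omega> in M. P (N \<omega>)"
  shows "AE z in E. AE \<omega> in M. P (add_point (N \<omega>) z)"
proof -
  have "Measurable.pred (M \<Otimes>\<^sub>M E) (\<lambda>p. P (add_point (N (fst p)) (snd p)))" by measurable
  then show ?thesis
    using AE_add_point[OF P ae] ME.AE_commute[of "\<lambda>\<omega> z. P (add_point (N \<omega>) z)"] by (simp add: pred_def)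
qed

lemma at_past_before: "sets \<eta> = sets E \<Longrightarrow> fst w \<le> s \<Longrightarrow> at_past \<phi> (before \<eta> s) w = at_past \<phi> \<eta> w"
  by (simp add: at_past_def before_before)

lemma pred_integrable_at:
  fixes \<phi> :: "_ \<Rightarrow> 'h::{banach, second_countable_topology}"
  assumes \<phi>: "\<phi> \<in> borel_measurable CTU"
  shows "Measurable.pred CS (integrable_at \<phi>)"
proof -
  note [measurable] = measurable_at_past[OF \<phi>]
  have m: "case_prod (\<lambda>\<eta> z. ennreal (norm (at_past \<phi> \<eta> z))) \<in> borel_measurable (CS \<Otimes>\<^sub>M E)"
    unfolding case_prod_beta' by measurable
  note [measurable] = measurable_nn_integral_counting[OF m] E.borel_measurable_nn_integral[OF m]
  have "Measurable.pred CS (\<lambda>\<eta>. finite_on_cells \<eta> \<and> (if finite_on_cells \<eta> then \<integral>\<^sup>+z. ennreal (norm (at_past \<phi> \<eta> z)) \<partial>\<eta> else 0) < \<infinity> \<and> (\<integral>\<^sup>+z. ennreal (norm (at_past \<phi> \<eta> z)) \<partial>E) < \<infinity>)"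
    by measurable
  then show ?thesis
    by (rule measurable_cong[THEN iffD1, rotated])
      (auto simp: integrable_at_def integrable_iff_bounded measurable_at_past_self[OF \<phi>] measurable_at_past_E[OF \<phi>])
qed

text \<open>
  The energy accumulated strictly before time \<open>s\<close>. It depends on the strict past only, so that
  stopping at an energy level preserves predictability.
\<close>

definition energy :: "real \<Rightarrow> ('u, 'h::real_normed_vector) integrand \<Rightarrow> (real \<times> 'u) measure \<Rightarrow> real \<Rightarrow> ennreal" where
  "energy p \<phi> \<eta> s = (\<integral>\<^sup>+w. ennreal (norm (at_past \<phi> \<eta> w) powr p) * indicator ({..<s} \<times> UNIV) w \<partial>E)"

lemma measurable_energy:
  fixes \<phi> :: "_ \<Rightarrow> 'h::{banach, second_countable_topology}"
  assumes \<phi>: "\<phi> \<in> borel_measurable CTU" and [measurable]: "f \<in> A \<rightarrow>\<^sub>M CS" "s \<in> borel_measurable A"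
  shows "(\<lambda>x. energy p \<phi> (f x) (s x)) \<in> borel_measurable A"
proof -
  have [measurable]: "(\<lambda>q. at_past \<phi> (f (fst q)) (snd q)) \<in> borel_measurable (A \<Otimes>\<^sub>M E)"
    by (rule measurable_at_past_compose[OF \<phi>]) measurable
  have [measurable]: "(\<lambda>q. fst (snd q)) \<in> borel_measurable (A \<Otimes>\<^sub>M E)"
    by (rule measurable_compose[OF measurable_snd measurable_fst_intensity])
  have "(\<lambda>q. ennreal (norm (at_past \<phi> (f (fst q)) (snd q)) powr p) * (if fst (snd q) < s (fst q) then 1 else 0)) \<in> borel_measurable (A \<Otimes>\<^sub>M E)"
    by measurable
  moreover have "(if fst w < t then 1 else 0) = (indicator ({..<t} \<times> UNIV) w :: ennreal)" for w :: "real \<times> 'u" and t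
    by (cases w) (simp add: indicator_def)
  ultimately show ?thesis
    unfolding energy_def by (intro E.borel_measurable_nn_integral) (simp add: case_prod_beta')
qed

lemma energy_before:
  assumes "sets \<eta> = sets E"
  shows "energy p \<phi> (before \<eta> s) s = energy p \<phi> \<eta> s"
  unfolding energy_def
proof (intro nn_integral_cong)
  fix w :: "real \<times> 'u"
  show "ennreal (norm (at_past \<phi> (before \<eta> s) w) powr p) * indicator ({..<s} \<times> UNIV) w =
    ennreal (norm (at_past \<phi> \<eta> w) powr p) * indicator ({..<s} \<times> UNIV) w"
    using at_past_before[OF assms, of w s \<phi>] by (cases w) (auto simp: indicator_def)
qed

lemma energy_mono: "s \<le> t \<Longrightarrow> energy p \<phi> \<eta> s \<le> energy p \<phi> \<eta> t"
  unfolding energy_def by (intro nn_integral_mono mult_left_mono) (auto simp: indicator_def)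

lemma AE_time_ne: "AE w in E. fst w \<noteq> b"
proof -
  have "AE t in tm. t \<noteq> b"
  proof (rule AE_I[where N="{b} \<inter> {0..T}"])
    show "emeasure tm ({b} \<inter> {0..T}) = 0" by (rule null_time_singleton)
    show "{b} \<inter> {0..T} \<in> sets tm" unfolding time_measure_def by (auto simp: sets_restrict_space image_iff intro!: bexI[of _ "{b}"])
  qed auto
  from AE_pair_fst[OF sigma_finite_nu this] show ?thesis unfolding intensity_def .
qed

text \<open>
  The set of times at which the accumulated energy is at most \<open>m\<close> is an interval starting at \<open>0\<close>. The
  accumulated energy is left continuous, so that it is at most \<open>m\<close> also at the supremum of that
  interval, and the supremum itself is a null set of times.
\<close>

lemma stopped_energy_le:
  assumes u [measurable]: "u \<in> borel_measurable E"
  shows "(\<integral>\<^sup>+w. (if (\<integral>\<^sup>+v. u v * indicator ({..<fst w} \<times> UNIV) v \<partial>E) \<le> m then u w else 0) \<partial>E) \<le> (m :: ennreal)"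
proof -
  define A where "A s = (\<integral>\<^sup>+v. u v * indicator ({..<s} \<times> UNIV) v \<partial>E)" for s
  define S where "S = {s \<in> {0..T}. A s \<le> m}"
  show ?thesis
  proof (cases "S = {}")
    case True
    have "fst w \<in> {0..T}" if "w \<in> space E" for w using that by (auto simp: intensity_def space_pair_measure)
    then have "(\<integral>\<^sup>+w. (if A (fst w) \<le> m then u w else 0) \<partial>E) = (\<integral>\<^sup>+w. 0 \<partial>E)"
      using True by (intro nn_integral_cong) (auto simp: S_def)
    then show ?thesis by (simp add: A_def)
  next
    case False
    have bdd: "bdd_above S" unfolding S_def by (auto intro!: bdd_aboveI[of _ T])
    define b where "b = Sup S"
    have "\<exists>t\<in>S. b - inverse (real (Suc n)) < t" for n
      using less_cSupE[of "b - inverse (real (Suc n))" S] False by (auto simp: b_def)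
    then obtain t where t: "\<And>n. t n \<in> S" "\<And>n. b - inverse (real (Suc n)) < t n" by metis
    have tb: "t n \<le> b" for n unfolding b_def using t(1) bdd by (rule cSup_upper)
    have meas: "(\<lambda>v. u v * indicator ({..<s} \<times> UNIV) v) \<in> borel_measurable E" for s
    proof -
      have [measurable]: "fst \<in> borel_measurable E" by (rule measurable_fst_intensity)
      have "(\<lambda>v. u v * (if fst v < s then 1 else 0)) \<in> borel_measurable E" by measurable
      moreover have "(if fst w < s then 1 else 0) = (indicator ({..<s} \<times> UNIV) w :: ennreal)" for w :: "real \<times> 'u"
        by (cases w) (simp add: indicator_def)
      ultimately show ?thesis by simp
    qed
    have "A b \<le> m"
      unfolding A_def
    proof (rule nn_integral_fatou_le[OF meas])
      show "(\<integral>\<^sup>+v. u v * indicator ({..<t n} \<times> UNIV) v \<partial>E) \<le> m" for n using t(1)[of n] by (simp add: S_def A_def)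
      show "AE v in E. (\<lambda>n. u v * indicator ({..<t n} \<times> UNIV) v) \<longlonglongrightarrow> u v * indicator ({..<b} \<times> UNIV) v"
      proof (rule AE_I2, rule tendsto_eventually)
        fix v :: "real \<times> 'u"
        show "eventually (\<lambda>n. u v * indicator ({..<t n} \<times> UNIV) v = u v * indicator ({..<b} \<times> UNIV) v) sequentially"
        proof (cases "fst v < b")
          case True
          then obtain k where k: "inverse (real (Suc k)) < b - fst v" using reals_Archimedean[of "b - fst v"] by auto
          show ?thesis using eventually_ge_at_top[of k]
          proof eventually_elim
            case (elim n)
            have "inverse (real (Suc n)) \<le> inverse (real (Suc k))" using elim by (simp add: le_imp_inverse_le)
            then have "fst v < t n" using k t(2)[of n] by linarith
            then show ?case using True by (cases v) (simp add: indicator_def)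
          qed
        next
          case False
          then have "\<not> fst v < t n" for n using tb[of n] by linarith
          then show ?thesis using False by (cases v) (simp add: indicator_def)
        qed
      qed
    qed
    have "(\<integral>\<^sup>+w. (if A (fst w) \<le> m then u w else 0) \<partial>E) \<le> A b"
      unfolding A_def[of b]
    proof (rule nn_integral_mono_AE)
      show "AE w in E. (if A (fst w) \<le> m then u w else 0) \<le> u w * indicator ({..<b} \<times> UNIV) w"
        using AE_time_ne[of b] AE_space
      proof eventually_elim
        case (elim w)
        show ?case
        proof (cases "A (fst w) \<le> m")
          case True
          then have "fst w \<in> S" using elim(2) by (auto simp: S_def intensity_def space_pair_measure)
          then have "fst w \<le> b" unfolding b_def using bdd by (rule cSup_upper)
          then show ?thesis using elim(1) by (cases w) (simp add: indicator_def)
        qed simp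
      qed
    qed
    then show ?thesis using \<open>A b \<le> m\<close> by (simp add: A_def)
  qed
qed

context
  fixes p q :: real and \<phi> :: "('u, 'h::{real_inner, banach, second_countable_topology}) integrand"
    and z :: "real \<times> 'u"
  assumes p: "p \<in> {1..2}" and q: "q \<in> {1..2}" and \<phi>: "\<phi> \<in> borel_measurable CTU" and z: "z \<in> space E"
begin

abbreviation "\<phi>z \<equiv> with_point z \<phi>"

lemma measurable_\<phi>z: "\<phi>z \<in> borel_measurable CTU"
  by (rule measurable_with_point[OF \<phi> z])

text \<open>
  Both the original and the shifted integrand have to be controlled, so that the difference is
  controlled as well.
\<close>

definition calm :: "nat \<Rightarrow> (real \<times> 'u) measure \<Rightarrow> real \<Rightarrow> bool" where
  "calm m \<eta> s \<longleftrightarrow> energy p \<phi> \<eta> s \<le> of_nat m \<and> energy p \<phi>z \<eta> s \<le> of_nat m"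

definition stop :: "nat \<Rightarrow> ('u, 'h) integrand \<Rightarrow> ('u, 'h) integrand" where
  "stop m \<psi> x = (if calm m (fst (fst x)) (snd (fst x)) then \<psi> x else 0)"

lemma measurable_stop:
  assumes [measurable]: "\<psi> \<in> borel_measurable CTU"
  shows "stop m \<psi> \<in> borel_measurable CTU"
proof -
  have "(\<lambda>x. snd (fst x)) \<in> CTU \<rightarrow>\<^sub>M tm" by measurable
  then have s: "(\<lambda>x. snd (fst x)) \<in> borel_measurable CTU" by (simp add: measurable_into_time)
  have f: "(\<lambda>x. fst (fst x)) \<in> CTU \<rightarrow>\<^sub>M CS" by measurable
  note [measurable] = measurable_energy[OF \<phi> f s] measurable_energy[OF measurable_\<phi>z f s]
  have [measurable]: "Measurable.pred CTU (\<lambda>x. calm m (fst (fst x)) (snd (fst x)))" unfolding calm_def by measurable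
  show ?thesis unfolding stop_def[abs_def] by measurable
qed

lemma at_past_stop: "sets \<eta> = sets E \<Longrightarrow> at_past (stop m \<psi>) \<eta> w = (if calm m \<eta> (fst w) then at_past \<psi> \<eta> w else 0)"
  by (simp add: at_past_def stop_def calm_def energy_before)

lemma trunc_stop: "trunc k (stop m \<psi>) = stop m (trunc k \<psi>)"
  by (auto simp: trunc_def stop_def fun_eq_iff)

lemma trunc_shift: "trunc k \<phi>z = with_point z (trunc k \<phi>)"
  by (simp add: trunc_def with_point_def fun_eq_iff)

lemma stop_diff: "(\<lambda>x. stop m \<psi> x - stop m \<theta> x) = stop m (\<lambda>x. \<psi> x - \<theta> x)"
  by (auto simp: stop_def fun_eq_iff)

text \<open>
  The stopped integrand has energy at most \<open>m\<close> along every path.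
\<close>

lemma stop_integrands:
  assumes \<psi>: "\<psi> \<in> borel_measurable CTU" and le: "\<And>\<eta> s. calm m \<eta> s \<Longrightarrow> energy p \<psi> \<eta> s \<le> of_nat m"
  shows "stop m \<psi> \<in> integrands p"
proof -
  have "moment p (stop m \<psi>) \<le> (\<integral>\<^sup>+\<omega>. of_nat m \<partial>M)"
    unfolding moment_def
  proof (intro nn_integral_mono)
    fix \<omega> assume \<omega>: "\<omega> \<in> space M"
    let ?u = "\<lambda>w. ennreal (norm (at_past \<psi> (N \<omega>) w) powr p)"
    have "(\<integral>\<^sup>+w. ennreal (norm (at_past (stop m \<psi>) (N \<omega>) w) powr p) \<partial>E) \<le>
      (\<integral>\<^sup>+w. (if (\<integral>\<^sup>+v. ?u v * indicator ({..<fst w} \<times> UNIV) v \<partial>E) \<le> of_nat m then ?u w else 0) \<partial>E)"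
      using le by (intro nn_integral_mono) (auto simp: at_past_stop[OF sets_N[OF \<omega>]] energy_def[symmetric])
    also have "\<dots> \<le> of_nat m"
      by (rule stopped_energy_le) (use measurable_at_past_E[OF \<psi> N_counting[OF \<omega>]] in measurable)
    finally show "(\<integral>\<^sup>+w. ennreal (norm (at_past (stop m \<psi>) (N \<omega>) w) powr p) \<partial>E) \<le> of_nat m" .
  qed
  also have "\<dots> < \<infinity>" by (simp add: emeasure_space_1 ennreal_of_nat_eq_real_of_nat)
  finally show ?thesis using measurable_stop[OF \<psi>] by (simp add: integrands_def)
qed

text \<open>
  All of \<open>[0,T]\<close> lies strictly before the time \<open>T + 1\<close>.
\<close>

definition calm_event :: "nat \<Rightarrow> 'w \<Rightarrow> bool" where
  "calm_event m \<omega> \<longleftrightarrow> calm m (N \<omega>) (T + 1)"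

lemma J_stop:
  assumes \<omega>: "\<omega> \<in> space M" and c: "calm_event m \<omega>"
  shows "J (stop m \<psi>) (N \<omega>) = J \<psi> (N \<omega>)" "integrable_at (stop m \<psi>) (N \<omega>) \<longleftrightarrow> integrable_at \<psi> (N \<omega>)"
proof -
  have calm: "calm m (N \<omega>) (fst w)" if "w \<in> space E" for w
  proof -
    have "fst w \<le> T + 1" using that by (auto simp: intensity_def space_pair_measure)
    then show ?thesis using c energy_mono[of "fst w" "T + 1"] unfolding calm_event_def calm_def by (blast intro: order_trans)
  qed
  have l: "at_past (stop m \<psi>) (N \<omega>) w = at_past \<psi> (N \<omega>) w" if "w \<in> space E" for w
    using calm[OF that] by (simp add: at_past_stop[OF sets_N[OF \<omega>]])
  then have l': "at_past (stop m \<psi>) (N \<omega>) w = at_past \<psi> (N \<omega>) w" if "w \<in> space (N \<omega>)" for w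
    using that space_N[OF \<omega>] by simp
  have "(\<integral>w. at_past (stop m \<psi>) (N \<omega>) w \<partial>N \<omega>) = (\<integral>w. at_past \<psi> (N \<omega>) w \<partial>N \<omega>)"
    "(\<integral>w. at_past (stop m \<psi>) (N \<omega>) w \<partial>E) = (\<integral>w. at_past \<psi> (N \<omega>) w \<partial>E)"
    by (intro Bochner_Integration.integral_cong refl l' l; assumption)+
  then show "J (stop m \<psi>) (N \<omega>) = J \<psi> (N \<omega>)" by (simp add: J_def)
  have "integrable (N \<omega>) (at_past (stop m \<psi>) (N \<omega>)) \<longleftrightarrow> integrable (N \<omega>) (at_past \<psi> (N \<omega>))"
    "integrable E (at_past (stop m \<psi>) (N \<omega>)) \<longleftrightarrow> integrable E (at_past \<psi> (N \<omega>))"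
    by (intro Bochner_Integration.integrable_cong refl l' l; assumption)+
  then show "integrable_at (stop m \<psi>) (N \<omega>) \<longleftrightarrow> integrable_at \<psi> (N \<omega>)" by (simp add: integrable_at_def)
qed

text \<open>
  On the event that both energies stay below \<open>m\<close> the following random variables coincide: the
  \<open>L\<^sup>q\<close> integral of \<open>\<phi>\<^sup>z - \<phi>\<close>, the \<open>L\<^sup>q\<close> integral of the stopped difference, its \<open>L\<^sup>p\<close> integral, and the
  limit of the pathwise integrals of the stopped and truncated \<open>\<phi>\<^sup>z\<close> minus those of \<open>\<phi>\<close>. In the last
  expression stopping has no effect, and the relation for paths applies to each truncation.
\<close>

lemma commutation_at_point:
  assumes f: "f \<in> borel_measurable CS" and Y: "is_integral q (\<lambda>x. \<phi>z x - \<phi> x) Y"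
    and lim: "AE \<omega> in M. (\<lambda>j. J (trunc (r j) \<phi>) (N \<omega>)) \<longlonglongrightarrow> f (N \<omega>)"
    and limz: "AE \<omega> in M. (\<lambda>j. J (trunc (r j) \<phi>) (add_point (N \<omega>) z)) \<longlonglongrightarrow> f (add_point (N \<omega>) z)"
    and integrable_at: "AE \<omega> in M. \<forall>k. integrable_at (trunc k \<phi>) (N \<omega>)"
    and okz: "AE \<omega> in M. \<forall>k. integrable_at (trunc k \<phi>) (add_point (N \<omega>) z)"
    and fin: "AE \<omega> in M. energy p \<phi> (N \<omega>) (T + 1) < \<infinity>"
    and finz: "AE \<omega> in M. energy p \<phi> (add_point (N \<omega>) z) (T + 1) < \<infinity>"
    and r: "strict_mono (r :: nat \<Rightarrow> nat)"
  shows "AE \<omega> in M. f (add_point (N \<omega>) z) - f (N \<omega>) = Y \<omega> + at_past \<phi> (N \<omega>) z"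
proof -
  have p1: "1 \<le> p" "p \<le> 2" "0 < p" "0 \<le> p" "1 \<le> q" "q \<le> 2" "0 \<le> q" using p q by auto
  let ?\<theta> = "\<lambda>x. \<phi>z x - \<phi> x"
  note mz = measurable_\<phi>z
  have on_event: "AE \<omega> in M. calm_event m \<omega> \<longrightarrow> f (add_point (N \<omega>) z) - f (N \<omega>) = Y \<omega> + at_past \<phi> (N \<omega>) z" for m
  proof -
    have C1: "stop m \<phi> \<in> integrands p" by (rule stop_integrands[OF \<phi>]) (simp add: calm_def)
    have C2: "stop m \<phi>z \<in> integrands p" by (rule stop_integrands[OF mz]) (simp add: calm_def)
    have Cd: "stop m ?\<theta> \<in> integrands p" using integrands_diff[OF C2 C1 p1(4)] by (simp add: stop_diff)
    have m\<theta>: "?\<theta> \<in> borel_measurable CTU" using mz \<phi> by measurable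
    have Cq: "stop m ?\<theta> \<in> integrands q"
    proof -
      have "moment q (stop m ?\<theta>) \<le> moment q ?\<theta>"
        unfolding moment_def using p1 by (intro nn_integral_mono ennreal_leI powr_mono2) (auto simp: at_past_stop sets_N)
      then show ?thesis using integrandsD(2)[OF is_integralD(1)[OF Y]] measurable_stop[OF m\<theta>] by (auto simp: integrands_def intro: le_less_trans)
    qed
    obtain W where W: "is_integral p (stop m ?\<theta>) W" by (rule is_integral_exists[OF p Cd])
    obtain W' where W': "is_integral q (stop m ?\<theta>) W'" by (rule is_integral_exists[OF q Cq])
    have WW': "AE \<omega> in M. W \<omega> = W' \<omega>" by (rule is_integral_unique[OF p q W W'])
    have W'Y: "AE \<omega> in M. calm_event m \<omega> \<longrightarrow> W' \<omega> = Y \<omega>"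
    proof (rule mean_pow_limit_unique[OF is_integralD(2)[OF W'] is_integralD(2)[OF Y] _ _ p1(5,6) p1(5,6) is_integral_trunc[OF W' p1(5)] is_integral_trunc[OF Y p1(5)]])
      show "(\<lambda>\<omega>. J (trunc k (stop m ?\<theta>)) (N \<omega>)) \<in> borel_measurable M" for k
        by (intro measurable_J_N measurable_trunc measurable_stop m\<theta>)
      show "(\<lambda>\<omega>. J (trunc k ?\<theta>) (N \<omega>)) \<in> borel_measurable M" for k
        by (intro measurable_J_N measurable_trunc m\<theta>)
      show "AE \<omega> in M. calm_event m \<omega> \<longrightarrow> (\<forall>k. J (trunc k (stop m ?\<theta>)) (N \<omega>) = J (trunc k ?\<theta>) (N \<omega>))"
        by (rule AE_I2) (simp add: trunc_stop J_stop)
    qed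
    \<comment> \<open>Truncating \<open>\<phi>\<^sup>z\<close> and \<open>\<phi>\<close> separately differs from truncating their difference, but both
      approximate the stopped difference in the moment of order \<open>p\<close>.\<close>
    define \<psi> where "\<psi> k x = trunc k (stop m \<phi>z) x - trunc k (stop m \<phi>) x" for k x
    have \<psi>C: "\<psi> k \<in> integrands 1 \<inter> integrands p" for k
      unfolding \<psi>_def using trunc_integrands[OF C1 p1(1), of k] trunc_integrands[OF C2 p1(1), of k] p1 by (intro IntI integrands_diff) auto
    have "(\<lambda>k. moment p (\<lambda>x. stop m ?\<theta> x - \<psi> k x)) \<longlonglongrightarrow> 0"
    proof (rule ennreal_tendsto_0_le)
      let ?a = "\<lambda>k x. stop m \<phi>z x - trunc k (stop m \<phi>z) x" and ?b = "\<lambda>k x. stop m \<phi> x - trunc k (stop m \<phi>) x"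
      show "(\<lambda>k. ennreal (2 powr p) * (moment p (?a k) + moment p (?b k))) \<longlonglongrightarrow> 0"
      proof -
        have "(\<lambda>k. ennreal (2 powr p) * (moment p (?a k) + moment p (?b k))) \<longlonglongrightarrow> ennreal (2 powr p) * (0 + 0)"
          by (intro ennreal_tendsto_cmult tendsto_add moment_trunc_tendsto C1 C2 p1) simp
        then show ?thesis by simp
      qed
      fix k
      have ma: "?a k \<in> borel_measurable CTU" "?b k \<in> borel_measurable CTU"
        by (intro borel_measurable_diff measurable_trunc measurable_stop mz \<phi>)+
      have eq: "(\<lambda>x. stop m ?\<theta> x - \<psi> k x) = (\<lambda>x. ?a k x + (-1) *\<^sub>R ?b k x)"
        by (auto simp: fun_eq_iff \<psi>_def stop_diff[symmetric])
      have "moment p (\<lambda>x. stop m ?\<theta> x - \<psi> k x) \<le> ennreal (2 powr p) * (moment p (?a k) + moment p (\<lambda>x. (-1) *\<^sub>R ?b k x))"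
        unfolding eq by (rule moment_add[OF ma(1) borel_measurable_scaleR[OF borel_measurable_const ma(2)] p1(4)])
      also have "moment p (\<lambda>x. (-1) *\<^sub>R ?b k x) = moment p (?b k)" by (subst moment_scaleR[OF ma(2)]) simp
      finally show "moment p (\<lambda>x. stop m ?\<theta> x - \<psi> k x) \<le> ennreal (2 powr p) * (moment p (?a k) + moment p (?b k))" .
    qed
    then have limW: "(\<lambda>k. mean_pow p (\<lambda>\<omega>. W \<omega> - J (\<psi> k) (N \<omega>))) \<longlonglongrightarrow> 0"
      by (rule is_integralD(3)[OF W \<psi>C])
    have limWr: "(\<lambda>j. mean_pow p (\<lambda>\<omega>. W \<omega> - J (\<psi> (r j)) (N \<omega>))) \<longlonglongrightarrow> 0"
      using LIMSEQ_subseq_LIMSEQ[OF limW r] by (simp add: comp_def)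
    obtain g :: "nat \<Rightarrow> nat" where g: "strict_mono g" "AE \<omega> in M. (\<lambda>j. W \<omega> - J (\<psi> (r (g j))) (N \<omega>)) \<longlonglongrightarrow> 0"
    proof (rule mean_pow_AE_subseq[OF _ p1(1,2) limWr])
      show "(\<lambda>\<omega>. W \<omega> - J (\<psi> (r j)) (N \<omega>)) \<in> borel_measurable M" for j
        using \<psi>C[of "r j"] integrandsD(1) by (intro borel_measurable_diff is_integralD(2)[OF W] measurable_J_N) auto
    qed (rule that)
    have WZ: "AE \<omega> in M. calm_event m \<omega> \<longrightarrow> W \<omega> = f (add_point (N \<omega>) z) - at_past \<phi> (N \<omega>) z - f (N \<omega>)"
      using g(2) lim limz integrable_at okz AE_space
    proof eventually_elim
      case (elim \<omega>)
      show ?case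
      proof
        assume ev: "calm_event m \<omega>"
        note c = N_counting[OF elim(6)]
        have Jk: "J (\<psi> k) (N \<omega>) = (J (trunc k \<phi>) (add_point (N \<omega>) z) - at_past (trunc k \<phi>) (N \<omega>) z) - J (trunc k \<phi>) (N \<omega>)" for k
        proof -
          note ap = J_add_point[OF measurable_trunc[OF \<phi>] c z elim(5)[rule_format, of k]]
          have o: "integrable_at (stop m (trunc k \<phi>z)) (N \<omega>)" "integrable_at (stop m (trunc k \<phi>)) (N \<omega>)"
            using ap(1) elim(4) J_stop(2)[OF elim(6) ev] by (auto simp: trunc_shift)
          have "J (\<psi> k) (N \<omega>) = J (stop m (trunc k \<phi>z)) (N \<omega>) - J (stop m (trunc k \<phi>)) (N \<omega>)"
            unfolding \<psi>_def trunc_stop by (rule integrable_at_diff(2)[OF o])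
          also have "\<dots> = J (with_point z (trunc k \<phi>)) (N \<omega>) - J (trunc k \<phi>) (N \<omega>)"
            by (simp add: J_stop(1)[OF elim(6) ev] trunc_shift)
          finally show ?thesis using ap(2) by simp
        qed
        have "(\<lambda>j. J (\<psi> (r j)) (N \<omega>)) \<longlonglongrightarrow> (f (add_point (N \<omega>) z) - at_past \<phi> (N \<omega>) z) - f (N \<omega>)"
          unfolding Jk
        proof (intro tendsto_diff elim)
          have "(\<lambda>k. at_past (trunc k \<phi>) (N \<omega>) z) \<longlonglongrightarrow> at_past \<phi> (N \<omega>) z" unfolding at_past_def by (rule trunc_tendsto)
          from LIMSEQ_subseq_LIMSEQ[OF this r] show "(\<lambda>j. at_past (trunc (r j) \<phi>) (N \<omega>) z) \<longlonglongrightarrow> at_past \<phi> (N \<omega>) z" by (simp add: comp_def)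
        qed
        from LIMSEQ_subseq_LIMSEQ[OF this g(1)]
        have "(\<lambda>j. J (\<psi> (r (g j))) (N \<omega>)) \<longlonglongrightarrow> f (add_point (N \<omega>) z) - at_past \<phi> (N \<omega>) z - f (N \<omega>)" by (simp add: comp_def)
        from tendsto_add[OF elim(1) this] show "W \<omega> = f (add_point (N \<omega>) z) - at_past \<phi> (N \<omega>) z - f (N \<omega>)"
          by (simp add: LIMSEQ_const_iff)
      qed
    qed
    show ?thesis using WW' W'Y WZ
    proof eventually_elim
      case (elim \<omega>)
      show ?case
      proof
        assume "calm_event m \<omega>"
        then have "Y \<omega> = f (add_point (N \<omega>) z) - at_past \<phi> (N \<omega>) z - f (N \<omega>)" using elim by simp
        then show "f (add_point (N \<omega>) z) - f (N \<omega>) = Y \<omega> + at_past \<phi> (N \<omega>) z" by simp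
      qed
    qed
  qed
  have "AE \<omega> in M. \<forall>m. calm_event m \<omega> \<longrightarrow> f (add_point (N \<omega>) z) - f (N \<omega>) = Y \<omega> + at_past \<phi> (N \<omega>) z"
    unfolding AE_all_countable by (rule allI) (rule on_event)
  then show ?thesis
    using fin finz AE_space
  proof eventually_elim
    case (elim \<omega>)
    have e: "energy p \<phi>z (N \<omega>) (T + 1) = energy p \<phi> (add_point (N \<omega>) z) (T + 1)"
      unfolding energy_def by (simp only: at_past_add_point[OF sets_N[OF elim(4)]])
    let ?e = "max (energy p \<phi> (N \<omega>) (T + 1)) (energy p \<phi>z (N \<omega>) (T + 1))"
    have "?e < \<top>" using elim(2,3) e by (simp only: max_less_iff_conj infinity_ennreal_def)
    from ennreal_Ex_less_of_nat[OF this] obtain m :: nat where "?e < of_nat m" ..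
    then have "calm_event m \<omega>" by (auto simp: calm_event_def calm_def)
    then show ?case using elim(1) by blast
  qed
qed

end

end

section \<open>Representatives of the difference operators\<close>

context poisson_setting
begin

sublocale PME: pair_sigma_finite PM E
proof -
  have "sigma_finite_measure PM" unfolding process_measure_def ..
  then show "pair_sigma_finite PM E" by (simp add: pair_sigma_finite_def sigma_finite_E)
qed

lemma PM_components [measurable]:
  "(\<lambda>\<xi>. fst (fst \<xi>)) \<in> PM \<rightarrow>\<^sub>M M" "(\<lambda>\<xi>. snd (fst \<xi>)) \<in> PM \<rightarrow>\<^sub>M tm" "snd \<in> PM \<rightarrow>\<^sub>M \<nu>"
  unfolding process_measure_def by measurable

lemma PM_point [measurable]: "(\<lambda>\<xi>. (snd (fst \<xi>), snd \<xi>)) \<in> PM \<rightarrow>\<^sub>M E"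
  by (intro measurable_PairE) measurable

text \<open>
  A function \<open>f\<close> with \<open>F = f(N)\<close> exists since the \<open>\<sigma>\<close>-algebra on \<open>\<Omega>\<close> is the completion of the one
  generated by \<open>N\<close>.
\<close>

lemma diff_op_unfold:
  fixes F :: "'w \<Rightarrow> 'h::{real_inner, banach, second_countable_topology}"
  assumes M: "sets M = sets (P_completion M (vimage_algebra (space M) N CS))" and F: "F \<in> borel_measurable M"
  obtains f where "f \<in> borel_measurable CS" "AE \<omega> in M. F \<omega> = f (N \<omega>)"
    "diff_op T \<nu> M N F = (\<lambda>z \<omega>. f (add_point (N \<omega>) z) - f (N \<omega>))"
proof -
  have NS: "N \<in> space M \<rightarrow> space CS" using N_counting by auto
  then interpret sigma_algebra "space M" "events_mod_null M N CS" by (rule sigma_algebra_events_mod_null)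
  have "sets (vimage_algebra (space M) N CS) \<subseteq> events_mod_null M N CS"
    unfolding sets_vimage_algebra
  proof (rule sigma_sets_subset, safe)
    fix A assume "A \<in> sets CS"
    then show "N -` A \<inter> space M \<in> events_mod_null M N CS" by (auto simp: events_mod_null_def intro!: bexI[of _ A] AE_I2)
  qed
  moreover have "null_sets M \<subseteq> events_mod_null M N CS" using null_set_in_events by auto
  ultimately have "sigma_sets (space M) (sets (vimage_algebra (space M) N CS) \<union> null_sets M) \<subseteq> events_mod_null M N CS"
    by (intro sigma_sets_subset) auto
  moreover have "sets (vimage_algebra (space M) N CS) \<subseteq> Pow (space M)"
    using sets.space_closed[of "vimage_algebra (space M) N CS"] by simp
  ultimately have "sets M \<subseteq> events_mod_null M N CS" unfolding M by (simp add: sets_P_completion(1))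
  from factorisation_mod_null[OF F refl this]
  obtain f where "f \<in> borel_measurable CS" "AE \<omega> in M. F \<omega> = f (N \<omega>)" .
  then have "\<exists>f. f \<in> borel_measurable CS \<and> (AE \<omega> in M. F \<omega> = f (N \<omega>))" by blast
  from someI_ex[OF this] show ?thesis
    by (intro that[of "SOME f. f \<in> borel_measurable CS \<and> (AE \<omega> in M. F \<omega> = f (N \<omega>))"]) (simp_all add: diff_op_def Let_def)
qed

lemma diff_op_process_unfold:
  fixes \<Phi> :: "_ \<Rightarrow> 'h::{real_inner, banach, second_countable_topology}"
  assumes r: "rep_by \<Phi> \<phi>"
  obtains \<phi>0 where "\<phi>0 \<in> borel_measurable CTU"
    "AE \<xi> in PM. \<Phi> \<xi> = \<phi>0 ((N (fst (fst \<xi>)), snd (fst \<xi>)), snd \<xi>)"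
    "\<And>z \<xi>. diff_op_process T \<nu> M N \<Phi> z \<xi> =
       \<phi>0 ((add_point (N (fst (fst \<xi>))) z, snd (fst \<xi>)), snd \<xi>) - \<phi>0 ((N (fst (fst \<xi>)), snd (fst \<xi>)), snd \<xi>)"
proof -
  let ?P = "\<lambda>\<phi>. \<phi> \<in> borel_measurable CTU \<and> (AE ((\<omega>, s), y) in PM. \<Phi> ((\<omega>, s), y) = \<phi> ((N \<omega>, s), y))"
  let ?\<phi>1 = "\<lambda>x. at_past \<phi> (fst (fst x)) (snd (fst x), snd x)"
  have "?\<phi>1 \<in> borel_measurable CTU"
    by (rule measurable_at_past_compose[OF _ _ measurable_time_point]) (use r in \<open>auto simp: rep_by_def\<close>)
  moreover have "AE ((\<omega>, s), y) in PM. \<Phi> ((\<omega>, s), y) = ?\<phi>1 ((N \<omega>, s), y)"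
    using r by (auto simp: rep_by_def case_prod_beta elim!: eventually_mono)
  ultimately have "?P ?\<phi>1" by blast
  then have P: "?P (SOME \<phi>. ?P \<phi>)" by (rule someI[of ?P])
  show ?thesis
  proof (rule that[of "SOME \<phi>. ?P \<phi>"])
    show "(SOME \<phi>. ?P \<phi>) \<in> borel_measurable CTU" by (rule P[THEN conjunct1])
    show "AE \<xi> in PM. \<Phi> \<xi> = (SOME \<phi>. ?P \<phi>) ((N (fst (fst \<xi>)), snd (fst \<xi>)), snd \<xi>)"
      using P[THEN conjunct2] by eventually_elim (simp add: case_prod_beta)
    show "diff_op_process T \<nu> M N \<Phi> z \<xi> =
       (SOME \<phi>. ?P \<phi>) ((add_point (N (fst (fst \<xi>))) z, snd (fst \<xi>)), snd \<xi>) - (SOME \<phi>. ?P \<phi>) ((N (fst (fst \<xi>)), snd (fst \<xi>)), snd \<xi>)" for z \<xi>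
      unfolding diff_op_process_def Let_def by (cases \<xi>, cases "fst \<xi>") simp
  qed
qed

text \<open>
  The representative chosen in the difference operator and the canonical integrand agree almost
  everywhere at \<open>N\<close>. By Mecke's formula, at a fixed time and mark, they also agree at \<open>N + \<delta>\<^sub>z\<close> for almost
  every \<open>z\<close>. The canonical form of the derivative is thus \<open>\<phi>\<^sup>z - \<phi>\<close>.
\<close>

lemma diff_op_process_eq:
  fixes \<Phi> :: "_ \<Rightarrow> 'h::{real_inner, banach, second_countable_topology}"
  assumes r: "rep_by \<Phi> \<phi>"
  shows "AE z in E. AE \<xi> in PM. diff_op_process T \<nu> M N \<Phi> z \<xi> =
      at_past (\<lambda>x. with_point z \<phi> x - \<phi> x) (N (fst (fst \<xi>))) (snd (fst \<xi>), snd \<xi>)"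
    and "(\<lambda>p. diff_op_process T \<nu> M N \<Phi> (snd p) (fst p)) \<in> borel_measurable (PM \<Otimes>\<^sub>M E)"
proof -
  obtain \<phi>0 where \<phi>0: "\<phi>0 \<in> borel_measurable CTU"
    and rep0: "AE \<xi> in PM. \<Phi> \<xi> = \<phi>0 ((N (fst (fst \<xi>)), snd (fst \<xi>)), snd \<xi>)"
    and D: "\<And>z \<xi>. diff_op_process T \<nu> M N \<Phi> z \<xi> =
       \<phi>0 ((add_point (N (fst (fst \<xi>))) z, snd (fst \<xi>)), snd \<xi>) - \<phi>0 ((N (fst (fst \<xi>)), snd (fst \<xi>)), snd \<xi>)"
    by (rule diff_op_process_unfold[OF r]) (rule that)
  have \<phi>: "\<phi> \<in> borel_measurable CTU" using r by (simp add: rep_by_def)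
  have [measurable]: "(\<lambda>p. fst (fst (fst p))) \<in> PM \<Otimes>\<^sub>M E \<rightarrow>\<^sub>M M" "(\<lambda>p. snd (fst (fst p))) \<in> PM \<Otimes>\<^sub>M E \<rightarrow>\<^sub>M tm"
    "(\<lambda>p. snd (fst p)) \<in> PM \<Otimes>\<^sub>M E \<rightarrow>\<^sub>M \<nu>" "(\<lambda>p. (snd (fst (fst p)), snd (fst p))) \<in> PM \<Otimes>\<^sub>M E \<rightarrow>\<^sub>M E"
    by (rule measurable_compose[OF measurable_fst PM_components(1)], rule measurable_compose[OF measurable_fst PM_components(2)],
        rule measurable_compose[OF measurable_fst PM_components(3)], rule measurable_compose[OF measurable_fst PM_point])
  have m1: "(\<lambda>p. \<phi>0 ((add_point (N (fst (fst (fst p)))) (snd p), snd (fst (fst p))), snd (fst p))) \<in> borel_measurable (PM \<Otimes>\<^sub>M E)"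
    by (rule measurable_compose[OF _ \<phi>0]) measurable
  have m2: "(\<lambda>p. \<phi>0 ((N (fst (fst (fst p))), snd (fst (fst p))), snd (fst p))) \<in> borel_measurable (PM \<Otimes>\<^sub>M E)"
    by (rule measurable_compose[OF _ \<phi>0]) measurable
  have m3: "(\<lambda>p. at_past \<phi> (add_point (N (fst (fst (fst p)))) (snd p)) (snd (fst (fst p)), snd (fst p))) \<in> borel_measurable (PM \<Otimes>\<^sub>M E)"
    by (rule measurable_at_past_compose[OF \<phi>]) measurable
  show "(\<lambda>p. diff_op_process T \<nu> M N \<Phi> (snd p) (fst p)) \<in> borel_measurable (PM \<Otimes>\<^sub>M E)"
    unfolding D using m1 m2 by measurable
  let ?d = "\<lambda>\<eta> s y. \<phi>0 ((\<eta>, s), y) = at_past \<phi> \<eta> (s, y)"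
  have d_ae: "AE \<xi> in PM. ?d (N (fst (fst \<xi>))) (snd (fst \<xi>)) (snd \<xi>)"
    using rep0 r[unfolded rep_by_def, THEN conjunct2] by eventually_elim simp
  \<comment> \<open>The exceptional set. Its section at \<open>\<xi> = ((\<omega>, s), y)\<close> is null for almost every \<open>\<xi>\<close>, as follows from
    \<open>AE_add_point\<close> with \<open>s\<close> and \<open>y\<close> fixed.\<close>
  define Q where "Q = {p \<in> space (PM \<Otimes>\<^sub>M E). \<not> ?d (add_point (N (fst (fst (fst p)))) (snd p)) (snd (fst (fst p))) (snd (fst p))}"
  have Q [measurable]: "Q \<in> sets (PM \<Otimes>\<^sub>M E)" unfolding Q_def using m1 m3 by measurable
  define h where "h \<xi> = (\<integral>\<^sup>+z. indicator Q (\<xi>, z) \<partial>E)" for \<xi>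
  have h: "h \<in> borel_measurable PM" unfolding h_def by measurable
  have "AE w in E. AE \<omega> in M. h ((\<omega>, fst w), snd w) = 0"
    using AE_PM_D(2)[OF d_ae] AE_space
  proof eventually_elim
    case (elim w)
    have w: "fst w \<in> space tm" "snd w \<in> space \<nu>" using elim(2) by (auto simp: intensity_def space_pair_measure)
    have [measurable]: "(\<lambda>\<eta>. \<phi>0 ((\<eta>, fst w), snd w)) \<in> borel_measurable CS"
      by (rule measurable_compose[OF _ \<phi>0]) (use w in measurable)
    have [measurable]: "(\<lambda>\<eta>. at_past \<phi> \<eta> (fst w, snd w)) \<in> borel_measurable CS"
      by (rule measurable_at_past_compose[OF \<phi>]) (use elim(2) in simp_all)
    have "Measurable.pred CS (\<lambda>\<eta>. ?d \<eta> (fst w) (snd w))" by measurable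
    from AE_add_point[OF this] elim(1)
    have "AE \<omega> in M. AE z in E. ?d (add_point (N \<omega>) z) (fst w) (snd w)" by simp
    then show ?case
    proof eventually_elim
      case (elim \<omega>)
      have "h ((\<omega>, fst w), snd w) = (\<integral>\<^sup>+z. 0 \<partial>E)"
        unfolding h_def using elim by (intro nn_integral_cong_AE) (auto elim!: eventually_mono simp: Q_def indicator_def)
      then show ?case by simp
    qed
  qed
  then have "AE \<xi> in PM. h \<xi> = 0" by (rule AE_PM_I[rotated]) (use h in measurable)
  then have "AE \<xi> in PM. AE z in E. (\<xi>, z) \<notin> Q"
    using AE_space
  proof eventually_elim
    case (elim \<xi>)
    have "(\<lambda>z. indicator Q (\<xi>, z) :: ennreal) \<in> borel_measurable E" using elim(2) by measurable
    from nn_integral_0_iff_AE[OF this] elim(1) show ?case unfolding h_def by (auto elim!: eventually_mono simp: indicator_def split: if_splits)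
  qed
  then have "AE z in E. AE \<xi> in PM. (\<xi>, z) \<notin> Q"
    using PME.AE_commute[of "\<lambda>\<xi> z. (\<xi>, z) \<notin> Q"] Q by simp
  then show "AE z in E. AE \<xi> in PM. diff_op_process T \<nu> M N \<Phi> z \<xi> =
      at_past (\<lambda>x. with_point z \<phi> x - \<phi> x) (N (fst (fst \<xi>))) (snd (fst \<xi>), snd \<xi>)"
    using AE_space
  proof eventually_elim
    case (elim z)
    note z = elim(2)
    show ?case using elim(1) d_ae AE_space
    proof eventually_elim
      case (elim \<xi>)
      have "fst (fst \<xi>) \<in> space M" using measurable_space[OF PM_components(1) elim(3)] .
      then have l: "at_past \<phi> (add_point (N (fst (fst \<xi>))) z) (snd (fst \<xi>), snd \<xi>) = at_past (with_point z \<phi>) (N (fst (fst \<xi>))) (snd (fst \<xi>), snd \<xi>)"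
        by (rule at_past_add_point[OF sets_N])
      have "(\<xi>, z) \<in> space (PM \<Otimes>\<^sub>M E)" using elim(3) z by (simp add: space_pair_measure)
      then have "?d (add_point (N (fst (fst \<xi>))) z) (snd (fst \<xi>)) (snd \<xi>)" using elim(1) by (simp add: Q_def)
      then show ?case using elim(2) l by (simp add: D at_past_comp2[of "(-)"])
    qed
  qed
qed

text \<open>
  The difference \<open>\<phi>\<^sup>z - \<phi>\<close> at the strict past is a predictable version of the derivative, jointly in
  \<open>z\<close>; hence the chosen version has the defining properties.
\<close>

lemma diff_op_predictable_props:
  fixes \<Phi> :: "_ \<Rightarrow> 'h::{real_inner, banach, second_countable_topology}"
  assumes r: "rep_by \<Phi> \<phi>"
  shows "diff_op_predictable T \<nu> M N \<Phi> \<in> borel_measurable ((PT \<Otimes>\<^sub>M borel) \<Otimes>\<^sub>M E)"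
    and "AE z in E. AE \<xi> in PM. diff_op_predictable T \<nu> M N \<Phi> (\<xi>, z) = diff_op_process T \<nu> M N \<Phi> z \<xi>"
proof -
  let ?P = "\<lambda>\<Psi>. \<Psi> \<in> borel_measurable ((PT \<Otimes>\<^sub>M borel) \<Otimes>\<^sub>M E) \<and>
     (AE (\<xi>, z) in PM \<Otimes>\<^sub>M E. \<Psi> (\<xi>, z) = diff_op_process T \<nu> M N \<Phi> z \<xi>)"
  have \<phi>: "\<phi> \<in> borel_measurable CTU" using r by (simp add: rep_by_def)
  define \<Psi> where "\<Psi> p = at_past (with_point (snd p) \<phi>) (N (fst (fst (fst p)))) (snd (fst (fst p)), snd (fst p)) -
      at_past \<phi> (N (fst (fst (fst p)))) (snd (fst (fst p)), snd (fst p))" for p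
  have \<Psi>: "\<Psi> \<in> borel_measurable ((PT \<Otimes>\<^sub>M borel) \<Otimes>\<^sub>M E)"
    unfolding \<Psi>_def
    by (intro borel_measurable_diff measurable_canonical_shift[OF \<phi>] measurable_compose[OF measurable_fst measurable_canonical[OF \<phi>]])
  have id: "(\<lambda>p. p) \<in> PM \<Otimes>\<^sub>M E \<rightarrow>\<^sub>M (PT \<Otimes>\<^sub>M borel) \<Otimes>\<^sub>M E"
  proof -
    have "(\<lambda>\<xi>. \<xi>) \<in> PM \<rightarrow>\<^sub>M PT \<Otimes>\<^sub>M borel" using measurable_PT_PM[OF measurable_ident refl] unfolding id_def .
    then have "(\<lambda>p. (fst p, snd p)) \<in> PM \<Otimes>\<^sub>M E \<rightarrow>\<^sub>M (PT \<Otimes>\<^sub>M borel) \<Otimes>\<^sub>M E"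
      by (intro measurable_Pair measurable_compose[OF measurable_fst] measurable_snd)
    then show ?thesis by simp
  qed
  have meq: "Measurable.pred (PM \<Otimes>\<^sub>M E) (\<lambda>p. G p = diff_op_process T \<nu> M N \<Phi> (snd p) (fst p))"
    if "G \<in> borel_measurable ((PT \<Otimes>\<^sub>M borel) \<Otimes>\<^sub>M E)" for G
  proof -
    have "G \<in> borel_measurable (PM \<Otimes>\<^sub>M E)" using measurable_compose[OF id that] by simp
    then show ?thesis using diff_op_process_eq(2)[OF r] by measurable
  qed
  have aeq: "AE z in E. AE \<xi> in PM. \<Psi> (\<xi>, z) = diff_op_process T \<nu> M N \<Phi> z \<xi>"
    using diff_op_process_eq(1)[OF r]
  proof eventually_elim
    case (elim z)
    then show ?case by eventually_elim (simp add: \<Psi>_def at_past_comp2[of "(-)"])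
  qed
  then have "AE \<xi> in PM. AE z in E. \<Psi> (\<xi>, z) = diff_op_process T \<nu> M N \<Phi> z \<xi>"
    using PME.AE_commute[of "\<lambda>\<xi> z. \<Psi> (\<xi>, z) = diff_op_process T \<nu> M N \<Phi> z \<xi>"] meq[OF \<Psi>] by (simp add: pred_def)
  then have "AE p in PM \<Otimes>\<^sub>M E. \<Psi> p = diff_op_process T \<nu> M N \<Phi> (snd p) (fst p)"
    using PME.AE_pair_measure[of "\<lambda>p. \<Psi> p = diff_op_process T \<nu> M N \<Phi> (snd p) (fst p)"] meq[OF \<Psi>] by (simp add: pred_def)
  then have "?P \<Psi>" using \<Psi> by (simp add: case_prod_beta)
  then have P: "?P (diff_op_predictable T \<nu> M N \<Phi>)"
    unfolding diff_op_predictable_def by (rule someI[of ?P])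
  show "diff_op_predictable T \<nu> M N \<Phi> \<in> borel_measurable ((PT \<Otimes>\<^sub>M borel) \<Otimes>\<^sub>M E)" by (rule P[THEN conjunct1])
  have "AE p in PM \<Otimes>\<^sub>M E. diff_op_predictable T \<nu> M N \<Phi> p = diff_op_process T \<nu> M N \<Phi> (snd p) (fst p)"
    using P[THEN conjunct2] by eventually_elim (simp add: case_prod_beta)
  from PME.AE_pair_swap[OF this]
  show "AE z in E. AE \<xi> in PM. diff_op_predictable T \<nu> M N \<Phi> (\<xi>, z) = diff_op_process T \<nu> M N \<Phi> z \<xi>" by simp
qed

lemma diff_op_predictable_section:
  fixes \<Phi> :: "_ \<Rightarrow> 'h::{real_inner, banach, second_countable_topology}"
  assumes r: "rep_by \<Phi> \<phi>"
    and fin: "AE z in E. (\<integral>\<^sup>+\<omega>. \<integral>\<^sup>+s. \<integral>\<^sup>+y. ennreal (norm (diff_op_process T \<nu> M N \<Phi> z ((\<omega>, s), y)) powr q) \<partial>\<nu> \<partial>tm \<partial>M) < \<infinity>"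
  shows "AE z in E. (\<lambda>\<xi>. diff_op_predictable T \<nu> M N \<Phi> (\<xi>, z)) \<in> LP q \<and>
    rep_by (\<lambda>\<xi>. diff_op_predictable T \<nu> M N \<Phi> (\<xi>, z)) (\<lambda>x. with_point z \<phi> x - \<phi> x)"
  using fin diff_op_predictable_props(2)[OF r] diff_op_process_eq(1)[OF r] AE_space
proof eventually_elim
  case (elim z)
  let ?\<Psi> = "\<lambda>\<xi>. diff_op_predictable T \<nu> M N \<Phi> (\<xi>, z)"
  have \<phi>: "\<phi> \<in> borel_measurable CTU" using r by (simp add: rep_by_def)
  have m: "?\<Psi> \<in> borel_measurable (PT \<Otimes>\<^sub>M borel)"
    by (rule measurable_compose[OF measurable_Pair2'[OF elim(4)] diff_op_predictable_props(1)[OF r]])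
  have mD: "(\<lambda>\<xi>. diff_op_process T \<nu> M N \<Phi> z \<xi>) \<in> borel_measurable PM"
    using measurable_compose[OF measurable_Pair2'[OF elim(4)] diff_op_process_eq(2)[OF r]] by simp
  have "(\<integral>\<^sup>+\<xi>. ennreal (norm (?\<Psi> \<xi>) powr q) \<partial>PM) = (\<integral>\<^sup>+\<xi>. ennreal (norm (diff_op_process T \<nu> M N \<Phi> z \<xi>) powr q) \<partial>PM)"
    using elim(2) by (intro nn_integral_cong_AE) (auto elim!: eventually_mono)
  also have "\<dots> < \<infinity>" using elim(1) mD by (subst nn_integral_PM_iterated) simp_all
  finally have "?\<Psi> \<in> LP q" by (rule LP_I[OF m])
  moreover have "(\<lambda>x. with_point z \<phi> x - \<phi> x) \<in> borel_measurable CTU"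
    using measurable_with_point[OF \<phi> elim(4)] \<phi> by measurable
  moreover have "AE \<xi> in PM. ?\<Psi> \<xi> = at_past (\<lambda>x. with_point z \<phi> x - \<phi> x) (N (fst (fst \<xi>))) (snd (fst \<xi>), snd \<xi>)"
    using elim(2,3) by eventually_elim simp
  ultimately show ?case by (simp add: rep_by_def)
qed

text \<open>
  Along a subsequence the integrals of the truncated integrands converge almost surely to \<open>f(N)\<close>.
  Convergence, integrability of the truncations and finiteness of the energy are properties of the
  configuration, so they also hold at \<open>N + \<delta>\<^sub>z\<close> for almost every \<open>z\<close>.
\<close>

lemma commutation_at_almost_every_point:
  fixes \<Phi> :: "_ \<Rightarrow> 'h::{real_inner, banach, second_countable_topology}"
  assumes p: "p \<in> {1..2}" and q: "q \<in> {1..2}" and \<Phi>: "\<Phi> \<in> LP p"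
    and f: "f \<in> borel_measurable CS" and Ff: "AE \<omega> in M. stochastic_integral T \<nu> M N p \<Phi> \<omega> = f (N \<omega>)"
    and fin: "AE z in E. (\<integral>\<^sup>+\<omega>. \<integral>\<^sup>+s. \<integral>\<^sup>+y. ennreal (norm (diff_op_process T \<nu> M N \<Phi> z ((\<omega>, s), y)) powr q) \<partial>\<nu> \<partial>tm \<partial>M) < \<infinity>"
  shows "AE z in E. AE \<omega> in M. f (add_point (N \<omega>) z) - f (N \<omega>) - \<Phi> ((\<omega>, fst z), snd z) =
    stochastic_integral T \<nu> M N q (\<lambda>\<xi>. diff_op_predictable T \<nu> M N \<Phi> (\<xi>, z)) \<omega>"
proof -
  have p1: "1 \<le> p" "p \<le> 2" "0 < p" using p by auto
  obtain \<phi> where r: "rep_by \<Phi> \<phi>" by (rule ex_rep_by_LP[OF \<Phi>])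
  have \<phi>: "\<phi> \<in> borel_measurable CTU" using r by (simp add: rep_by_def)
  have C: "\<phi> \<in> integrands p" by (rule rep_by_integrands[OF r \<Phi>])
  have fN: "(\<lambda>\<omega>. f (N \<omega>)) \<in> borel_measurable M" by (rule measurable_compose[OF measurable_N f])
  have L: "is_integral p \<phi> (\<lambda>\<omega>. f (N \<omega>))"
    by (rule stochastic_integral_is_integral[OF p \<Phi> r fN]) (use Ff in \<open>auto elim!: eventually_mono\<close>)
  have mJ: "J (trunc k \<phi>) \<in> borel_measurable CS" for k by (rule measurable_J[OF measurable_trunc[OF \<phi>]])
  obtain g :: "nat \<Rightarrow> nat" where g: "strict_mono g" "AE \<omega> in M. (\<lambda>j. f (N \<omega>) - J (trunc (g j) \<phi>) (N \<omega>)) \<longlonglongrightarrow> 0"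
  proof (rule mean_pow_AE_subseq[OF _ p1(1,2) is_integral_trunc[OF L p1(1)]])
    show "(\<lambda>\<omega>. f (N \<omega>) - J (trunc k \<phi>) (N \<omega>)) \<in> borel_measurable M" for k
      using fN measurable_compose[OF measurable_N mJ] by (rule borel_measurable_diff)
  qed (rule that)
  define G1 where "G1 \<eta> \<longleftrightarrow> (\<lambda>j. f \<eta> - J (trunc (g j) \<phi>) \<eta>) \<longlonglongrightarrow> 0" for \<eta>
  define G2 where "G2 \<eta> \<longleftrightarrow> (\<forall>k. integrable_at (trunc k \<phi>) \<eta>)" for \<eta>
  define G3 where "G3 \<eta> \<longleftrightarrow> energy p \<phi> \<eta> (T + 1) < \<infinity>" for \<eta>
  have p1': "Measurable.pred CS G1"
    unfolding G1_def tendsto_zero_iff_countable using f mJ by measurable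
  have p2': "Measurable.pred CS G2"
    unfolding G2_def using pred_integrable_at[OF measurable_trunc[OF \<phi>]] by measurable
  have p3': "Measurable.pred CS G3"
  proof -
    have "(\<lambda>\<eta>. energy p \<phi> \<eta> (T + 1)) \<in> borel_measurable CS" by (rule measurable_energy[OF \<phi>]) simp_all
    then show ?thesis unfolding G3_def by measurable
  qed
  have a1: "AE \<omega> in M. G1 (N \<omega>)" unfolding G1_def by (rule g(2))
  have a2: "AE \<omega> in M. G2 (N \<omega>)"
    unfolding G2_def AE_all_countable
  proof
    fix k
    have "trunc k \<phi> \<in> integrands 1" using trunc_integrands[OF C p1(1)] by auto
    then show "AE \<omega> in M. integrable_at (trunc k \<phi>) (N \<omega>)" by (intro AE_integrable_at integrandsD)
  qed
  have a3: "AE \<omega> in M. G3 (N \<omega>)"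
  proof -
    have "AE \<omega> in M. (\<integral>\<^sup>+w. ennreal (norm (at_past \<phi> (N \<omega>) w) powr p) \<partial>E) \<noteq> \<infinity>"
    proof (rule nn_integral_PInf_AE)
      show "(\<lambda>\<omega>. \<integral>\<^sup>+w. ennreal (norm (at_past \<phi> (N \<omega>) w) powr p) \<partial>E) \<in> borel_measurable M"
        by (rule nn_integral_measurable_M[OF \<phi>]) measurable
      show "(\<integral>\<^sup>+\<omega>. \<integral>\<^sup>+w. ennreal (norm (at_past \<phi> (N \<omega>) w) powr p) \<partial>E \<partial>M) \<noteq> \<infinity>"
        using integrandsD(2)[OF C] by (simp add: moment_def)
    qed
    then show ?thesis
    proof eventually_elim
      case (elim \<omega>)
      have "energy p \<phi> (N \<omega>) (T + 1) \<le> (\<integral>\<^sup>+w. ennreal (norm (at_past \<phi> (N \<omega>) w) powr p) \<partial>E)"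
        unfolding energy_def by (intro nn_integral_mono) (auto simp: indicator_def)
      then show ?case using elim by (auto simp: G3_def top.not_eq_extremum intro: le_less_trans)
    qed
  qed
  have lim_iff: "G1 \<eta> \<longleftrightarrow> (\<lambda>j. J (trunc (g j) \<phi>) \<eta>) \<longlonglongrightarrow> f \<eta>" for \<eta>
  proof
    assume "G1 \<eta>"
    from tendsto_diff[OF tendsto_const[of "f \<eta>"] this[unfolded G1_def]] show "(\<lambda>j. J (trunc (g j) \<phi>) \<eta>) \<longlonglongrightarrow> f \<eta>" by simp
  next
    assume "(\<lambda>j. J (trunc (g j) \<phi>) \<eta>) \<longlonglongrightarrow> f \<eta>"
    from tendsto_diff[OF tendsto_const[of "f \<eta>"] this] show "G1 \<eta>" by (simp add: G1_def)
  qed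
  show ?thesis
    using AE_add_point_swap[OF p1' a1] AE_add_point_swap[OF p2' a2] AE_add_point_swap[OF p3' a3]
      diff_op_predictable_section[OF r fin] AE_PM_D(2)[OF r[unfolded rep_by_def, THEN conjunct2]] AE_space
  proof eventually_elim
    case (elim z)
    let ?\<Psi> = "\<lambda>\<xi>. diff_op_predictable T \<nu> M N \<Phi> (\<xi>, z)"
    note \<Psi> = elim(4)[THEN conjunct1] elim(4)[THEN conjunct2]
    have Y: "is_integral q (\<lambda>x. with_point z \<phi> x - \<phi> x) (stochastic_integral T \<nu> M N q ?\<Psi>)"
      by (rule stochastic_integral_is_integral[OF q \<Psi> stochastic_integral_measurable[OF q \<Psi>(1)]]) simp
    have "AE \<omega> in M. f (add_point (N \<omega>) z) - f (N \<omega>) = stochastic_integral T \<nu> M N q ?\<Psi> \<omega> + at_past \<phi> (N \<omega>) z"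
    proof (rule commutation_at_point[OF p q \<phi> elim(6) f Y _ _ _ _ _ _ g(1)])
      show "AE \<omega> in M. (\<lambda>j. J (trunc (g j) \<phi>) (N \<omega>)) \<longlonglongrightarrow> f (N \<omega>)"
        "AE \<omega> in M. (\<lambda>j. J (trunc (g j) \<phi>) (add_point (N \<omega>) z)) \<longlonglongrightarrow> f (add_point (N \<omega>) z)"
        using a1 elim(1) by (simp_all add: lim_iff)
    qed (use a2 a3 elim(2,3) in \<open>simp_all add: G2_def G3_def\<close>)
    with elim(5) show ?case by eventually_elim simp
  qed
qed

end

section \<open>The commutation relation\<close>

context poisson_setting
begin

text \<open>
  One jointly measurable solution suffices for the chosen family to have the defining property. The
  commutation relation itself provides it: for almost every \<open>z\<close> the integral is
  \<open>f(N + \<delta>\<^sub>z) - f(N) - \<Phi>(z)\<close>, which is jointly measurable.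
\<close>

lemma stochastic_integral_family_props:
  fixes G :: "('w \<times> real) \<times> 'u \<Rightarrow> 'h::real_normed_vector"
  assumes G: "G \<in> borel_measurable PM"
    and ae: "AE z in E. AE \<omega> in M. G ((\<omega>, fst z), snd z) = stochastic_integral T \<nu> M N q (\<lambda>\<xi>. \<Psi> (\<xi>, z)) \<omega>"
  shows "stochastic_integral_family T \<nu> M N q \<Psi> \<in> borel_measurable PM"
    and "AE z in E. AE \<omega> in M. stochastic_integral_family T \<nu> M N q \<Psi> ((\<omega>, fst z), snd z) =
      stochastic_integral T \<nu> M N q (\<lambda>\<xi>. \<Psi> (\<xi>, z)) \<omega>"
proof -
  let ?P = "\<lambda>G. G \<in> borel_measurable PM \<and>
     (AE (t, x) in E. AE \<omega> in M. G ((\<omega>, t), x) = stochastic_integral T \<nu> M N q (\<lambda>\<xi>. \<Psi> (\<xi>, (t, x))) \<omega>)"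
  have "?P G" using G ae by (simp add: case_prod_beta)
  then have P: "?P (stochastic_integral_family T \<nu> M N q \<Psi>)"
    unfolding stochastic_integral_family_def by (rule someI[of ?P])
  show "stochastic_integral_family T \<nu> M N q \<Psi> \<in> borel_measurable PM" by (rule P[THEN conjunct1])
  show "AE z in E. AE \<omega> in M. stochastic_integral_family T \<nu> M N q \<Psi> ((\<omega>, fst z), snd z) =
      stochastic_integral T \<nu> M N q (\<lambda>\<xi>. \<Psi> (\<xi>, z)) \<omega>"
    using P[THEN conjunct2] by (simp add: case_prod_beta)
qed

lemma difference_of_stochastic_integral:
  fixes \<Phi> :: "_ \<Rightarrow> 'h::{real_inner, banach, second_countable_topology}"
  assumes M: "sets M = sets (P_completion M (vimage_algebra (space M) N CS))"
    and p: "p \<in> {1..2}" and q: "q \<in> {1..2}" and \<Phi>: "\<Phi> \<in> LP p"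
    and fin: "AE z in E. (\<integral>\<^sup>+\<omega>. \<integral>\<^sup>+s. \<integral>\<^sup>+y. ennreal (norm (diff_op_process T \<nu> M N \<Phi> z ((\<omega>, s), y)) powr q) \<partial>\<nu> \<partial>tm \<partial>M) < \<infinity>"
  shows "AE ((\<omega>, t), x) in PM. diff_op T \<nu> M N (stochastic_integral T \<nu> M N p \<Phi>) (t, x) \<omega> =
    stochastic_integral_family T \<nu> M N q (diff_op_predictable T \<nu> M N \<Phi>) ((\<omega>, t), x) + \<Phi> ((\<omega>, t), x)"
proof -
  let ?G' = "stochastic_integral_family T \<nu> M N q (diff_op_predictable T \<nu> M N \<Phi>)"
  obtain f where f [measurable]: "f \<in> borel_measurable CS" and Ff: "AE \<omega> in M. stochastic_integral T \<nu> M N p \<Phi> \<omega> = f (N \<omega>)"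
    and D: "diff_op T \<nu> M N (stochastic_integral T \<nu> M N p \<Phi>) = (\<lambda>z \<omega>. f (add_point (N \<omega>) z) - f (N \<omega>))"
    by (rule diff_op_unfold[OF M stochastic_integral_measurable[OF p \<Phi>]])
  define G where "G \<xi> = f (add_point (N (fst (fst \<xi>))) (snd (fst \<xi>), snd \<xi>)) - f (N (fst (fst \<xi>))) - \<Phi> \<xi>" for \<xi>
  have [measurable]: "G \<in> borel_measurable PM"
  proof -
    note [measurable] = LP_D(2)[OF \<Phi>]
    show ?thesis unfolding G_def by measurable
  qed
  have G: "AE z in E. AE \<omega> in M. G ((\<omega>, fst z), snd z) =
      stochastic_integral T \<nu> M N q (\<lambda>\<xi>. diff_op_predictable T \<nu> M N \<Phi> (\<xi>, z)) \<omega>"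
    using commutation_at_almost_every_point[OF p q \<Phi> f Ff fin] by (simp add: G_def)
  note G' [measurable] = stochastic_integral_family_props[OF \<open>G \<in> borel_measurable PM\<close> G]
  have "AE \<xi> in PM. G \<xi> = ?G' \<xi>"
  proof (rule AE_PM_I)
    show "Measurable.pred PM (\<lambda>\<xi>. G \<xi> = ?G' \<xi>)" using G'(1) by measurable
    show "AE z in E. AE \<omega> in M. G ((\<omega>, fst z), snd z) = ?G' ((\<omega>, fst z), snd z)"
      using G G'(2)
    proof eventually_elim
      case (elim z)
      from elim show ?case by eventually_elim simp
    qed
  qed
  then show ?thesis
  proof eventually_elim
    case (elim \<xi>)
    then show ?case by (cases \<xi>, cases "fst \<xi>") (simp add: D G_def algebra_simps)
  qed
qed

end

theorem proposition4p13:
  fixes T p q :: real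
    and \<nu> :: "'u::{real_inner, banach, second_countable_topology} measure"
    and M :: "'w measure"
    and N :: "'w \<Rightarrow> (real \<times> 'u) measure"
    and X :: "nat \<Rightarrow> 'w \<Rightarrow> real \<times> 'u"
    and \<Phi> :: "('w \<times> real) \<times> 'u \<Rightarrow> 'h::{real_inner, banach, second_countable_topology}"
  assumes "0 < T"
    and "sets \<nu> = sets borel" and "sigma_finite_measure \<nu>"
    and "prob_space M" and "complete_measure M"
    and "poisson_random_measure M (intensity T \<nu>) N"
    and "sum_of_diracs M (intensity T \<nu>) X N"
    and "sets M = sets (P_completion M
           (vimage_algebra (space M) N (counting_space (intensity T \<nu>))))"
    and "p \<in> {1<..2}" and "q \<in> {1..2}"
    and "\<Phi> \<in> Lp_pr T \<nu> M N p"
    and "AE z in intensity T \<nu>.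
           (\<integral>\<^sup>+\<omega>. \<integral>\<^sup>+s. \<integral>\<^sup>+y. ennreal (norm (diff_op_process T \<nu> M N \<Phi> z ((\<omega>, s), y)) powr q)
              \<partial>\<nu> \<partial>time_measure T \<partial>M) < \<infinity>"
  shows "AE ((\<omega>, t), x) in process_measure T \<nu> M.
           diff_op T \<nu> M N (stochastic_integral T \<nu> M N p \<Phi>) (t, x) \<omega> =
             stochastic_integral_family T \<nu> M N q (diff_op_predictable T \<nu> M N \<Phi>) ((\<omega>, t), x)
             + \<Phi> ((\<omega>, t), x)"
proof -
  have "space \<nu> = UNIV" using sets_eq_imp_space_eq[OF assms(2)] by simp
  then have "poisson_setting T \<nu> M N" using assms(1-4,6)
    by (intro poisson_setting.intro time_poisson.intro poisson_setting_axioms.intro) simp_all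
  then show ?thesis
    by (rule poisson_setting.difference_of_stochastic_integral) (use assms(8-12) in auto)
qed

end
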